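(* Let $\mathbf{S}$ be a symmetric monoidal category. Let $G$ be a group. There are equivalences of categories (1) $\mathbf{Alg}\left(\mathbb{D}\otimes\mathbb{H}\otimes\mathbb{G},\mathbf{S}\right)\simeq\mathrm{Fun}\left(G,\mathbf{IMon}(\mathbf{S})\right)$; (2) $\mathbf{Alg}\left((\mathbb{D}\otimes\mathbb{H}\otimes\mathbb{G})^{op},\mathbf{S}\right)\simeq\mathrm{Fun}\left(G,\mathbf{IComon}(\mathbf{S})\right)$ and (3) $\mathbf{Alg}\left(\mathbb{D}\otimes(\mathbb{H}\otimes\mathbb{G})\otimes\mathbb{D}^{op},\mathbf{S}\right)\simeq\mathrm{Fun}\left(G,\mathbf{IBimon}(\mathbf{S})\right)$.
   Context: For $n\geq 1$, $\underline{n}=\{1,\dots,n\}$, and $\underline{0}=\emptyset$. A PROP is a symmetric strict monoidal category whose objects are the sets $\underline{n}$, $n\ge 0$, with tensor product of objects given by addition. For a PROP $T$ and a symmetric monoidal category $\mathbf{S}$, $\mathbf{Alg}(T,\mathbf{S})$ is the category of symmetric strict monoidal functors $T\to\mathbf{S}$ and natural transformations. $G$ is regarded as a one-object category. $\mathbf{IMon}(\mathbf{S})$ is the category of involutive monoids: monoids $(M,\mu,\eta)$ with a morphism $i:M\to M$ such that $i^2=\mathrm{id}$, $i\eta=\eta$ and $i\mu=\mu\tau(i\otimes i)$ ($\tau$ the symmetry); morphisms are monoid morphisms commuting with $i$. $\mathbf{IComon}(\mathbf{S})$ is the category of involutive comonoids, defined dually ($i^2=\mathrm{id}$, $\varepsilon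 i=\varepsilon$, $\Delta i=(i\otimes i)\tau\Delta$). $\mathbf{IBimon}(\mathbf{S})$ is the category of involutive bimonoids: bimonoids with a morphism $i$ making them both an involutive monoid and an involutive comonoid. $\mathbb{D}$ is the strict monoidal category of the sets $\underline{n}$ and order-preserving maps (tensor product: ordinal sum, written $\amalg$ on morphisms); $m:\underline{2}\to\underline{1}$ and $u:\underline{0}\to\underline{1}$ are its unique such maps. $H_n=C_2^n\rtimes\Sigma_n$ is the hyperoctahedral group, and $H_n$ acts on $G^n$ through its underlying permutation. An element of $G^n\rtimes H_n$ is a permutation $\sigma\in\Sigma_n$ with labels $\epsilon_i\in C_2$, $x_i\in G$ ($1\le i\le n$) on the strand starting at $i$; multiplication composes permutations and multiplies labels along strands (the label on strand $i$ of $(y,\delta;\tau)(x,\epsilon;\sigma)$ is $(y_{\sigma(i)}x_i,\delta_{\sigma(i)}\epsilon_i)$). The PROP $Q=\mathbb{D}\otimes\mathbb{H}\otimes\mathbb{G}$ has as morphisms $\underline{n}\to\underline{m}$ the pairs $(\phi,g)$ with $\phi\in\mathrm{Hom}_{\mathbb{D}}(\underline{n},\underline{m})$, $g\in G^n\rtimes H_n$ (think "$\phi\circ g$"), with composition $(\phi_2,g_2)\circ(\phi_1,g_1)=\big(\phi_2\circ(g_2)_\star(\phi_1),\ \phi_1^\star(g_2)\,g_1\big)$. Here for $\phi\in\mathrm{Hom}_{\mathbb{D}}(\underline{n},\underline{m})$ and $g=(x,\epsilon;\sigma)\in G^m\rtimes H_m$: $g_\star(\phi)$ is the order-preserving map $\underline{n}\to\underline{m}$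 whose fibre over $\sigma(i)$ has $|\phi^{-1}(i)|$ elements, and $\phi^\star(g)\in G^n\rtimes H_n$ has labels $x_{\phi(k)}$, $\epsilon_{\phi(k)}$ at $k\in\underline{n}$ and underlying permutation the unique $\rho\in\Sigma_n$ with $\sigma\circ\phi=g_\star(\phi)\circ\rho$ that is order-preserving on $\phi^{-1}(i)$ if $\epsilon_i$ is trivial and order-reversing on $\phi^{-1}(i)$ if $\epsilon_i$ is non-trivial. Tensor product is juxtaposition and the symmetries are block permutations with trivial labels. The isomorphisms of $Q$ are the elements of the groups $G^n\rtimes H_n$. $Q^{op}$ has the inherited symmetric monoidal structure. $Q^{op}\otimes_{\mathbb{H}\otimes\mathbb{G}}Q$ and $Q\otimes_{\mathbb{H}\otimes\mathbb{G}}Q^{op}$ denote the categories of equivalence classes of cospans, respectively spans, in $Q$, where two (co)spans are equivalent if they differ by an isomorphism of the middle object. The PROP $\mathbb{D}\otimes(\mathbb{H}\otimes\mathbb{G})\otimes\mathbb{D}^{op}$ is (isomorphic to) the composite PROP $Q\otimes_{\mathbb{H}\otimes\mathbb{G}}Q^{op}$: its morphisms $\underline{n}\to\underline{m}$ are the classes of spans $\underline{n}\leftarrow\underline{p}\to\underline{m}$ in $Q$, and two spans are composed by replacing the inner cospan by a span by means of the distributive law $Q^{op}\otimes_{\mathbb{H}\otimes\mathbb{G}}Q\to Q\otimes_{\mathbb{H}\otimes\mathbb{G}}Q^{op}$ determined as follows. (i) For $g,h\in G^n\rtimes H_n$: $\underline{n}\xrightarrow{g}\underline{n}\xleftarrow{h}\underline{n}\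 \mapsto\ \underline{n}\xleftarrow{g^{-1}}\underline{n}\xrightarrow{h^{-1}}\underline{n}$. (ii) For $\phi\in\mathrm{Hom}_{\mathbb{D}}(\underline{n},\underline{m})$ and $g\in G^m\rtimes H_m$: $\underline{n}\xrightarrow{\phi}\underline{m}\xleftarrow{g}\underline{m}\ \mapsto\ \underline{n}\xleftarrow{\phi^\star(g)}\underline{n}\xrightarrow{g_\star(\phi)}\underline{m}$ and $\underline{m}\xrightarrow{g}\underline{m}\xleftarrow{\phi}\underline{n}\ \mapsto\ \underline{m}\xleftarrow{g_\star(\phi)}\underline{n}\xrightarrow{\phi^\star(g)}\underline{n}$. (iii) $\underline{2}\xrightarrow{m}\underline{1}\xleftarrow{m}\underline{2}\ \mapsto\ \underline{2}\xleftarrow{m^{\amalg 2}\circ\sigma_{2,3}}\underline{4}\xrightarrow{m^{\amalg 2}}\underline{2}$; $\ \underline{0}\xrightarrow{u}\underline{1}\xleftarrow{u}\underline{0}\ \mapsto\ \underline{0}\xleftarrow{\mathrm{id}_0}\underline{0}\xrightarrow{\mathrm{id}_0}\underline{0}$; $\ \underline{2}\xrightarrow{m}\underline{1}\xleftarrow{u}\underline{0}\ \mapsto\ \underline{2}\xleftarrow{u^{\amalg 2}}\underline{0}\xrightarrow{\mathrm{id}_0}\underline{0}$; $\ \underline{0}\xrightarrow{u}\underline{1}\xleftarrow{m}\underline{2}\ \mapsto\ \underline{0}\xleftarrow{\mathrm{id}_0}\underline{0}\xrightarrow{u^{\amalg 2}}\underline{2}$, where $\sigma_{2,3}=\mathrm{id}_1\amalg\sigma\amalg\mathrm{id}_1$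 and $\sigma$ is the transposition in $\Sigma_2$ with trivial labels.
   Formalization: Clause (ii) of the distributive law, ill-defined as printed, is read with labels inverted: (φ,g⁻¹)↦(φ*(g)⁻¹,g_*(φ)), and symmetrically. Natural transformations in Alg are monoidal. Strict functors into a non-strict S have canonical structure maps (identities if S is strict). *)

theory Defs
  imports "HOL-Algebra.Group" "HOL-Combinatorics.Permutations"
begin

section \<open>Categories, functors and equivalences\<close>

record ('o, 'a) category =
  Obj :: "'o set"
  Arr :: "'a set"
  Dom :: "'a \<Rightarrow> 'o"
  Cod :: "'a \<Rightarrow> 'o"
  Ide :: "'o \<Rightarrow> 'a"
  Comp :: "'a \<Rightarrow> 'a \<Rightarrow> 'a" (infixl "\<cdot>\<index>" 70)

definition Hom :: "('o, 'a, 'z) category_scheme \<Rightarrow> 'o \<Rightarrow> 'o \<Rightarrow> 'a set" where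
  "Hom C a b = {f \<in> Arr C. Dom C f = a \<and> Cod C f = b}"

locale category =
  fixes C :: "('o, 'a, 'z) category_scheme" (structure)
  assumes Dom_in_Obj: "f \<in> Arr C \<Longrightarrow> Dom C f \<in> Obj C"
    and Cod_in_Obj: "f \<in> Arr C \<Longrightarrow> Cod C f \<in> Obj C"
    and Ide_in_Hom: "a \<in> Obj C \<Longrightarrow> Ide C a \<in> Hom C a a"
    and Comp_in_Hom: "f \<in> Hom C a b \<Longrightarrow> g \<in> Hom C b c \<Longrightarrow> g \<cdot> f \<in> Hom C a c"
    and Comp_Ide: "f \<in> Hom C a b \<Longrightarrow> f \<cdot> Ide C a = f"
    and Ide_Comp: "f \<in> Hom C a b \<Longrightarrow> Ide C b \<cdot> f = f"
    and Comp_assoc: "f \<in> Hom C a b \<Longrightarrow> g \<in> Hom C b c \<Longrightarrow> h \<in> Hom C c d \<Longrightarrow>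
      h \<cdot> (g \<cdot> f) = (h \<cdot> g) \<cdot> f"

definition inverse_arrows :: "('o, 'a, 'z) category_scheme \<Rightarrow> 'a \<Rightarrow> 'a \<Rightarrow> bool" where
  "inverse_arrows C f g \<longleftrightarrow>
     f \<in> Arr C \<and> g \<in> Hom C (Cod C f) (Dom C f) \<and>
     g \<cdot>\<^bsub>C\<^esub> f = Ide C (Dom C f) \<and> f \<cdot>\<^bsub>C\<^esub> g = Ide C (Cod C f)"

definition iso_arr :: "('o, 'a, 'z) category_scheme \<Rightarrow> 'a \<Rightarrow> bool" where
  "iso_arr C f \<longleftrightarrow> (\<exists>g. inverse_arrows C f g)"

definition Inv :: "('o, 'a, 'z) category_scheme \<Rightarrow> 'a \<Rightarrow> 'a" where
  "Inv C f = (THE g. inverse_arrows C f g)"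

record ('o, 'a, 'p, 'b) cfunctor =
  FObj :: "'o \<Rightarrow> 'p"
  FArr :: "'a \<Rightarrow> 'b"

definition is_functor ::
  "('o, 'a, 'y) category_scheme \<Rightarrow> ('p, 'b, 'z) category_scheme \<Rightarrow>
   ('o, 'a, 'p, 'b, 'w) cfunctor_scheme \<Rightarrow> bool" where
  "is_functor C D F \<longleftrightarrow>
     (\<forall>a \<in> Obj C. FObj F a \<in> Obj D) \<and>
     (\<forall>f \<in> Arr C. FArr F f \<in> Hom D (FObj F (Dom C f)) (FObj F (Cod C f))) \<and>
     (\<forall>a \<in> Obj C. FArr F (Ide C a) = Ide D (FObj F a)) \<and>
     (\<forall>f \<in> Arr C. \<forall>g \<in> Arr C. Dom C g = Cod C f \<longrightarrow>
        FArr F (g \<cdot>\<^bsub>C\<^esub> f) = FArr F g \<cdot>\<^bsub>D\<^esub> FArr F f)"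

definition natural_transformation ::
  "('o, 'a, 'y) category_scheme \<Rightarrow> ('p, 'b, 'z) category_scheme \<Rightarrow>
   ('o, 'a, 'p, 'b, 'v) cfunctor_scheme \<Rightarrow> ('o, 'a, 'p, 'b, 'w) cfunctor_scheme \<Rightarrow>
   ('o \<Rightarrow> 'b) \<Rightarrow> bool" where
  "natural_transformation C D F F' \<theta> \<longleftrightarrow>
     (\<forall>a \<in> Obj C. \<theta> a \<in> Hom D (FObj F a) (FObj F' a)) \<and>
     (\<forall>f \<in> Arr C. FArr F' f \<cdot>\<^bsub>D\<^esub> \<theta> (Dom C f) = \<theta> (Cod C f) \<cdot>\<^bsub>D\<^esub> FArr F f)"

definition id_functor :: "('o, 'a, 'o, 'a) cfunctor" where
  "id_functor = \<lparr>FObj = (\<lambda>a. a), FArr = (\<lambda>f. f)\<rparr>"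

definition comp_functor ::
  "('p, 'b, 'q, 'c) cfunctor \<Rightarrow> ('o, 'a, 'p, 'b) cfunctor \<Rightarrow> ('o, 'a, 'q, 'c) cfunctor" where
  "comp_functor G F = \<lparr>FObj = FObj G \<circ> FObj F, FArr = FArr G \<circ> FArr F\<rparr>"

definition equivalent_categories ::
  "('o, 'a, 'y) category_scheme \<Rightarrow> ('p, 'b, 'z) category_scheme \<Rightarrow> bool" where
  "equivalent_categories C D \<longleftrightarrow>
     category C \<and> category D \<and>
     (\<exists>F G \<eta> \<epsilon>.
        is_functor C D F \<and> is_functor D C G \<and>
        natural_transformation C C id_functor (comp_functor G F) \<eta> \<and>
        (\<forall>a \<in> Obj C. iso_arr C (\<eta> a)) \<and>
        natural_transformation D D (comp_functor F G) id_functor \<epsilon> \<and>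
        (\<forall>b \<in> Obj D. iso_arr D (\<epsilon> b)))"

text \<open>
  Arrows of categories of structured objects or of functors carry their source and target,
  so that domain and codomain are functions of the arrow.
\<close>

datatype ('x, 't) mor = Mor (src: 'x) (tgt: 'x) (under: 't)

text \<open>
  Functors and transformations that are elements of a functor category are required to be
  \<^const>\<open>extensional\<close>, so that they are determined by their values on the source category.
\<close>

definition Fun ::
  "('o, 'a, 'y) category_scheme \<Rightarrow> ('p, 'b, 'z) category_scheme \<Rightarrow>
   (('o, 'a, 'p, 'b) cfunctor, (('o, 'a, 'p, 'b) cfunctor, 'o \<Rightarrow> 'b) mor) category" where
  "Fun C D =
     (let Fs = {F. is_functor C D F \<and>
                   FObj F \<in> extensional (Obj C) \<and> FArr F \<in> extensional (Arr C)}
      in \<lparr>Obj = Fs,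
          Arr = {Mor F F' \<theta> | F F' \<theta>.
                   F \<in> Fs \<and> F' \<in> Fs \<and> natural_transformation C D F F' \<theta> \<and>
                   \<theta> \<in> extensional (Obj C)},
          Dom = src, Cod = tgt,
          Ide = (\<lambda>F. Mor F F (\<lambda>a \<in> Obj C. Ide D (FObj F a))),
          Comp = (\<lambda>t s. Mor (src s) (tgt t) (\<lambda>a \<in> Obj C. under t a \<cdot>\<^bsub>D\<^esub> under s a))\<rparr>)"

definition one_object_category :: "('g, 'z) monoid_scheme \<Rightarrow> (unit, 'g) category" where
  "one_object_category G =
     \<lparr>Obj = {()}, Arr = carrier G, Dom = (\<lambda>_. ()), Cod = (\<lambda>_. ()),
      Ide = (\<lambda>_. \<one>\<^bsub>G\<^esub>), Comp = (\<lambda>x y. x \<otimes>\<^bsub>G\<^esub> y)\<rparr>"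


section \<open>Symmetric monoidal categories\<close>

record ('o, 'a) smc = "('o, 'a) category" +
  TObj :: "'o \<Rightarrow> 'o \<Rightarrow> 'o" (infixl "\<boxdot>\<index>" 75)
  TArr :: "'a \<Rightarrow> 'a \<Rightarrow> 'a" (infixl "\<boxtimes>\<index>" 75)
  TUnit :: "'o"
  Assoc :: "'o \<Rightarrow> 'o \<Rightarrow> 'o \<Rightarrow> 'a"
  LUnit :: "'o \<Rightarrow> 'a"
  RUnit :: "'o \<Rightarrow> 'a"
  Sym :: "'o \<Rightarrow> 'o \<Rightarrow> 'a"

locale symmetric_monoidal_category = category S
  for S :: "('o, 'a, 'z) smc_scheme" (structure) +
  assumes TUnit_in_Obj: "TUnit S \<in> Obj S"
    and TObj_in_Obj: "a \<in> Obj S \<Longrightarrow> b \<in> Obj S \<Longrightarrow> a \<boxdot> b \<in> Obj S"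
    and TArr_in_Hom: "f \<in> Hom S a b \<Longrightarrow> g \<in> Hom S c d \<Longrightarrow> f \<boxtimes> g \<in> Hom S (a \<boxdot> c) (b \<boxdot> d)"
    and TArr_Ide: "a \<in> Obj S \<Longrightarrow> b \<in> Obj S \<Longrightarrow> Ide S a \<boxtimes> Ide S b = Ide S (a \<boxdot> b)"
    and TArr_Comp: "f \<in> Hom S a b \<Longrightarrow> g \<in> Hom S b c \<Longrightarrow> f' \<in> Hom S a' b' \<Longrightarrow> g' \<in> Hom S b' c' \<Longrightarrow>
      (g \<cdot> f) \<boxtimes> (g' \<cdot> f') = (g \<boxtimes> g') \<cdot> (f \<boxtimes> f')"
    and Assoc_in_Hom: "a \<in> Obj S \<Longrightarrow> b \<in> Obj S \<Longrightarrow> c \<in> Obj S \<Longrightarrow>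
      Assoc S a b c \<in> Hom S ((a \<boxdot> b) \<boxdot> c) (a \<boxdot> (b \<boxdot> c))"
    and Assoc_iso: "a \<in> Obj S \<Longrightarrow> b \<in> Obj S \<Longrightarrow> c \<in> Obj S \<Longrightarrow> iso_arr S (Assoc S a b c)"
    and Assoc_natural: "f \<in> Hom S a a' \<Longrightarrow> g \<in> Hom S b b' \<Longrightarrow> h \<in> Hom S c c' \<Longrightarrow>
      Assoc S a' b' c' \<cdot> ((f \<boxtimes> g) \<boxtimes> h) = (f \<boxtimes> (g \<boxtimes> h)) \<cdot> Assoc S a b c"
    and LUnit_in_Hom: "a \<in> Obj S \<Longrightarrow> LUnit S a \<in> Hom S (TUnit S \<boxdot> a) a"
    and LUnit_iso: "a \<in> Obj S \<Longrightarrow> iso_arr S (LUnit S a)"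
    and LUnit_natural: "f \<in> Hom S a b \<Longrightarrow> LUnit S b \<cdot> (Ide S (TUnit S) \<boxtimes> f) = f \<cdot> LUnit S a"
    and RUnit_in_Hom: "a \<in> Obj S \<Longrightarrow> RUnit S a \<in> Hom S (a \<boxdot> TUnit S) a"
    and RUnit_iso: "a \<in> Obj S \<Longrightarrow> iso_arr S (RUnit S a)"
    and RUnit_natural: "f \<in> Hom S a b \<Longrightarrow> RUnit S b \<cdot> (f \<boxtimes> Ide S (TUnit S)) = f \<cdot> RUnit S a"
    and Sym_in_Hom: "a \<in> Obj S \<Longrightarrow> b \<in> Obj S \<Longrightarrow> Sym S a b \<in> Hom S (a \<boxdot> b) (b \<boxdot> a)"
    and Sym_natural: "f \<in> Hom S a a' \<Longrightarrow> g \<in> Hom S b b' \<Longrightarrow>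
      Sym S a' b' \<cdot> (f \<boxtimes> g) = (g \<boxtimes> f) \<cdot> Sym S a b"
    and Sym_Sym: "a \<in> Obj S \<Longrightarrow> b \<in> Obj S \<Longrightarrow> Sym S b a \<cdot> Sym S a b = Ide S (a \<boxdot> b)"
    and pentagon: "a \<in> Obj S \<Longrightarrow> b \<in> Obj S \<Longrightarrow> c \<in> Obj S \<Longrightarrow> d \<in> Obj S \<Longrightarrow>
      Assoc S a b (c \<boxdot> d) \<cdot> Assoc S (a \<boxdot> b) c d =
      (Ide S a \<boxtimes> Assoc S b c d) \<cdot> Assoc S a (b \<boxdot> c) d \<cdot> (Assoc S a b c \<boxtimes> Ide S d)"
    and triangle: "a \<in> Obj S \<Longrightarrow> b \<in> Obj S \<Longrightarrow>
      (Ide S a \<boxtimes> LUnit S b) \<cdot> Assoc S a (TUnit S) b = RUnit S a \<boxtimes> Ide S b"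
    and hexagon: "a \<in> Obj S \<Longrightarrow> b \<in> Obj S \<Longrightarrow> c \<in> Obj S \<Longrightarrow>
      Assoc S b c a \<cdot> Sym S a (b \<boxdot> c) \<cdot> Assoc S a b c =
      (Ide S b \<boxtimes> Sym S a c) \<cdot> Assoc S b a c \<cdot> (Sym S a b \<boxtimes> Ide S c)"

definition opposite :: "('o, 'a) smc \<Rightarrow> ('o, 'a) smc" where
  "opposite C =
     \<lparr>Obj = Obj C, Arr = Arr C, Dom = Cod C, Cod = Dom C, Ide = Ide C,
      Comp = (\<lambda>g f. f \<cdot>\<^bsub>C\<^esub> g), TObj = TObj C, TArr = TArr C, TUnit = TUnit C,
      Assoc = (\<lambda>a b c. Inv C (Assoc C a b c)),
      LUnit = (\<lambda>a. Inv C (LUnit C a)), RUnit = (\<lambda>a. Inv C (RUnit C a)),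
      Sym = (\<lambda>a b. Sym C b a)\<rparr>"

text \<open>The canonical arrows built from the associativity and unit constraints alone.\<close>

inductive_set canonical_arrows :: "('o, 'a, 'z) smc_scheme \<Rightarrow> 'a set"
  for S :: "('o, 'a, 'z) smc_scheme" where
  "a \<in> Obj S \<Longrightarrow> Ide S a \<in> canonical_arrows S"
| "a \<in> Obj S \<Longrightarrow> b \<in> Obj S \<Longrightarrow> c \<in> Obj S \<Longrightarrow> Assoc S a b c \<in> canonical_arrows S"
| "a \<in> Obj S \<Longrightarrow> LUnit S a \<in> canonical_arrows S"
| "a \<in> Obj S \<Longrightarrow> RUnit S a \<in> canonical_arrows S"
| "f \<in> canonical_arrows S \<Longrightarrow> Inv S f \<in> canonical_arrows S"
| "f \<in> canonical_arrows S \<Longrightarrow> g \<in> canonical_arrows S \<Longrightarrow> Dom S g = Cod S f \<Longrightarrow>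
     g \<cdot>\<^bsub>S\<^esub> f \<in> canonical_arrows S"
| "f \<in> canonical_arrows S \<Longrightarrow> g \<in> canonical_arrows S \<Longrightarrow> f \<boxtimes>\<^bsub>S\<^esub> g \<in> canonical_arrows S"

lemma (in symmetric_monoidal_category) canonical_arrows_strict:
  assumes "\<And>a b c. a \<in> Obj S \<Longrightarrow> b \<in> Obj S \<Longrightarrow> c \<in> Obj S \<Longrightarrow> \<exists>d \<in> Obj S. Assoc S a b c = Ide S d"
    and "\<And>a. a \<in> Obj S \<Longrightarrow> \<exists>d \<in> Obj S. LUnit S a = Ide S d"
    and "\<And>a. a \<in> Obj S \<Longrightarrow> \<exists>d \<in> Obj S. RUnit S a = Ide S d"
    and "f \<in> canonical_arrows S"
  shows "\<exists>d \<in> Obj S. f = Ide S d"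
  using assms(4)
proof induction
  case (5 f)
  then obtain d where d: "d \<in> Obj S" "f = Ide S d" by blast
  have h: "Ide S d \<in> Hom S d d" using d Ide_in_Hom by blast
  then have dc: "Dom S (Ide S d) = d" "Cod S (Ide S d) = d" "Ide S d \<in> Arr S"
    by (auto simp: Hom_def)
  have "Inv S f = Ide S d"
    unfolding Inv_def d(2)
  proof (rule the_equality)
    show "inverse_arrows S (Ide S d) (Ide S d)"
      using h dc Comp_Ide[OF h] by (simp add: inverse_arrows_def)
  next
    fix g assume g: "inverse_arrows S (Ide S d) g"
    then have "g \<in> Hom S d d" using dc by (simp add: inverse_arrows_def)
    then have "g = g \<cdot> Ide S d" by (rule Comp_Ide[symmetric])
    also have "\<dots> = Ide S d" using g dc by (simp add: inverse_arrows_def)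
    finally show "g = Ide S d" .
  qed
  then show ?case using d by blast
next
  case (6 f g)
  then obtain d e where d: "d \<in> Obj S" "f = Ide S d" "e \<in> Obj S" "g = Ide S e" by blast
  have "Dom S (Ide S e) = e" "Cod S (Ide S d) = d"
    using Ide_in_Hom[OF d(1)] Ide_in_Hom[OF d(3)] by (auto simp: Hom_def)
  then have "e = d" using 6(3) d by simp
  then show ?case using d Comp_Ide[OF Ide_in_Hom] by metis
next
  case (7 f g)
  then show ?case using TArr_Ide TObj_in_Obj by metis
qed (use assms(1-3) in blast)+


section \<open>Algebras\<close>

text \<open>
  The target \<open>S\<close> need not be strict, whereas the source \<open>T\<close> of an algebra is. A symmetric strict
  monoidal functor preserves tensor products up to the canonical isomorphisms of \<open>S\<close>: its structure
  maps \<open>F a \<otimes> F b \<rightarrow> F (a \<otimes> b)\<close> and \<open>I \<rightarrow> F I\<close> lie in \<^const>\<open>canonical_arrows\<close>. If \<open>S\<close> is strict,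
  they are identities by \<open>canonical_arrows_strict\<close>, that is, \<open>F a \<otimes> F b = F (a \<otimes> b)\<close>
  and \<open>I = F I\<close>.
  Strict equality for arbitrary \<open>S\<close> would be too narrow: in general a monoid \<open>M\<close> does not satisfy
  \<open>(M \<otimes> M) \<otimes> M = M \<otimes> (M \<otimes> M)\<close>. Transformations between algebras are monoidal, as otherwise they
  are not determined by their component at \<open>1\<close>.
\<close>

record ('o, 'a, 'p, 'b) monfunctor = "('o, 'a, 'p, 'b) cfunctor" +
  FTens :: "'o \<times> 'o \<Rightarrow> 'b"
  FUnit :: "'b"

definition symmetric_strict_monoidal_functor ::
  "('o, 'a, 'y) smc_scheme \<Rightarrow> ('p, 'b, 'z) smc_scheme \<Rightarrow>
   ('o, 'a, 'p, 'b, 'w) monfunctor_scheme \<Rightarrow> bool" where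
  "symmetric_strict_monoidal_functor T S F \<longleftrightarrow>
     is_functor T S F \<and>
     (\<forall>a \<in> Obj T. \<forall>b \<in> Obj T.
        FTens F (a, b) \<in> Hom S (FObj F a \<boxdot>\<^bsub>S\<^esub> FObj F b) (FObj F (a \<boxdot>\<^bsub>T\<^esub> b)) \<and>
        FTens F (a, b) \<in> canonical_arrows S) \<and>
     FUnit F \<in> Hom S (TUnit S) (FObj F (TUnit T)) \<and>
     FUnit F \<in> canonical_arrows S \<and>
     (\<forall>f \<in> Arr T. \<forall>g \<in> Arr T.
        FArr F (f \<boxtimes>\<^bsub>T\<^esub> g) \<cdot>\<^bsub>S\<^esub> FTens F (Dom T f, Dom T g) =
        FTens F (Cod T f, Cod T g) \<cdot>\<^bsub>S\<^esub> (FArr F f \<boxtimes>\<^bsub>S\<^esub> FArr F g)) \<and>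
     (\<forall>a \<in> Obj T. \<forall>b \<in> Obj T. \<forall>c \<in> Obj T.
        FArr F (Assoc T a b c) \<cdot>\<^bsub>S\<^esub> FTens F (a \<boxdot>\<^bsub>T\<^esub> b, c) \<cdot>\<^bsub>S\<^esub>
          (FTens F (a, b) \<boxtimes>\<^bsub>S\<^esub> Ide S (FObj F c)) =
        FTens F (a, b \<boxdot>\<^bsub>T\<^esub> c) \<cdot>\<^bsub>S\<^esub> (Ide S (FObj F a) \<boxtimes>\<^bsub>S\<^esub> FTens F (b, c)) \<cdot>\<^bsub>S\<^esub>
          Assoc S (FObj F a) (FObj F b) (FObj F c)) \<and>
     (\<forall>a \<in> Obj T.
        FArr F (LUnit T a) \<cdot>\<^bsub>S\<^esub> FTens F (TUnit T, a) \<cdot>\<^bsub>S\<^esub> (FUnit F \<boxtimes>\<^bsub>S\<^esub> Ide S (FObj F a)) =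
        LUnit S (FObj F a)) \<and>
     (\<forall>a \<in> Obj T.
        FArr F (RUnit T a) \<cdot>\<^bsub>S\<^esub> FTens F (a, TUnit T) \<cdot>\<^bsub>S\<^esub> (Ide S (FObj F a) \<boxtimes>\<^bsub>S\<^esub> FUnit F) =
        RUnit S (FObj F a)) \<and>
     (\<forall>a \<in> Obj T. \<forall>b \<in> Obj T.
        FArr F (Sym T a b) \<cdot>\<^bsub>S\<^esub> FTens F (a, b) =
        FTens F (b, a) \<cdot>\<^bsub>S\<^esub> Sym S (FObj F a) (FObj F b))"

definition monoidal_transformation ::
  "('o, 'a, 'y) smc_scheme \<Rightarrow> ('p, 'b, 'z) smc_scheme \<Rightarrow>
   ('o, 'a, 'p, 'b, 'v) monfunctor_scheme \<Rightarrow> ('o, 'a, 'p, 'b, 'w) monfunctor_scheme \<Rightarrow>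
   ('o \<Rightarrow> 'b) \<Rightarrow> bool" where
  "monoidal_transformation T S F F' \<theta> \<longleftrightarrow>
     natural_transformation T S F F' \<theta> \<and>
     (\<forall>a \<in> Obj T. \<forall>b \<in> Obj T.
        \<theta> (a \<boxdot>\<^bsub>T\<^esub> b) \<cdot>\<^bsub>S\<^esub> FTens F (a, b) = FTens F' (a, b) \<cdot>\<^bsub>S\<^esub> (\<theta> a \<boxtimes>\<^bsub>S\<^esub> \<theta> b)) \<and>
     \<theta> (TUnit T) \<cdot>\<^bsub>S\<^esub> FUnit F = FUnit F'"

definition Alg ::
  "('o, 'a, 'y) smc_scheme \<Rightarrow> ('p, 'b, 'z) smc_scheme \<Rightarrow>
   (('o, 'a, 'p, 'b) monfunctor, (('o, 'a, 'p, 'b) monfunctor, 'o \<Rightarrow> 'b) mor) category" where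
  "Alg T S =
     (let Fs = {F. symmetric_strict_monoidal_functor T S F \<and>
                   FObj F \<in> extensional (Obj T) \<and> FArr F \<in> extensional (Arr T) \<and>
                   FTens F \<in> extensional (Obj T \<times> Obj T)}
      in \<lparr>Obj = Fs,
          Arr = {Mor F F' \<theta> | F F' \<theta>.
                   F \<in> Fs \<and> F' \<in> Fs \<and> monoidal_transformation T S F F' \<theta> \<and>
                   \<theta> \<in> extensional (Obj T)},
          Dom = src, Cod = tgt,
          Ide = (\<lambda>F. Mor F F (\<lambda>a \<in> Obj T. Ide S (FObj F a))),
          Comp = (\<lambda>t s. Mor (src s) (tgt t) (\<lambda>a \<in> Obj T. under t a \<cdot>\<^bsub>S\<^esub> under s a))\<rparr>)"


section \<open>Involutive monoids, comonoids and bimonoids\<close>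

definition structured_objects ::
  "('o, 'a, 'z) category_scheme \<Rightarrow> 'x set \<Rightarrow> ('x \<Rightarrow> 'o) \<Rightarrow> ('x \<Rightarrow> 'x \<Rightarrow> 'a \<Rightarrow> bool) \<Rightarrow>
   ('x, ('x, 'a) mor) category" where
  "structured_objects S X ob P =
     \<lparr>Obj = X,
      Arr = {Mor M N f | M N f. M \<in> X \<and> N \<in> X \<and> f \<in> Hom S (ob M) (ob N) \<and> P M N f},
      Dom = src, Cod = tgt,
      Ide = (\<lambda>M. Mor M M (Ide S (ob M))),
      Comp = (\<lambda>t s. Mor (src s) (tgt t) (under t \<cdot>\<^bsub>S\<^esub> under s))\<rparr>"

record ('o, 'a) imon =
  MObj :: "'o"
  MMult :: "'a"
  MUnit :: "'a"
  MInv :: "'a"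

record ('o, 'a) icomon =
  CObj :: "'o"
  CComult :: "'a"
  CCounit :: "'a"
  CInv :: "'a"

record ('o, 'a) ibimon = "('o, 'a) imon" +
  BComult :: "'a"
  BCounit :: "'a"

definition comonoid_part :: "('o, 'a) ibimon \<Rightarrow> ('o, 'a) icomon" where
  "comonoid_part B =
     \<lparr>CObj = MObj B, CComult = BComult B, CCounit = BCounit B, CInv = MInv B\<rparr>"

definition is_monoid :: "('o, 'a, 'y) smc_scheme \<Rightarrow> ('o, 'a, 'z) imon_scheme \<Rightarrow> bool" where
  "is_monoid S M \<longleftrightarrow>
     (let X = MObj M; \<mu> = MMult M; \<eta> = MUnit M in
      X \<in> Obj S \<and> \<mu> \<in> Hom S (X \<boxdot>\<^bsub>S\<^esub> X) X \<and> \<eta> \<in> Hom S (TUnit S) X \<and>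
      \<mu> \<cdot>\<^bsub>S\<^esub> (\<mu> \<boxtimes>\<^bsub>S\<^esub> Ide S X) = \<mu> \<cdot>\<^bsub>S\<^esub> (Ide S X \<boxtimes>\<^bsub>S\<^esub> \<mu>) \<cdot>\<^bsub>S\<^esub> Assoc S X X X \<and>
      \<mu> \<cdot>\<^bsub>S\<^esub> (\<eta> \<boxtimes>\<^bsub>S\<^esub> Ide S X) = LUnit S X \<and>
      \<mu> \<cdot>\<^bsub>S\<^esub> (Ide S X \<boxtimes>\<^bsub>S\<^esub> \<eta>) = RUnit S X)"

definition is_involutive_monoid :: "('o, 'a, 'y) smc_scheme \<Rightarrow> ('o, 'a, 'z) imon_scheme \<Rightarrow> bool" where
  "is_involutive_monoid S M \<longleftrightarrow>
     is_monoid S M \<and>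
     (let X = MObj M; \<mu> = MMult M; \<eta> = MUnit M; i = MInv M in
      i \<in> Hom S X X \<and> i \<cdot>\<^bsub>S\<^esub> i = Ide S X \<and> i \<cdot>\<^bsub>S\<^esub> \<eta> = \<eta> \<and>
      i \<cdot>\<^bsub>S\<^esub> \<mu> = \<mu> \<cdot>\<^bsub>S\<^esub> Sym S X X \<cdot>\<^bsub>S\<^esub> (i \<boxtimes>\<^bsub>S\<^esub> i))"

definition is_monoid_mor ::
  "('o, 'a, 'y) smc_scheme \<Rightarrow> ('o, 'a, 'z) imon_scheme \<Rightarrow> ('o, 'a, 'z) imon_scheme \<Rightarrow> 'a \<Rightarrow> bool" where
  "is_monoid_mor S M N f \<longleftrightarrow>
     f \<cdot>\<^bsub>S\<^esub> MMult M = MMult N \<cdot>\<^bsub>S\<^esub> (f \<boxtimes>\<^bsub>S\<^esub> f) \<and> f \<cdot>\<^bsub>S\<^esub> MUnit M = MUnit N"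

definition is_comonoid :: "('o, 'a, 'y) smc_scheme \<Rightarrow> ('o, 'a, 'z) icomon_scheme \<Rightarrow> bool" where
  "is_comonoid S M \<longleftrightarrow>
     (let X = CObj M; \<Delta> = CComult M; \<epsilon> = CCounit M in
      X \<in> Obj S \<and> \<Delta> \<in> Hom S X (X \<boxdot>\<^bsub>S\<^esub> X) \<and> \<epsilon> \<in> Hom S X (TUnit S) \<and>
      Assoc S X X X \<cdot>\<^bsub>S\<^esub> (\<Delta> \<boxtimes>\<^bsub>S\<^esub> Ide S X) \<cdot>\<^bsub>S\<^esub> \<Delta> = (Ide S X \<boxtimes>\<^bsub>S\<^esub> \<Delta>) \<cdot>\<^bsub>S\<^esub> \<Delta> \<and>
      LUnit S X \<cdot>\<^bsub>S\<^esub> (\<epsilon> \<boxtimes>\<^bsub>S\<^esub> Ide S X) \<cdot>\<^bsub>S\<^esub> \<Delta> = Ide S X \<and>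
      RUnit S X \<cdot>\<^bsub>S\<^esub> (Ide S X \<boxtimes>\<^bsub>S\<^esub> \<epsilon>) \<cdot>\<^bsub>S\<^esub> \<Delta> = Ide S X)"

definition is_involutive_comonoid ::
  "('o, 'a, 'y) smc_scheme \<Rightarrow> ('o, 'a, 'z) icomon_scheme \<Rightarrow> bool" where
  "is_involutive_comonoid S M \<longleftrightarrow>
     is_comonoid S M \<and>
     (let X = CObj M; \<Delta> = CComult M; \<epsilon> = CCounit M; i = CInv M in
      i \<in> Hom S X X \<and> i \<cdot>\<^bsub>S\<^esub> i = Ide S X \<and> \<epsilon> \<cdot>\<^bsub>S\<^esub> i = \<epsilon> \<and>
      \<Delta> \<cdot>\<^bsub>S\<^esub> i = (i \<boxtimes>\<^bsub>S\<^esub> i) \<cdot>\<^bsub>S\<^esub> Sym S X X \<cdot>\<^bsub>S\<^esub> \<Delta>)"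

definition is_comonoid_mor ::
  "('o, 'a, 'y) smc_scheme \<Rightarrow> ('o, 'a, 'z) icomon_scheme \<Rightarrow> ('o, 'a, 'z) icomon_scheme \<Rightarrow> 'a \<Rightarrow> bool" where
  "is_comonoid_mor S M N f \<longleftrightarrow>
     CComult N \<cdot>\<^bsub>S\<^esub> f = (f \<boxtimes>\<^bsub>S\<^esub> f) \<cdot>\<^bsub>S\<^esub> CComult M \<and> CCounit N \<cdot>\<^bsub>S\<^esub> f = CCounit M"

text \<open>The exchange of the middle factors, \<open>(a \<otimes> b) \<otimes> (c \<otimes> d) \<rightarrow> (a \<otimes> c) \<otimes> (b \<otimes> d)\<close>.\<close>

definition middle_exchange :: "('o, 'a, 'z) smc_scheme \<Rightarrow> 'o \<Rightarrow> 'o \<Rightarrow> 'o \<Rightarrow> 'o \<Rightarrow> 'a" where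
  "middle_exchange S a b c d =
     Inv S (Assoc S a c (b \<boxdot>\<^bsub>S\<^esub> d)) \<cdot>\<^bsub>S\<^esub>
     (Ide S a \<boxtimes>\<^bsub>S\<^esub>
        (Assoc S c b d \<cdot>\<^bsub>S\<^esub> (Sym S b c \<boxtimes>\<^bsub>S\<^esub> Ide S d) \<cdot>\<^bsub>S\<^esub> Inv S (Assoc S b c d))) \<cdot>\<^bsub>S\<^esub>
     Assoc S a b (c \<boxdot>\<^bsub>S\<^esub> d)"

definition is_bimonoid :: "('o, 'a, 'y) smc_scheme \<Rightarrow> ('o, 'a) ibimon \<Rightarrow> bool" where
  "is_bimonoid S B \<longleftrightarrow>
     is_monoid S B \<and> is_comonoid S (comonoid_part B) \<and>
     (let X = MObj B; \<mu> = MMult B; \<eta> = MUnit B; \<Delta> = BComult B; \<epsilon> = BCounit B in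
      \<Delta> \<cdot>\<^bsub>S\<^esub> \<mu> = (\<mu> \<boxtimes>\<^bsub>S\<^esub> \<mu>) \<cdot>\<^bsub>S\<^esub> middle_exchange S X X X X \<cdot>\<^bsub>S\<^esub> (\<Delta> \<boxtimes>\<^bsub>S\<^esub> \<Delta>) \<and>
      \<Delta> \<cdot>\<^bsub>S\<^esub> \<eta> = (\<eta> \<boxtimes>\<^bsub>S\<^esub> \<eta>) \<cdot>\<^bsub>S\<^esub> Inv S (LUnit S (TUnit S)) \<and>
      \<epsilon> \<cdot>\<^bsub>S\<^esub> \<mu> = LUnit S (TUnit S) \<cdot>\<^bsub>S\<^esub> (\<epsilon> \<boxtimes>\<^bsub>S\<^esub> \<epsilon>) \<and>
      \<epsilon> \<cdot>\<^bsub>S\<^esub> \<eta> = Ide S (TUnit S))"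

definition is_involutive_bimonoid :: "('o, 'a, 'y) smc_scheme \<Rightarrow> ('o, 'a) ibimon \<Rightarrow> bool" where
  "is_involutive_bimonoid S B \<longleftrightarrow>
     is_bimonoid S B \<and> is_involutive_monoid S B \<and> is_involutive_comonoid S (comonoid_part B)"

definition IMon ::
  "('o, 'a, 'z) smc_scheme \<Rightarrow> (('o, 'a) imon, (('o, 'a) imon, 'a) mor) category" where
  "IMon S = structured_objects S {M. is_involutive_monoid S M} MObj
     (\<lambda>M N f. is_monoid_mor S M N f \<and> f \<cdot>\<^bsub>S\<^esub> MInv M = MInv N \<cdot>\<^bsub>S\<^esub> f)"

definition IComon ::
  "('o, 'a, 'z) smc_scheme \<Rightarrow> (('o, 'a) icomon, (('o, 'a) icomon, 'a) mor) category" where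
  "IComon S = structured_objects S {M. is_involutive_comonoid S M} CObj
     (\<lambda>M N f. is_comonoid_mor S M N f \<and> f \<cdot>\<^bsub>S\<^esub> CInv M = CInv N \<cdot>\<^bsub>S\<^esub> f)"

definition IBimon ::
  "('o, 'a, 'z) smc_scheme \<Rightarrow> (('o, 'a) ibimon, (('o, 'a) ibimon, 'a) mor) category" where
  "IBimon S = structured_objects S {B. is_involutive_bimonoid S B} MObj
     (\<lambda>B B' f. is_monoid_mor S B B' f \<and>
        is_comonoid_mor S (comonoid_part B) (comonoid_part B') f \<and>
        f \<cdot>\<^bsub>S\<^esub> MInv B = MInv B' \<cdot>\<^bsub>S\<^esub> f)"


section \<open>Order-preserving maps and the groups \<open>G\<^sup>n \<rtimes> H\<^sub>n\<close>\<close>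

text \<open>
  The object \<open>{1..n}\<close> of a PROP is represented by the number \<open>n\<close>. Maps out of \<open>{1..n}\<close> and families
  of labels are extensional functions on \<open>{1..n}\<close>, and permutations of \<open>{1..n}\<close> are the identity
  elsewhere (\<^const>\<open>permutes\<close>). The group \<open>C\<^sub>2\<close> is \<open>bool\<close> with exclusive or; \<open>True\<close> is
  the non-trivial element.
\<close>

definition ord_maps :: "nat \<Rightarrow> nat \<Rightarrow> (nat \<Rightarrow> nat) set" where
  "ord_maps n m = {\<phi> \<in> {1..n} \<rightarrow>\<^sub>E {1..m}. mono_on {1..n} \<phi>}"

datatype 'g lperm = LPerm (glabel: "nat \<Rightarrow> 'g") (clabel: "nat \<Rightarrow> bool") (perm: "nat \<Rightarrow> nat")

definition lperms :: "('g, 'z) monoid_scheme \<Rightarrow> nat \<Rightarrow> 'g lperm set" where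
  "lperms G n = {LPerm x e s | x e s.
     x \<in> {1..n} \<rightarrow>\<^sub>E carrier G \<and> e \<in> extensional {1..n} \<and> s permutes {1..n}}"

definition lp_one :: "('g, 'z) monoid_scheme \<Rightarrow> nat \<Rightarrow> 'g lperm" where
  "lp_one G n = LPerm (\<lambda>i \<in> {1..n}. \<one>\<^bsub>G\<^esub>) (\<lambda>i \<in> {1..n}. False) id"

definition lp_mult :: "('g, 'z) monoid_scheme \<Rightarrow> nat \<Rightarrow> 'g lperm \<Rightarrow> 'g lperm \<Rightarrow> 'g lperm" where
  "lp_mult G n h g = LPerm
     (\<lambda>i \<in> {1..n}. glabel h (perm g i) \<otimes>\<^bsub>G\<^esub> glabel g i)
     (\<lambda>i \<in> {1..n}. clabel h (perm g i) \<noteq> clabel g i)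
     (perm h \<circ> perm g)"

definition lp_inv :: "('g, 'z) monoid_scheme \<Rightarrow> nat \<Rightarrow> 'g lperm \<Rightarrow> 'g lperm" where
  "lp_inv G n g = LPerm
     (\<lambda>i \<in> {1..n}. inv\<^bsub>G\<^esub> (glabel g (inv_into UNIV (perm g) i)))
     (\<lambda>i \<in> {1..n}. clabel g (inv_into UNIV (perm g) i))
     (inv_into UNIV (perm g))"

text \<open>For \<open>\<phi> : n \<rightarrow> m\<close> and \<open>g\<close> on \<open>m\<close> strands: \<open>push n m g \<phi> = g\<^sub>\<star>(\<phi>)\<close> and
  \<open>pull n m \<phi> g = \<phi>\<^sup>\<star>(g)\<close>.\<close>

definition push :: "nat \<Rightarrow> nat \<Rightarrow> 'g lperm \<Rightarrow> (nat \<Rightarrow> nat) \<Rightarrow> (nat \<Rightarrow> nat)" where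
  "push n m g \<phi> = (THE \<psi>. \<psi> \<in> ord_maps n m \<and>
     (\<forall>i \<in> {1..m}. card {k \<in> {1..n}. \<psi> k = perm g i} = card {k \<in> {1..n}. \<phi> k = i}))"

definition pull :: "nat \<Rightarrow> nat \<Rightarrow> (nat \<Rightarrow> nat) \<Rightarrow> 'g lperm \<Rightarrow> 'g lperm" where
  "pull n m \<phi> g = LPerm
     (\<lambda>k \<in> {1..n}. glabel g (\<phi> k))
     (\<lambda>k \<in> {1..n}. clabel g (\<phi> k))
     (THE \<rho>. \<rho> permutes {1..n} \<and>
        (\<forall>k \<in> {1..n}. perm g (\<phi> k) = push n m g \<phi> (\<rho> k)) \<and>
        (\<forall>k \<in> {1..n}. \<forall>l \<in> {1..n}. k < l \<and> \<phi> k = \<phi> l \<longrightarrow>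
           (if clabel g (\<phi> k) then \<rho> l < \<rho> k else \<rho> k < \<rho> l)))"


section \<open>The PROP \<open>Q = \<D> \<otimes> \<H> \<otimes> \<G>\<close>\<close>

datatype 'g qarr = QArr (qdom: nat) (qcod: nat) (qmap: "nat \<Rightarrow> nat") (qgrp: "'g lperm")

definition qord :: "('g, 'z) monoid_scheme \<Rightarrow> nat \<Rightarrow> nat \<Rightarrow> (nat \<Rightarrow> nat) \<Rightarrow> 'g qarr" where
  "qord G n m \<phi> = QArr n m \<phi> (lp_one G n)"

definition qiso :: "nat \<Rightarrow> 'g lperm \<Rightarrow> 'g qarr" where
  "qiso n g = QArr n n (\<lambda>k \<in> {1..n}. k) g"

definition qide :: "('g, 'z) monoid_scheme \<Rightarrow> nat \<Rightarrow> 'g qarr" where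
  "qide G n = qiso n (lp_one G n)"

definition qcomp :: "('g, 'z) monoid_scheme \<Rightarrow> 'g qarr \<Rightarrow> 'g qarr \<Rightarrow> 'g qarr" where
  "qcomp G b a =
     (let n = qdom a; m = qcod a in
      QArr n (qcod b)
        (compose {1..n} (qmap b) (push n m (qgrp b) (qmap a)))
        (lp_mult G n (pull n m (qmap a) (qgrp b)) (qgrp a)))"

definition qtensor :: "'g qarr \<Rightarrow> 'g qarr \<Rightarrow> 'g qarr" where
  "qtensor a b =
     (let n = qdom a; m = qcod a; N = n + qdom b; g = qgrp a; h = qgrp b in
      QArr N (m + qcod b)
        (\<lambda>k \<in> {1..N}. if k \<le> n then qmap a k else qmap b (k - n) + m)
        (LPerm
           (\<lambda>k \<in> {1..N}. if k \<le> n then glabel g k else glabel h (k - n))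
           (\<lambda>k \<in> {1..N}. if k \<le> n then clabel g k else clabel h (k - n))
           (\<lambda>k. if k \<le> n then perm g k else perm h (k - n) + n)))"

definition block_perm :: "nat \<Rightarrow> nat \<Rightarrow> nat \<Rightarrow> nat" where
  "block_perm n m k =
     (if k \<in> {1..n} then k + m else if k \<in> {n + 1..n + m} then k - n else k)"

definition qsym :: "('g, 'z) monoid_scheme \<Rightarrow> nat \<Rightarrow> nat \<Rightarrow> 'g qarr" where
  "qsym G n m =
     qiso (n + m) (LPerm (glabel (lp_one G (n + m))) (clabel (lp_one G (n + m))) (block_perm n m))"

definition DHG :: "('g, 'z) monoid_scheme \<Rightarrow> (nat, 'g qarr) smc" where
  "DHG G =
     \<lparr>Obj = UNIV,
      Arr = {QArr n m \<phi> g | n m \<phi> g. \<phi> \<in> ord_maps n m \<and> g \<in> lperms G n},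
      Dom = qdom, Cod = qcod, Ide = qide G, Comp = qcomp G,
      TObj = (+), TArr = qtensor, TUnit = 0,
      Assoc = (\<lambda>a b c. qide G (a + b + c)), LUnit = qide G, RUnit = qide G,
      Sym = qsym G\<rparr>"


section \<open>The distributive law and the PROP \<open>\<D> \<otimes> (\<H> \<otimes> \<G>) \<otimes> \<D>\<^sup>o\<^sup>p\<close>\<close>

definition q_m :: "('g, 'z) monoid_scheme \<Rightarrow> 'g qarr" where
  "q_m G = qord G 2 1 (\<lambda>k \<in> {1..2}. 1)"

definition q_u :: "('g, 'z) monoid_scheme \<Rightarrow> 'g qarr" where
  "q_u G = qord G 0 1 (\<lambda>k \<in> {1..0}. 1)"

definition q_sigma23 :: "('g, 'z) monoid_scheme \<Rightarrow> 'g qarr" where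
  "q_sigma23 G = qtensor (qtensor (qide G 1) (qsym G 1 1)) (qide G 1)"

text \<open>
  \<open>dist_law G (f, h) (l, r)\<close>: the law sends the cospan \<open>n \<rightarrow> m \<leftarrow> p\<close> with legs \<open>f\<close>, \<open>h\<close> to the
  span \<open>n \<leftarrow> q \<rightarrow> p\<close> with legs \<open>l\<close>, \<open>r\<close>. It is the relation generated by the prescribed values
  under the closure properties of a distributive law of PROPs: compatibility with isomorphisms of
  the middle objects, with composition in either leg, and with tensor products.

  The values on a cospan of an order-preserving map and an isomorphism come from the identity
  \<open>g \<circ> \<phi> = g\<^sub>\<star>(\<phi>) \<circ> \<phi>\<^sup>\<star>(g)\<close>: they are
  \<open>(\<phi>, g\<^sup>-\<^sup>1) \<mapsto> (\<phi>\<^sup>\<star>(g)\<^sup>-\<^sup>1, g\<^sub>\<star>(\<phi>))\<close> and \<open>(g\<^sup>-\<^sup>1, \<phi>) \<mapsto> (g\<^sub>\<star>(\<phi>), \<phi>\<^sup>\<star>(g)\<^sup>-\<^sup>1)\<close>.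
  The formulas without the inverses do not respect isomorphisms of the middle object of a cospan:
  if \<open>\<phi> : 1 \<rightarrow> 3\<close> hits \<open>1\<close> and \<open>k\<close> is the transposition of \<open>2\<close> and \<open>3\<close>, then \<open>k \<circ> \<phi> = \<phi>\<close>, so
  \<open>(\<phi>, g)\<close> and \<open>(\<phi>, k g)\<close> are equivalent cospans, whereas \<open>g\<^sub>\<star>(\<phi>)\<close> and \<open>(k g)\<^sub>\<star>(\<phi>)\<close> differ
  for \<open>g\<close> the transposition of \<open>1\<close> and \<open>2\<close>.
\<close>

inductive dist_law ::
  "('g, 'z) monoid_scheme \<Rightarrow> 'g qarr \<times> 'g qarr \<Rightarrow> 'g qarr \<times> 'g qarr \<Rightarrow> bool"
  for G :: "('g, 'z) monoid_scheme" where
  iso_iso: "g \<in> lperms G n \<Longrightarrow> h \<in> lperms G n \<Longrightarrow>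
    dist_law G (qiso n g, qiso n h) (qiso n (lp_inv G n g), qiso n (lp_inv G n h))"
| ord_iso: "\<phi> \<in> ord_maps n m \<Longrightarrow> g \<in> lperms G m \<Longrightarrow>
    dist_law G (qord G n m \<phi>, qiso m (lp_inv G m g))
      (qiso n (lp_inv G n (pull n m \<phi> g)), qord G n m (push n m g \<phi>))"
| iso_ord: "\<phi> \<in> ord_maps n m \<Longrightarrow> g \<in> lperms G m \<Longrightarrow>
    dist_law G (qiso m (lp_inv G m g), qord G n m \<phi>)
      (qord G n m (push n m g \<phi>), qiso n (lp_inv G n (pull n m \<phi> g)))"
| m_m: "dist_law G (q_m G, q_m G)
    (qcomp G (qtensor (q_m G) (q_m G)) (q_sigma23 G), qtensor (q_m G) (q_m G))"
| u_u: "dist_law G (q_u G, q_u G) (qide G 0, qide G 0)"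
| m_u: "dist_law G (q_m G, q_u G) (qtensor (q_u G) (q_u G), qide G 0)"
| u_m: "dist_law G (q_u G, q_m G) (qide G 0, qtensor (q_u G) (q_u G))"
| cospan_iso: "dist_law G (f, h) s \<Longrightarrow> k \<in> lperms G (qcod f) \<Longrightarrow>
    dist_law G (qcomp G (qiso (qcod f) k) f, qcomp G (qiso (qcod f) k) h) s"
| span_iso: "dist_law G c (l, r) \<Longrightarrow> k \<in> lperms G (qdom l) \<Longrightarrow>
    dist_law G c (qcomp G l (qiso (qdom l) k), qcomp G r (qiso (qdom l) k))"
| comp_left: "dist_law G (f, h) (l, r) \<Longrightarrow> dist_law G (f', l) (l', r') \<Longrightarrow>
    dist_law G (qcomp G f f', h) (l', qcomp G r r')"
| comp_right: "dist_law G (f, h) (l, r) \<Longrightarrow> dist_law G (r, h') (l', r') \<Longrightarrow>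
    dist_law G (f, qcomp G h h') (qcomp G l l', r')"
| tensor: "dist_law G (f, h) (l, r) \<Longrightarrow> dist_law G (f', h') (l', r') \<Longrightarrow>
    dist_law G (qtensor f f', qtensor h h') (qtensor l l', qtensor r r')"

datatype 'g sarr = SArr (sdom: nat) (scod: nat) (spans: "('g qarr \<times> 'g qarr) set")

definition span_class ::
  "('g, 'z) monoid_scheme \<Rightarrow> 'g qarr \<Rightarrow> 'g qarr \<Rightarrow> ('g qarr \<times> 'g qarr) set" where
  "span_class G l r =
     {(qcomp G l (qiso (qdom l) k), qcomp G r (qiso (qdom l) k)) | k. k \<in> lperms G (qdom l)}"

text \<open>
  Composition and tensor product of classes are the unions of the classes obtained from all
  choices of representatives.
\<close>

definition scomp :: "('g, 'z) monoid_scheme \<Rightarrow> 'g sarr \<Rightarrow> 'g sarr \<Rightarrow> 'g sarr" where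
  "scomp G t s = SArr (sdom s) (scod t)
     (\<Union>{span_class G (qcomp G l1 l) (qcomp G r2 r) | l1 r1 l2 r2 l r.
        (l1, r1) \<in> spans s \<and> (l2, r2) \<in> spans t \<and> dist_law G (r1, l2) (l, r)})"

definition stensor :: "('g, 'z) monoid_scheme \<Rightarrow> 'g sarr \<Rightarrow> 'g sarr \<Rightarrow> 'g sarr" where
  "stensor G s t = SArr (sdom s + sdom t) (scod s + scod t)
     (\<Union>{span_class G (qtensor l1 l2) (qtensor r1 r2) | l1 r1 l2 r2.
        (l1, r1) \<in> spans s \<and> (l2, r2) \<in> spans t})"

definition side :: "('g, 'z) monoid_scheme \<Rightarrow> nat \<Rightarrow> 'g sarr" where
  "side G n = SArr n n (span_class G (qide G n) (qide G n))"

definition ssym :: "('g, 'z) monoid_scheme \<Rightarrow> nat \<Rightarrow> nat \<Rightarrow> 'g sarr" where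
  "ssym G n m = SArr (n + m) (m + n) (span_class G (qide G (n + m)) (qsym G n m))"

definition DHGD :: "('g, 'z) monoid_scheme \<Rightarrow> (nat, 'g sarr) smc" where
  "DHGD G =
     \<lparr>Obj = UNIV,
      Arr = {SArr n m (span_class G l r) | n m p l r.
               l \<in> Hom (DHG G) p n \<and> r \<in> Hom (DHG G) p m},
      Dom = sdom, Cod = scod, Ide = side G, Comp = scomp G,
      TObj = (+), TArr = stensor G, TUnit = 0,
      Assoc = (\<lambda>a b c. side G (a + b + c)), LUnit = side G, RUnit = side G,
      Sym = ssym G\<rparr>"

end

(*
  A PROP T acts on an object X of S through the PROP of endomorphisms of X, whose arrows n -> m are the
  arrows of S between tensor powers of X: an algebra over T amounts to an arrow map from T to such a PROP
  that preserves everything on the nose. Transformations of algebras are determined by their component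
  at 1, so evaluation at 1 is an equivalence as soon as maps out of T correspond to structures on X.

  For Q every arrow has the normal form (iterated multiplications) o (permutation) o (labels), and the
  relations between these pieces are exactly those of an involutive monoid with an action of G. Reversing
  arrows gives the case of the opposite PROP. For the PROP of spans, the relation dist_law is the graph of
  a function up to isomorphism, because every value is a pullback of the underlying sets, decorated with
  labels and orders along fibres; a map out of it is a pair of maps on Q and on its opposite, which agree
  on isomorphisms and satisfy the four generating exchange relations, that is, the bimonoid axioms.
*)
theory Submission
  imports Defs
begin

text \<open>\<open>S\<close> need not be strict. Its constraints are absorbed once by conjugating
  tensor products with isomorphisms from the product of \<open>A a\<close> and \<open>A b\<close> to
  \<open>A (a + b)\<close>; the PROP \<open>endo S A t\<close> so obtained is strict, and normal
  forms are only ever computed in strict PROPs. The hard point for \<open>Q\<close> is that normal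
  forms multiply. Composition in \<open>Q\<close> is given by descriptions (\<open>push\<close>,
  \<open>pull\<close>), so arrows are recoded by maps, labels and total orders, for which
  composition is lexicographic. A label is moved past an iterated multiplication by a rule that
  holds for any labelled monoid; since \<open>Q\<close> carries one itself, the rule in
  \<open>Q\<close> and the rule in the target are two instances of it and can be compared. For
  spans, the squares of the law need not commute in \<open>Q\<close>: orders agree only inside the
  fibres of the legs. Sets, labels and these fibrewise orders still determine the span up to an
  isomorphism of the middle object, as composition of classes requires. Reversing arrows reverses
  the action, so comonoids see inverses of group elements. Evaluation at 1 hits every structure on
  the nose, because the powers of \<open>X\<close> are chosen so that the first one is
  \<open>X\<close> itself.\<close>

abbreviation (input) iff_ascii (infixr "<->" 25) where "A <-> B \<equiv> A = B"
abbreviation (input) Comp_at ("(_ \<cdot>\<^sub>_ _)" [70, 1000, 71] 70) where "g \<cdot>\<^sub>C f \<equiv> Comp C g f"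
abbreviation (input) TArr_at ("(_ \<boxtimes>\<^sub>_ _)" [75, 1000, 76] 75) where "f \<boxtimes>\<^sub>C g \<equiv> TArr C f g"
abbreviation (input) TObj_at ("(_ \<boxdot>\<^sub>_ _)" [75, 1000, 76] 75) where "a \<boxdot>\<^sub>C b \<equiv> TObj C a b"

section \<open>Strict PROPs\<close>

text \<open>Typing rules alone, with sources and targets computed even for arrows that do not
  compose, as holds in records that store both ends. The PROP of spans enters at this level: its
  algebras are studied through maps into strict PROPs.\<close>

locale prop_ops =
 fixes P :: "(nat, 'p, 'z) smc_scheme" (structure)
 assumes Ide_Arr [simp]: "Ide P n : Arr P"
  and Dom_Ide [simp]: "Dom P (Ide P n) = n"
  and Cod_Ide [simp]: "Cod P (Ide P n) = n"
  and Comp_Arr: "f : Arr P ==> g : Arr P ==> Dom P g = Cod P f ==> g \<cdot> f : Arr P"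
  and Dom_Comp [simp]: "Dom P (g \<cdot> f) = Dom P f"
  and Cod_Comp [simp]: "Cod P (g \<cdot> f) = Cod P g"
  and TArr_Arr: "f : Arr P ==> g : Arr P ==> f \<boxtimes> g : Arr P"
  and Dom_TArr [simp]: "Dom P (f \<boxtimes> g) = Dom P f + Dom P g"
  and Cod_TArr [simp]: "Cod P (f \<boxtimes> g) = Cod P f + Cod P g"
  and Sym_Arr [simp]: "Sym P a b : Arr P"
  and Dom_Sym [simp]: "Dom P (Sym P a b) = a + b"
  and Cod_Sym [simp]: "Cod P (Sym P a b) = b + a"

definition prop_map ::
 "(nat, 'a, 'y) smc_scheme => (nat, 'b, 'z) smc_scheme => ('a => 'b) => bool" where
 "prop_map T P F <->
   (\<forall>f \<in> Arr T. F f : Arr P & Dom P (F f) = Dom T f & Cod P (F f) = Cod T f) &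
   (\<forall>n. F (Ide T n) = Ide P n) &
   (\<forall>f \<in> Arr T. \<forall>g \<in> Arr T. Dom T g = Cod T f --> F (g \<cdot>\<^sub>T f) = F g \<cdot>\<^sub>P F f) &
   (\<forall>f \<in> Arr T. \<forall>g \<in> Arr T. F (f \<boxtimes>\<^sub>T g) = F f \<boxtimes>\<^sub>P F g) &
   (\<forall>a b. F (Sym T a b) = Sym P a b)"

locale strict_prop = prop_ops P for P :: "(nat, 'p, 'z) smc_scheme" (structure) +
 assumes Comp_Ide: "f : Arr P ==> f \<cdot> Ide P (Dom P f) = f"
  and Ide_Comp: "f : Arr P ==> Ide P (Cod P f) \<cdot> f = f"
  and Comp_assoc: "f : Arr P ==> g : Arr P ==> h : Arr P ==>
   Dom P g = Cod P f ==> Dom P h = Cod P g ==> h \<cdot> g \<cdot> f = h \<cdot> (g \<cdot> f)"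
  and TArr_Ide [simp]: "Ide P a \<boxtimes> Ide P b = Ide P (a + b)"
  and TArr_Comp: "f : Arr P ==> g : Arr P ==> f' : Arr P ==> g' : Arr P ==>
   Dom P g = Cod P f ==> Dom P g' = Cod P f' ==>
   (g \<boxtimes> g') \<cdot> (f \<boxtimes> f') = (g \<cdot> f) \<boxtimes> (g' \<cdot> f')"
  and TArr_assoc: "f : Arr P ==> g : Arr P ==> h : Arr P ==>
   f \<boxtimes> g \<boxtimes> h = f \<boxtimes> (g \<boxtimes> h)"
  and Ide0_TArr [simp]: "f : Arr P ==> Ide P 0 \<boxtimes> f = f"
  and TArr_Ide0 [simp]: "f : Arr P ==> f \<boxtimes> Ide P 0 = f"
  and Sym_natural: "f : Arr P ==> g : Arr P ==>
   Sym P (Cod P f) (Cod P g) \<cdot> (f \<boxtimes> g) = (g \<boxtimes> f) \<cdot> Sym P (Dom P f) (Dom P g)"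
  and Sym_Sym [simp]: "Sym P b a \<cdot> Sym P a b = Ide P (a + b)"
  and hexagon: "Sym P a (b + c) = (Ide P b \<boxtimes> Sym P a c) \<cdot> (Sym P a b \<boxtimes> Ide P c)"
begin

lemma Comp_Ide' [simp]: "f : Arr P ==> n = Dom P f ==> f \<cdot> Ide P n = f"
 using Comp_Ide by simp

lemma Ide_Comp' [simp]: "f : Arr P ==> n = Cod P f ==> Ide P n \<cdot> f = f"
 using Ide_Comp by simp

lemma Sym_natural': "f : Arr P ==> g : Arr P ==> a = Cod P f ==> b = Cod P g ==>
   Sym P a b \<cdot> (f \<boxtimes> g) = (g \<boxtimes> f) \<cdot> Sym P (Dom P f) (Dom P g)"
 using Sym_natural by simp

declare Comp_Arr [simp] TArr_Arr [simp]

lemma TArr_Ide_left: "f : Arr P ==> g : Arr P ==> a = Cod P f ==> b = Dom P g ==>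
  (Ide P a \<boxtimes> g) \<cdot> (f \<boxtimes> Ide P b) = f \<boxtimes> g"
 by (simp add: TArr_Comp)

lemma TArr_Ide_right: "f : Arr P ==> g : Arr P ==> a = Dom P f ==> b = Cod P g ==>
  (f \<boxtimes> Ide P b) \<cdot> (Ide P a \<boxtimes> g) = f \<boxtimes> g"
 by (simp add: TArr_Comp)

lemma Ide_TArr_Comp: "f : Arr P ==> g : Arr P ==> Dom P g = Cod P f ==>
  (Ide P a \<boxtimes> g) \<cdot> (Ide P a \<boxtimes> f) = Ide P a \<boxtimes> (g \<cdot> f)"
 by (simp add: TArr_Comp)

lemma Sym_cancel: "f : Arr P ==> Cod P f = a + b ==> Sym P b a \<cdot> (Sym P a b \<cdot> f) = f"
 by (metis Comp_assoc Cod_Sym Dom_Sym Ide_Comp' Sym_Arr Sym_Sym)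

text \<open>The hexagon with \<open>b = c = 0\<close> makes \<open>Sym P a 0\<close> idempotent, and
  an invertible idempotent is an identity.\<close>

lemma Sym_unit_right: "Sym P a 0 = Ide P a"
proof -
 have "Sym P a 0 = Sym P a 0 \<cdot> Sym P a 0"
  using hexagon[of a 0 0] by simp
 then have "Sym P 0 a \<cdot> Sym P a 0 = Sym P 0 a \<cdot> (Sym P a 0 \<cdot> Sym P a 0)"
  by simp
 then show ?thesis
  by (subst (asm) Sym_cancel) auto
qed

lemma Sym_unit_left: "Sym P 0 a = Ide P a"
 using Sym_Sym[of 0 a] Sym_unit_right[of a] Ide_Comp'[of "Sym P 0 a"] by simp

text \<open>The right-hand side is a left inverse of the hexagon expression for
  \<open>Sym P c (a + b)\<close>, and so is \<open>Sym P (a + b) c\<close>; the second hexagon thus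
  follows from the first by involutivity.\<close>

lemma hexagon': "Sym P (a + b) c = (Sym P a c \<boxtimes> Ide P b) \<cdot> (Ide P a \<boxtimes> Sym P b c)"
proof -
 let ?x = "(Sym P a c \<boxtimes> Ide P b) \<cdot> (Ide P a \<boxtimes> Sym P b c)"
 let ?y = "(Ide P a \<boxtimes> Sym P c b) \<cdot> (Sym P c a \<boxtimes> Ide P b)"
 have "?x \<cdot> ?y = (Sym P a c \<boxtimes> Ide P b) \<cdot> ((Ide P a \<boxtimes> Sym P b c) \<cdot> ((Ide P a \<boxtimes> Sym P c b) \<cdot> (Sym P c a \<boxtimes> Ide P b)))"
  by (simp add: Comp_assoc add.assoc add.commute)
 also have "(Ide P a \<boxtimes> Sym P b c) \<cdot> ((Ide P a \<boxtimes> Sym P c b) \<cdot> (Sym P c a \<boxtimes> Ide P b))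
   = ((Ide P a \<boxtimes> Sym P b c) \<cdot> (Ide P a \<boxtimes> Sym P c b)) \<cdot> (Sym P c a \<boxtimes> Ide P b)"
  by (rule Comp_assoc[symmetric]) (auto simp: add_ac)
 also have "... = (Sym P c a \<boxtimes> Ide P b)"
  by (subst Ide_TArr_Comp) (auto simp: add_ac)
 also have "(Sym P a c \<boxtimes> Ide P b) \<cdot> (Sym P c a \<boxtimes> Ide P b) = Ide P (c + a + b)"
  by (simp add: TArr_Comp)
 finally have xy: "?x \<cdot> ?y = Ide P (c + (a + b))" by (simp add: add.assoc)
 have y: "?y = Sym P c (a + b)" by (rule hexagon[symmetric])
 have "?x = ?x \<cdot> (?y \<cdot> Sym P (a + b) c)"
  unfolding y by (simp add: add_ac)
 also have "... = ?x \<cdot> ?y \<cdot> Sym P (a + b) c"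
  by (rule Comp_assoc[symmetric]) (auto simp: add_ac)
 also have "... = Sym P (a + b) c"
  unfolding xy by simp
 finally show ?thesis by simp
qed

end

section \<open>Iterated tensor products and permutations\<close>

text \<open>Factors are numbered from 1 so that they are the points of \<open>{1..n}\<close>, and
  the new factor comes last, in step with the recursion of \<open>pm\<close>.\<close>

primrec bt :: "(nat, 'p, 'z) smc_scheme => (nat => 'p) => nat => 'p" where
 "bt P f 0 = Ide P 0"
| "bt P f (Suc n) = bt P f n \<boxtimes>\<^sub>P f (Suc n)"

lemma bt_cong: "(!!j. 1 <= j ==> j <= n ==> f j = g j) ==> bt P f n = bt P g n"
 by (induction n) auto

text \<open>Renumbers the values that remain when \<open>k\<close> is removed from
  \<open>{1..Suc n}\<close>. The value \<open>k\<close> goes to the top instead of out of the range: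
  \<open>del k n\<close> is then a bijection, and for \<open>k = s (Suc n)\<close> the composite
  with \<open>s\<close> fixes \<open>Suc n\<close>, hence permutes \<open>{1..n}\<close>.\<close>

definition del :: "nat => nat => nat => nat" where
 "del k n i = (if i = k then Suc n else if k < i & i <= Suc n then i - 1 else i)"

text \<open>The image \<open>s (n + 1)\<close> of the last strand is split off; it is carried back past the
 strands that end behind it.\<close>

primrec pm :: "(nat, 'p, 'z) smc_scheme => nat => (nat => nat) => 'p" where
 "pm P 0 s = Ide P 0"
| "pm P (Suc n) s = (Ide P (s (Suc n) - 1) \<boxtimes>\<^sub>P Sym P (Suc n - s (Suc n)) 1) \<cdot>\<^sub>P
   (pm P n (del (s (Suc n)) n \<circ> s) \<boxtimes>\<^sub>P Ide P 1)"

text \<open>Indexed by the number \<open>a\<close> of strands to the left of the swapped pair, to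
  match the arrow \<open>sw a b\<close>.\<close>

definition adj :: "nat => nat => nat" where
 "adj a = transpose (a + 1) (a + 2)"

declare pm.simps(2) [simp del]

lemma adj_apply: "adj a i = (if i = a + 1 then a + 2 else if i = a + 2 then a + 1 else i)"
 by (simp add: adj_def transpose_def)

lemma adj_adj [simp]: "adj a (adj a i) = i"
 by (simp add: adj_def)

lemma adj_permutes: "a + 2 + b = n ==> adj a permutes {1..n}"
 unfolding adj_def by (rule permutes_swap_id) auto

lemma del_permutes:
 assumes s: "s permutes {1..Suc n}"
 shows "(del (s (Suc n)) n \<circ> s) permutes {1..n}"
proof -
 let ?k = "s (Suc n)"
 have k: "1 <= ?k" "?k <= Suc n" using permutes_in_image[OF s, of "Suc n"] by auto
 have "bij_betw (del ?k n) {1..Suc n} {1..Suc n}"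
  by (rule bij_betw_byWitness[where f' = "%i. if i = Suc n then ?k else if ?k <= i then Suc i else i"])
   (use k in "auto simp: del_def")
 then have "del ?k n permutes {1..Suc n}"
  by (rule bij_imp_permutes) (use k in "auto simp: del_def")
 then have c: "(del ?k n \<circ> s) permutes {1..Suc n}" by (rule permutes_compose[OF s])
 show ?thesis
 proof (rule permutes_superset[OF c])
  fix x assume "x : {1..Suc n} - {1..n}"
  then have "x = Suc n" by auto
  then show "(del ?k n \<circ> s) x = x" by (simp add: del_def)
 qed
qed

text \<open>Adjacent transpositions carry the image \<open>k\<close> of the last point up step by
  step; once that point is fixed, the permutation lives on one point less. Composing with the same
  transposition again undoes a step. The bound \<open>n\<close> stays fixed while \<open>m\<close>
  shrinks, so that \<open>step\<close> always applies on the full set of strands.\<close>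

lemma adjacent_induct [consumes 1, case_names id adj]:
 assumes "s permutes {1..n}"
  and "Q id"
  and step: "!!a b s. a + 2 + b = n ==> s permutes {1..n} ==> Q s ==> Q (adj a \<circ> s)"
 shows "Q s"
proof -
 have "m <= n ==> s permutes {1..m} ==> Q s" for m
 proof (induction m arbitrary: s)
  case 0
  then have "s = id" by simp
  then show ?case using assms(2) by (simp only:)
 next
  case (Suc m)
  have sn: "s' permutes {1..n}" if "s' permutes {1..Suc m}" for s'
   using permutes_subset[OF that] Suc.prems(1) by auto
  have *: "1 <= k ==> Suc m - k = d ==> s permutes {1..Suc m} ==> s (Suc m) = k ==> Q s" for d k s
  proof (induction d arbitrary: k s)
   case 0
   then have "k = Suc m"
    using permutes_in_image[of s "{1..Suc m}" "Suc m"] by auto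
   have "s permutes {1..m}"
    by (rule permutes_superset[OF 0(3)]) (use 0 \<open>k = Suc m\<close> in "auto elim: le_SucE")
   then show ?case using Suc.IH Suc.prems(1) by simp
  next
   case (Suc d)
   obtain a where a: "k = a + 1" using Suc.prems(1) by (metis add.commute le_add_diff_inverse)
   have adjp: "adj a permutes {1..Suc m}"
    by (rule adj_permutes[where b = "Suc m - (a + 2)"]) (use a Suc.prems in auto)
   have "Q (adj a \<circ> s)"
   proof (rule Suc.IH[of "k + 1"])
    show "(adj a \<circ> s) permutes {1..Suc m}" by (rule permutes_compose[OF Suc.prems(3) adjp])
    show "(adj a \<circ> s) (Suc m) = k + 1" using Suc.prems a by (simp add: adj_apply)
   qed (use Suc.prems in auto)
   then have "Q (adj a \<circ> (adj a \<circ> s))"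
    by (rule step[rotated 2, where b = "n - (a + 2)"])
     (use a Suc.prems \<open>Suc m <= n\<close> sn[OF permutes_compose[OF Suc.prems(3) adjp]] in auto)
   then show ?case by (simp add: comp_def)
  qed
  show ?case using *[of "s (Suc m)" _ s] permutes_in_image[OF Suc.prems(2), of "Suc m"] Suc.prems by auto
 qed
 then show ?thesis using assms(1) by blast
qed

definition perm_sum :: "nat => (nat => nat) => (nat => nat) => nat => nat" where
 "perm_sum n s t = (%k. if k <= n then s k else t (k - n) + n)"

lemma perm_sum_id_adj:
 assumes "t permutes {1..m}"
 shows "perm_sum n id (adj a \<circ> t) = adj (n + a) \<circ> perm_sum n id t"
 using permutes_in_image[OF assms] by (auto simp: perm_sum_def adj_apply fun_eq_iff)

lemma perm_sum_id_permutes: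
 assumes "t permutes {1..m}"
 shows "perm_sum n id t permutes {1..n + m}"
 using assms
proof (induction rule: adjacent_induct)
 case id
 have "perm_sum n id id = id" by (auto simp: perm_sum_def)
 then show ?case by (simp only: permutes_id)
next
 case (adj a b t)
 have "adj (n + a) permutes {1..n + m}"
  by (rule adj_permutes) (use adj in auto)
 then show ?case
  unfolding perm_sum_id_adj[OF adj(2)] by (rule permutes_compose[OF adj(3)])
qed

lemma perm_sum_comp:
 assumes "s permutes {1..n}" and "t permutes {1..m}"
 shows "perm_sum n s t = s \<circ> perm_sum n id t"
proof
 fix k
 show "perm_sum n s t k = (s \<circ> perm_sum n id t) k"
 proof (cases "k <= n")
  case False
  then have "1 <= t (k - n)"
   using permutes_in_image[OF assms(2), of "k - n"] permutes_not_in[OF assms(2), of "k - n"]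
   by (cases "k - n <= m") auto
  then have "s (t (k - n) + n) = t (k - n) + n"
   by (intro permutes_not_in[OF assms(1)]) auto
  then show ?thesis using False by (simp add: perm_sum_def)
 qed (simp add: perm_sum_def)
qed

lemma perm_sum_permutes:
 assumes "s permutes {1..n}" and "t permutes {1..m}"
 shows "perm_sum n s t permutes {1..n + m}"
proof -
 have "s permutes {1..n + m}" by (rule permutes_subset[OF assms(1)]) auto
 then show ?thesis
  unfolding perm_sum_comp[OF assms] using perm_sum_id_permutes[OF assms(2)] by (simp add: permutes_compose)
qed

section \<open>Permutations as arrows of a strict PROP\<close>

context strict_prop
begin

lemma Dom_bt [simp]: "Dom P (bt P f n) = (\<Sum>j = 1..n. Dom P (f j))"
 by (induction n) auto

lemma Cod_bt [simp]: "Cod P (bt P f n) = (\<Sum>j = 1..n. Cod P (f j))"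
 by (induction n) auto

lemma bt_Arr [simp]: "(!!j. 1 <= j ==> j <= n ==> f j : Arr P) ==> bt P f n : Arr P"
 by (induction n) auto

lemma bt_add:
 "(!!j. 1 <= j ==> j <= m + n ==> f j : Arr P) ==>
  bt P f (m + n) = bt P f m \<boxtimes> bt P (%j. f (m + j)) n"
 by (induction n) (auto simp: TArr_assoc)

lemma bt_Comp:
 assumes "!!j. 1 <= j ==> j <= n ==> f j : Arr P & g j : Arr P & Dom P (g j) = Cod P (f j)"
 shows "bt P g n \<cdot> bt P f n = bt P (%j. g j \<cdot> f j) n"
 using assms
proof (induction n)
 case (Suc n)
 have "(\<Sum>j = 1..n. Dom P (g j)) = (\<Sum>j = 1..n. Cod P (f j))"
  by (rule sum.cong) (use Suc.prems in auto)
 then show ?case using Suc by (simp add: TArr_Comp)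
qed simp

lemma bt_Ide: "(!!j. 1 <= j ==> j <= n ==> f j = Ide P 1) ==> bt P f n = Ide P n"
 by (induction n) auto

definition sw :: "nat => nat => 'p" where
 "sw a b = Ide P a \<boxtimes> (Sym P 1 1 \<boxtimes> Ide P b)"

lemma sw_Arr [simp]: "sw a b : Arr P"
 by (simp add: sw_def)

lemma Dom_sw [simp]: "Dom P (sw a b) = a + 2 + b"
 and Cod_sw [simp]: "Cod P (sw a b) = a + 2 + b"
 by (auto simp: sw_def)

lemma Ide_sw: "Ide P c \<boxtimes> sw a b = sw (c + a) b"
 by (simp add: sw_def flip: TArr_assoc)

lemma sw_Ide: "sw a b \<boxtimes> Ide P c = sw a (b + c)"
 by (simp add: sw_def TArr_assoc)

lemma pm_Hom: "s permutes {1..n} ==> pm P n s : Arr P & Dom P (pm P n s) = n & Cod P (pm P n s) = n"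
proof (induction n arbitrary: s)
 case (Suc n)
 have k: "1 <= s (Suc n)" "s (Suc n) <= Suc n"
  using permutes_in_image[OF Suc.prems, of "Suc n"] by auto
 have "pm P n (del (s (Suc n)) n \<circ> s) : Arr P & Dom P (pm P n (del (s (Suc n)) n \<circ> s)) = n
   & Cod P (pm P n (del (s (Suc n)) n \<circ> s)) = n"
  by (rule Suc.IH[OF del_permutes[OF Suc.prems]])
 with k show ?case unfolding pm.simps by simp
qed simp

lemma pm_Arr [simp]: "s permutes {1..n} ==> pm P n s : Arr P"
 and Dom_pm [simp]: "s permutes {1..n} ==> Dom P (pm P n s) = n"
 and Cod_pm [simp]: "s permutes {1..n} ==> Cod P (pm P n s) = n"
 using pm_Hom by auto

lemma pm_id: "pm P n id = Ide P n"
proof (induction n)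
 case (Suc n)
 have *: "del (Suc n) n \<circ> id = id" by (auto simp: del_def)
 show ?case unfolding pm.simps id_apply[of "Suc n"] * Suc by (simp add: Sym_unit_left)
qed simp

lemma pm_id' [simp]: "pm P n (%k. k) = Ide P n"
 using pm_id by (simp add: id_def)

text \<open>This and the next three facts are the ways in which a swap meets the crossing that
  inserts the last strand in \<open>pm\<close>: beside it, inside the strands that are crossed, and
  at its end, where it shortens or lengthens the crossing.\<close>

lemma sw_past_Sym: "sw a (c + d + 1) \<cdot> (Ide P (a + 2 + c) \<boxtimes> Sym P d 1) =
  (Ide P (a + 2 + c) \<boxtimes> Sym P d 1) \<cdot> (sw a (c + d) \<boxtimes> Ide P 1)"
proof -
 have "sw a (c + d + 1) = sw a c \<boxtimes> Ide P (d + 1)" by (simp add: sw_Ide add.assoc)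
 moreover have "sw a (c + d) \<boxtimes> Ide P 1 = sw a c \<boxtimes> Ide P (d + 1)" by (simp add: sw_Ide add.assoc)
 ultimately show ?thesis by (simp add: TArr_Ide_left TArr_Ide_right)
qed

lemma Sym_past_sw: "sw (c + 1 + a) b \<cdot> (Ide P c \<boxtimes> Sym P (a + 2 + b) 1) =
  (Ide P c \<boxtimes> Sym P (a + 2 + b) 1) \<cdot> (sw (c + a) b \<boxtimes> Ide P 1)"
proof -
 have 1: "sw (c + 1 + a) b = Ide P c \<boxtimes> (Ide P 1 \<boxtimes> sw a b)" by (simp add: Ide_sw)
 have 2: "sw (c + a) b \<boxtimes> Ide P 1 = Ide P c \<boxtimes> (sw a b \<boxtimes> Ide P 1)"
  by (simp flip: TArr_assoc Ide_sw)
 have "Sym P (a + 2 + b) 1 \<cdot> (sw a b \<boxtimes> Ide P 1) = (Ide P 1 \<boxtimes> sw a b) \<cdot> Sym P (a + 2 + b) 1"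
  by (subst Sym_natural') auto
 then show ?thesis unfolding 1 2 by (simp add: Ide_TArr_Comp)
qed

lemma sw_Sym_up: "sw a b \<cdot> (Ide P a \<boxtimes> Sym P (1 + b) 1) = Ide P (a + 1) \<boxtimes> Sym P b 1"
proof -
 have "(Sym P 1 1 \<boxtimes> Ide P b) \<cdot> Sym P (1 + b) 1
  = ((Sym P 1 1 \<boxtimes> Ide P b) \<cdot> (Sym P 1 1 \<boxtimes> Ide P b)) \<cdot> (Ide P 1 \<boxtimes> Sym P b 1)"
  by (simp only: hexagon') (simp add: Comp_assoc)
 also have "... = Ide P 1 \<boxtimes> Sym P b 1" by (simp add: TArr_Comp)
 finally have "sw a b \<cdot> (Ide P a \<boxtimes> Sym P (1 + b) 1) = Ide P a \<boxtimes> (Ide P 1 \<boxtimes> Sym P b 1)"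
  unfolding sw_def by (subst Ide_TArr_Comp) auto
 then show ?thesis by (simp flip: TArr_assoc)
qed

lemma sw_Sym_down: "sw a b \<cdot> (Ide P (a + 1) \<boxtimes> Sym P b 1) = Ide P a \<boxtimes> Sym P (1 + b) 1"
proof -
 have "Ide P (a + 1) \<boxtimes> Sym P b 1 = Ide P a \<boxtimes> (Ide P 1 \<boxtimes> Sym P b 1)"
  by (simp flip: TArr_assoc)
 then show ?thesis unfolding sw_def hexagon'[of 1 b 1] by (simp add: Ide_TArr_Comp)
qed

text \<open>Let \<open>k\<close> be the image of the last strand. A swap below or above
  \<open>k\<close> passes to the shorter permutation \<open>s'\<close> (above \<open>k\<close> with
  its index lowered by one), while a swap involving \<open>k\<close> leaves \<open>s'\<close> alone
  and only changes the length of the final crossing.\<close>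

lemma pm_adj:
 assumes "a + 2 + b = n" and "s permutes {1..n}"
 shows "pm P n (adj a \<circ> s) = sw a b \<cdot> pm P n s"
 using assms
proof (induction n arbitrary: a b s)
 case (Suc n)
 define k where "k = s (Suc n)"
 have k: "1 <= k" "k <= Suc n"
  using permutes_in_image[OF Suc.prems(2), of "Suc n"] by (auto simp: k_def)
 define c d where "c = k - 1" and "d = Suc n - k"
 have cd: "k = Suc c" "n = c + d" using k by (auto simp: c_def d_def)
 define s' where "s' = del k n \<circ> s"
 have s': "s' permutes {1..n}" unfolding s'_def k_def by (rule del_permutes[OF Suc.prems(2)])
 have L: "pm P (Suc n) s = (Ide P c \<boxtimes> Sym P d 1) \<cdot> (pm P n s' \<boxtimes> Ide P 1)"
  by (simp add: pm.simps s'_def c_def d_def flip: k_def)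
 define X where "X = pm P n s'"
 have [simp]: "X : Arr P" "Dom P X = n" "Cod P X = n"
  using pm_Hom[OF s'] by (auto simp: X_def)
 note L = L[folded X_def] and IH = Suc.IH[OF _ s', folded X_def]
 consider (lt) "a + 2 < k" | (gt) "k < a + 1" | (eq1) "a + 1 = k" | (eq2) "a + 2 = k" by linarith
 then show ?case
 proof cases
  case lt
  define e where "e = c - (a + 2)"
  have e: "c = a + 2 + e" "b = e + d + 1" using lt cd Suc.prems(1) by (auto simp: e_def)
  have k1: "(adj a \<circ> s) (Suc n) = k" using lt by (simp add: adj_apply flip: k_def)
  have dl: "del k n \<circ> (adj a \<circ> s) = adj a \<circ> s'"
   using lt k by (auto simp: s'_def fun_eq_iff del_def adj_apply)
  have "pm P (Suc n) (adj a \<circ> s) = (Ide P c \<boxtimes> Sym P d 1) \<cdot> (pm P n (adj a \<circ> s') \<boxtimes> Ide P 1)"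
   unfolding pm.simps k1 dl c_def d_def by (rule refl)
  also have "pm P n (adj a \<circ> s') = sw a (e + d) \<cdot> X"
   by (rule IH) (use cd e in auto)
  also have "(Ide P c \<boxtimes> Sym P d 1) \<cdot> ((sw a (e + d) \<cdot> X) \<boxtimes> Ide P 1) =
    (Ide P c \<boxtimes> Sym P d 1) \<cdot> ((sw a (e + d) \<boxtimes> Ide P 1) \<cdot> (X \<boxtimes> Ide P 1))"
   using cd e by (simp add: TArr_Comp)
  also have "... = ((Ide P c \<boxtimes> Sym P d 1) \<cdot> (sw a (e + d) \<boxtimes> Ide P 1)) \<cdot> (X \<boxtimes> Ide P 1)"
   by (rule Comp_assoc[symmetric]) (use cd e in auto)
  also have "... = (sw a b \<cdot> (Ide P c \<boxtimes> Sym P d 1)) \<cdot> (X \<boxtimes> Ide P 1)"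
   using sw_past_Sym[of a e d] e by simp
  also have "... = sw a b \<cdot> pm P (Suc n) s"
   unfolding L by (rule Comp_assoc) (use cd e in auto)
  finally show ?thesis .
 next
  case gt
  define e where "e = a - (c + 1)"
  have e: "a = c + 1 + e" "d = e + 2 + b" using gt cd Suc.prems(1) by (auto simp: e_def)
  have k1: "(adj a \<circ> s) (Suc n) = k" using gt by (simp add: adj_apply flip: k_def)
  have dl: "del k n \<circ> (adj a \<circ> s) = adj (c + e) \<circ> s'"
   using gt k cd e by (auto simp: s'_def fun_eq_iff del_def adj_apply)
  have "pm P (Suc n) (adj a \<circ> s) = (Ide P c \<boxtimes> Sym P d 1) \<cdot> (pm P n (adj (c + e) \<circ> s') \<boxtimes> Ide P 1)"
   unfolding pm.simps k1 dl by (simp only: c_def d_def)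
  also have "pm P n (adj (c + e) \<circ> s') = sw (c + e) b \<cdot> X"
   by (rule IH) (use cd e in auto)
  also have "(Ide P c \<boxtimes> Sym P d 1) \<cdot> ((sw (c + e) b \<cdot> X) \<boxtimes> Ide P 1) =
    (Ide P c \<boxtimes> Sym P d 1) \<cdot> ((sw (c + e) b \<boxtimes> Ide P 1) \<cdot> (X \<boxtimes> Ide P 1))"
   using cd e by (simp add: TArr_Comp)
  also have "... = ((Ide P c \<boxtimes> Sym P d 1) \<cdot> (sw (c + e) b \<boxtimes> Ide P 1)) \<cdot> (X \<boxtimes> Ide P 1)"
   by (rule Comp_assoc[symmetric]) (use cd e in auto)
  also have "... = (sw a b \<cdot> (Ide P c \<boxtimes> Sym P d 1)) \<cdot> (X \<boxtimes> Ide P 1)"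
   using Sym_past_sw[of c e b] e by simp
  also have "... = sw a b \<cdot> pm P (Suc n) s"
   unfolding L by (rule Comp_assoc) (use cd e in auto)
  finally show ?thesis .
 next
  case eq1
  have ac: "a = c" "d = 1 + b" using eq1 cd Suc.prems(1) by auto
  have k1: "(adj a \<circ> s) (Suc n) = k + 1" using eq1 by (simp add: adj_apply flip: k_def)
  have dl: "del (k + 1) n \<circ> (adj a \<circ> s) = s'"
   using eq1 k cd ac by (auto simp: s'_def fun_eq_iff del_def adj_apply)
  have "pm P (Suc n) (adj a \<circ> s) = (Ide P (a + 1) \<boxtimes> Sym P b 1) \<cdot> (X \<boxtimes> Ide P 1)"
   unfolding pm.simps k1 dl X_def using cd ac by simp
  also have "... = (sw a b \<cdot> (Ide P a \<boxtimes> Sym P (1 + b) 1)) \<cdot> (X \<boxtimes> Ide P 1)"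
   by (simp only: sw_Sym_up)
  also have "... = sw a b \<cdot> pm P (Suc n) s"
   unfolding L ac by (rule Comp_assoc) (use cd ac in auto)
  finally show ?thesis .
 next
  case eq2
  have ac: "c = a + 1" "d = b" using eq2 cd Suc.prems(1) by auto
  have k1: "(adj a \<circ> s) (Suc n) = a + 1" using eq2 by (simp add: adj_apply flip: k_def)
  have dl: "del (a + 1) n \<circ> (adj a \<circ> s) = s'"
   using eq2 k cd ac by (auto simp: s'_def fun_eq_iff del_def adj_apply)
  have "pm P (Suc n) (adj a \<circ> s) = (Ide P a \<boxtimes> Sym P (1 + b) 1) \<cdot> (X \<boxtimes> Ide P 1)"
   unfolding pm.simps k1 dl X_def using cd ac by simp
  also have "... = (sw a b \<cdot> (Ide P (a + 1) \<boxtimes> Sym P b 1)) \<cdot> (X \<boxtimes> Ide P 1)"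
   by (simp only: sw_Sym_down)
  also have "... = sw a b \<cdot> pm P (Suc n) s"
   unfolding L ac by (rule Comp_assoc) (use cd ac in auto)
  finally show ?thesis .
 qed
qed simp

text \<open>Adjacent transpositions generate, so \<open>pm_adj\<close> determines left
  multiplication by any permutation. As \<open>pm\<close> is a function of the permutation itself,
  the relations between transpositions hold automatically.\<close>

lemma pm_Comp:
 assumes "s permutes {1..n}" and "t permutes {1..n}"
 shows "pm P n (s \<circ> t) = pm P n s \<cdot> pm P n t"
 using assms(1)
proof (induction rule: adjacent_induct)
 case id
 then show ?case using assms(2) by simp
next
 case (adj a b s)
 have "pm P n (adj a \<circ> (s \<circ> t)) = sw a b \<cdot> (pm P n s \<cdot> pm P n t)"
  by (subst pm_adj[OF adj(1) permutes_compose[OF assms(2) adj(2)]], subst adj(3)) (rule refl)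
 also have "... = pm P n (adj a \<circ> s) \<cdot> pm P n t"
  using adj(1,2) assms(2) by (simp add: pm_adj Comp_assoc)
 finally show ?case by (simp only: o_assoc)
qed

lemma pm_TArr_left:
 assumes "s permutes {1..n}"
 shows "pm P (n + m) s = pm P n s \<boxtimes> Ide P m"
 using assms
proof (induction rule: adjacent_induct)
 case id
 then show ?case by (simp add: pm_id)
next
 case (adj a b s)
 have "s permutes {1..n + m}" by (rule permutes_subset[OF adj(2)]) auto
 then have "pm P (n + m) (adj a \<circ> s) = sw a (b + m) \<cdot> (pm P n s \<boxtimes> Ide P m)"
  using adj by (subst pm_adj[where b = "b + m"]) auto
 also have "... = pm P n (adj a \<circ> s) \<boxtimes> Ide P m"
  using adj by (simp add: TArr_Comp pm_adj flip: sw_Ide)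
 finally show ?case .
qed

lemma pm_TArr_right:
 assumes "t permutes {1..m}"
 shows "perm_sum n id t permutes {1..n + m} & pm P (n + m) (perm_sum n id t) = Ide P n \<boxtimes> pm P m t"
 using assms
proof (induction rule: adjacent_induct)
 case id
 have "perm_sum n id id = id" by (auto simp: perm_sum_def)
 then show ?case by (simp only: permutes_id pm_id TArr_Ide simp_thms)
next
 case (adj a b t)
 note * = perm_sum_id_adj[OF adj(2)]
 have "adj (n + a) permutes {1..n + m}"
  by (rule adj_permutes) (use adj in auto)
 then show ?case
  unfolding *
  using adj(1,2) conjunct1[OF adj(3)] conjunct2[OF adj(3)] pm_adj[of "n + a" b "n + m" "perm_sum n id t"]
   permutes_compose[of "perm_sum n id t" "{1..n + m}" "adj (n + a)"]
  by (simp only: pm_adj[OF adj(1,2)]) (simp add: Ide_TArr_Comp flip: Ide_sw)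
qed

lemma pm_TArr:
 assumes "s permutes {1..n}" and "t permutes {1..m}"
 shows "pm P (n + m) (perm_sum n s t) = pm P n s \<boxtimes> pm P m t"
proof -
 have "s permutes {1..n + m}" by (rule permutes_subset[OF assms(1)]) auto
 then show ?thesis
  unfolding perm_sum_comp[OF assms]
  using pm_TArr_left[OF assms(1), of m] pm_TArr_right[OF assms(2), of n] assms
  by (simp add: pm_Comp TArr_Ide_right)
qed

lemma sw_bt:
 assumes "!!j. 1 <= j ==> j <= n ==> f j : Arr P & Dom P (f j) = 1 & Cod P (f j) = 1" and "a + 2 + b = n"
 shows "sw a b \<cdot> bt P f n = bt P (f \<circ> adj a) n \<cdot> sw a b"
proof -
 let ?g = "f \<circ> adj a"
 have n: "n = a + (2 + b)" using assms(2) by simp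
 have split: "bt P h n = bt P h a \<boxtimes> ((h (a + 1) \<boxtimes> h (a + 2)) \<boxtimes> bt P (%j. h (a + (2 + j))) b)"
  if "!!j. 1 <= j ==> j <= n ==> h j : Arr P & Dom P (h j) = 1 & Cod P (h j) = 1" for h
 proof -
  have "bt P (%j. h (a + j)) 2 = h (a + 1) \<boxtimes> h (a + 2)"
   using that n by (simp add: numeral_2_eq_2)
  then show ?thesis
   unfolding n by (subst bt_add, use that n in force, subst bt_add, use that n in force) simp
 qed
 have gh: "?g j : Arr P & Dom P (?g j) = 1 & Cod P (?g j) = 1" if "1 <= j" "j <= n" for j
  using assms(1)[of "adj a j"] assms(2) that by (auto simp: adj_apply)
 have fj: "f j : Arr P" "Dom P (f j) = 1" "Cod P (f j) = 1" if "1 <= j" "j <= n" for j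
  using assms(1) that by auto
 have sums: "(\<Sum>j = 1..a. Dom P (f j)) = a" "(\<Sum>j = 1..b. Dom P (f (a + (2 + j)))) = b"
  "(\<Sum>j = 1..a. Cod P (f j)) = a" "(\<Sum>j = 1..b. Cod P (f (a + (2 + j)))) = b"
  using assms(2) fj by simp_all
 have ar: "bt P f a : Arr P" "bt P (%j. f (a + (2 + j))) b : Arr P"
  by (rule bt_Arr, use n fj in simp)+
 have g1: "bt P ?g a = bt P f a" "bt P (%j. ?g (a + (2 + j))) b = bt P (%j. f (a + (2 + j))) b"
  by (rule bt_cong, simp add: adj_apply)+
 have g2: "?g (a + 1) = f (a + 2)" "?g (a + 2) = f (a + 1)" by (simp_all add: adj_apply)
 define X Y x y where "X = bt P f a" and "Y = bt P (%j. f (a + (2 + j))) b"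
  and "x = f (a + 1)" and "y = f (a + 2)"
 have [simp]: "X : Arr P" "Dom P X = a" "Cod P X = a" "Y : Arr P" "Dom P Y = b" "Cod P Y = b"
  "x : Arr P" "Dom P x = 1" "Cod P x = 1" "y : Arr P" "Dom P y = 1" "Cod P y = 1"
  using ar sums n fj by (simp_all add: X_def Y_def x_def y_def)
 have 1: "bt P f n = X \<boxtimes> ((x \<boxtimes> y) \<boxtimes> Y)"
  unfolding X_def Y_def x_def y_def by (rule split) (rule assms(1))
 have 2: "bt P ?g n = X \<boxtimes> ((y \<boxtimes> x) \<boxtimes> Y)"
  unfolding X_def Y_def x_def y_def g1[symmetric] g2[symmetric] by (rule split) (rule gh)
 have "Sym P 1 1 \<cdot> (x \<boxtimes> y) = (y \<boxtimes> x) \<cdot> Sym P 1 1"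
  by (subst Sym_natural') auto
 then show ?thesis unfolding 1 2 sw_def by (simp add: TArr_Comp)
qed

text \<open>The strand that starts at \<open>j\<close> ends at \<open>s j\<close>, so before the
  permutation it carries \<open>f (s j)\<close>. This is the rule by which labels are multiplied
  along strands.\<close>

lemma pm_bt:
 assumes "s permutes {1..n}"
  and "!!j. 1 <= j ==> j <= n ==> f j : Arr P & Dom P (f j) = 1 & Cod P (f j) = 1"
 shows "bt P f n \<cdot> pm P n s = pm P n s \<cdot> bt P (f \<circ> s) n"
 using assms
proof (induction arbitrary: f rule: adjacent_induct)
 case id
 have "(\<Sum>j = Suc 0..n. Dom P (f j)) = n" "(\<Sum>j = Suc 0..n. Cod P (f j)) = n" using id by simp_all
 then show ?case using id by (simp add: pm_id)
next
 case (adj a b s)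
 have ap: "adj a permutes {1..n}" by (rule adj_permutes[OF adj(1)])
 have g: "(f \<circ> adj a) j : Arr P & Dom P ((f \<circ> adj a) j) = 1 & Cod P ((f \<circ> adj a) j) = 1"
  if "1 <= j" "j <= n" for j
  using adj(4)[of "adj a j"] permutes_in_image[OF ap, of j] that by auto
 have gs: "(f \<circ> adj a \<circ> s) j : Arr P & Dom P ((f \<circ> adj a \<circ> s) j) = 1 & Cod P ((f \<circ> adj a \<circ> s) j) = 1"
  if "1 <= j" "j <= n" for j
  using g[of "s j"] permutes_in_image[OF adj(2), of j] that by auto
 have h: "bt P h n : Arr P & Dom P (bt P h n) = n & Cod P (bt P h n) = n"
  if "!!j. 1 <= j ==> j <= n ==> h j : Arr P & Dom P (h j) = 1 & Cod P (h j) = 1" for h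
  using that by simp
 have hs: "bt P f n : Arr P & Dom P (bt P f n) = n & Cod P (bt P f n) = n"
  "bt P (f \<circ> adj a) n : Arr P & Dom P (bt P (f \<circ> adj a) n) = n & Cod P (bt P (f \<circ> adj a) n) = n"
  "bt P (f \<circ> adj a \<circ> s) n : Arr P & Dom P (bt P (f \<circ> adj a \<circ> s) n) = n & Cod P (bt P (f \<circ> adj a \<circ> s) n) = n"
  by (rule h, fact adj, rule h, fact g, rule h, fact gs)
 have c: "sw a b \<cdot> bt P (f \<circ> adj a) n = bt P f n \<cdot> sw a b"
  using sw_bt[OF g adj(1)] by (simp add: comp_def)
 have "bt P f n \<cdot> pm P n (adj a \<circ> s) = (bt P f n \<cdot> sw a b) \<cdot> pm P n s"
  using adj(1,2) hs by (simp add: pm_adj Comp_assoc)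
 also have "... = sw a b \<cdot> (bt P (f \<circ> adj a) n \<cdot> pm P n s)"
  unfolding c[symmetric] using adj(1,2) hs by (simp add: Comp_assoc)
 also have "... = sw a b \<cdot> (pm P n s \<cdot> bt P (f \<circ> adj a \<circ> s) n)"
  by (subst adj(3)[of "f \<circ> adj a"]) (rule g, assumption+, rule refl)
 also have "... = pm P n (adj a \<circ> s) \<cdot> bt P (f \<circ> adj a \<circ> s) n"
  using adj(1,2) hs by (simp add: pm_adj Comp_assoc)
 finally show ?case by (simp only: o_assoc)
qed

end

section \<open>Order-preserving maps and labelled permutations\<close>

text \<open>Each value \<open>s k\<close> is the number of points \<open>l\<close> with
  \<open>s l \<le> s k\<close>, so the induced order determines the permutation. This is what allows
  a permutation to be replaced by a total order.\<close>

lemma perm_eqI_order: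
 assumes s: "s permutes {1..n}" and t: "t permutes {1..n::nat}"
  and o: "!!k l. k : {1..n} ==> l : {1..n} ==> k ~= l ==> s k < s l <-> t k < t l"
 shows "s = t"
proof
 have *: "r k = card {l \<in> {1..n}. r l <= r k}" if r: "r permutes {1..n}" and k: "k : {1..n}" for r k
 proof -
  have rk: "r k : {1..n}" using permutes_in_image[OF r] k by blast
  have "r ` {l \<in> {1..n}. r l <= r k} = {1..r k}"
  proof
   show "{1..r k} \<subseteq> r ` {l \<in> {1..n}. r l <= r k}"
   proof
    fix i assume "i : {1..r k}"
    then have i: "i : {1..n}" "i <= r k" using rk by auto
    then obtain l where "l : {1..n}" "i = r l" using permutes_image[OF r] by blast
    then show "i : r ` {l \<in> {1..n}. r l <= r k}" using i by blast
   qed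
   show "r ` {l \<in> {1..n}. r l <= r k} \<subseteq> {1..r k}"
   proof
    fix i assume "i : r ` {l \<in> {1..n}. r l <= r k}"
    then obtain l where "l : {1..n}" "i = r l" "r l <= r k" by blast
    then show "i : {1..r k}" using permutes_in_image[OF r, of l] by simp
   qed
  qed
  moreover have "inj_on r {l \<in> {1..n}. r l <= r k}"
   using permutes_inj[OF r] by (meson inj_on_subset subset_UNIV)
  ultimately show ?thesis by (metis card_image card_atLeastAtMost diff_Suc_1)
 qed
 fix k show "s k = t k"
 proof (cases "k : {1..n}")
  case True
  have "s l <= s k <-> t l <= t k" if l: "l : {1..n}" for l
   using o[OF True l] permutes_inj[OF s] permutes_inj[OF t] by (metis inj_eq linorder_not_less order_refl)
  then have "{l \<in> {1..n}. s l <= s k} = {l \<in> {1..n}. t l <= t k}" by blast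
  then show ?thesis using *[OF s True] *[OF t True] by simp
 next
  case False then show ?thesis using permutes_not_in[OF s] permutes_not_in[OF t] by simp
 qed
qed

text \<open>The converse of \<open>perm_eqI_order\<close>: counting predecessors, \<open>k\<close>
  itself included, ranks the points from 1 to \<open>n\<close>.\<close>

lemma rank_exists:
 assumes irr: "!!k. k : {1..n} ==> ~ R k k"
  and tr: "!!k l m. k : {1..n} ==> l : {1..n} ==> m : {1..n} ==> R k l ==> R l m ==> R k m"
  and tot: "!!k l. k : {1..n} ==> l : {1..n} ==> k ~= l ==> R k l \<or> R l k"
 shows "\<exists>r. r permutes {1..n::nat} & (\<forall>k \<in> {1..n}. \<forall>l \<in> {1..n}. r k < r l <-> R k l)"
proof -
 define D where "D k = {l \<in> {1..n}. R l k \<or> l = k}" for k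
 define r where "r k = (if k : {1..n} then card (D k) else k)" for k
 have less: "r k < r l" if "k : {1..n}" "l : {1..n}" "R k l" for k l
 proof -
  have "D k \<subseteq> D l" unfolding D_def using tr that by blast
  moreover have "l : D l" "l \<notin> D k" unfolding D_def using that irr tr by blast+
  ultimately have "D k \<subset> D l" by blast
  then have "card (D k) < card (D l)" by (intro psubset_card_mono) (auto simp: D_def)
  then show ?thesis using that by (simp add: r_def)
 qed
 have iff: "r k < r l <-> R k l" if "k : {1..n}" "l : {1..n}" for k l
  using less that tot irr by (metis less_asym less_irrefl)
 have inj: "inj_on r {1..n}"
  by (rule inj_onI) (metis less tot less_irrefl)
 have "r k : {1..n}" if k: "k : {1..n}" for k
 proof -
  have "card (D k) <= card {1..n}" by (rule card_mono) (auto simp: D_def)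
  moreover have "k : D k" using k by (simp add: D_def)
  then have "card (D k) ~= 0" using finite_subset[of "D k" "{1..n}"] by (auto simp: D_def)
  ultimately show ?thesis using k by (simp add: r_def)
 qed
 then have "r ` {1..n} = {1..n}" using inj by (intro endo_inj_surj) auto
 then have "bij_betw r {1..n} {1..n}" using inj by (simp add: bij_betw_def)
 then have "r permutes {1..n}" by (rule bij_imp_permutes) (unfold r_def, rule if_not_P)
 then show ?thesis using iff by blast
qed

lemma ord_maps_mono: "f : ord_maps n m ==> k : {1..n} ==> l : {1..n} ==> k <= l ==> f k <= f l"
 by (auto simp: ord_maps_def mono_on_def)

lemma ord_maps_range: "f : ord_maps n m ==> k : {1..n} ==> f k : {1..m}"
 by (auto simp: ord_maps_def)

text \<open>By monotonicity the points sent to values at most \<open>j\<close> form an initial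
  segment, which is determined by its size.\<close>

lemma ord_maps_le_iff:
 assumes h: "h : ord_maps n m" and k: "k : {1..n}"
 shows "h k <= j <-> k <= card {l \<in> {1..n}. h l <= j}"
proof
 show "k <= card {l \<in> {1..n}. h l <= j}" if "h k <= j"
 proof -
  have "{1..k} \<subseteq> {l \<in> {1..n}. h l <= j}" using ord_maps_mono[OF h, of _ k] k that by force
  then have "card {1..k} <= card {l \<in> {1..n}. h l <= j}" by (rule card_mono[rotated]) auto
  then show ?thesis by simp
 qed
 show "h k <= j" if "k <= card {l \<in> {1..n}. h l <= j}"
 proof (rule ccontr)
  assume "~ h k <= j"
  then have "{l \<in> {1..n}. h l <= j} \<subseteq> {1..<k}" using ord_maps_mono[OF h k] by force
  then have "card {l \<in> {1..n}. h l <= j} <= card {1..<k}" by (rule card_mono[rotated]) auto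
  then show False using that k by auto
 qed
qed

text \<open>Partial sums of the fibre sizes are the lengths of the initial segments in
  \<open>ord_maps_le_iff\<close>. This gives uniqueness for the description that defines
  \<open>push\<close>.\<close>

lemma ord_maps_eqI:
 assumes f: "f : ord_maps n m" and g: "g : ord_maps n m"
  and c: "!!i. i : {1..m} ==> card {k \<in> {1..n}. f k = i} = card {k \<in> {1..n}. g k = i}"
 shows "f = g"
proof -
 have le: "card {k \<in> {1..n}. h k <= j} = (\<Sum>i = 1..j. card {k \<in> {1..n}. h k = i})"
  if h: "h : ord_maps n m" for h j
 proof -
  have "h k >= 1" if "k : {1..n}" for k using h that by (auto simp: ord_maps_def)
  then have "{k \<in> {1..n}. h k <= j} = (\<Union>i \<in> {1..j}. {k \<in> {1..n}. h k = i})" by auto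
  also have "card ... = (\<Sum>i = 1..j. card {k \<in> {1..n}. h k = i})"
   by (rule card_UN_disjoint) auto
  finally show ?thesis .
 qed
 note iff = ord_maps_le_iff
 have "f k = g k" if k: "k : {1..n}" for k
 proof -
  have "f k <= j <-> g k <= j" if "j <= m" for j
  proof -
   have "card {k \<in> {1..n}. f k <= j} = card {k \<in> {1..n}. g k <= j}"
    unfolding le[OF f] le[OF g] by (rule sum.cong) (use c that in auto)
   then show ?thesis using iff[OF f k, of j] iff[OF g k, of j] by simp
  qed
  moreover have "f k <= m" "g k <= m" using f g k by (auto simp: ord_maps_def)
  ultimately show ?thesis by (metis order_antisym order_refl)
 qed
 then show ?thesis
  using f g unfolding ord_maps_def mem_Collect_eq by (blast intro: PiE_ext)
qed

lemma lperms_iff: "g : lperms G n <->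
  glabel g : {1..n} \<rightarrow>\<^sub>E carrier G & clabel g : extensional {1..n} & perm g permutes {1..n}"
 by (cases g) (auto simp: lperms_def)

text \<open>Ranking strands by this order produces the permutation in \<open>pull\<close>. The order
  is lexicographic: permuted images first, then positions inside a fibre, reversed at a non-trivial
  label.\<close>

definition fib_less :: "'g lperm => (nat => nat) => nat => nat => bool" where
 "fib_less g f k l <-> perm g (f k) < perm g (f l) \<or>
   f k = f l & (if clabel g (f k) then l < k else k < l)"

text \<open>Both descriptions are resolved together. The rank permutation \<open>r\<close> of
  \<open>fib_less\<close> is built first; \<open>p\<close> is then forced by the equation
  \<open>?s \<circ> f = p \<circ> r\<close>, and its monotonicity is the lexicographic nature of
  \<open>fib_less\<close>. Uniqueness comes from fibre sizes for \<open>push\<close> and from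
  induced orders for \<open>pull\<close>.\<close>

lemma push_pull:
 assumes f: "f : ord_maps n m" and g: "g : lperms G m"
 shows push_ord_maps: "push n m g f : ord_maps n m"
  and perm_pull: "perm (pull n m f g) permutes {1..n}"
  and push_perm: "!!k. k : {1..n} ==> push n m g f (perm (pull n m f g) k) = perm g (f k)"
  and pull_less: "!!k l. k : {1..n} ==> l : {1..n} ==>
   perm (pull n m f g) k < perm (pull n m f g) l <-> fib_less g f k l"
proof -
 let ?s = "perm g"
 have s: "?s permutes {1..m}" using g by (simp add: lperms_iff)
 have sinj: "?s i = ?s j <-> i = j" for i j using permutes_inj[OF s] by (simp add: inj_eq)
 have "\<exists>r. r permutes {1..n} & (\<forall>k \<in> {1..n}. \<forall>l \<in> {1..n}. r k < r l <-> fib_less g f k l)"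
  by (rule rank_exists) (use sinj in "auto simp: fib_less_def nat_neq_iff split: if_splits")
 then obtain r where r: "r permutes {1..n}"
  and rl: "!!k l. k : {1..n} ==> l : {1..n} ==> r k < r l <-> fib_less g f k l" by blast
 define ri where "ri = inv_into UNIV r"
 have ri: "ri permutes {1..n}" unfolding ri_def by (rule permutes_inv[OF r])
 have rri: "r (ri k) = k" "ri (r k) = k" for k
  unfolding ri_def using permutes_inverses[OF r] by auto
 define p where "p = (\<lambda>i \<in> {1..n}. ?s (f (ri i)))"
 have rin: "ri k : {1..n} <-> k : {1..n}" "r k : {1..n} <-> k : {1..n}" for k
  using permutes_in_image[OF ri] permutes_in_image[OF r] by blast+
 have p: "p : ord_maps n m"
  unfolding ord_maps_def mem_Collect_eq
 proof
  show "p : {1..n} \<rightarrow>\<^sub>E {1..m}"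
   using ord_maps_range[OF f] rin permutes_in_image[OF s] by (fastforce simp: p_def)
  show "mono_on {1..n} p"
  proof (rule mono_onI)
   fix i j assume ij: "i : {1..n}" "j : {1..n}" "i <= j"
   show "p i <= p j"
   proof (cases "i = j")
    case False
    then have "r (ri i) < r (ri j)" using ij rri by simp
    then have "fib_less g f (ri i) (ri j)" using rl rin ij by blast
    then show ?thesis using ij by (auto simp: fib_less_def p_def)
   qed simp
  qed
 qed
 have pr: "p (r k) = ?s (f k)" if "k : {1..n}" for k
  using that rin rri by (simp add: p_def)
 have pc: "card {k \<in> {1..n}. p k = ?s i} = card {k \<in> {1..n}. f k = i}" for i
 proof -
  have "{k \<in> {1..n}. p k = ?s i} = r ` {k \<in> {1..n}. f k = i}"
  proof
   show "{k \<in> {1..n}. p k = ?s i} \<subseteq> r ` {k \<in> {1..n}. f k = i}"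
   proof
    fix k assume "k : {k \<in> {1..n}. p k = ?s i}"
    then have "ri k : {k \<in> {1..n}. f k = i}" using rin sinj by (auto simp: p_def)
    then show "k : r ` {k \<in> {1..n}. f k = i}" using rri by (metis imageI)
   qed
  qed (use pr rin in auto)
  moreover have "inj_on r X" for X
   using permutes_inj[OF r] by (meson inj_on_subset subset_UNIV)
  ultimately show ?thesis by (simp add: card_image)
 qed
 have push: "push n m g f = p"
  unfolding push_def
 proof (rule the_equality)
  fix q assume q: "q : ord_maps n m &
   (\<forall>i \<in> {1..m}. card {k \<in> {1..n}. q k = ?s i} = card {k \<in> {1..n}. f k = i})"
  show "q = p"
  proof (rule ord_maps_eqI[of _ n m])
   fix i assume "i : {1..m}"
   then obtain j where "j : {1..m}" "i = ?s j" using permutes_image[OF s] by blast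
   then show "card {k \<in> {1..n}. q k = i} = card {k \<in> {1..n}. p k = i}"
    using q pc by simp
  qed (use q p in auto)
 qed (use p pc in blast)
 have "(THE r. r permutes {1..n} &
    (\<forall>k \<in> {1..n}. perm g (f k) = push n m g f (r k)) &
    (\<forall>k \<in> {1..n}. \<forall>l \<in> {1..n}. k < l & f k = f l -->
      (if clabel g (f k) then r l < r k else r k < r l))) = r"
  unfolding push
 proof (rule the_equality)
  fix q assume q: "q permutes {1..n} &
    (\<forall>k \<in> {1..n}. perm g (f k) = p (q k)) &
    (\<forall>k \<in> {1..n}. \<forall>l \<in> {1..n}. k < l & f k = f l -->
      (if clabel g (f k) then q l < q k else q k < q l))"
  have qp: "q permutes {1..n}" using q by blast
  \<comment> \<open>Strands of different fibres are separated by the monotone map \<open>p\<close>,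
    strands of one fibre by the condition on labels.\<close>
  have le: "q k < q l" if kl: "k : {1..n}" "l : {1..n}" and "fib_less g f k l" for k l
  proof (cases "f k = f l")
   case False
   then have "p (q k) < p (q l)" using that q by (auto simp: fib_less_def)
   then show ?thesis
    using ord_maps_mono[OF p, of "q l" "q k"] permutes_in_image[OF qp] kl by (meson not_le)
  next
   case True
   then show ?thesis using that q unfolding fib_less_def
    by (metis (full_types) less_irrefl)
  qed
  show "q = r"
  proof (rule perm_eqI_order[OF qp r])
   fix k l assume kl: "k : {1..n}" "l : {1..n}" "k ~= l"
   have "r k < r l \<or> r l < r k" using kl rri by (metis nat_neq_iff)
   then show "q k < q l <-> r k < r l"
    using le kl rl by (metis less_asym)
  qed
 next
  have "if clabel g (f k) then r l < r k else r k < r l"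
   if "k : {1..n}" "l : {1..n}" "k < l & f k = f l" for k l
   using that rl by (auto simp: fib_less_def)
  then show "r permutes {1..n} & (\<forall>k \<in> {1..n}. perm g (f k) = p (r k)) &
    (\<forall>k \<in> {1..n}. \<forall>l \<in> {1..n}. k < l & f k = f l -->
      (if clabel g (f k) then r l < r k else r k < r l))"
   using r pr by auto
 qed
 then have pull: "perm (pull n m f g) = r" by (simp add: pull_def)
 show "push n m g f : ord_maps n m" "perm (pull n m f g) permutes {1..n}"
  "!!k. k : {1..n} ==> push n m g f (perm (pull n m f g) k) = perm g (f k)"
  "!!k l. k : {1..n} ==> l : {1..n} ==>
   perm (pull n m f g) k < perm (pull n m f g) l <-> fib_less g f k l"
  unfolding push pull by (rule p, rule r, erule pr, erule (1) rl)
qed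

lemma pull_labels:
 "k : {1..n} ==> glabel (pull n m f g) k = glabel g (f k)"
 "k : {1..n} ==> clabel (pull n m f g) k = clabel g (f k)"
 by (simp_all add: pull_def)

lemma pull_lperms:
 assumes f: "f : ord_maps n m" and g: "g : lperms G m"
 shows "pull n m f g : lperms G n"
 unfolding lperms_iff
proof (intro conjI)
 show "perm (pull n m f g) permutes {1..n}" by (rule perm_pull[OF f g])
 show "glabel (pull n m f g) : {1..n} \<rightarrow>\<^sub>E carrier G"
  using ord_maps_range[OF f] g by (fastforce simp: pull_def lperms_iff)
qed (simp add: pull_def)

section \<open>The PROP \<open>Q\<close>\<close>

text \<open>An arrow of \<open>Q\<close> is determined by the underlying map \<open>qf\<close>, the total order \<open>qlt\<close> on its
 source (which is all that is left of the permutation) and the labels. In these terms composition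
 has a simple description, so that equations between arrows can be checked pointwise.\<close>

definition qf :: "'g qarr => nat => nat" where
 "qf a k = qmap a (perm (qgrp a) k)"

definition qlt :: "'g qarr => nat => nat => bool" where
 "qlt a k l <-> perm (qgrp a) k < perm (qgrp a) l"

abbreviation gl :: "'g qarr => nat => 'g" where "gl a \<equiv> glabel (qgrp a)"
abbreviation cl :: "'g qarr => nat => bool" where "cl a \<equiv> clabel (qgrp a)"

abbreviation QA :: "('g, 'z) monoid_scheme => 'g qarr set" where "QA G \<equiv> Arr (DHG G)"

lemma QA_iff: "a : QA G <-> qmap a : ord_maps (qdom a) (qcod a) & qgrp a : lperms G (qdom a)"
 by (cases a) (auto simp: DHG_def)

lemma DHG_sel [simp]: "Dom (DHG G) = qdom" "Cod (DHG G) = qcod" "Ide (DHG G) = qide G"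
 "Comp (DHG G) = qcomp G" "TArr (DHG G) = qtensor" "Sym (DHG G) = qsym G" "Obj (DHG G) = UNIV"
 "TObj (DHG G) = (+)" "TUnit (DHG G) = 0" "Assoc (DHG G) = (%a b c. qide G (a + b + c))"
 "LUnit (DHG G) = qide G" "RUnit (DHG G) = qide G"
 by (simp_all add: DHG_def)

lemma diff_ge_1 [simp]: "~ k <= a ==> Suc 0 <= k - (a::nat)"
 by simp

lemma diff_le [simp]: "k <= a + b ==> k - a <= (b::nat)"
 by simp

lemma perm_in: "a : QA G ==> perm (qgrp a) k : {1..qdom a} <-> k : {1..qdom a}"
 by (metis QA_iff lperms_iff permutes_in_image)

lemma perm_le: "a : QA G ==> Suc 0 <= k ==> k <= qdom a ==> Suc 0 <= perm (qgrp a) k & perm (qgrp a) k <= qdom a"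
 using perm_in[of a G k] by simp

lemma perm_inj: "a : QA G ==> perm (qgrp a) k = perm (qgrp a) l <-> k = l"
 by (metis QA_iff lperms_iff permutes_inj inj_eq)

lemma qf_range: "a : QA G ==> Suc 0 <= k ==> k <= qdom a ==> Suc 0 <= qf a k & qf a k <= qcod a"
 using perm_in[of a G k] ord_maps_range[of "qmap a" "qdom a" "qcod a"]
 by (fastforce simp: QA_iff qf_def)

lemma qf_nz: "a : QA G ==> Suc 0 <= k ==> k <= qdom a ==> 0 < qf a k"
 using qf_range[of a G k] by simp

lemma qf_le_add: "a : QA G ==> Suc 0 <= k ==> k <= qdom a ==> qf a k <= qcod a + x"
 using qf_range[of a G k] by simp

lemma gl_carrier: "a : QA G ==> Suc 0 <= k ==> k <= qdom a ==> gl a k : carrier G"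
 by (auto simp: QA_iff lperms_iff)

lemma qlt_total: "a : QA G ==> k ~= l ==> qlt a k l <-> ~ qlt a l k"
 using perm_inj[of a G k l] by (auto simp: qlt_def)

lemma qlt_irrefl [simp]: "~ qlt a k k"
 by (simp add: qlt_def)

text \<open>\<open>qmap a\<close> is monotone, so the order on strands refines the order of their
  images; only the order inside fibres is additional data.\<close>

lemma qf_less_qlt:
 "a : QA G ==> Suc 0 <= k ==> k <= qdom a ==> Suc 0 <= l ==> l <= qdom a ==> qf a k < qf a l ==> qlt a k l"
 using ord_maps_mono[of "qmap a" "qdom a" "qcod a" "perm (qgrp a) l" "perm (qgrp a) k"]
  perm_in[of a G k] perm_in[of a G l]
 by (fastforce simp: QA_iff qlt_def qf_def)

text \<open>Equal orders give equal permutations by \<open>perm_eqI_order\<close>; permutations are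
  onto, so \<open>qf\<close> then determines \<open>qmap\<close>.\<close>

lemma qarr_eqI:
 assumes a: "a : QA G" and b: "b : QA G" and d: "qdom a = qdom b" and c: "qcod a = qcod b"
  and f: "!!k. 1 <= k ==> k <= qdom a ==> qf a k = qf b k"
  and g: "!!k. 1 <= k ==> k <= qdom a ==> gl a k = gl b k"
  and e: "!!k. 1 <= k ==> k <= qdom a ==> cl a k = cl b k"
  and o: "!!k l. 1 <= k ==> k <= qdom a ==> Suc 0 <= l ==> l <= qdom a ==> k ~= l ==> qlt a k l = qlt b k l"
 shows "a = b"
proof -
 have pa: "perm (qgrp a) permutes {1..qdom a}" and pb: "perm (qgrp b) permutes {1..qdom a}"
  using a b d by (auto simp: QA_iff lperms_iff)
 have s: "perm (qgrp a) = perm (qgrp b)"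
  by (rule perm_eqI_order[OF pa pb], unfold qlt_def[symmetric], rule o) simp_all
 have "qmap a i = qmap b i" if "i : {1..qdom a}" for i
 proof -
  have "i : perm (qgrp a) ` {1..qdom a}" unfolding permutes_image[OF pa] by (rule that)
  then obtain k where k: "k : {1..qdom a}" "i = perm (qgrp a) k" by blast
  show ?thesis using f[of k] k unfolding qf_def s by simp
 qed
 moreover have "qmap a : {1..qdom a} \<rightarrow>\<^sub>E {1..qcod a}" "qmap b : {1..qdom a} \<rightarrow>\<^sub>E {1..qcod a}"
  using a b c d by (simp_all add: QA_iff ord_maps_def)
 ultimately have "qmap a = qmap b" by (blast intro: PiE_ext)
 moreover have "gl a = gl b"
 proof (rule PiE_ext)
  show "gl a : {1..qdom a} \<rightarrow>\<^sub>E carrier G" "gl b : {1..qdom a} \<rightarrow>\<^sub>E carrier G"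
   using a b d by (simp_all add: QA_iff lperms_iff)
 qed (simp add: g)
 moreover have "cl a = cl b"
 proof (rule extensionalityI)
  show "cl a : extensional {1..qdom a}" "cl b : extensional {1..qdom a}"
   using a b d by (simp_all add: QA_iff lperms_iff)
 qed (simp add: e)
 ultimately show ?thesis using d c s by (intro qarr.expand lperm.expand conjI)
qed

lemma qdc [simp]:
 "qdom (qcomp G b a) = qdom a" "qcod (qcomp G b a) = qcod b"
 "qdom (qtensor a b) = qdom a + qdom b" "qcod (qtensor a b) = qcod a + qcod b"
 "qdom (qiso n g) = n" "qcod (qiso n g) = n" "qdom (qide G n) = n" "qcod (qide G n) = n"
 "qdom (qord G n m f) = n" "qcod (qord G n m f) = m"
 "qdom (qsym G n m) = n + m" "qcod (qsym G n m) = m + n"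
 by (simp_all add: qcomp_def qtensor_def qiso_def qide_def qord_def qsym_def Let_def)

lemma id_ord_maps: "(\<lambda>k \<in> {1..n}. k) : ord_maps n n"
 by (auto simp: ord_maps_def mono_on_def)

lemma qiso_QA: "qiso n g : QA G <-> g : lperms G n"
 using id_ord_maps by (auto simp: QA_iff qiso_def)

lemma qiso_qf: "g : lperms G n ==> Suc 0 <= k ==> k <= n ==> qf (qiso n g) k = perm g k"
 using permutes_in_image[of "perm g" "{1..n}" k] by (auto simp: qf_def qiso_def lperms_iff)

lemma qiso_qlt [simp]: "qlt (qiso n g) k l <-> perm g k < perm g l"
 by (simp add: qlt_def qiso_def)

lemma qiso_qgrp [simp]: "qgrp (qiso n g) = g"
 by (simp add: qiso_def)

lemma qord_qf [simp]: "qf (qord G n m f) k = f k"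
 by (simp add: qf_def qord_def lp_one_def)

lemma qord_qlt [simp]: "qlt (qord G n m f) k l <-> k < l"
 by (simp add: qlt_def qord_def lp_one_def)

lemma qord_labels [simp]:
 "Suc 0 <= k ==> k <= n ==> gl (qord G n m f) k = \<one>\<^bsub>G\<^esub>"
 "Suc 0 <= k ==> k <= n ==> ~ cl (qord G n m f) k"
 by (simp_all add: qord_def lp_one_def)

lemma qide_labels [simp]:
 "Suc 0 <= k ==> k <= n ==> gl (qide G n) k = \<one>\<^bsub>G\<^esub>"
 "Suc 0 <= k ==> k <= n ==> ~ cl (qide G n) k"
 "Suc 0 <= k ==> k <= n ==> qf (qide G n) k = k"
 "qlt (qide G n) k l <-> k < l"
 by (simp_all add: qide_def qiso_def lp_one_def qf_def qlt_def)

lemma block_perm_permutes: "block_perm n m permutes {1..n + m}"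
proof (rule bij_imp_permutes)
 show "bij_betw (block_perm n m) {1..n + m} {1..n + m}"
  by (rule bij_betw_byWitness[where f' = "block_perm m n"]) (auto simp: block_perm_def)
qed (auto simp: block_perm_def)

lemma qsym_labels [simp]:
 "Suc 0 <= k ==> k <= n + m ==> gl (qsym G n m) k = \<one>\<^bsub>G\<^esub>"
 "Suc 0 <= k ==> k <= n + m ==> ~ cl (qsym G n m) k"
 "Suc 0 <= k ==> k <= n + m ==> qf (qsym G n m) k = (if k <= n then k + m else k - n)"
 "Suc 0 <= k ==> k <= n + m ==> Suc 0 <= l ==> l <= n + m ==> qlt (qsym G n m) k l <->
  (if k <= n then k + m else k - n) < (if l <= n then l + m else l - n)"
 by (auto simp: qsym_def qiso_def lp_one_def qf_def qlt_def block_perm_def)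

lemma qtensor_labels [simp]:
 "Suc 0 <= k ==> k <= qdom a + qdom b ==> gl (qtensor a b) k = (if k <= qdom a then gl a k else gl b (k - qdom a))"
 "Suc 0 <= k ==> k <= qdom a + qdom b ==> cl (qtensor a b) k = (if k <= qdom a then cl a k else cl b (k - qdom a))"
 by (simp_all add: qtensor_def Let_def)

lemma qtensor_perm:
 "perm (qgrp (qtensor a b)) = perm_sum (qdom a) (perm (qgrp a)) (perm (qgrp b))"
 by (simp add: qtensor_def Let_def perm_sum_def fun_eq_iff)

lemma qtensor_qf:
 assumes "a : QA G" "b : QA G" "Suc 0 <= k" "k <= qdom a + qdom b"
 shows "qf (qtensor a b) k = (if k <= qdom a then qf a k else qf b (k - qdom a) + qcod a)"
 using perm_le[OF assms(1), of k] perm_le[OF assms(2), of "k - qdom a"] assms(3,4)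
 by (auto simp: qf_def qtensor_def Let_def)

lemma qtensor_qlt:
 assumes "a : QA G" "b : QA G" "Suc 0 <= k" "k <= qdom a + qdom b" "Suc 0 <= l" "l <= qdom a + qdom b"
 shows "qlt (qtensor a b) k l <->
  (if k <= qdom a then qdom a < l \<or> qlt a k l else qdom a < l & qlt b (k - qdom a) (l - qdom a))"
 using perm_le[OF assms(1), of k] perm_le[OF assms(2), of "k - qdom a"]
  perm_le[OF assms(1), of l] perm_le[OF assms(2), of "l - qdom a"] assms(3-6)
 by (auto simp: qlt_def qtensor_perm perm_sum_def)

context group
begin

lemma lp_one_lperms [simp]: "lp_one G n : lperms G n"
 by (auto simp: lperms_iff lp_one_def permutes_id[unfolded id_def] id_def)

lemma qide_QA [simp]: "qide G n : QA G"
 by (simp add: qide_def qiso_QA)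

lemma qord_QA [simp]: "qord G n m f : QA G <-> f : ord_maps n m"
 by (simp add: QA_iff qord_def)

lemma qsym_QA [simp]: "qsym G n m : QA G"
 unfolding qsym_def qiso_QA
 using lp_one_lperms[of "n + m"] block_perm_permutes by (simp add: lperms_iff)

lemma qtensor_QA [simp]:
 assumes a: "a : QA G" and b: "b : QA G"
 shows "qtensor a b : QA G"
 unfolding QA_iff lperms_iff qtensor_perm
proof (intro conjI)
 show "qmap (qtensor a b) : ord_maps (qdom (qtensor a b)) (qcod (qtensor a b))"
  unfolding ord_maps_def mem_Collect_eq
 proof
  have ra: "qmap a k : {1..qcod a}" if "k : {1..qdom a}" for k
   using ord_maps_range a that by (auto simp: QA_iff)
  have rb: "qmap b k : {1..qcod b}" if "k : {1..qdom b}" for k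
   using ord_maps_range b that by (auto simp: QA_iff)
  have ra': "1 <= qmap a k & qmap a k <= qcod a" if "Suc 0 <= k" "k <= qdom a" for k using ra that by simp
  have rb': "1 <= qmap b k & qmap b k <= qcod b" if "Suc 0 <= k" "k <= qdom b" for k using rb that by simp
  show "qmap (qtensor a b) : {1..qdom (qtensor a b)} \<rightarrow>\<^sub>E {1..qcod (qtensor a b)}"
  proof
   fix k assume k: "k : {1..qdom (qtensor a b)}"
   show "qmap (qtensor a b) k : {1..qcod (qtensor a b)}"
    using ra'[of k] rb'[of "k - qdom a"] k by (auto simp: qtensor_def Let_def)
  next
   fix k assume "k \<notin> {1..qdom (qtensor a b)}"
   then show "qmap (qtensor a b) k = undefined"
    unfolding qdc by (simp only: qtensor_def Let_def qarr.sel restrict_apply if_False)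
  qed
  show "mono_on {1..qdom (qtensor a b)} (qmap (qtensor a b))"
  proof (rule mono_onI)
   fix k l assume kl: "k : {1..qdom (qtensor a b)}" "l : {1..qdom (qtensor a b)}" "k <= l"
   show "qmap (qtensor a b) k <= qmap (qtensor a b) l"
    using kl ra'[of k] ord_maps_mono[of "qmap a" "qdom a" "qcod a" k l]
     ord_maps_mono[of "qmap b" "qdom b" "qcod b" "k - qdom a" "l - qdom a"] a b
    by (auto simp: qtensor_def Let_def QA_iff)
  qed
 qed
 show "gl (qtensor a b) : {1..qdom (qtensor a b)} \<rightarrow>\<^sub>E carrier G"
 proof
  fix k assume "k : {1..qdom (qtensor a b)}"
  then show "gl (qtensor a b) k : carrier G"
   using gl_carrier[OF a, of k] gl_carrier[OF b, of "k - qdom a"] by auto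
 next
  fix k assume "k \<notin> {1..qdom (qtensor a b)}"
  then show "gl (qtensor a b) k = undefined"
   unfolding qdc by (simp only: qtensor_def Let_def qarr.sel lperm.sel restrict_apply if_False)
 qed
 show "cl (qtensor a b) : extensional {1..qdom (qtensor a b)}" by (simp add: qtensor_def Let_def)
 show "perm_sum (qdom a) (perm (qgrp a)) (perm (qgrp b)) permutes {1..qdom (qtensor a b)}"
  unfolding qdc by (rule perm_sum_permutes) (use a b in "simp_all add: QA_iff lperms_iff")
qed

lemma qcomp_QA [simp]:
 assumes a: "a : QA G" and b: "b : QA G" and c: "qdom b = qcod a"
 shows "qcomp G b a : QA G"
 unfolding QA_iff lperms_iff
proof (intro conjI)
 let ?n = "qdom a" and ?m = "qcod a"
 have fa: "qmap a : ord_maps ?n ?m" and gb: "qgrp b : lperms G ?m" and fb: "qmap b : ord_maps ?m (qcod b)"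
  using a b c by (auto simp: QA_iff)
 have pu: "push ?n ?m (qgrp b) (qmap a) : ord_maps ?n ?m" by (rule push_ord_maps[OF fa gb])
 show "qmap (qcomp G b a) : ord_maps (qdom (qcomp G b a)) (qcod (qcomp G b a))"
  unfolding ord_maps_def mem_Collect_eq
 proof
  show "qmap (qcomp G b a) : {1..qdom (qcomp G b a)} \<rightarrow>\<^sub>E {1..qcod (qcomp G b a)}"
   using ord_maps_range[OF fb] ord_maps_range[OF pu]
   by (fastforce simp: qcomp_def Let_def compose_def)
  show "mono_on {1..qdom (qcomp G b a)} (qmap (qcomp G b a))"
   using ord_maps_mono[OF fb] ord_maps_mono[OF pu] ord_maps_range[OF pu]
   by (intro mono_onI) (simp add: qcomp_def Let_def compose_def)
 qed
 have pl: "pull ?n ?m (qmap a) (qgrp b) : lperms G ?n" by (rule pull_lperms[OF fa gb])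
 show "gl (qcomp G b a) : {1..qdom (qcomp G b a)} \<rightarrow>\<^sub>E carrier G"
 proof (rule PiE_I)
  fix k assume k: "k : {1..qdom (qcomp G b a)}"
  then have "glabel (pull ?n ?m (qmap a) (qgrp b)) (perm (qgrp a) k) : carrier G"
   using pl perm_in[OF a, of k] by (auto simp: lperms_iff)
  then show "gl (qcomp G b a) k : carrier G"
   using k gl_carrier[OF a, of k] by (auto simp: qcomp_def Let_def lp_mult_def)
 next
  fix k assume "k \<notin> {1..qdom (qcomp G b a)}"
  then show "gl (qcomp G b a) k = undefined"
   unfolding qdc by (simp only: qcomp_def Let_def lp_mult_def qarr.sel lperm.sel restrict_apply if_False)
 qed
 show "cl (qcomp G b a) : extensional {1..qdom (qcomp G b a)}"
  by (simp add: qcomp_def Let_def lp_mult_def)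
 show "perm (qgrp (qcomp G b a)) permutes {1..qdom (qcomp G b a)}"
  using perm_pull[OF fa gb] a by (simp add: qcomp_def Let_def lp_mult_def permutes_compose QA_iff lperms_iff)
qed

text \<open>\<open>pull\<close> ranks strands by \<open>fib_less\<close>, so the order of a
  composite is that lexicographic order read along the permutation of \<open>a\<close>. These rules
  let composites be computed without unfolding \<open>push\<close> and \<open>pull\<close>.\<close>

lemma qcomp_props:
 assumes a: "a : QA G" and b: "b : QA G" and c: "qdom b = qcod a" and k: "Suc 0 <= k" "k <= qdom a"
 shows qcomp_qf: "qf (qcomp G b a) k = qf b (qf a k)"
  and qcomp_gl: "gl (qcomp G b a) k = gl b (qf a k) \<otimes> gl a k"
  and qcomp_cl: "cl (qcomp G b a) k <-> cl b (qf a k) ~= cl a k"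
  and qcomp_qlt: "Suc 0 <= l ==> l <= qdom a ==> qlt (qcomp G b a) k l <->
   (if qf a k = qf a l then (if cl b (qf a k) then qlt a l k else qlt a k l) else qlt b (qf a k) (qf a l))"
proof -
 let ?n = "qdom a" and ?m = "qcod a"
 have fa: "qmap a : ord_maps ?n ?m" and gb: "qgrp b : lperms G ?m" and fb: "qmap b : ord_maps ?m (qcod b)"
  using a b c by (auto simp: QA_iff)
 have pk: "perm (qgrp a) k : {1..?n}" using perm_in[OF a, of k] k by simp
 have ppk: "perm (pull ?n ?m (qmap a) (qgrp b)) (perm (qgrp a) k) : {1..?n}"
  using permutes_in_image[OF perm_pull[OF fa gb]] pk by blast
 show "qf (qcomp G b a) k = qf b (qf a k)"
  using push_perm[OF fa gb pk] ppk by (simp add: qcomp_def Let_def lp_mult_def compose_def qf_def)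
 show "gl (qcomp G b a) k = gl b (qf a k) \<otimes> gl a k"
  using pk k by (simp add: qcomp_def Let_def lp_mult_def pull_labels qf_def)
 show "cl (qcomp G b a) k <-> cl b (qf a k) ~= cl a k"
  using pk k by (simp add: qcomp_def Let_def lp_mult_def pull_labels qf_def)
 show "qlt (qcomp G b a) k l <->
   (if qf a k = qf a l then (if cl b (qf a k) then qlt a l k else qlt a k l) else qlt b (qf a k) (qf a l))"
  if "Suc 0 <= l" "l <= qdom a"
 proof -
  have pl: "perm (qgrp a) l : {1..?n}" using perm_in[OF a, of l] that by simp
  show ?thesis
   using pull_less[OF fa gb pk pl] perm_inj[OF b, of "qf a k" "qf a l"]
   by (auto simp: qcomp_def Let_def lp_mult_def qlt_def fib_less_def qf_def)
 qed
qed

lemmas q_simps = qcomp_qf qcomp_gl qcomp_cl qcomp_qlt qtensor_qf qtensor_qlt qf_range qf_nz gl_carrier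

end

section \<open>The axioms of a strict PROP for \<open>Q\<close>\<close>

context group
begin

text \<open>Pointwise both sides compose maps and multiply labels along strands. In a fibre merged
  at an early stage the reversals of the later stages accumulate, which matches the addition of
  their labels in the group of order two.\<close>

lemma qcomp_assoc:
 assumes "f : QA G" "g : QA G" "h : QA G" "qdom g = qcod f" "qdom h = qcod g"
 shows "qcomp G (qcomp G h g) f = qcomp G h (qcomp G g f)"
 by (rule qarr_eqI[of _ G]) (use assms in "auto simp: q_simps m_assoc")

lemma qf_less_iff:
 assumes "a : QA G" "Suc 0 <= k" "k <= qdom a" "Suc 0 <= l" "l <= qdom a" "qf a k ~= qf a l"
 shows "qf a k < qf a l <-> qlt a k l"
 using qf_less_qlt[of a G k l] qf_less_qlt[of a G l k] qlt_total[of a G k l] assms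
 by (metis nat_neq_iff)

lemma qtensor_left:
 assumes "a : QA G" "b : QA G" "Suc 0 <= k" "k <= qdom a"
 shows "qf (qtensor a b) k = qf a k" "gl (qtensor a b) k = gl a k" "cl (qtensor a b) k = cl a k"
  "Suc 0 <= l ==> l <= qdom a ==> qlt (qtensor a b) k l = qlt a k l"
  "l <= qdom b ==> 0 < l ==> qlt (qtensor a b) k (l + qdom a)"
 using assms by (simp_all add: qtensor_qf qtensor_qlt)

lemma qtensor_right:
 assumes "a : QA G" "b : QA G" "0 < k" "k <= qdom b"
 shows "qf (qtensor a b) (k + qdom a) = qf b k + qcod a" "gl (qtensor a b) (k + qdom a) = gl b k"
  "cl (qtensor a b) (k + qdom a) = cl b k"
  "0 < l ==> l <= qdom b ==> qlt (qtensor a b) (k + qdom a) (l + qdom a) = qlt b k l"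
  "Suc 0 <= l ==> l <= qdom a ==> ~ qlt (qtensor a b) (k + qdom a) l"
 using assms by (simp_all add: qtensor_qf qtensor_qlt)

text \<open>A point of the right summand is written as \<open>j + n\<close>, so that the rules
  \<open>qtensor_right\<close> rewrite without truncated subtraction.\<close>

lemma split_cases:
 assumes "Suc 0 <= k" "k <= n + m"
 obtains "k <= n" | j where "k = j + n" "0 < j" "j <= m"
proof (cases "k <= n")
 case False
 then have "k = (k - n) + n" "0 < k - n" "k - n <= m" using assms by auto
 then show ?thesis using that(2) by blast
qed (use that in blast)

lemma qcomp_qtensor:
 assumes [simp]: "f : QA G" "g : QA G" "f' : QA G" "g' : QA G" "qdom g = qcod f" "qdom g' = qcod f'"
 shows "qcomp G (qtensor g g') (qtensor f f') = qtensor (qcomp G g f) (qcomp G g' f')"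
proof -
 note fl = qf_range[of f G] qf_range[of f' G] qf_nz[of f' G]
 have [simp]: "g : QA G & True" by simp
 note L = qtensor_left[of f f'] qtensor_right[of f f'] qtensor_left[of g g', unfolded assms(5)] qtensor_right[of g g', unfolded assms(5)]
  qtensor_left[of "qcomp G g f" "qcomp G g' f'", simplified]
  qtensor_right[of "qcomp G g f" "qcomp G g' f'", simplified]
 note S = qcomp_qf qcomp_gl qcomp_cl qcomp_qlt
 show ?thesis
 proof (rule qarr_eqI[of _ G])
 fix k assume k: "1 <= k" "k <= qdom (qcomp G (qtensor g g') (qtensor f f'))"
 then have k': "Suc 0 <= k" "k <= qdom f + qdom f'" by auto
 show "qf (qcomp G (qtensor g g') (qtensor f f')) k = qf (qtensor (qcomp G g f) (qcomp G g' f')) k"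
  by (rule split_cases[OF k']) (use k' in "simp_all add: S L fl")
 show "gl (qcomp G (qtensor g g') (qtensor f f')) k = gl (qtensor (qcomp G g f) (qcomp G g' f')) k"
  by (rule split_cases[OF k']) (use k' in "simp_all add: S L fl")
 show "cl (qcomp G (qtensor g g') (qtensor f f')) k = cl (qtensor (qcomp G g f) (qcomp G g' f')) k"
  by (rule split_cases[OF k']) (use k' in "simp_all add: S L fl")
next
 fix k l assume "1 <= k" "k <= qdom (qcomp G (qtensor g g') (qtensor f f'))"
  "Suc 0 <= l" "l <= qdom (qcomp G (qtensor g g') (qtensor f f'))"
 then have k': "Suc 0 <= k" "k <= qdom f + qdom f'" and l': "Suc 0 <= l" "l <= qdom f + qdom f'" by auto
 have ne: "qf f i ~= qf f' j + qcod f" if "Suc 0 <= i" "i <= qdom f" "0 < j" "j <= qdom f'" for i j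
  using fl(1)[of i] fl(3)[of j] that by simp
 show "qlt (qcomp G (qtensor g g') (qtensor f f')) k l = qlt (qtensor (qcomp G g f) (qcomp G g' f')) k l"
  by (rule split_cases[OF k']; rule split_cases[OF l'])
   (use k' l' in "simp_all add: S L fl ne ne[symmetric]")
 qed simp_all
qed

lemma qtensor_assoc:
 assumes "f : QA G" "g : QA G" "h : QA G"
 shows "qtensor (qtensor f g) h = qtensor f (qtensor g h)"
 by (auto simp: qtensor_def Let_def fun_eq_iff add_ac)

lemma qsym_natural:
 assumes [simp]: "f : QA G" "g : QA G"
 shows "qcomp G (qsym G (qcod f) (qcod g)) (qtensor f g) = qcomp G (qtensor g f) (qsym G (qdom f) (qdom g))"
proof -
 note fl = qf_le_add[of f G] qf_le_add[of g G] trans_le_add1[of 1, unfolded One_nat_def]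
  qf_range[of f G] qf_range[of g G] qf_nz[of g G] qf_nz[of f G] qf_nz[of g G, THEN gr_implies_not0] qf_nz[of f G, THEN gr_implies_not0] gl_carrier[of f G] gl_carrier[of g G]
 note L = qtensor_left[of f g] qtensor_right[of f g] qtensor_left[of g f] qtensor_right[of g f]
 note S = qcomp_qf qcomp_gl qcomp_cl qcomp_qlt
 show ?thesis
 proof (rule qarr_eqI[of _ G])
 fix k assume k: "1 <= k" "k <= qdom (qcomp G (qsym G (qcod f) (qcod g)) (qtensor f g))"
 then have k': "Suc 0 <= k" "k <= qdom f + qdom g" by auto
 show "qf (qcomp G (qsym G (qcod f) (qcod g)) (qtensor f g)) k = qf (qcomp G (qtensor g f) (qsym G (qdom f) (qdom g))) k"
  by (rule split_cases[OF k']) (use k' in "simp_all add: S L fl")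
 show "gl (qcomp G (qsym G (qcod f) (qcod g)) (qtensor f g)) k = gl (qcomp G (qtensor g f) (qsym G (qdom f) (qdom g))) k"
  by (rule split_cases[OF k']) (use k' in "simp_all add: S L fl")
 show "cl (qcomp G (qsym G (qcod f) (qcod g)) (qtensor f g)) k = cl (qcomp G (qtensor g f) (qsym G (qdom f) (qdom g))) k"
  by (rule split_cases[OF k']) (use k' in "simp_all add: S L fl")
next
 fix k l assume "1 <= k" "k <= qdom (qcomp G (qsym G (qcod f) (qcod g)) (qtensor f g))"
  "Suc 0 <= l" "l <= qdom (qcomp G (qsym G (qcod f) (qcod g)) (qtensor f g))" "k ~= l"
 then have k': "Suc 0 <= k" "k <= qdom f + qdom g" and l': "Suc 0 <= l" "l <= qdom f + qdom g" "k ~= l" by auto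
 \<comment> \<open>The images of the two factors occupy disjoint blocks on either side of the
   equation, so strands of different factors are never merged.\<close>
 have ne: "qf f i ~= qf g j + qcod f" "~ qf f i + qcod g < qf g j" "qf g j < qf f i + qcod g"
  "qf f i + qcod g ~= qf g j"
  if "Suc 0 <= i" "i <= qdom f" "0 < j" "j <= qdom g" for i j
  using qf_range[of f G i] qf_range[of g G j] qf_nz[of f G i] qf_nz[of g G j] that by auto
 show "qlt (qcomp G (qsym G (qcod f) (qcod g)) (qtensor f g)) k l =
   qlt (qcomp G (qtensor g f) (qsym G (qdom f) (qdom g))) k l"
  by (rule split_cases[OF k']; rule split_cases[OF l'(1,2)])
   (use k' l' in "simp_all add: S L fl ne ne(1)[symmetric] ne(4)[symmetric] qf_less_iff")
 qed simp_all
qed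

lemma qsym_hexagon: "qsym G a (b + c) =
  qcomp G (qtensor (qide G b) (qsym G a c)) (qtensor (qsym G a b) (qide G c))"
proof -
 let ?L = "qsym G a (b + c)"
 let ?R = "qcomp G (qtensor (qide G b) (qsym G a c)) (qtensor (qsym G a b) (qide G c))"
 have c3: "k <= a \<or> (\<exists>j. k = j + a & 0 < j & j <= b) \<or> (\<exists>j. k = j + (a + b) & 0 < j & j <= c)"
  if "k <= a + (b + c)" for k
  using that by presburger
 note L = qtensor_left[of "qsym G a b" "qide G c", simplified] qtensor_right[of "qsym G a b" "qide G c", simplified]
  qtensor_left[of "qide G b" "qsym G a c", simplified] qtensor_right[of "qide G b" "qsym G a c", simplified]
 note S = qcomp_qf qcomp_gl qcomp_cl qcomp_qlt
 have f1: "qf (qtensor (qsym G a b) (qide G c)) k = (if k <= a then k + b else if k <= a + b then k - a else k)"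
  and f2: "qlt (qtensor (qsym G a b) (qide G c)) k l <-> qf (qtensor (qsym G a b) (qide G c)) k < qf (qtensor (qsym G a b) (qide G c)) l"
  if "Suc 0 <= k" "k <= a + (b + c)" "Suc 0 <= l" "l <= a + (b + c)" for k l
  using that by (auto simp: qtensor_qf[of _ G] qtensor_qlt[of _ G])
 have g1: "qf (qtensor (qide G b) (qsym G a c)) k = (if k <= b then k else if k <= b + a then k + c else k - a)"
  and g2: "qlt (qtensor (qide G b) (qsym G a c)) k l <-> qf (qtensor (qide G b) (qsym G a c)) k < qf (qtensor (qide G b) (qsym G a c)) l"
  if "Suc 0 <= k" "k <= a + (b + c)" "Suc 0 <= l" "l <= a + (b + c)" for k l
  using that by (auto simp: qtensor_qf[of _ G] qtensor_qlt[of _ G])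
 show ?thesis
 proof (rule qarr_eqI[of _ G])
  fix k assume k: "1 <= k" "k <= qdom ?L"
  then have k': "Suc 0 <= k" "k <= a + (b + c)" by auto
  show "qf ?L k = qf ?R k" "gl ?L k = gl ?R k" "cl ?L k = cl ?R k"
   using k' by (auto simp: S f1 g1)
 next
  fix k l assume "1 <= k" "k <= qdom ?L" "Suc 0 <= l" "l <= qdom ?L" "k ~= l"
  then have kl: "Suc 0 <= k" "k <= a + (b + c)" "Suc 0 <= l" "l <= a + (b + c)" "k ~= l" by auto
  show "qlt ?L k l = qlt ?R k l"
   using kl by (auto simp: S f1 f2 g1 g2)
 qed simp_all
qed

lemma qsym_qsym: "qcomp G (qsym G b a) (qsym G a b) = qide G (a + b)"
 by (rule qarr_eqI[of _ G]) (auto simp: q_simps)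

lemma qide_qide: "qtensor (qide G a) (qide G b) = qide G (a + b)"
proof (rule qarr_eqI[of _ G])
 fix k assume "1 <= k" "k <= qdom (qtensor (qide G a) (qide G b))"
 then show "qf (qtensor (qide G a) (qide G b)) k = qf (qide G (a + b)) k"
  "gl (qtensor (qide G a) (qide G b)) k = gl (qide G (a + b)) k"
  "cl (qtensor (qide G a) (qide G b)) k = cl (qide G (a + b)) k"
  by (simp_all add: qtensor_qf[of _ G])
next
 fix k l assume "1 <= k" "k <= qdom (qtensor (qide G a) (qide G b))"
  "Suc 0 <= l" "l <= qdom (qtensor (qide G a) (qide G b))"
 then show "qlt (qtensor (qide G a) (qide G b)) k l = qlt (qide G (a + b)) k l"
  by (auto simp: qtensor_qlt[of _ G])
qed simp_all

lemma qcomp_qide: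
 assumes "f : QA G"
 shows "qcomp G f (qide G (qdom f)) = f" "qcomp G (qide G (qcod f)) f = f"
 by (rule qarr_eqI[of _ G]; use assms in "simp add: q_simps qf_less_iff")+

lemma qtensor_qide0:
 assumes "f : QA G"
 shows "qtensor (qide G 0) f = f" "qtensor f (qide G 0) = f"
 by (rule qarr_eqI[of _ G]; use assms in "simp add: qtensor_qf[of _ G] qtensor_qlt[of _ G]")+

sublocale Q: strict_prop "DHG G"
 by unfold_locales (auto simp: qcomp_assoc qcomp_qtensor qtensor_assoc qsym_natural qsym_hexagon
   qsym_qsym qide_qide qcomp_qide qtensor_qide0)

end

section \<open>Generators of \<open>Q\<close> and induction over them\<close>

definition qlab :: "'g => bool => 'g qarr" where
 "qlab x e = qiso 1 (LPerm (\<lambda>i \<in> {1..1}. x) (\<lambda>i \<in> {1..1}. e) id)"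

definition qmn :: "('g, 'z) monoid_scheme => nat => 'g qarr" where
 "qmn G n = qord G n 1 (\<lambda>k \<in> {1..n}. 1)"

definition QI :: "('g, 'z) monoid_scheme => 'g qarr set" where
 "QI G = {qiso n g | n g. g : lperms G n}"

lemma qlab_simps [simp]: "qdom (qlab x e) = 1" "qcod (qlab x e) = 1"
 "gl (qlab x e) (Suc 0) = x" "cl (qlab x e) (Suc 0) = e" "qf (qlab x e) (Suc 0) = 1"
 "qlt (qlab x e) k l <-> k < l"
 by (simp_all add: qlab_def qf_def qiso_def qlt_def)

lemma qmn_simps [simp]: "qdom (qmn G n) = n" "qcod (qmn G n) = 1"
 "Suc 0 <= k ==> k <= n ==> qf (qmn G n) k = 1"
 "Suc 0 <= k ==> k <= n ==> gl (qmn G n) k = \<one>\<^bsub>G\<^esub>"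
 "Suc 0 <= k ==> k <= n ==> ~ cl (qmn G n) k"
 "qlt (qmn G n) k l <-> k < l"
 by (simp_all add: qmn_def)

lemma const_ord_maps: "(\<lambda>k \<in> {1..n}. 1) : ord_maps n 1"
 by (auto simp: ord_maps_def mono_on_def)

lemma q_m_qmn: "q_m G = qmn G 2" and q_u_qmn: "q_u G = qmn G 0"
 by (simp_all add: q_m_def q_u_def qmn_def)

context group
begin

lemmas qs = qcomp_qf qcomp_gl qcomp_cl qcomp_qlt qtensor_qf[of _ G] qtensor_qlt[of _ G]
 qf_range[of _ G] qf_nz[of _ G] qf_nz[of _ G, THEN gr_implies_not0] gl_carrier[of _ G] qf_le_add[of _ G]

lemma qlab_QA [simp]: "x : carrier G ==> qlab x e : QA G"
 unfolding qlab_def qiso_QA by (auto simp: lperms_iff permutes_id[unfolded id_def] id_def)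

lemma qmn_QA [simp]: "qmn G n : QA G"
 using const_ord_maps by (simp add: qmn_def)

lemma ord_maps_one: "f : ord_maps n 1 ==> qord G n 1 f = qmn G n"
 unfolding qmn_def
 by (rule qarr_eqI[of _ G]) (use const_ord_maps ord_maps_range[of f n 1] in auto)

lemma ord_maps_zero: "f : ord_maps n 0 ==> n = 0 & qord G n 0 f = qide G 0"
proof -
 assume f: "f : ord_maps n 0"
 then have n: "n = 0" using ord_maps_range[of f n 0 1] by (cases n) auto
 have "qord G n 0 f = qide G 0"
  by (rule qarr_eqI[of _ G]) (use f n in auto)
 then show ?thesis using n by simp
qed

lemma qmn_1: "qmn G 1 = qide G 1"
 by (rule qarr_eqI[of _ G]) auto

lemma qmn_add: "qmn G (n + m) = qcomp G (q_m G) (qtensor (qmn G n) (qmn G m))"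
 unfolding q_m_qmn by (rule qarr_eqI[of _ G]) (auto simp: qs)

lemma qmn_Suc: "qmn G (Suc n) = qcomp G (q_m G) (qtensor (qmn G n) (qide G 1))"
 using qmn_add[of n 1] unfolding qmn_1 by simp

text \<open>The points that land in the first \<open>a\<close> values form an initial segment by
  monotonicity; its length \<open>n1\<close> is where the source is cut.\<close>

lemma qord_split:
 assumes f: "f : ord_maps n (a + b)"
 obtains n1 n2 f1 f2 where "n = n1 + n2" "f1 : ord_maps n1 a" "f2 : ord_maps n2 b"
  "qord G n (a + b) f = qtensor (qord G n1 a f1) (qord G n2 b f2)"
proof -
 define n1 where "n1 = card {k \<in> {1..n}. f k <= a}"
 have "n1 <= card {1..n}" unfolding n1_def by (rule card_mono) auto
 then have n1: "n1 <= n" by simp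
 define n2 where "n2 = n - n1"
 have n: "n = n1 + n2" using n1 by (simp add: n2_def)
 have iff: "f k <= a <-> k <= n1" if "k : {1..n}" for k
  unfolding n1_def by (rule ord_maps_le_iff[OF f that])
 have rng: "1 <= f k" "f k <= a + b" if "Suc 0 <= k" "k <= n" for k
  using ord_maps_range[OF f, of k] that by auto
 have mono: "f k <= f l" if "Suc 0 <= k" "k <= l" "l <= n" for k l
  using ord_maps_mono[OF f, of k l] that by auto
 define f1 f2 where "f1 = (\<lambda>k \<in> {1..n1}. f k)" and "f2 = (\<lambda>k \<in> {1..n2}. f (k + n1) - a)"
 have f1: "f1 : ord_maps n1 a"
  using iff rng mono n by (auto simp: f1_def ord_maps_def mono_on_def)
 have gt: "a < f (k + n1)" if "Suc 0 <= k" "k <= n2" for k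
  using iff[of "k + n1"] that n by auto
 have f2: "f2 : ord_maps n2 b"
  unfolding ord_maps_def mem_Collect_eq
 proof
  show "f2 : {1..n2} \<rightarrow>\<^sub>E {1..b}"
  proof
   fix k assume "k : {1..n2}"
   then show "f2 k : {1..b}" using gt[of k] rng[of "k + n1"] n by (auto simp: f2_def)
  qed (simp only: f2_def restrict_apply if_False)
  show "mono_on {1..n2} f2"
   using mono n by (intro mono_onI) (auto simp: f2_def intro!: diff_le_mono)
 qed
 have "qord G n (a + b) f = qtensor (qord G n1 a f1) (qord G n2 b f2)"
 proof (rule qarr_eqI[of _ G])
  fix k assume "1 <= k" "k <= qdom (qord G n (a + b) f)"
  then have k: "Suc 0 <= k" "k <= n1 + n2" using n by auto
  show "qf (qord G n (a + b) f) k = qf (qtensor (qord G n1 a f1) (qord G n2 b f2)) k"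
   using f1 f2 k gt[of "k - n1"] by (auto simp: qtensor_qf[of _ G] f1_def f2_def)
  show "gl (qord G n (a + b) f) k = gl (qtensor (qord G n1 a f1) (qord G n2 b f2)) k"
   "cl (qord G n (a + b) f) k = cl (qtensor (qord G n1 a f1) (qord G n2 b f2)) k"
   using k n by simp_all
 next
  fix k l assume "1 <= k" "k <= qdom (qord G n (a + b) f)" "Suc 0 <= l" "l <= qdom (qord G n (a + b) f)"
  then show "qlt (qord G n (a + b) f) k l = qlt (qtensor (qord G n1 a f1) (qord G n2 b f2)) k l"
   using f1 f2 n by (auto simp: qtensor_qlt[of _ G])
 qed (use f f1 f2 n in simp_all)
 then show ?thesis by (rule that[OF n f1 f2])
qed

text \<open>Splitting off the last point of the target, together with its fibre, presents an
  order-preserving map as a tensor product of iterated multiplications \<open>qmn\<close>.\<close>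

lemma qord_induct [consumes 1, case_names zero qmn tensor]:
 assumes "f : ord_maps n m" and "R (qide G 0)" and "!!n. R (qmn G n)"
  and tens: "!!n m f n'. f : ord_maps n m ==> R (qord G n m f) ==> R (qtensor (qord G n m f) (qmn G n'))"
 shows "R (qord G n m f)"
 using assms(1)
proof (induction m arbitrary: n f)
 case 0
 then show ?case using ord_maps_zero[of f n] assms(2) by metis
next
 case (Suc m)
 then have "f : ord_maps n (m + 1)" by simp
 then obtain n1 n2 f1 f2 where "n = n1 + n2" "f1 : ord_maps n1 m" "f2 : ord_maps n2 1"
  "qord G n (m + 1) f = qtensor (qord G n1 m f1) (qord G n2 1 f2)" by (rule qord_split)
 then show ?case using tens Suc.IH ord_maps_one[of f2 n2] by simp
qed

text \<open>Justifies reading the pair of an order-preserving map and a group element as a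
  composite.\<close>

lemma q_decomp: "a : QA G ==> a = qcomp G (qord G (qdom a) (qcod a) (qmap a)) (qiso (qdom a) (qgrp a))"
proof (rule qarr_eqI[of _ G])
 assume a: "a : QA G"
 have f: "qmap a : ord_maps (qdom a) (qcod a)" and g: "qgrp a : lperms G (qdom a)" using a by (auto simp: QA_iff)
 let ?o = "qord G (qdom a) (qcod a) (qmap a)" and ?i = "qiso (qdom a) (qgrp a)"
 have o: "?o : QA G" and i: "?i : QA G" using f g by (simp_all add: qiso_QA)
 show "a : QA G" "qcomp G ?o ?i : QA G" by (fact a, simp add: f g qiso_QA)
 have p: "Suc 0 <= perm (qgrp a) k" "perm (qgrp a) k <= qdom a" if "1 <= k" "k <= qdom a" for k
  using perm_le[OF a, of k] that by auto
 fix k assume k: "1 <= k" "k <= qdom a"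
 then show "qf a k = qf (qcomp G ?o ?i) k" "gl a k = gl (qcomp G ?o ?i) k" "cl a k = cl (qcomp G ?o ?i) k"
  using p[OF k] gl_carrier[OF a, of k] by (simp_all add: qs f g qiso_QA qiso_qf[OF g] qf_def[of a])
 fix l assume l: "Suc 0 <= l" "l <= qdom a" "k ~= l"
 then show "qlt a k l = qlt (qcomp G ?o ?i) k l"
  using p[OF k] k p[of l] perm_inj[OF a, of k l] by (simp add: qs f g qiso_QA qiso_qf[OF g] qlt_def[of a])
qed simp_all
text \<open>If \<open>qf a\<close> is injective, the order on strands is the order of their images
  by \<open>qf_less_iff\<close>, so \<open>qf a\<close> itself serves as the permutation and the
  order-preserving part is the identity.\<close>

lemma QI_iff: "a : QI G <-> a : QA G & qcod a = qdom a & inj_on (qf a) {1..qdom a}"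
proof
 assume "a : QI G"
 then obtain n g where a: "a = qiso n g" "g : lperms G n" by (auto simp: QI_def)
 then have "inj (perm g)" using permutes_inj[of "perm g" "{1..n}"] by (simp add: lperms_iff)
 moreover have "qf a k = perm g k" if "k : {1..n}" for k
  unfolding a(1) by (rule qiso_qf[OF a(2)]) (use that in auto)
 ultimately have "inj_on (qf a) {1..n}"
  by (metis inj_on_cong inj_on_subset subset_UNIV)
 then show "a : QA G & qcod a = qdom a & inj_on (qf a) {1..qdom a}"
  using a by (simp add: qiso_QA)
next
 assume a: "a : QA G & qcod a = qdom a & inj_on (qf a) {1..qdom a}"
 let ?n = "qdom a"
 define s where "s k = (if k : {1..?n} then qf a k else k)" for k
 have rng: "qf a ` {1..?n} \<subseteq> {1..?n}" using qf_range[of a G] a by auto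
 then have "qf a ` {1..?n} = {1..?n}" using a by (intro endo_inj_surj) auto
 then have "bij_betw (qf a) {1..?n} {1..?n}" using a by (simp add: bij_betw_def)
 then have "bij_betw s {1..?n} {1..?n}" by (rule bij_betw_cong[THEN iffD1, rotated]) (simp add: s_def)
 then have s: "s permutes {1..?n}" by (rule bij_imp_permutes) (unfold s_def, rule if_not_P)
 let ?g = "LPerm (gl a) (cl a) s"
 have "qgrp a : lperms G ?n" using a unfolding QA_iff by blast
 then have g: "?g : lperms G ?n" using s unfolding lperms_iff lperm.sel by blast
 have "a = qiso ?n ?g"
 proof (rule qarr_eqI[of _ G])
  fix k l assume kl: "1 <= k" "k <= ?n" "Suc 0 <= l" "l <= ?n" "k ~= l"
  have "qf a k ~= qf a l"
   using kl inj_onD[of "qf a" "{1..?n}" k l] a by auto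
  then show "qlt a k l = qlt (qiso ?n ?g) k l"
   using kl qf_less_iff[of a k l] conjunct1[OF a] by (simp add: s_def)
 next
  fix k assume "1 <= k" "k <= ?n"
  then show "qf a k = qf (qiso ?n ?g) k" using qiso_qf[OF g, of k] by (simp add: s_def)
 qed (use conjunct1[OF a] conjunct1[OF conjunct2[OF a]] g in "simp_all add: qiso_QA")
 then show "a : QI G" unfolding QI_def mem_Collect_eq using g by (intro exI conjI)
qed

lemma QI_QA: "a : QI G ==> a : QA G"
 by (simp add: QI_iff)

lemma QI_qcod: "a : QI G ==> qcod a = qdom a"
 by (simp add: QI_iff)

lemma qiso_QI [simp]: "g : lperms G n ==> qiso n g : QI G"
 by (auto simp: QI_def)

lemma qide_QI [simp]: "qide G n : QI G"
 by (auto simp: QI_iff inj_on_def)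

lemma qsym_QI [simp]: "qsym G n m : QI G"
 by (auto simp: QI_iff inj_on_def split: if_splits)

lemma qlab_QI [simp]: "x : carrier G ==> qlab x e : QI G"
 by (auto simp: QI_iff inj_on_def)

lemma qcomp_QI: "a : QI G ==> b : QI G ==> qdom b = qcod a ==> qcomp G b a : QI G"
 unfolding QI_iff
proof (intro conjI inj_onI; elim conjE)
 fix k l assume *: "a : QA G" "b : QA G" "qdom b = qcod a" "qcod a = qdom a" "inj_on (qf a) {1..qdom a}"
  "inj_on (qf b) {1..qdom b}"
  "k : {1..qdom (qcomp G b a)}" "l : {1..qdom (qcomp G b a)}" "qf (qcomp G b a) k = qf (qcomp G b a) l"
 then have kl: "k : {1..qdom a}" "l : {1..qdom a}" by simp_all
 then have "qf a k : {1..qdom b}" "qf a l : {1..qdom b}"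
  using qf_range[OF *(1), of k] qf_range[OF *(1), of l] *(3) by auto
 moreover have "qf b (qf a k) = qf b (qf a l)"
  using *(9) kl by (simp add: qcomp_qf[OF *(1-3)])
 ultimately have "qf a k = qf a l" by (rule inj_onD[OF *(6), rotated])
 then show "k = l" by (rule inj_onD[OF *(5) _ kl])
qed simp_all

lemma qtensor_QI: "a : QI G ==> b : QI G ==> qtensor a b : QI G"
 unfolding QI_iff
proof (intro conjI inj_onI; elim conjE)
 fix k l assume *: "a : QA G" "b : QA G" "qcod a = qdom a" "inj_on (qf a) {1..qdom a}" "inj_on (qf b) {1..qdom b}"
  "k : {1..qdom (qtensor a b)}" "l : {1..qdom (qtensor a b)}" "qf (qtensor a b) k = qf (qtensor a b) l"
 have ra: "qf a i <= qdom a" if "Suc 0 <= i" "i <= qdom a" for i using qf_range[of a G i] * that by simp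
 have rb: "0 < qf b (i - qdom a)" if "i <= qdom a + qdom b" "~ i <= qdom a" for i using qf_nz[of b G "i - qdom a"] * that by simp
 show "k = l"
  using * ra[of k] ra[of l] rb[of k] rb[of l] inj_onD[OF *(4), of k l] inj_onD[OF *(5), of "k - qdom a" "l - qdom a"]
  by (auto simp: qtensor_qf[of _ G] split: if_splits)
qed simp_all

text \<open>The same recursion as in \<open>pm\<close>, now with labels: the last strand, with its
  label, is added on the right and carried back to its place \<open>k\<close>.\<close>

lemma QI_split_last:
 assumes g: "g : lperms G (Suc n)"
 defines "k \<equiv> perm g (Suc n)"
 obtains g' where "g' : lperms G n"
  "qiso (Suc n) g = qcomp G (qtensor (qide G (k - 1)) (qsym G (Suc n - k) 1))
    (qtensor (qiso n g') (qlab (glabel g (Suc n)) (clabel g (Suc n))))"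
proof -
 let ?s = "perm g"
 have s: "?s permutes {1..Suc n}" using g by (simp add: lperms_iff)
 have k: "1 <= k" "k <= Suc n" using permutes_in_image[OF s, of "Suc n"] by (auto simp: k_def)
 define g' where "g' = LPerm (\<lambda>i \<in> {1..n}. glabel g i) (\<lambda>i \<in> {1..n}. clabel g i) (del k n \<circ> ?s)"
 have "del k n \<circ> ?s permutes {1..n}" unfolding k_def by (rule del_permutes[OF s])
 then have g': "g' : lperms G n" using g by (auto simp: g'_def lperms_iff)
 have x: "glabel g (Suc n) : carrier G" using g by (auto simp: lperms_iff)
 let ?x = "qlab (glabel g (Suc n)) (clabel g (Suc n))"
 let ?A = "qtensor (qide G (k - 1)) (qsym G (Suc n - k) 1)" and ?B = "qtensor (qiso n g') ?x"
 have QB: "?B : QA G" and QA: "?A : QA G" using g' x by (simp_all add: qiso_QA)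
 have dB: "qdom ?A = qcod ?B" using k by simp
 have sk: "?s i ~= k" "1 <= ?s i" "?s i <= Suc n" if "Suc 0 <= i" "i <= n" for i
  using permutes_in_image[OF s, of i] permutes_inj[OF s] that by (auto simp: k_def inj_eq)
 have fB: "qf ?B i = del k n (?s i)" if "Suc 0 <= i" "i <= Suc n" for i
 proof (cases "i = Suc n")
  case True
  then show ?thesis using g' x by (simp add: qs qiso_QA del_def flip: k_def)
 next
  case False
  then show ?thesis using that g' x qiso_qf[OF g', of i]
   by (simp add: qs qiso_QA) (simp add: g'_def)
 qed
 have fA: "qf ?A j = (if j < k then j else if j = Suc n then k else j + 1)" if "Suc 0 <= j" "j <= Suc n" for j
  using that k by (auto simp: qs)
 have lA: "gl ?A j = \<one>" "~ cl ?A j" if "Suc 0 <= j" "j <= Suc n" for j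
  using that k by auto
 have lB: "gl ?B i = glabel g i" "cl ?B i = clabel g i" if "Suc 0 <= i" "i <= Suc n" for i
  using that by (auto simp: g'_def le_Suc_eq)
 have f: "qf (qcomp G ?A ?B) i = ?s i" if "Suc 0 <= i" "i <= Suc n" for i
 proof -
  have r: "Suc 0 <= del k n (?s i)" "del k n (?s i) <= Suc n"
   using sk(2,3)[of i] that k by (cases "i = Suc n"; force simp: del_def k_def)+
  have "qf (qcomp G ?A ?B) i = qf ?A (qf ?B i)"
   by (rule qcomp_qf[OF QB QA dB]) (use that in simp_all)
  also have "... = ?s i"
   unfolding fB[OF that] fA[OF r] using that sk[of i] k
   by (cases "i = Suc n") (auto simp: del_def simp flip: k_def)
  finally show ?thesis .
 qed
 have C: "qcomp G ?A ?B : QI G"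
  using g' x k by (intro qcomp_QI qtensor_QI qide_QI qsym_QI qiso_QI qlab_QI) auto
 have "qiso (Suc n) g = qcomp G ?A ?B"
 proof (rule qarr_eqI[of _ G])
  fix i assume "1 <= i" "i <= qdom (qiso (Suc n) g)"
  then have i: "Suc 0 <= i" "i <= Suc n" by auto
  then have r: "Suc 0 <= qf ?B i" "qf ?B i <= Suc n" using qf_range[OF QB, of i] by auto
  have "glabel g i : carrier G" using g i by (auto simp: lperms_iff)
  moreover have "gl (qcomp G ?A ?B) i = gl ?A (qf ?B i) \<otimes> gl ?B i"
   by (rule qcomp_gl[OF QB QA dB]) (use i in simp_all)
  ultimately show "gl (qiso (Suc n) g) i = gl (qcomp G ?A ?B) i"
   unfolding lA(1)[OF r] lB(1)[OF i] by simp
  have "cl (qcomp G ?A ?B) i <-> cl ?A (qf ?B i) ~= cl ?B i"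
   by (rule qcomp_cl[OF QB QA dB]) (use i in simp_all)
  then show "cl (qiso (Suc n) g) i = cl (qcomp G ?A ?B) i"
   using lA(2)[OF r] unfolding lB(2)[OF i] by simp
  show "qf (qiso (Suc n) g) i = qf (qcomp G ?A ?B) i"
   using i qiso_qf[OF g, of i] f[OF i] by simp
 next
  fix i j assume "1 <= i" "i <= qdom (qiso (Suc n) g)" "Suc 0 <= j" "j <= qdom (qiso (Suc n) g)" "i ~= j"
  then have ij: "Suc 0 <= i" "i <= Suc n" "Suc 0 <= j" "j <= Suc n" "i ~= j" by auto
  have "?s i ~= ?s j" using ij permutes_inj[OF s] by (simp add: inj_eq)
  then show "qlt (qiso (Suc n) g) i j = qlt (qcomp G ?A ?B) i j"
   using qf_less_iff[of "qcomp G ?A ?B" i j] ij C f[of i] f[of j] by (simp add: QI_iff)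
 qed (use C g k in "simp_all add: qiso_QA QI_QA")
 then show ?thesis using that[OF g'] by blast
qed

text \<open>Labels on one strand and the transposition generate all isomorphisms:
  \<open>QI_split_last\<close> reduces to crossings with a single strand, and the hexagon reduces
  these to transpositions.\<close>

lemma QI_induct [consumes 1, case_names qide qsym qlab qcomp qtensor]:
 assumes a: "a : QI G"
  and qide: "!!n. R (qide G n)" and qsym: "R (qsym G 1 1)"
  and qlab: "!!x e. x : carrier G ==> R (qlab x e)"
  and qcomp: "!!a b. a : QI G ==> b : QI G ==> qdom b = qcod a ==> R a ==> R b ==> R (qcomp G b a)"
  and qtensor: "!!a b. a : QI G ==> b : QI G ==> R a ==> R b ==> R (qtensor a b)"
 shows "R a"
proof -
 have sym: "R (qsym G d 1)" for d
 proof (induction d)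
  case 0
  then show ?case using Q.Sym_unit_left[of 1] qide[of 1] by simp
 next
  case (Suc d)
  have "qsym G (Suc d) 1 = qcomp G (qtensor (qsym G d 1) (qide G 1)) (qtensor (qide G d) (qsym G 1 1))"
   using Q.hexagon'[of d 1 1] by simp
  then show ?case using Suc qide qsym by (auto intro!: qcomp qtensor qtensor_QI)
 qed
 have "g : lperms G n ==> R (qiso n g)" for n g
 proof (induction n arbitrary: g)
  case 0
  have "qiso 0 g = qide G 0" by (rule qarr_eqI[of _ G]) (use 0 in "simp_all add: qiso_QA")
  then show ?case using qide by simp
 next
  case (Suc n)
  let ?k = "perm g (Suc n)"
  have s: "perm g permutes {1..Suc n}" using Suc.prems by (simp add: lperms_iff)
  have k: "1 <= ?k" "?k <= Suc n" using permutes_in_image[OF s, of "Suc n"] by auto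
  have x: "glabel g (Suc n) : carrier G" using Suc.prems by (auto simp: lperms_iff)
  obtain g' where g': "g' : lperms G n" and
   eq: "qiso (Suc n) g = qcomp G (qtensor (qide G (?k - 1)) (qsym G (Suc n - ?k) 1))
    (qtensor (qiso n g') (qlab (glabel g (Suc n)) (clabel g (Suc n))))"
   by (rule QI_split_last[OF Suc.prems])
  show ?case
   unfolding eq using k x g' Suc.IH sym qlab qide
   by (intro qcomp qtensor qtensor_QI qide_QI qsym_QI qiso_QI qlab_QI) auto
 qed
 then show ?thesis using a by (auto simp: QI_def)
qed

text \<open>By \<open>q_decomp\<close> and \<open>qord_induct\<close> every arrow is built from
  isomorphisms and the maps \<open>qmn\<close>, and the latter are iterates of \<open>q_m\<close>
  starting from \<open>q_u\<close>.\<close>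

lemma QA_induct [consumes 1, case_names qide qsym qlab q_m q_u qcomp qtensor]:
 assumes a: "a : QA G"
  and qide: "!!n. R (qide G n)" and qsym: "R (qsym G 1 1)"
  and qlab: "!!x e. x : carrier G ==> R (qlab x e)"
  and q_m: "R (q_m G)" and q_u: "R (q_u G)"
  and qcomp: "!!a b. a : QA G ==> b : QA G ==> qdom b = qcod a ==> R a ==> R b ==> R (qcomp G b a)"
  and qtensor: "!!a b. a : QA G ==> b : QA G ==> R a ==> R b ==> R (qtensor a b)"
 shows "R a"
proof -
 have iso: "R b" if "b : QI G" for b
  using that by (induction rule: QI_induct) (use qsym in "auto intro: qide qlab qcomp qtensor QI_QA")
 have qmn: "R (qmn G n)" for n
 proof (induction n)
  case 0
  then show ?case using q_u by (simp add: q_u_qmn)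
 next
  case (Suc n)
  then show ?case
   unfolding qmn_Suc using q_m qide by (intro qcomp qtensor) (auto simp: q_m_qmn)
 qed
 have ord: "R (qord G n m f)" if "f : ord_maps n m" for n m f
  using that by (induction rule: qord_induct) (auto intro: qmn qide qtensor)
 have f: "qmap a : ord_maps (qdom a) (qcod a)" and g: "qgrp a : lperms G (qdom a)" using a by (auto simp: QA_iff)
 have "R (qcomp G (qord G (qdom a) (qcod a) (qmap a)) (qiso (qdom a) (qgrp a)))"
  using f g by (intro qcomp ord iso) (auto simp: qiso_QA)
 then show ?thesis using q_decomp[OF a] by simp
qed

lemma qlab_one: "qlab \<one> False = qide G 1"
 by (rule qarr_eqI[of _ G]) auto

lemma qlab_qlab: "x : carrier G ==> y : carrier G ==> qcomp G (qlab y d) (qlab x e) = qlab (y \<otimes> x) (d ~= e)"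
 by (rule qarr_eqI[of _ G]) (auto simp: qs)

lemma qlab_q_u: "x : carrier G ==> qcomp G (qlab x e) (q_u G) = q_u G"
 unfolding q_u_qmn by (rule qarr_eqI[of _ G]) (auto simp: qs)

lemma le_2_iff: "k <= 2 <-> k = 0 \<or> k = Suc 0 \<or> k = (2 :: nat)"
 by auto

lemma qlab_q_m: "x : carrier G ==> qcomp G (qlab x False) (q_m G) =
  qcomp G (q_m G) (qtensor (qlab x False) (qlab x False))"
 unfolding q_m_qmn by (rule qarr_eqI[of _ G]) (auto simp: qs le_2_iff)

lemma qlab_q_m': "x : carrier G ==> qcomp G (qlab x True) (q_m G) =
  qcomp G (qcomp G (q_m G) (qsym G 1 1)) (qtensor (qlab x True) (qlab x True))"
 unfolding q_m_qmn by (rule qarr_eqI[of _ G]) (auto simp: qs le_2_iff)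

text \<open>Both sides are the threefold multiplication \<open>qmn G 3\<close>.\<close>

lemma q_m_assoc: "qcomp G (q_m G) (qtensor (q_m G) (qide G 1)) = qcomp G (q_m G) (qtensor (qide G 1) (q_m G))"
 using qmn_add[of 2 1] qmn_add[of 1 2] unfolding qmn_1 q_m_qmn by (metis add.commute)

lemma q_m_unit: "qcomp G (q_m G) (qtensor (q_u G) (qide G 1)) = qide G 1"
  "qcomp G (q_m G) (qtensor (qide G 1) (q_u G)) = qide G 1"
 using qmn_add[of 0 1] qmn_add[of 1 0] unfolding qmn_1 q_u_qmn add_0_left add_0_right by simp_all

lemma lp_mult_lperms:
 assumes g: "g : lperms G n" and h: "h : lperms G n"
 shows "lp_mult G n g h : lperms G n" and "qcomp G (qiso n g) (qiso n h) = qiso n (lp_mult G n g h)"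
proof -
 have hp: "perm h permutes {1..n}" and gp: "perm g permutes {1..n}" using g h by (auto simp: lperms_iff)
 have r: "Suc 0 <= perm h k" "perm h k <= n" if "Suc 0 <= k" "k <= n" for k
  using permutes_in_image[OF hp, of k] that by auto
 have gc: "glabel g k : carrier G" "glabel h k : carrier G" if "Suc 0 <= k" "k <= n" for k
  using g h that by (auto simp: lperms_iff)
 show m: "lp_mult G n g h : lperms G n"
  using r gc permutes_compose[OF hp gp] by (auto simp: lperms_iff lp_mult_def)
 show "qcomp G (qiso n g) (qiso n h) = qiso n (lp_mult G n g h)"
 proof (rule qarr_eqI[of _ G])
  fix k assume "1 <= k" "k <= qdom (qcomp G (qiso n g) (qiso n h))"
  then have k: "Suc 0 <= k" "k <= n" by auto
  show "qf (qcomp G (qiso n g) (qiso n h)) k = qf (qiso n (lp_mult G n g h)) k"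
   "gl (qcomp G (qiso n g) (qiso n h)) k = gl (qiso n (lp_mult G n g h)) k"
   "cl (qcomp G (qiso n g) (qiso n h)) k = cl (qiso n (lp_mult G n g h)) k"
   using k r[OF k] g h
   by (simp_all add: qcomp_qf qcomp_gl qcomp_cl qiso_QA qiso_qf[OF g] qiso_qf[OF h] qiso_qf[OF m])
    (simp_all add: lp_mult_def)
 next
  fix k l assume "1 <= k" "k <= qdom (qcomp G (qiso n g) (qiso n h))"
   "Suc 0 <= l" "l <= qdom (qcomp G (qiso n g) (qiso n h))" "k ~= l"
  then have k: "Suc 0 <= k" "k <= n" "Suc 0 <= l" "l <= n" "perm h k ~= perm h l"
   using permutes_inj[OF hp] by (auto simp: inj_eq)
  show "qlt (qcomp G (qiso n g) (qiso n h)) k l = qlt (qiso n (lp_mult G n g h)) k l"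
   using k g h by (simp add: qcomp_qlt qiso_QA qiso_qf[OF h]) (simp add: lp_mult_def)
 qed (use g h m in "simp_all add: qiso_QA")
qed

end

section \<open>Monoids with labels in a strict PROP\<close>

text \<open>An involutive monoid with an action of \<open>G\<close> by automorphisms, stated in the
  form in which labels occur in \<open>Q\<close>: one action of the product of \<open>G\<close> with
  the group of order two, whose second component decides between homomorphisms and
  anti-homomorphisms of \<open>mu\<close>. The test \<open>d ~= e\<close> is multiplication in the
  group of order two.\<close>

locale labelled_monoid = strict_prop P + group G
 for P :: "(nat, 'p, 'z) smc_scheme" (structure) and G :: "('g, 'w) monoid_scheme" (structure) +
 fixes mu eta :: 'p and lab :: "'g => bool => 'p"
 assumes lab_Arr: "x : carrier G ==> lab x e : Arr P & Dom P (lab x e) = 1 & Cod P (lab x e) = 1"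
  and mu_Arr: "mu : Arr P & Dom P mu = 2 & Cod P mu = 1"
  and eta_Arr: "eta : Arr P & Dom P eta = 0 & Cod P eta = 1"
  and lab_one: "lab \<one>\<^bsub>G\<^esub> False = Ide P 1"
  and lab_lab: "x : carrier G ==> y : carrier G ==> lab y d \<cdot> lab x e = lab (y \<otimes>\<^bsub>G\<^esub> x) (d ~= e)"
  and mu_assoc: "mu \<cdot> (mu \<boxtimes> Ide P 1) = mu \<cdot> (Ide P 1 \<boxtimes> mu)"
  and mu_eta_left: "mu \<cdot> (eta \<boxtimes> Ide P 1) = Ide P 1"
  and mu_eta_right: "mu \<cdot> (Ide P 1 \<boxtimes> eta) = Ide P 1"
  and lab_eta: "x : carrier G ==> lab x e \<cdot> eta = eta"
  and lab_mu: "x : carrier G ==> lab x False \<cdot> mu = mu \<cdot> (lab x False \<boxtimes> lab x False)"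
  and lab_mu': "x : carrier G ==> lab x True \<cdot> mu = mu \<cdot> Sym P 1 1 \<cdot> (lab x True \<boxtimes> lab x True)"
begin

lemma arr [simp]: "mu : Arr P" "Dom P mu = 2" "Cod P mu = Suc 0" "eta : Arr P" "Dom P eta = 0" "Cod P eta = Suc 0"
 "x : carrier G ==> lab x e : Arr P" "x : carrier G ==> Dom P (lab x e) = Suc 0"
 "x : carrier G ==> Cod P (lab x e) = Suc 0"
 using mu_Arr eta_Arr lab_Arr by auto

primrec mk :: "nat => 'p" where
 "mk 0 = eta"
| "mk (Suc k) = mu \<cdot> (mk k \<boxtimes> Ide P 1)"

lemma mk_Arr [simp]: "mk k : Arr P" "Dom P (mk k) = k" "Cod P (mk k) = Suc 0"
 by (induction k) auto

lemma mk_1: "mk (Suc 0) = Ide P 1"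
 using mu_eta_left by simp

lemma mk_2: "mk 2 = mu"
 unfolding numeral_2_eq_2 mk.simps(2)[of "Suc 0"] mk_1 by simp

lemma mk_add: "mu \<cdot> (mk k \<boxtimes> mk j) = mk (k + j)"
proof (induction j)
 case 0
 have "mu \<cdot> (mk k \<boxtimes> eta) = mu \<cdot> ((Ide P 1 \<boxtimes> eta) \<cdot> (mk k \<boxtimes> Ide P 0))"
  by (subst TArr_Ide_left) auto
 also have "... = (mu \<cdot> (Ide P 1 \<boxtimes> eta)) \<cdot> (mk k \<boxtimes> Ide P 0)"
  by (rule Comp_assoc[symmetric]) auto
 finally show ?case by (simp only: mu_eta_right) simp
next
 case (Suc j)
 have "mu \<cdot> (mk k \<boxtimes> mk (Suc j)) = mu \<cdot> ((Ide P 1 \<boxtimes> mu) \<cdot> (mk k \<boxtimes> (mk j \<boxtimes> Ide P 1)))"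
  by (simp add: TArr_Comp)
 also have "... = (mu \<cdot> (mu \<boxtimes> Ide P 1)) \<cdot> ((mk k \<boxtimes> mk j) \<boxtimes> Ide P 1)"
  unfolding mu_assoc by (simp add: Comp_assoc TArr_assoc)
 also have "... = mu \<cdot> ((mu \<cdot> (mk k \<boxtimes> mk j)) \<boxtimes> Ide P 1)"
  by (simp add: Comp_assoc TArr_Comp)
 finally show ?case by (simp only: Suc) simp
qed

text \<open>This is composition of order-preserving maps over a single point, where fibre sizes add
  up.\<close>

lemma mk_bt: "mk k \<cdot> bt P (%j. mk (c j)) k = mk (\<Sum>j = 1..k. c j)"
proof (induction k)
 case (Suc k)
 have "mk (Suc k) \<cdot> bt P (%j. mk (c j)) (Suc k) =
   mu \<cdot> ((mk k \<boxtimes> Ide P 1) \<cdot> (bt P (%j. mk (c j)) k \<boxtimes> mk (c (Suc k))))"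
  by (simp add: Comp_assoc)
 also have "... = mu \<cdot> ((mk k \<cdot> bt P (%j. mk (c j)) k) \<boxtimes> mk (c (Suc k)))"
  by (simp add: TArr_Comp)
 finally show ?case by (simp only: Suc mk_add) simp
qed simp

text \<open>The arrow \<open>rv n x e\<close> puts the label \<open>(x, e)\<close> on each of \<open>n\<close> strands and reverses their order
 if \<open>e\<close> is non-trivial.\<close>

primrec rv :: "nat => 'g => bool => 'p" where
 "rv 0 x e = Ide P 0"
| "rv (Suc n) x e = (if e then Sym P n 1 \<cdot> (rv n x e \<boxtimes> lab x e) else rv n x e \<boxtimes> lab x e)"

lemma rv_Arr [simp]: "x : carrier G ==> rv n x e : Arr P & Dom P (rv n x e) = n & Cod P (rv n x e) = n"
 by (induction n) auto

text \<open>Iterates \<open>lab_mu\<close> and \<open>lab_mu'\<close>: at each step a non-trivial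
  \<open>e\<close> contributes one crossing, and the crossings add up to the reversal in
  \<open>rv\<close>.\<close>

lemma lab_mk: "x : carrier G ==> lab x e \<cdot> mk n = mk n \<cdot> rv n x e"
proof (induction n)
 case 0
 then show ?case using lab_eta by simp
next
 case (Suc n)
 note x = Suc.prems and IH = Suc.IH[OF Suc.prems]
 have "lab x e \<cdot> mk (Suc n) = (lab x e \<cdot> mu) \<cdot> (mk n \<boxtimes> Ide P 1)"
  using x by (simp add: Comp_assoc)
 also have "... = mk (Suc n) \<cdot> rv (Suc n) x e"
 proof (cases e)
  case False
  have "(lab x e \<cdot> mu) \<cdot> (mk n \<boxtimes> Ide P 1) = mu \<cdot> ((lab x e \<cdot> mk n) \<boxtimes> lab x e)"
   using x False lab_mu[OF x] by (simp add: Comp_assoc TArr_Comp)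
  also have "... = mu \<cdot> ((mk n \<boxtimes> Ide P 1) \<cdot> (rv n x e \<boxtimes> lab x e))"
   unfolding IH using x by (simp add: TArr_Comp)
  also have "... = mk (Suc n) \<cdot> rv (Suc n) x e"
   using x False by (simp add: Comp_assoc)
  finally show ?thesis .
 next
  case True
  have "(lab x e \<cdot> mu) \<cdot> (mk n \<boxtimes> Ide P 1) = mu \<cdot> (Sym P 1 1 \<cdot> ((lab x e \<cdot> mk n) \<boxtimes> lab x e))"
   using x True lab_mu'[OF x] by (simp add: Comp_assoc TArr_Comp)
  also have "(lab x e \<cdot> mk n) \<boxtimes> lab x e = (mk n \<boxtimes> Ide P 1) \<cdot> (rv n x e \<boxtimes> lab x e)"
   unfolding IH using x by (simp add: TArr_Comp)
  also have "mu \<cdot> (Sym P 1 1 \<cdot> ((mk n \<boxtimes> Ide P 1) \<cdot> (rv n x e \<boxtimes> lab x e)))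
    = mu \<cdot> ((Sym P 1 1 \<cdot> (mk n \<boxtimes> Ide P 1)) \<cdot> (rv n x e \<boxtimes> lab x e))"
   using x by (simp add: Comp_assoc)
  also have "Sym P 1 1 \<cdot> (mk n \<boxtimes> Ide P 1) = (Ide P 1 \<boxtimes> mk n) \<cdot> Sym P n 1"
   by (subst Sym_natural') auto
  also have "mu \<cdot> ((Ide P 1 \<boxtimes> mk n) \<cdot> Sym P n 1 \<cdot> (rv n x e \<boxtimes> lab x e))
    = (mu \<cdot> (Ide P 1 \<boxtimes> mk n)) \<cdot> (Sym P n 1 \<cdot> (rv n x e \<boxtimes> lab x e))"
   using x by (simp add: Comp_assoc)
  also have "mu \<cdot> (Ide P 1 \<boxtimes> mk n) = mk (Suc n)"
   using mk_add[of 1 n] unfolding One_nat_def mk_1 by (simp only: One_nat_def plus_nat.add_Suc add_0_left)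
  also have "mk (Suc n) \<cdot> (Sym P n 1 \<cdot> (rv n x e \<boxtimes> lab x e)) = mk (Suc n) \<cdot> rv (Suc n) x e"
   using True by simp
  finally show ?thesis .
 qed
 finally show ?case .
qed

section \<open>Normal forms in a strict PROP and their multiplicativity\<close>

definition fc :: "nat => (nat => nat) => nat => nat" where
 "fc n f j = card {k \<in> {1..n}. f k = j}"

definition lb :: "'g lperm => nat => 'p" where
 "lb g k = lab (glabel g k) (clabel g k)"

definition NF :: "'g qarr => 'p" where
 "NF a = bt P (%j. mk (fc (qdom a) (qmap a) j)) (qcod a) \<cdot>
   (pm P (qdom a) (perm (qgrp a)) \<cdot> bt P (lb (qgrp a)) (qdom a))"

lemma sum_fc: "f : ord_maps n m ==> (\<Sum>j = 1..m. fc n f j) = n"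
proof -
 assume f: "f : ord_maps n m"
 have "(\<Union>j \<in> {1..m}. {k \<in> {1..n}. f k = j}) = {1..n}" using ord_maps_range[OF f] by blast
 then have "n = card (\<Union>j \<in> {1..m}. {k \<in> {1..n}. f k = j})" by simp
 also have "... = (\<Sum>j = 1..m. fc n f j)" unfolding fc_def by (rule card_UN_disjoint) auto
 finally show ?thesis by simp
qed

lemma lb_Arr: "g : lperms G n ==> 1 <= k ==> k <= n ==> lb g k : Arr P & Dom P (lb g k) = 1 & Cod P (lb g k) = 1"
 unfolding lb_def by (rule lab_Arr) (auto simp: lperms_iff)

lemma bt_lb:
 assumes "g : lperms G n"
 shows "bt P (lb g) n : Arr P & Dom P (bt P (lb g) n) = n & Cod P (bt P (lb g) n) = n"
 using lb_Arr[OF assms] by simp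

lemma bt_mk:
 assumes "f : ord_maps n m"
 shows "bt P (%j. mk (fc n f j)) m : Arr P & Dom P (bt P (%j. mk (fc n f j)) m) = n
  & Cod P (bt P (%j. mk (fc n f j)) m) = m"
 using sum_fc[OF assms] by simp

definition NI :: "nat => 'g lperm => 'p" where
 "NI n g = pm P n (perm g) \<cdot> bt P (lb g) n"

lemma NI_Arr: "g : lperms G n ==> NI n g : Arr P & Dom P (NI n g) = n & Cod P (NI n g) = n"
 using bt_lb[of g n] by (simp add: NI_def lperms_iff)

lemma NF_Arr:
 assumes "a : QA G"
 shows "NF a : Arr P & Dom P (NF a) = qdom a & Cod P (NF a) = qcod a"
 using bt_mk[of "qmap a" "qdom a" "qcod a"] NI_Arr[of "qgrp a" "qdom a"] assms
 unfolding QA_iff NF_def NI_def[symmetric] by simp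

lemma lp_one_lb: "1 <= k ==> k <= n ==> lb (lp_one G n) k = Ide P 1"
 using lab_one by (simp add: lb_def lp_one_def)

lemma NI_one: "NI n (lp_one G n) = Ide P n"
proof -
 have "bt P (lb (lp_one G n)) n = Ide P n" by (rule bt_Ide) (rule lp_one_lb)
 moreover have "pm P n (perm (lp_one G n)) = Ide P n" by (simp add: lp_one_def pm_id)
 ultimately show ?thesis unfolding NI_def by simp
qed

lemma NF_qord: "f : ord_maps n m ==> NF (qord G n m f) = bt P (%j. mk (fc n f j)) m"
 using bt_mk[of f n m] NI_one[of n] unfolding NF_def NI_def by (simp add: qord_def)

lemma NF_qiso: "g : lperms G n ==> NF (qiso n g) = NI n g"
proof -
 assume g: "g : lperms G n"
 have "{k \<in> {1..n}. (\<lambda>k \<in> {1..n}. k) k = j} = {j}" if "1 <= j" "j <= n" for j using that by auto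
 then have "mk (fc n (\<lambda>k \<in> {1..n}. k) j) = Ide P 1" if "1 <= j" "j <= n" for j
  unfolding fc_def using that mk_1 by simp
 then have "bt P (%j. mk (fc n (\<lambda>k \<in> {1..n}. k) j)) n = Ide P n" by (rule bt_Ide)
 then show ?thesis using NI_Arr[OF g] by (simp add: NF_def qiso_def flip: NI_def)
qed

lemma NF_qide: "NF (qide G n) = Ide P n"
 unfolding qide_def by (simp add: NF_qiso NI_one)

lemma NF_decomp:
 assumes "f : ord_maps n m" "g : lperms G n"
 shows "NF (qcomp G (qord G n m f) (qiso n g)) = NF (qord G n m f) \<cdot> NF (qiso n g)"
proof -
 have "QArr n m f g : QA G" using assms by (simp add: QA_iff)
 from q_decomp[OF this] have eq: "qcomp G (qord G n m f) (qiso n g) = QArr n m f g" by simp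
 show ?thesis
  unfolding eq NF_qord[OF assms(1)] NF_qiso[OF assms(2)] by (simp add: NF_def NI_def)
qed

text \<open>Multiplication in the semidirect product: the labels of \<open>b\<close> slide back
  along the permutation of \<open>a\<close> by \<open>pm_bt\<close> and meet the labels of
  \<open>a\<close> strand by strand in \<open>lab_lab\<close>.\<close>

lemma NF_QI_qcomp:
 assumes a: "a : QI G" and b: "b : QI G" and d: "qdom b = qcod a"
 shows "NF (qcomp G b a) = NF b \<cdot> NF a"
proof -
 obtain n g h where n: "b = qiso n g" "a = qiso n h" and g: "g : lperms G n" and h: "h : lperms G n"
  using a b d by (auto simp: QI_def)
 have hp: "perm h permutes {1..n}" and gp: "perm g permutes {1..n}" using g h by (auto simp: lperms_iff)
 have r: "Suc 0 <= perm h k" "perm h k <= n" if "Suc 0 <= k" "k <= n" for k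
  using permutes_in_image[OF hp, of k] that by auto
 note m = lp_mult_lperms[OF g h]
 have lbm: "lb (lp_mult G n g h) k = (lb g \<circ> perm h) k \<cdot> lb h k" if k: "1 <= k" "k <= n" for k
  using g h r[of k] k unfolding lb_def o_apply
  by (subst lab_lab) (auto simp: lperms_iff lp_mult_def)
 have lbh: "(lb g \<circ> perm h) k : Arr P & Dom P ((lb g \<circ> perm h) k) = 1 & Cod P ((lb g \<circ> perm h) k) = 1"
  if "1 <= k" "k <= n" for k
  using lb_Arr[OF g, of "perm h k"] r[of k] that by simp
 have bh: "bt P (lb g \<circ> perm h) n : Arr P & Dom P (bt P (lb g \<circ> perm h) n) = n & Cod P (bt P (lb g \<circ> perm h) n) = n"
  using lbh by simp
 have "bt P (lb (lp_mult G n g h)) n = bt P (%k. (lb g \<circ> perm h) k \<cdot> lb h k) n"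
  by (rule bt_cong) (rule lbm)
 also have "... = bt P (lb g \<circ> perm h) n \<cdot> bt P (lb h) n"
  by (rule bt_Comp[symmetric]) (use lbh lb_Arr[OF h] in auto)
 finally have 1: "bt P (lb (lp_mult G n g h)) n = bt P (lb g \<circ> perm h) n \<cdot> bt P (lb h) n" .
 have 2: "pm P n (perm (lp_mult G n g h)) = pm P n (perm g) \<cdot> pm P n (perm h)"
  unfolding lp_mult_def lperm.sel by (rule pm_Comp[OF gp hp])
 have "NI n (lp_mult G n g h) = pm P n (perm g) \<cdot> (pm P n (perm h) \<cdot> bt P (lb g \<circ> perm h) n) \<cdot> bt P (lb h) n"
  unfolding NI_def 1 2 using gp hp bh bt_lb[OF h] by (simp add: Comp_assoc)
 also have "pm P n (perm h) \<cdot> bt P (lb g \<circ> perm h) n = bt P (lb g) n \<cdot> pm P n (perm h)"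
  by (rule pm_bt[symmetric, OF hp lb_Arr[OF g]])
 also have "pm P n (perm g) \<cdot> (bt P (lb g) n \<cdot> pm P n (perm h)) \<cdot> bt P (lb h) n = NI n g \<cdot> NI n h"
  unfolding NI_def using gp hp bt_lb[OF g] bt_lb[OF h] by (simp add: Comp_assoc)
 finally show ?thesis unfolding n m(2) using g h m(1) by (simp add: NF_qiso)
qed

lemma NF_qtensor:
 assumes a: "a : QA G" and b: "b : QA G"
 shows "NF (qtensor a b) = NF a \<boxtimes> NF b"
proof -
 let ?n = "qdom a" and ?m = "qcod a" and ?c = "qtensor a b"
 have fa: "qmap a : ord_maps ?n ?m" and fb: "qmap b : ord_maps (qdom b) (qcod b)"
  and ga: "qgrp a : lperms G ?n" and gb: "qgrp b : lperms G (qdom b)"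
  using a b by (auto simp: QA_iff)
 have pa: "perm (qgrp a) permutes {1..?n}" and pb: "perm (qgrp b) permutes {1..qdom b}"
  using ga gb by (auto simp: lperms_iff)
 have ra: "1 <= qmap a k" "qmap a k <= ?m" if "k : {1..?n}" for k
  using ord_maps_range[OF fa that] by auto
 have rb: "1 <= qmap b k" "qmap b k <= qcod b" if "k : {1..qdom b}" for k
  using ord_maps_range[OF fb that] by auto
 have c1: "fc (?n + qdom b) (qmap ?c) j = fc ?n (qmap a) j" if "1 <= j" "j <= ?m" for j
 proof -
  have "{k \<in> {1..?n + qdom b}. qmap ?c k = j} = {k \<in> {1..?n}. qmap a k = j}"
  proof (rule Set.set_eqI)
   fix k
   show "k : {k \<in> {1..?n + qdom b}. qmap ?c k = j} <-> k : {k \<in> {1..?n}. qmap a k = j}"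
    using rb[of "k - ?n"] that by (cases "k <= ?n") (auto simp: qtensor_def Let_def)
  qed
  then show ?thesis by (simp add: fc_def)
 qed
 have c2: "fc (?n + qdom b) (qmap ?c) (?m + j) = fc (qdom b) (qmap b) j" if "1 <= j" "j <= qcod b" for j
 proof -
  have "{k \<in> {1..?n + qdom b}. qmap ?c k = ?m + j} = (%k. k + ?n) ` {k \<in> {1..qdom b}. qmap b k = j}"
  proof (intro Set.set_eqI iffI)
   fix k assume k: "k : {k \<in> {1..?n + qdom b}. qmap ?c k = ?m + j}"
   have "~ k <= ?n"
   proof
    assume "k <= ?n"
    then show False using k ra[of k] that by (auto simp: qtensor_def Let_def)
   qed
   moreover have "qmap b (k - ?n) = j" using k calculation by (auto simp: qtensor_def Let_def)
   ultimately show "k : (%k. k + ?n) ` {k \<in> {1..qdom b}. qmap b k = j}"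
    using k by (intro image_eqI[of _ _ "k - ?n"]) auto
  next
   fix k assume "k : (%k. k + ?n) ` {k \<in> {1..qdom b}. qmap b k = j}"
   then show "k : {k \<in> {1..?n + qdom b}. qmap ?c k = ?m + j}"
    by (auto simp: qtensor_def Let_def)
  qed
  then show ?thesis by (simp add: fc_def card_image)
 qed
 have M: "bt P (%j. mk (fc (qdom ?c) (qmap ?c) j)) (qcod ?c) =
   bt P (%j. mk (fc ?n (qmap a) j)) ?m \<boxtimes> bt P (%j. mk (fc (qdom b) (qmap b) j)) (qcod b)"
  unfolding qdc by (subst bt_add) (auto intro!: arg_cong2[of _ _ _ _ "TArr P"] bt_cong simp: c1 c2)
 have Pm: "pm P (qdom ?c) (perm (qgrp ?c)) = pm P ?n (perm (qgrp a)) \<boxtimes> pm P (qdom b) (perm (qgrp b))"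
  unfolding qdc qtensor_perm by (rule pm_TArr[OF pa pb])
 have gc: "qgrp ?c : lperms G (?n + qdom b)" using qtensor_QA[OF a b] by (simp add: QA_iff)
 have L: "bt P (lb (qgrp ?c)) (qdom ?c) = bt P (lb (qgrp a)) ?n \<boxtimes> bt P (lb (qgrp b)) (qdom b)"
  unfolding qdc using lb_Arr[OF gc]
  by (subst bt_add) (auto intro!: arg_cong2[of _ _ _ _ "TArr P"] bt_cong simp: lb_def)
 show ?thesis
  unfolding NF_def M Pm L using bt_mk[OF fa] bt_mk[OF fb] pa pb bt_lb[OF ga] bt_lb[OF gb]
  by (simp add: TArr_Comp)
qed

text \<open>The recursion of \<open>pm\<close> at a block permutation is the hexagon with one strand
  split off.\<close>

lemma pm_block_perm: "pm P (a + b) (block_perm a b) = Sym P a b"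
proof (induction b)
 case 0
 have "block_perm a 0 = id" by (auto simp: block_perm_def fun_eq_iff)
 then show ?case by (simp only: pm_id Sym_unit_right add_0_right)
next
 case (Suc b)
 have 1: "block_perm a (Suc b) (Suc (a + b)) = Suc b" by (simp add: block_perm_def)
 have 2: "del (Suc b) (a + b) \<circ> block_perm a (Suc b) = block_perm a b"
  by (auto simp: del_def block_perm_def fun_eq_iff)
 have "pm P (a + Suc b) (block_perm a (Suc b)) = (Ide P b \<boxtimes> Sym P a 1) \<cdot> (Sym P a b \<boxtimes> Ide P 1)"
  unfolding add_Suc_right pm.simps(2) 1 2 Suc by simp
 then show ?case using hexagon[of a b 1] by simp
qed

lemma NF_qsym: "NF (qsym G a b) = Sym P a b"
proof -
 let ?g = "LPerm (glabel (lp_one G (a + b))) (clabel (lp_one G (a + b))) (block_perm a b)"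
 have g: "?g : lperms G (a + b)" using qsym_QA[of a b] unfolding qsym_def qiso_QA .
 have "bt P (lb ?g) (a + b) = Ide P (a + b)"
  by (rule bt_Ide) (use lp_one_lb[of _ "a + b"] in "simp add: lb_def")
 then have "NI (a + b) ?g = Sym P a b" unfolding NI_def by (simp add: pm_block_perm)
 then show ?thesis unfolding qsym_def NF_qiso[OF g] .
qed

lemma NF_qlab: "x : carrier G ==> NF (qlab x e) = lab x e"
proof -
 assume x: "x : carrier G"
 let ?g = "LPerm (\<lambda>i \<in> {1..1}. x) (\<lambda>i \<in> {1..1}. e) id"
 have g: "?g : lperms G 1" using qlab_QA[OF x, of e] unfolding qlab_def qiso_QA .
 have "lb ?g 1 = lab x e" by (simp add: lb_def)
 then have "NI 1 ?g = lab x e" unfolding NI_def lperm.sel pm_id using x by simp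
 then show ?thesis unfolding qlab_def NF_qiso[OF g] .
qed

lemma NF_qmn: "NF (qmn G n) = mk n"
proof -
 have "{k \<in> {1..n}. (\<lambda>k \<in> {1..n}. 1) k = Suc 0} = {1..n}" by auto
 then have "fc n (\<lambda>k \<in> {1..n}. 1) (Suc 0) = n" unfolding fc_def by (simp only: card_atLeastAtMost)
 then show ?thesis unfolding qmn_def NF_qord[OF const_ord_maps] by simp
qed

lemma qord_qtensor:
 assumes "f : ord_maps n m" "f' : ord_maps n' m'"
 obtains h where "h : ord_maps (n + n') (m + m')"
  "qtensor (qord G n m f) (qord G n' m' f') = qord G (n + n') (m + m') h"
proof -
 let ?t = "qtensor (qord G n m f) (qord G n' m' f')"
 have t: "?t : QA G" using assms by simp
 then have h: "qmap ?t : ord_maps (n + n') (m + m')" by (simp add: QA_iff)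
 have "perm_sum n id id = id" by (auto simp: perm_sum_def)
 then have p: "perm (qgrp ?t) = (%k. k)" unfolding qtensor_perm by (simp add: qord_def lp_one_def id_def)
 have "?t = qord G (n + n') (m + m') (qmap ?t)"
 proof (rule qarr_eqI[of _ G])
  fix k assume "1 <= k" "k <= qdom ?t"
  then show "qf ?t k = qf (qord G (n + n') (m + m') (qmap ?t)) k"
   "gl ?t k = gl (qord G (n + n') (m + m') (qmap ?t)) k"
   "cl ?t k = cl (qord G (n + n') (m + m') (qmap ?t)) k"
   by (simp_all add: qf_def[of ?t] p)
 next
  fix k l
  show "qlt ?t k l = qlt (qord G (n + n') (m + m') (qmap ?t)) k l" by (simp add: qlt_def[of ?t] p)
 qed (use t h in simp_all)
 then show ?thesis using that[OF h] by simp
qed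

lemma q_decomp':
 assumes a: "a : QA G"
 obtains f i where "f : ord_maps (qdom a) (qcod a)" "i : QI G" "qdom i = qdom a" "qcod i = qdom a"
  "a = qcomp G (qord G (qdom a) (qcod a) f) i"
proof (rule that)
 show "a = qcomp G (qord G (qdom a) (qcod a) (qmap a)) (qiso (qdom a) (qgrp a))" by (rule q_decomp[OF a])
qed (use a in "simp_all add: QA_iff")

lemma NF_qord_QI:
 assumes f: "f : ord_maps n m" and i: "i : QI G" "qdom i = n"
 shows "NF (qcomp G (qord G n m f) i) = NF (qord G n m f) \<cdot> NF i"
proof -
 obtain g where "i = qiso n g" "g : lperms G n" using i by (auto simp: QI_def)
 then show ?thesis using NF_decomp[OF f] by simp
qed

lemma NF_qcomp_QI:
 assumes a: "a : QA G" and i: "i : QI G" "qcod i = qdom a"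
 shows "NF (qcomp G a i) = NF a \<cdot> NF i"
proof -
 obtain f j where f: "f : ord_maps (qdom a) (qcod a)" and j: "j : QI G" "qdom j = qdom a" "qcod j = qdom a"
  and eq: "a = qcomp G (qord G (qdom a) (qcod a) f) j"
  using q_decomp'[OF a] .
 let ?o = "qord G (qdom a) (qcod a) f"
 have ij: "qdom i = qdom a" using i by (simp add: QI_iff)
 have o: "?o : QA G" using f by simp
 have N: "NF ?o : Arr P" "Dom P (NF ?o) = qdom a" "NF j : Arr P" "Dom P (NF j) = qdom a" "Cod P (NF j) = qdom a"
  "NF i : Arr P" "Cod P (NF i) = qdom a"
  using NF_Arr[OF o] NF_Arr[OF QI_QA[OF j(1)]] NF_Arr[OF QI_QA[OF i(1)]] i j by auto
 have "qcomp G a i = qcomp G ?o (qcomp G j i)"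
  by (subst eq, rule qcomp_assoc) (use o i j in "simp_all add: QI_QA")
 then have "NF (qcomp G a i) = NF ?o \<cdot> NF (qcomp G j i)"
  using NF_qord_QI[OF f] qcomp_QI[OF i(1) j(1)] i j ij by simp
 also have "... = NF ?o \<cdot> NF j \<cdot> NF i"
  using NF_QI_qcomp[OF i(1) j(1)] i j ij N by (simp add: Comp_assoc)
 also have "NF ?o \<cdot> NF j = NF a"
  using NF_qord_QI[OF f j(1,2)] eq by simp
 finally show ?thesis .
qed

lemma qmn_qord:
 assumes h: "h : ord_maps n k"
 shows "qcomp G (qmn G k) (qord G n k h) = qmn G n"
proof (rule qarr_eqI[of _ G])
 have hQ: "qord G n k h : QA G" and d: "qdom (qmn G k) = qcod (qord G n k h)" using h by simp_all
 note c = qcomp_qf[OF hQ qmn_QA d, unfolded qdc qord_qf] qcomp_gl[OF hQ qmn_QA d, unfolded qdc qord_qf]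
  qcomp_cl[OF hQ qmn_QA d, unfolded qdc qord_qf] qcomp_qlt[OF hQ qmn_QA d, unfolded qdc qord_qf]
 have rng: "Suc 0 <= h i" "h i <= k" if "Suc 0 <= i" "i <= n" for i
  using ord_maps_range[OF h, of i] that by auto
 fix i assume "1 <= i" "i <= qdom (qcomp G (qmn G k) (qord G n k h))"
 then have i: "Suc 0 <= i" "i <= n" by simp_all
 show "qf (qcomp G (qmn G k) (qord G n k h)) i = qf (qmn G n) i"
  "gl (qcomp G (qmn G k) (qord G n k h)) i = gl (qmn G n) i"
  "cl (qcomp G (qmn G k) (qord G n k h)) i = cl (qmn G n) i"
  unfolding c[OF i] using i rng[OF i] by simp_all
 fix j assume "Suc 0 <= j" "j <= qdom (qcomp G (qmn G k) (qord G n k h))"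
 then have j: "Suc 0 <= j" "j <= n" by simp_all
 show "qlt (qcomp G (qmn G k) (qord G n k h)) i j = qlt (qmn G n) i j"
  unfolding c(4)[OF i j] using i j rng[OF i] rng[OF j] qf_less_iff[OF hQ, of i j] by simp
qed (use h in simp_all)

text \<open>The outer map is a tensor product of maps \<open>qmn\<close>, and the inner one splits
  accordingly by \<open>qord_split\<close>; over one point the claim is \<open>mk_bt\<close>. The
  inner map is quantified in \<open>R\<close> so that it can vary while the outer one is
  decomposed.\<close>

lemma NF_qord_qord:
 assumes "f : ord_maps m l" and "h : ord_maps n m"
 shows "NF (qcomp G (qord G m l f) (qord G n m h)) = NF (qord G m l f) \<cdot> NF (qord G n m h)"
proof -
 define R where "R a <-> (\<forall>n h. h : ord_maps n (qdom a) -->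
  NF (qcomp G a (qord G n (qdom a) h)) = NF a \<cdot> NF (qord G n (qdom a) h))" for a
 have "R (qord G m l f)"
  using assms(1)
 proof (induction rule: qord_induct)
  case zero
  show ?case unfolding R_def
  proof (intro allI impI)
   fix n h assume "h : ord_maps n (qdom (qide G 0))"
   then have h: "h : ord_maps n 0" by simp
   then show "NF (qcomp G (qide G 0) (qord G n (qdom (qide G 0)) h)) =
     NF (qide G 0) \<cdot> NF (qord G n (qdom (qide G 0)) h)"
    using NF_Arr[of "qord G n 0 h"] qcomp_qide(2)[of "qord G n 0 h"] by (simp add: NF_qide)
  qed
 next
  case (qmn k)
  show ?case unfolding R_def
  proof (intro allI impI)
   fix n h assume h: "h : ord_maps n (qdom (qmn G k))"
   have "qcomp G (qmn G k) (qord G n k h) = qmn G n" using h by (simp add: qmn_qord)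
   moreover have "NF (qmn G k) \<cdot> NF (qord G n k h) = mk n"
    using h by (simp only: NF_qmn NF_qord qmn_simps mk_bt sum_fc)
   ultimately show "NF (qcomp G (qmn G k) (qord G n (qdom (qmn G k)) h)) =
     NF (qmn G k) \<cdot> NF (qord G n (qdom (qmn G k)) h)"
    by (simp add: NF_qmn)
  qed
 next
  case (tensor m l f m')
  show ?case unfolding R_def
  proof (intro allI impI)
   let ?a = "qord G m l f" and ?b = "qmn G m'"
   fix n h assume "h : ord_maps n (qdom (qtensor ?a ?b))"
   then have "h : ord_maps n (m + m')" by simp
   then obtain n1 n2 h1 h2 where h: "n = n1 + n2" "h1 : ord_maps n1 m" "h2 : ord_maps n2 m'"
    and eq: "qord G n (m + m') h = qtensor (qord G n1 m h1) (qord G n2 m' h2)" by (rule qord_split)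
   have ih1: "NF (qcomp G ?a (qord G n1 m h1)) = NF ?a \<cdot> NF (qord G n1 m h1)"
    using tensor h by (simp add: R_def)
   have "qcomp G ?b (qord G n2 m' h2) = qmn G n2"
    by (rule qmn_qord[OF h(3)])
   moreover have "NF ?b \<cdot> NF (qord G n2 m' h2) = mk n2"
    using h by (simp only: NF_qmn NF_qord mk_bt sum_fc)
   ultimately have ih2: "NF (qcomp G ?b (qord G n2 m' h2)) = NF ?b \<cdot> NF (qord G n2 m' h2)"
    by (simp add: NF_qmn)
   have A: "?a : QA G" "?b : QA G" "qord G n1 m h1 : QA G" "qord G n2 m' h2 : QA G" using tensor h by simp_all
   have "NF (qcomp G (qtensor ?a ?b) (qord G n (m + m') h)) =
     NF (qtensor (qcomp G ?a (qord G n1 m h1)) (qcomp G ?b (qord G n2 m' h2)))"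
    unfolding eq using A by (subst qcomp_qtensor) simp_all
   also have "... = NF (qcomp G ?a (qord G n1 m h1)) \<boxtimes> NF (qcomp G ?b (qord G n2 m' h2))"
    by (rule NF_qtensor) (rule qcomp_QA; use A in simp)+
   also have "... = (NF ?a \<boxtimes> NF ?b) \<cdot> (NF (qord G n1 m h1) \<boxtimes> NF (qord G n2 m' h2))"
    unfolding ih1 ih2 using A[THEN NF_Arr] by (simp add: TArr_Comp)
   also have "... = NF (qtensor ?a ?b) \<cdot> NF (qord G n (m + m') h)"
    unfolding eq NF_qtensor[OF A(1,2)] NF_qtensor[OF A(3,4)] ..
   finally show "NF (qcomp G (qtensor ?a ?b) (qord G n (qdom (qtensor ?a ?b)) h)) =
     NF (qtensor ?a ?b) \<cdot> NF (qord G n (qdom (qtensor ?a ?b)) h)" by simp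
  qed
 qed
 then show ?thesis using assms(2) by (simp add: R_def)
qed

text \<open>The crux: an isomorphism after an order-preserving map is not in normal form, and
  \<open>NF\<close> of the composite refers to the normal form computed by \<open>push\<close> and
  \<open>pull\<close>. Induction over the generators of the isomorphism makes that computation
  explicit.\<close>

lemma NF_QI_qord:
 assumes "a : QI G" and "h : ord_maps n (qdom a)"
 shows "NF (qcomp G a (qord G n (qdom a) h)) = NF a \<cdot> NF (qord G n (qdom a) h)"
 using assms
proof (induction arbitrary: n h rule: QI_induct)
 case (qide m)
 then have "h : ord_maps n m" by simp
 then show ?case
  using NF_Arr[of "qord G n m h"] qcomp_qide(2)[of "qord G n m h"] by (simp add: NF_qide)
next
 case qsym
 then have "h : ord_maps n (1 + 1)" by simp
 then obtain a b h1 h2 where "n = a + b" "h1 : ord_maps a 1" "h2 : ord_maps b 1"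
  "qord G n (1 + 1) h = qtensor (qord G a 1 h1) (qord G b 1 h2)" by (rule qord_split)
 then have eq: "qord G n (1 + 1) h = qtensor (qmn G a) (qmn G b)" by (simp only: ord_maps_one)
 obtain f where f: "f : ord_maps (b + a) (1 + 1)" "qtensor (qmn G b) (qmn G a) = qord G (b + a) (1 + 1) f"
  unfolding qmn_def by (rule qord_qtensor[OF const_ord_maps const_ord_maps])
 \<comment> \<open>Naturality of the symmetry in \<open>Q\<close> produces the normal form, and
   naturality in \<open>P\<close> shows that its image is the right one.\<close>
 have "qcomp G (qsym G 1 1) (qtensor (qmn G a) (qmn G b)) = qcomp G (qtensor (qmn G b) (qmn G a)) (qsym G a b)"
  using qsym_natural[OF qmn_QA qmn_QA, of a b] by simp
 moreover have "NF (qcomp G (qtensor (qmn G b) (qmn G a)) (qsym G a b)) =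
   NF (qtensor (qmn G b) (qmn G a)) \<cdot> NF (qsym G a b)"
  unfolding f(2) by (rule NF_qord_QI[OF f(1)]) simp_all
 moreover have "Sym P 1 1 \<cdot> (mk a \<boxtimes> mk b) = (mk b \<boxtimes> mk a) \<cdot> Sym P a b"
  by (subst Sym_natural') auto
 moreover have d: "qdom (qsym G 1 1) = 1 + 1" by simp
 ultimately show ?case
  unfolding d eq by (simp only: NF_qtensor[OF qmn_QA qmn_QA] NF_qmn NF_qsym)
next
 case (qlab x e)
 have h: "h : ord_maps n 1" using qlab(2) by simp
 \<comment> \<open>\<open>Q\<close> carries a labelled monoid itself, so \<open>lab_mk\<close> holds
   in \<open>Q\<close> and yields the normal form of a label after \<open>qmn\<close>. The same rule
   in \<open>P\<close> gives the image. The two reversals correspond under \<open>NF\<close> because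
   \<open>rv\<close> consists of isomorphisms, on which \<open>NF\<close> is already
   multiplicative.\<close>
 interpret QM: labelled_monoid "DHG G" G "q_m G" "q_u G" qlab
  by unfold_locales
   (use q_m_assoc q_m_unit in "auto simp: q_m_qmn q_u_qmn qlab_one qlab_qlab
    qlab_q_u[unfolded q_u_qmn] qlab_q_m[unfolded q_m_qmn] qlab_q_m'[unfolded q_m_qmn]")
 have qmk: "QM.mk k = qmn G k" for k
 proof (induction k)
  case 0
  show ?case unfolding QM.mk.simps(1) by (rule q_u_qmn)
 next
  case (Suc k)
  then show ?case using qmn_Suc[of k] by simp
 qed
 have rv: "QM.rv k x e : QI G & qdom (QM.rv k x e) = k & NF (QM.rv k x e) = rv k x e" for k
 proof (induction k)
  case 0
  then show ?case by (simp add: NF_qide)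
 next
  case (Suc k)
  let ?r = "QM.rv k x e"
  have t: "qtensor ?r (qlab x e) : QI G" using Suc qlab(1) by (simp add: qtensor_QI)
  have nt: "NF (qtensor ?r (qlab x e)) = rv k x e \<boxtimes> lab x e"
   using Suc qlab(1) by (simp add: NF_qtensor QI_QA NF_qlab)
  have qc: "qcod ?r = k" using Suc QI_qcod by simp
  show ?case
  proof (cases e)
   case True
   have "qcomp G (qsym G k 1) (qtensor ?r (qlab x e)) : QI G"
    by (rule qcomp_QI[OF t qsym_QI]) (simp add: qc)
   moreover have "NF (qcomp G (qsym G k 1) (qtensor ?r (qlab x e))) = Sym P k 1 \<cdot> (rv k x e \<boxtimes> lab x e)"
    using NF_QI_qcomp[OF t qsym_QI, of k 1] nt by (simp add: qc NF_qsym)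
   ultimately show ?thesis using True Suc by simp
  qed (use t nt Suc in simp)
 qed
 have "qcomp G (qlab x e) (qmn G n) = qcomp G (qmn G n) (QM.rv n x e)"
  using QM.lab_mk[OF qlab(1), of e n] unfolding qmk by simp
 moreover have "NF (qcomp G (qmn G n) (QM.rv n x e)) = mk n \<cdot> rv n x e"
  using NF_qord_QI[OF const_ord_maps, of "QM.rv n x e" n] rv[of n] by (simp only: NF_qmn flip: qmn_def)
 moreover have d: "qdom (qlab x e) = 1" by simp
 ultimately show ?case
  unfolding d ord_maps_one[OF h] using lab_mk[OF qlab(1), of e n] by (simp only: NF_qmn NF_qlab[OF qlab(1)])
next
 case (qcomp a b)
 let ?h = "qord G n (qdom a) h"
 have h: "h : ord_maps n (qdom a)" using qcomp.prems by simp
 have A: "a : QA G" "b : QA G" "?h : QA G" using qcomp(1,2) h by (simp_all add: QI_QA)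
 have ah: "qcomp G a ?h : QA G" using A by simp
 \<comment> \<open>The composite of \<open>a\<close> with the order-preserving map is brought to
   normal form first, so that the second factor \<open>b\<close> again meets an order-preserving
   map.\<close>
 obtain f i where f: "f : ord_maps n (qcod a)" and i: "i : QI G" "qdom i = n" "qcod i = n"
  and eq: "qcomp G a ?h = qcomp G (qord G n (qcod a) f) i"
  using q_decomp'[OF ah] by auto
 let ?f = "qord G n (qcod a) f"
 have F: "?f : QA G" using f by simp
 have bf: "qcomp G b ?f : QA G" using F A qcomp(3) by simp
 note N = NF_Arr[OF A(1)] NF_Arr[OF A(2)] NF_Arr[OF A(3)] NF_Arr[OF F] NF_Arr[OF QI_QA[OF i(1)]]
 have "qcomp G (qcomp G b a) ?h = qcomp G b (qcomp G a ?h)"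
  by (rule qcomp_assoc) (use A qcomp(3) in simp_all)
 also have "... = qcomp G (qcomp G b ?f) i"
  unfolding eq by (rule qcomp_assoc[symmetric]) (use A F i qcomp(3) in "simp_all add: QI_QA")
 finally have "NF (qcomp G (qcomp G b a) ?h) = NF (qcomp G b ?f) \<cdot> NF i"
  using NF_qcomp_QI[OF bf i(1)] i by simp
 also have "NF (qcomp G b ?f) = NF b \<cdot> NF ?f"
  using qcomp.IH(2)[of f n] f qcomp(3) by simp
 also have "NF b \<cdot> NF ?f \<cdot> NF i = NF b \<cdot> NF (qcomp G ?f i)"
  unfolding NF_qord_QI[OF f i(1,2)] using N i qcomp(3) by (simp add: Comp_assoc)
 also have "... = NF b \<cdot> (NF a \<cdot> NF ?h)"
  unfolding eq[symmetric] using qcomp.IH(1)[OF h] by simp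
 also have "... = NF (qcomp G b a) \<cdot> NF ?h"
  unfolding NF_QI_qcomp[OF qcomp(1-3)] using N qcomp(3) by (simp add: Comp_assoc)
 finally show ?case by simp
next
 case (qtensor a b)
 then have "h : ord_maps n (qdom a + qdom b)" by simp
 then obtain n1 n2 h1 h2 where h: "n = n1 + n2" "h1 : ord_maps n1 (qdom a)" "h2 : ord_maps n2 (qdom b)"
  and eq: "qord G n (qdom a + qdom b) h = qtensor (qord G n1 (qdom a) h1) (qord G n2 (qdom b) h2)"
  by (rule qord_split)
 let ?h1 = "qord G n1 (qdom a) h1" and ?h2 = "qord G n2 (qdom b) h2"
 have A: "a : QA G" "b : QA G" "?h1 : QA G" "?h2 : QA G" using qtensor(1,2) h by (simp_all add: QI_QA)
 have "NF (qcomp G (qtensor a b) (qtensor ?h1 ?h2)) = NF (qtensor (qcomp G a ?h1) (qcomp G b ?h2))"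
  using A by (subst qcomp_qtensor) simp_all
 also have "... = NF (qcomp G a ?h1) \<boxtimes> NF (qcomp G b ?h2)"
  by (rule NF_qtensor) (rule qcomp_QA; use A in simp)+
 also have "... = (NF a \<boxtimes> NF b) \<cdot> (NF ?h1 \<boxtimes> NF ?h2)"
  unfolding qtensor.IH(1)[OF h(2)] qtensor.IH(2)[OF h(3)]
  using A[THEN NF_Arr] by (simp add: TArr_Comp)
 also have "... = NF (qtensor a b) \<cdot> NF (qtensor ?h1 ?h2)"
  using A by (simp add: NF_qtensor)
 finally show ?case using eq by simp
qed

text \<open>Write \<open>b\<close> as \<open>H\<close> after \<open>j\<close> and \<open>a\<close>
  as \<open>F\<close> after \<open>i\<close>, with \<open>F\<close>, \<open>H\<close>
  order-preserving and \<open>i\<close>, \<open>j\<close> isomorphisms. Only the middle pair,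
  \<open>j\<close> after \<open>F\<close>, is out of order; it is rewritten as \<open>F'\<close>
  after \<open>i'\<close> with the help of \<open>NF_QI_qord\<close>, and the outer pairs multiply
  by the earlier cases.\<close>

lemma NF_qcomp:
 assumes a: "a : QA G" and b: "b : QA G" and d: "qdom b = qcod a"
 shows "NF (qcomp G b a) = NF b \<cdot> NF a"
proof -
 obtain f i where f: "f : ord_maps (qdom a) (qcod a)" and i: "i : QI G" "qdom i = qdom a" "qcod i = qdom a"
  and ea: "a = qcomp G (qord G (qdom a) (qcod a) f) i" using q_decomp'[OF a] .
 obtain h j where h: "h : ord_maps (qdom b) (qcod b)" and j: "j : QI G" "qdom j = qdom b" "qcod j = qdom b"
  and eb: "b = qcomp G (qord G (qdom b) (qcod b) h) j" using q_decomp'[OF b] .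
 define F H where "F = qord G (qdom a) (qdom b) f" and "H = qord G (qdom b) (qcod b) h"
 have FH: "F : QA G" "H : QA G" "qdom F = qdom a" "qcod F = qdom b" "qdom H = qdom b" "qcod H = qcod b"
  using f h d by (simp_all add: F_def H_def)
 have ea: "a = qcomp G F i" and eb: "b = qcomp G H j" using ea eb d by (simp_all add: F_def H_def)
 have iA: "i : QA G" and jA: "j : QA G" using i j by (simp_all add: QI_QA)
 have jF: "qcomp G j F : QA G" using jA FH j by simp
 obtain f' i' where f': "f' : ord_maps (qdom a) (qdom b)" and i': "i' : QI G" "qdom i' = qdom a" "qcod i' = qdom a"
  and e: "qcomp G j F = qcomp G (qord G (qdom a) (qdom b) f') i'" using q_decomp'[OF jF] FH j by auto
 define F' where "F' = qord G (qdom a) (qdom b) f'"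
 have F': "F' : QA G" "qdom F' = qdom a" "qcod F' = qdom b" and e: "qcomp G j F = qcomp G F' i'"
  using f' e by (simp_all add: F'_def)
 have i'A: "i' : QA G" using i' by (simp add: QI_QA)
 note N = NF_Arr[OF FH(1)] NF_Arr[OF FH(2)] NF_Arr[OF F'(1)] NF_Arr[OF iA] NF_Arr[OF jA] NF_Arr[OF i'A]
 have HF': "qcomp G H F' : QA G" using FH F' by simp
 have ii: "qcomp G i' i : QI G" using i i' by (simp add: qcomp_QI)
 have "qcomp G b a = qcomp G H (qcomp G j (qcomp G F i))"
  unfolding ea eb by (rule qcomp_assoc) (use FH iA jA i j in simp_all)
 also have "qcomp G j (qcomp G F i) = qcomp G (qcomp G F' i') i"
  unfolding e[symmetric] by (rule qcomp_assoc[symmetric]) (use FH iA jA i j in simp_all)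
 also have "... = qcomp G F' (qcomp G i' i)"
  by (rule qcomp_assoc) (use F' iA i'A i i' in simp_all)
 also have "qcomp G H (qcomp G F' (qcomp G i' i)) = qcomp G (qcomp G H F') (qcomp G i' i)"
  by (rule qcomp_assoc[symmetric]) (use FH F' iA i'A i i' in simp_all)
 finally have "NF (qcomp G b a) = NF (qcomp G H F') \<cdot> NF (qcomp G i' i)"
  using NF_qcomp_QI[OF HF' ii] i' F' by simp
 also have "NF (qcomp G H F') = NF H \<cdot> NF F'"
  unfolding H_def F'_def by (rule NF_qord_qord[OF h f'])
 also have "NF (qcomp G i' i) = NF i' \<cdot> NF i"
  by (rule NF_QI_qcomp) (use i i' in simp_all)
 also have "NF H \<cdot> NF F' \<cdot> (NF i' \<cdot> NF i) = NF H \<cdot> ((NF F' \<cdot> NF i') \<cdot> NF i)"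
  using N FH F' i i' by (simp add: Comp_assoc)
 also have "NF F' \<cdot> NF i' = NF (qcomp G j F)"
  unfolding e unfolding F'_def by (rule NF_qord_QI[symmetric, OF f' i'(1,2)])
 also have "... = NF j \<cdot> NF F"
  using NF_QI_qord[OF j(1), of f "qdom a"] f j d by (simp add: F_def)
 also have "NF H \<cdot> (NF j \<cdot> NF F \<cdot> NF i) = (NF H \<cdot> NF j) \<cdot> (NF F \<cdot> NF i)"
  using N FH F' i j by (simp add: Comp_assoc)
 also have "NF H \<cdot> NF j = NF b"
  unfolding eb unfolding H_def by (rule NF_qord_QI[symmetric, OF h j(1,2)])
 also have "NF F \<cdot> NF i = NF a"
  unfolding ea unfolding F_def d by (rule NF_qord_QI[symmetric, OF f i(1,2)])
 finally show ?thesis .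
qed

theorem NF_prop_map: "prop_map (DHG G) P NF"
 unfolding prop_map_def DHG_sel
 using NF_Arr NF_qide NF_qcomp NF_qtensor NF_qsym by blast

lemma NF_q_m: "NF (q_m G) = mu" and NF_q_u: "NF (q_u G) = eta"
 unfolding q_m_qmn q_u_qmn NF_qmn mk_2 by simp_all

end

section \<open>Calculating in a symmetric monoidal category\<close>

context category
begin

lemma Hom_iff: "f : Hom C a b <-> f : Arr C & Dom C f = a & Cod C f = b"
 by (auto simp: Hom_def)

lemma ar_Ide [simp]: "a : Obj C ==> Ide C a : Arr C" "a : Obj C ==> Dom C (Ide C a) = a"
 "a : Obj C ==> Cod C (Ide C a) = a"
 using Ide_in_Hom by (auto simp: Hom_def)

lemma ar_obj [simp]: "f : Arr C ==> Dom C f : Obj C" "f : Arr C ==> Cod C f : Obj C"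
 using Dom_in_Obj Cod_in_Obj by auto

lemma ar_Comp [simp]: "f : Arr C ==> g : Arr C ==> Dom C g = Cod C f ==> g \<cdot> f : Arr C"
 "f : Arr C ==> g : Arr C ==> Dom C g = Cod C f ==> Dom C (g \<cdot> f) = Dom C f"
 "f : Arr C ==> g : Arr C ==> Dom C g = Cod C f ==> Cod C (g \<cdot> f) = Cod C g"
 using Comp_in_Hom[of f "Dom C f" "Cod C f" g "Cod C g"] by (auto simp: Hom_def)

lemma ar_id [simp]: "f : Arr C ==> a = Dom C f ==> f \<cdot> Ide C a = f"
 "f : Arr C ==> a = Cod C f ==> Ide C a \<cdot> f = f"
 using Comp_Ide[of f "Dom C f" "Cod C f"] Ide_Comp[of f "Dom C f" "Cod C f"] by (auto simp: Hom_def)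

lemma ar_assoc: "f : Arr C ==> g : Arr C ==> h : Arr C ==> Dom C g = Cod C f ==> Dom C h = Cod C g ==>
  h \<cdot> g \<cdot> f = h \<cdot> (g \<cdot> f)"
 using Comp_assoc[of f "Dom C f" "Cod C f" g "Cod C g" h "Cod C h"] by (simp add: Hom_def)

lemma ar_pull: "h \<cdot> g = k ==> f : Arr C ==> g : Arr C ==> h : Arr C ==> Dom C g = Cod C f ==> Dom C h = Cod C g ==>
  h \<cdot> (g \<cdot> f) = k \<cdot> f"
 using ar_assoc by metis

lemma inverse_arrows_unique: "inverse_arrows C f g ==> inverse_arrows C f h ==> g = h"
proof -
 assume g: "inverse_arrows C f g" and h: "inverse_arrows C f h"
 have "g = g \<cdot> (f \<cdot> h)" using g h by (simp add: inverse_arrows_def Hom_def)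
 also have "... = (g \<cdot> f) \<cdot> h" using g h by (intro ar_assoc[symmetric]) (auto simp: inverse_arrows_def Hom_def)
 also have "... = h" using g h by (simp add: inverse_arrows_def Hom_def)
 finally show ?thesis .
qed

lemma Inv_eqI: "inverse_arrows C f g ==> Inv C f = g"
 unfolding Inv_def by (rule the_equality) (auto dest: inverse_arrows_unique)

lemma iso_inverse: "iso_arr C f ==> inverse_arrows C f (Inv C f)"
 using Inv_eqI by (auto simp: iso_arr_def)

lemma iso_Arr: "iso_arr C f ==> f : Arr C"
 by (auto simp: iso_arr_def inverse_arrows_def)

lemma ar_Inv [simp]:
 assumes "iso_arr C f"
 shows "Inv C f : Arr C" "Dom C (Inv C f) = Cod C f" "Cod C (Inv C f) = Dom C f"
  "Inv C f \<cdot> f = Ide C (Dom C f)" "f \<cdot> Inv C f = Ide C (Cod C f)"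
 using iso_inverse[OF assms] by (auto simp: inverse_arrows_def Hom_def)

lemma ar_Inv_cancel [simp]:
 assumes "iso_arr C f" "g : Arr C"
 shows "Cod C g = Dom C f ==> Inv C f \<cdot> (f \<cdot> g) = g" "Cod C g = Cod C f ==> f \<cdot> (Inv C f \<cdot> g) = g"
 using assms iso_Arr[OF assms(1)] by (simp_all flip: ar_assoc)

lemma inverse_arrowsI:
 "f : Arr C ==> g : Arr C ==> Dom C g = Cod C f ==> Cod C g = Dom C f ==>
  g \<cdot> f = Ide C (Dom C f) ==> f \<cdot> g = Ide C (Cod C f) ==> inverse_arrows C f g"
 by (simp add: inverse_arrows_def Hom_def)

lemma iso_Ide [simp]: "a : Obj C ==> iso_arr C (Ide C a)"
 unfolding iso_arr_def by (rule exI[of _ "Ide C a"], rule inverse_arrowsI) auto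

lemma Inv_Ide [simp]: "a : Obj C ==> Inv C (Ide C a) = Ide C a"
 by (rule Inv_eqI, rule inverse_arrowsI) auto

lemma iso_Inv: "iso_arr C f ==> iso_arr C (Inv C f)"
 unfolding iso_arr_def[of C "Inv C f"] by (rule exI[of _ f], rule inverse_arrowsI) (auto simp: iso_Arr)

lemma iso_Comp: "iso_arr C f ==> iso_arr C g ==> Dom C g = Cod C f ==> iso_arr C (g \<cdot> f)"
 unfolding iso_arr_def[of C "g \<cdot> f"]
 by (rule exI[of _ "Inv C f \<cdot> Inv C g"], rule inverse_arrowsI) (auto simp: iso_Arr ar_assoc)

lemma iso_cancel_right:
 assumes "iso_arr C f" "x : Arr C" "y : Arr C" "Dom C x = Cod C f" "Dom C y = Cod C f" "x \<cdot> f = y \<cdot> f"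
 shows "x = y"
proof -
 have "x = x \<cdot> f \<cdot> Inv C f" using assms(1-5) by (simp add: ar_assoc iso_Arr)
 also have "... = y" unfolding assms(6) using assms(1-5) by (simp add: ar_assoc iso_Arr)
 finally show ?thesis .
qed

lemma iso_cancel_left:
 assumes "iso_arr C f" "x : Arr C" "y : Arr C" "Cod C x = Dom C f" "Cod C y = Dom C f" "f \<cdot> x = f \<cdot> y"
 shows "x = y"
proof -
 have "x = Inv C f \<cdot> (f \<cdot> x)" using assms(1-5) by simp
 also have "... = y" unfolding assms(6) using assms(1-5) by simp
 finally show ?thesis .
qed

end

context symmetric_monoidal_category
begin

lemma ar_obj_tensor [simp]: "TUnit S : Obj S" "a : Obj S ==> b : Obj S ==> a \<boxdot> b : Obj S"
 using TUnit_in_Obj TObj_in_Obj by auto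

lemma ar_tensor [simp]: "f : Arr S ==> g : Arr S ==> f \<boxtimes> g : Arr S"
 "f : Arr S ==> g : Arr S ==> Dom S (f \<boxtimes> g) = Dom S f \<boxdot> Dom S g"
 "f : Arr S ==> g : Arr S ==> Cod S (f \<boxtimes> g) = Cod S f \<boxdot> Cod S g"
 using TArr_in_Hom[of f "Dom S f" "Cod S f" g "Dom S g" "Cod S g"] by (auto simp: Hom_def)

lemma ar_tensor_Comp: "f : Arr S ==> g : Arr S ==> f' : Arr S ==> g' : Arr S ==>
  Dom S g = Cod S f ==> Dom S g' = Cod S f' ==> (g \<boxtimes> g') \<cdot> (f \<boxtimes> f') = (g \<cdot> f) \<boxtimes> (g' \<cdot> f')"
 using TArr_Comp[of f "Dom S f" "Cod S f" g "Cod S g" f' "Dom S f'" "Cod S f'" g' "Cod S g'"]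
 by (simp add: Hom_def)

lemma ar_tensor_Comp': "f : Arr S ==> g : Arr S ==> f' : Arr S ==> g' : Arr S ==> h : Arr S ==>
  Dom S g = Cod S f ==> Dom S g' = Cod S f' ==> Cod S h = Dom S f \<boxdot> Dom S f' ==>
  (g \<boxtimes> g') \<cdot> ((f \<boxtimes> f') \<cdot> h) = ((g \<cdot> f) \<boxtimes> (g' \<cdot> f')) \<cdot> h"
 by (subst ar_tensor_Comp[symmetric]) (auto simp: ar_assoc)

lemma ar_Assoc [simp]:
 assumes "a : Obj S" "b : Obj S" "c : Obj S"
 shows "Assoc S a b c : Arr S" "Dom S (Assoc S a b c) = a \<boxdot> b \<boxdot> c" "Cod S (Assoc S a b c) = a \<boxdot> (b \<boxdot> c)"
  "iso_arr S (Assoc S a b c)"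
 using Assoc_in_Hom[OF assms] Assoc_iso[OF assms] by (auto simp: Hom_def)

lemma ar_unit [simp]:
 assumes "a : Obj S"
 shows "LUnit S a : Arr S" "Dom S (LUnit S a) = TUnit S \<boxdot> a" "Cod S (LUnit S a) = a" "iso_arr S (LUnit S a)"
  "RUnit S a : Arr S" "Dom S (RUnit S a) = a \<boxdot> TUnit S" "Cod S (RUnit S a) = a" "iso_arr S (RUnit S a)"
 using LUnit_in_Hom[OF assms] RUnit_in_Hom[OF assms] LUnit_iso[OF assms] RUnit_iso[OF assms]
 by (auto simp: Hom_def)

lemma ar_Sym [simp]:
 assumes "a : Obj S" "b : Obj S"
 shows "Sym S a b : Arr S" "Dom S (Sym S a b) = a \<boxdot> b" "Cod S (Sym S a b) = b \<boxdot> a"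
 using Sym_in_Hom[OF assms] by (auto simp: Hom_def)

lemma iso_tensor [simp]: "iso_arr S f ==> iso_arr S g ==> iso_arr S (f \<boxtimes> g)"
 unfolding iso_arr_def[of S "f \<boxtimes> g"]
 by (rule exI[of _ "Inv S f \<boxtimes> Inv S g"], rule inverse_arrowsI)
  (auto simp: iso_Arr ar_tensor_Comp TArr_Ide)

lemma Assoc_nat: "f : Arr S ==> g : Arr S ==> h : Arr S ==>
  Assoc S (Cod S f) (Cod S g) (Cod S h) \<cdot> ((f \<boxtimes> g) \<boxtimes> h) = (f \<boxtimes> (g \<boxtimes> h)) \<cdot> Assoc S (Dom S f) (Dom S g) (Dom S h)"
 by (rule Assoc_natural) (auto simp: Hom_def)

lemma LUnit_nat: "f : Arr S ==> LUnit S (Cod S f) \<cdot> (Ide S (TUnit S) \<boxtimes> f) = f \<cdot> LUnit S (Dom S f)"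
 by (rule LUnit_natural) (auto simp: Hom_def)

lemma RUnit_nat: "f : Arr S ==> RUnit S (Cod S f) \<cdot> (f \<boxtimes> Ide S (TUnit S)) = f \<cdot> RUnit S (Dom S f)"
 by (rule RUnit_natural) (auto simp: Hom_def)

lemma Sym_nat: "f : Arr S ==> g : Arr S ==> Sym S (Cod S f) (Cod S g) \<cdot> (f \<boxtimes> g) = (g \<boxtimes> f) \<cdot> Sym S (Dom S f) (Dom S g)"
 by (rule Sym_natural) (auto simp: Hom_def)

lemma pentagon': "a : Obj S ==> b : Obj S ==> c : Obj S ==> d : Obj S ==>
  (Ide S a \<boxtimes> Assoc S b c d) \<cdot> (Assoc S a (b \<boxdot> c) d \<cdot> (Assoc S a b c \<boxtimes> Ide S d)) =
  Assoc S a b (c \<boxdot> d) \<cdot> Assoc S (a \<boxdot> b) c d"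
 using pentagon by (simp add: ar_assoc)

text \<open>Kelly's argument: tensored with the unit on the left, the equation follows from the
  pentagon and the triangle, and naturality of \<open>LUnit\<close> shows that tensoring with the
  unit is faithful.\<close>

lemma LUnit_tensor:
 assumes [simp]: "a : Obj S" "b : Obj S"
 shows "LUnit S (a \<boxdot> b) \<cdot> Assoc S (TUnit S) a b = LUnit S a \<boxtimes> Ide S b"
proof -
 let ?I = "TUnit S"
 let ?f = "LUnit S (a \<boxdot> b) \<cdot> Assoc S ?I a b" and ?g = "LUnit S a \<boxtimes> Ide S b"
 let ?X = "Assoc S ?I (?I \<boxdot> a) b \<cdot> (Assoc S ?I ?I a \<boxtimes> Ide S b)"
 have "(Ide S ?I \<boxtimes> ?f) \<cdot> ?X = (Ide S ?I \<boxtimes> LUnit S (a \<boxdot> b)) \<cdot> ((Ide S ?I \<boxtimes> Assoc S ?I a b) \<cdot> ?X)"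
  by (simp add: ar_tensor_Comp')
 also have "... = ((Ide S ?I \<boxtimes> LUnit S (a \<boxdot> b)) \<cdot> Assoc S ?I ?I (a \<boxdot> b)) \<cdot> Assoc S (?I \<boxdot> ?I) a b"
  by (simp add: pentagon' ar_assoc)
 also have "... = (RUnit S ?I \<boxtimes> (Ide S a \<boxtimes> Ide S b)) \<cdot> Assoc S (?I \<boxdot> ?I) a b"
  by (simp add: triangle TArr_Ide)
 also have "... = Assoc S ?I a b \<cdot> ((RUnit S ?I \<boxtimes> Ide S a) \<boxtimes> Ide S b)"
  using Assoc_nat[of "RUnit S ?I" "Ide S a" "Ide S b"] by simp
 also have "(RUnit S ?I \<boxtimes> Ide S a) \<boxtimes> Ide S b = ((Ide S ?I \<boxtimes> LUnit S a) \<boxtimes> Ide S b) \<cdot> (Assoc S ?I ?I a \<boxtimes> Ide S b)"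
  by (simp add: ar_tensor_Comp triangle)
 also have "Assoc S ?I a b \<cdot> ... = (Assoc S ?I a b \<cdot> ((Ide S ?I \<boxtimes> LUnit S a) \<boxtimes> Ide S b)) \<cdot> (Assoc S ?I ?I a \<boxtimes> Ide S b)"
  by (simp add: ar_assoc)
 also have "... = (Ide S ?I \<boxtimes> ?g) \<cdot> ?X"
  using Assoc_nat[of "Ide S ?I" "LUnit S a" "Ide S b"] by (simp add: ar_assoc)
 finally have 1: "Ide S ?I \<boxtimes> ?f = Ide S ?I \<boxtimes> ?g"
  by (rule iso_cancel_right[rotated -1]) (simp_all add: iso_Comp)
 have "?f \<cdot> LUnit S (?I \<boxdot> a \<boxdot> b) = ?g \<cdot> LUnit S (?I \<boxdot> a \<boxdot> b)"
  using LUnit_nat[of ?f] LUnit_nat[of ?g] 1 by simp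
 then show ?thesis by (rule iso_cancel_right[rotated -1]) simp_all
qed

text \<open>The mirror image of \<open>LUnit_tensor\<close>, with the pentagon for \<open>a\<close>,
  \<open>b\<close> and two units, and with faithfulness from naturality of
  \<open>RUnit\<close>.\<close>

lemma RUnit_tensor:
 assumes [simp]: "a : Obj S" "b : Obj S"
 shows "(Ide S a \<boxtimes> RUnit S b) \<cdot> Assoc S a b (TUnit S) = RUnit S (a \<boxdot> b)"
proof -
 let ?I = "TUnit S"
 let ?f = "(Ide S a \<boxtimes> RUnit S b) \<cdot> Assoc S a b ?I" and ?g = "RUnit S (a \<boxdot> b)"
 have "Assoc S a b ?I \<cdot> (?g \<boxtimes> Ide S ?I) = Assoc S a b ?I \<cdot> (((Ide S a \<boxtimes> Ide S b) \<boxtimes> LUnit S ?I) \<cdot> Assoc S (a \<boxdot> b) ?I ?I)"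
  by (simp add: TArr_Ide triangle)
 also have "... = (Assoc S a b ?I \<cdot> ((Ide S a \<boxtimes> Ide S b) \<boxtimes> LUnit S ?I)) \<cdot> Assoc S (a \<boxdot> b) ?I ?I"
  by (simp add: ar_assoc)
 also have "... = (Ide S a \<boxtimes> (Ide S b \<boxtimes> LUnit S ?I)) \<cdot> (Assoc S a b (?I \<boxdot> ?I) \<cdot> Assoc S (a \<boxdot> b) ?I ?I)"
  using Assoc_nat[of "Ide S a" "Ide S b" "LUnit S ?I"] by (simp add: ar_assoc)
 also have "... = (Ide S a \<boxtimes> (RUnit S b \<boxtimes> Ide S ?I)) \<cdot> (Assoc S a (b \<boxdot> ?I) ?I \<cdot> (Assoc S a b ?I \<boxtimes> Ide S ?I))"
  by (simp add: pentagon'[symmetric] ar_tensor_Comp' triangle)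
 also have "... = ((Ide S a \<boxtimes> (RUnit S b \<boxtimes> Ide S ?I)) \<cdot> Assoc S a (b \<boxdot> ?I) ?I) \<cdot> (Assoc S a b ?I \<boxtimes> Ide S ?I)"
  by (simp add: ar_assoc)
 also have "... = Assoc S a b ?I \<cdot> (?f \<boxtimes> Ide S ?I)"
  using Assoc_nat[of "Ide S a" "RUnit S b" "Ide S ?I", symmetric] by (simp add: ar_assoc ar_tensor_Comp)
 finally have 1: "?g \<boxtimes> Ide S ?I = ?f \<boxtimes> Ide S ?I"
  by (rule iso_cancel_left[rotated -1]) simp_all
 have "?f \<cdot> RUnit S (a \<boxdot> b \<boxdot> ?I) = ?g \<cdot> RUnit S (a \<boxdot> b \<boxdot> ?I)"
  using RUnit_nat[of ?f] RUnit_nat[of ?g] 1 by simp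
 then show ?thesis by (rule iso_cancel_right[rotated -1]) simp_all
qed

text \<open>Both sides agree once tensored with the unit on the right: naturality identifies
  \<open>LUnit\<close> tensored on the left by the unit with \<open>LUnit\<close> of the product of
  two units, and then \<open>LUnit_tensor\<close> is compared with the triangle.\<close>

lemma LUnit_RUnit: "LUnit S (TUnit S) = RUnit S (TUnit S)"
proof -
 let ?I = "TUnit S"
 have "LUnit S ?I \<cdot> (Ide S ?I \<boxtimes> LUnit S ?I) = LUnit S ?I \<cdot> LUnit S (?I \<boxdot> ?I)"
  using LUnit_nat[of "LUnit S ?I"] by simp
 then have 1: "Ide S ?I \<boxtimes> LUnit S ?I = LUnit S (?I \<boxdot> ?I)"
  by (rule iso_cancel_left[rotated -1]) simp_all
 have 2: "LUnit S ?I \<boxtimes> Ide S ?I = RUnit S ?I \<boxtimes> Ide S ?I"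
  using LUnit_tensor[of ?I ?I] triangle[of ?I ?I] 1 by simp
 have "LUnit S ?I \<cdot> RUnit S (?I \<boxdot> ?I) = RUnit S ?I \<cdot> RUnit S (?I \<boxdot> ?I)"
  using RUnit_nat[of "LUnit S ?I"] RUnit_nat[of "RUnit S ?I"] 2 by simp
 then show ?thesis by (rule iso_cancel_right[rotated -1]) simp_all
qed

lemma canonical_iso: "f : canonical_arrows S ==> iso_arr S f"
 by (induction rule: canonical_arrows.induct) (auto intro: iso_Inv iso_Comp)

end

section \<open>Tensor powers and the PROP of endomorphisms\<close>

text \<open>A strong monoidal functor from the natural numbers, as a discrete monoidal category, to
  \<open>S\<close>. It is the object part of an algebra, and equally the sequence of tensor powers
  of an object.\<close>

locale tensor_system = symmetric_monoidal_category S for S :: "('o, 'a, 'z) smc_scheme" (structure) +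
 fixes A :: "nat => 'o" and t :: "nat \<times> nat => 'a" and u :: 'a
 assumes A_Obj [simp]: "A n : Obj S"
  and t_Arr: "t (a, b) : Hom S (A a \<boxdot> A b) (A (a + b))"
  and t_iso [simp]: "iso_arr S (t (a, b))"
  and u_Arr: "u : Hom S (TUnit S) (A 0)"
  and u_iso [simp]: "iso_arr S u"
  and t_assoc: "t (a + b, c) \<cdot> (t (a, b) \<boxtimes> Ide S (A c)) =
   t (a, b + c) \<cdot> (Ide S (A a) \<boxtimes> t (b, c)) \<cdot> Assoc S (A a) (A b) (A c)"
  and t_lunit: "t (0, a) \<cdot> (u \<boxtimes> Ide S (A a)) = LUnit S (A a)"
  and t_runit: "t (a, 0) \<cdot> (Ide S (A a) \<boxtimes> u) = RUnit S (A a)"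

text \<open>Arrows carry their source and target, because \<open>A\<close> need not be injective.\<close>

definition endo :: "('o, 'a, 'z) smc_scheme => (nat => 'o) => (nat \<times> nat => 'a) => (nat, (nat, 'a) mor) smc" where
 "endo S A t =
   \<lparr>Obj = UNIV, Arr = {Mor n m f | n m f. f : Hom S (A n) (A m)}, Dom = src, Cod = tgt,
   Ide = (%n. Mor n n (Ide S (A n))),
   Comp = (%g f. Mor (src f) (tgt g) (under g \<cdot>\<^sub>S under f)),
   TObj = (+),
   TArr = (%f g. Mor (src f + src g) (tgt f + tgt g)
     (t (tgt f, tgt g) \<cdot>\<^sub>S ((under f \<boxtimes>\<^sub>S under g) \<cdot>\<^sub>S Inv S (t (src f, src g))))),
   TUnit = 0,
   Assoc = (%a b c. Mor (a + b + c) (a + b + c) (Ide S (A (a + b + c)))),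
   LUnit = (%n. Mor n n (Ide S (A n))), RUnit = (%n. Mor n n (Ide S (A n))),
   Sym = (%a b. Mor (a + b) (b + a) (t (b, a) \<cdot>\<^sub>S (Sym S (A a) (A b) \<cdot>\<^sub>S Inv S (t (a, b)))))\<rparr>"

lemma endo_sel [simp]: "Dom (endo S A t) = src" "Cod (endo S A t) = tgt"
 "Ide (endo S A t) n = Mor n n (Ide S (A n))"
 "Comp (endo S A t) g f = Mor (src f) (tgt g) (under g \<cdot>\<^sub>S under f)"
 "TArr (endo S A t) f g = Mor (src f + src g) (tgt f + tgt g)
     (t (tgt f, tgt g) \<cdot>\<^sub>S ((under f \<boxtimes>\<^sub>S under g) \<cdot>\<^sub>S Inv S (t (src f, src g))))"
 "Sym (endo S A t) a b = Mor (a + b) (b + a) (t (b, a) \<cdot>\<^sub>S (Sym S (A a) (A b) \<cdot>\<^sub>S Inv S (t (a, b))))"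
 by (simp_all add: endo_def)

context tensor_system
begin

abbreviation "P \<equiv> endo S A t"

lemma t_simps [simp]: "t (a, b) : Arr S" "Dom S (t (a, b)) = A a \<boxdot> A b" "Cod S (t (a, b)) = A (a + b)"
 "u : Arr S" "Dom S u = TUnit S" "Cod S u = A 0"
 using t_Arr u_Arr by (auto simp: Hom_def)

lemma endo_Arr: "f : Arr P <-> under f : Arr S & Dom S (under f) = A (src f) & Cod S (under f) = A (tgt f)"
 by (cases f) (auto simp: endo_def Hom_def)

lemma under_TArr:
 assumes "f : Arr P" "g : Arr P"
 shows "under (f \<boxtimes>\<^sub>P g) \<cdot> t (src f, src g) = t (tgt f, tgt g) \<cdot> (under f \<boxtimes> under g)"
 using assms by (simp add: endo_Arr ar_assoc)

lemma under_Sym: "under (Sym P a b) \<cdot> t (a, b) = t (b, a) \<cdot> Sym S (A a) (A b)"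
 by (simp add: ar_assoc)

lemma t_assoc': "t (a + b, c) \<cdot> (t (a, b) \<boxtimes> Ide S (A c)) =
   t (a, b + c) \<cdot> ((Ide S (A a) \<boxtimes> t (b, c)) \<cdot> Assoc S (A a) (A b) (A c))"
 using t_assoc by (simp add: ar_assoc)

text \<open>Equations between arrows out of a threefold product are tested after precomposition with
  the comparison isomorphism, where the inverses of \<open>t\<close> cancel.\<close>

lemma t3_cancel:
 assumes "x : Arr S" "y : Arr S" "Dom S x = A (a + b + c)" "Dom S y = A (a + b + c)"
  and "x \<cdot> (t (a + b, c) \<cdot> (t (a, b) \<boxtimes> Ide S (A c))) = y \<cdot> (t (a + b, c) \<cdot> (t (a, b) \<boxtimes> Ide S (A c)))"
 shows "x = y"
 by (rule iso_cancel_right[OF _ assms(1,2) _ _ assms(5)]) (use assms in "simp_all add: iso_Comp")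

lemma under_TArr_left:
 assumes f: "f : Arr P" and g: "g : Arr P" and h: "h : Arr P"
 shows "under ((f \<boxtimes>\<^sub>P g) \<boxtimes>\<^sub>P h) \<cdot> (t (src f + src g, src h) \<cdot> (t (src f, src g) \<boxtimes> Ide S (A (src h)))) =
  t (tgt f + tgt g, tgt h) \<cdot> ((t (tgt f, tgt g) \<boxtimes> Ide S (A (tgt h))) \<cdot> ((under f \<boxtimes> under g) \<boxtimes> under h))"
 using f g h by (simp add: endo_Arr ar_assoc ar_tensor_Comp)

lemma under_TArr_right:
 assumes f: "f : Arr P" and g: "g : Arr P" and h: "h : Arr P"
 shows "under (f \<boxtimes>\<^sub>P (g \<boxtimes>\<^sub>P h)) \<cdot> (t (src f + src g, src h) \<cdot> (t (src f, src g) \<boxtimes> Ide S (A (src h)))) =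
  t (tgt f + tgt g, tgt h) \<cdot> ((t (tgt f, tgt g) \<boxtimes> Ide S (A (tgt h))) \<cdot> ((under f \<boxtimes> under g) \<boxtimes> under h))"
proof -
 have a: "under f : Arr S" "under g : Arr S" "under h : Arr S" "Dom S (under f) = A (src f)" "Cod S (under f) = A (tgt f)"
  "Dom S (under g) = A (src g)" "Cod S (under g) = A (tgt g)" "Dom S (under h) = A (src h)" "Cod S (under h) = A (tgt h)"
  using f g h by (auto simp: endo_Arr)
 have "under (f \<boxtimes>\<^sub>P (g \<boxtimes>\<^sub>P h)) \<cdot> (t (src f + src g, src h) \<cdot> (t (src f, src g) \<boxtimes> Ide S (A (src h)))) =
   t (tgt f, tgt g + tgt h) \<cdot> ((Ide S (A (tgt f)) \<boxtimes> t (tgt g, tgt h)) \<cdot> ((under f \<boxtimes> (under g \<boxtimes> under h)) \<cdot>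
   Assoc S (A (src f)) (A (src g)) (A (src h))))"
  unfolding t_assoc' using a by (simp add: ar_assoc ar_tensor_Comp ar_tensor_Comp' add.assoc)
 also have "(under f \<boxtimes> (under g \<boxtimes> under h)) \<cdot> Assoc S (A (src f)) (A (src g)) (A (src h)) =
   Assoc S (A (tgt f)) (A (tgt g)) (A (tgt h)) \<cdot> ((under f \<boxtimes> under g) \<boxtimes> under h)"
  using Assoc_nat[of "under f" "under g" "under h"] a by simp
 also have "t (tgt f, tgt g + tgt h) \<cdot> ((Ide S (A (tgt f)) \<boxtimes> t (tgt g, tgt h)) \<cdot>
   (Assoc S (A (tgt f)) (A (tgt g)) (A (tgt h)) \<cdot> ((under f \<boxtimes> under g) \<boxtimes> under h))) =
   (t (tgt f, tgt g + tgt h) \<cdot> ((Ide S (A (tgt f)) \<boxtimes> t (tgt g, tgt h)) \<cdot>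
   Assoc S (A (tgt f)) (A (tgt g)) (A (tgt h)))) \<cdot> ((under f \<boxtimes> under g) \<boxtimes> under h)"
  using a by (simp add: ar_assoc add.assoc)
 also have "... = t (tgt f + tgt g, tgt h) \<cdot> ((t (tgt f, tgt g) \<boxtimes> Ide S (A (tgt h))) \<cdot> ((under f \<boxtimes> under g) \<boxtimes> under h))"
  unfolding t_assoc'[symmetric] using a by (simp add: ar_assoc)
 finally show ?thesis .
qed

lemma endo_ops: "prop_ops P"
 by unfold_locales (auto simp: endo_Arr)

lemma endo_TArr_assoc:
 assumes f: "f : Arr P" and g: "g : Arr P" and h: "h : Arr P"
 shows "f \<boxtimes>\<^sub>P g \<boxtimes>\<^sub>P h = f \<boxtimes>\<^sub>P (g \<boxtimes>\<^sub>P h)"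
proof -
 interpret prop_ops P by (rule endo_ops)
 have 1: "f \<boxtimes>\<^sub>P g \<boxtimes>\<^sub>P h : Arr P" "f \<boxtimes>\<^sub>P (g \<boxtimes>\<^sub>P h) : Arr P" by (intro TArr_Arr f g h)+
 have "under (f \<boxtimes>\<^sub>P g \<boxtimes>\<^sub>P h) = under (f \<boxtimes>\<^sub>P (g \<boxtimes>\<^sub>P h))"
  by (rule t3_cancel[of _ _ "src f" "src g" "src h"])
   (use 1 in \<open>simp_all only: endo_Arr under_TArr_left[OF f g h] under_TArr_right[OF f g h]\<close>, simp_all add: add.assoc)
 then show ?thesis by (simp add: add.assoc)
qed

text \<open>Precomposed with the threefold comparison, both sides turn into the two sides of the
  hexagon of \<open>S\<close>; \<open>t_assoc\<close> accounts for the associativity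
  constraints.\<close>

lemma endo_hexagon: "Sym P a (b + c) = (Ide P b \<boxtimes>\<^sub>P Sym P a c) \<cdot>\<^sub>P (Sym P a b \<boxtimes>\<^sub>P Ide P c)"
proof -
 interpret prop_ops P by (rule endo_ops)
 let ?A = "A a" and ?B = "A b" and ?C = "A c"
 let ?R = "(Ide P b \<boxtimes>\<^sub>P Sym P a c) \<cdot>\<^sub>P (Sym P a b \<boxtimes>\<^sub>P Ide P c)"
 have RA: "?R : Arr P" "Sym P a (b + c) : Arr P"
  by (rule Comp_Arr TArr_Arr Sym_Arr Ide_Arr | simp only: Dom_TArr Cod_TArr Dom_Sym Cod_Sym Dom_Ide Cod_Ide add_ac)+
 let ?t3 = "t (a + b, c) \<cdot> (t (a, b) \<boxtimes> Ide S ?C)"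
 have "under (Sym P a (b + c)) \<cdot> ?t3 =
   (under (Sym P a (b + c)) \<cdot> t (a, b + c)) \<cdot> ((Ide S ?A \<boxtimes> t (b, c)) \<cdot> Assoc S ?A ?B ?C)"
  unfolding t_assoc' using RA by (simp add: ar_assoc add_ac)
 also have "... = t (b + c, a) \<cdot> ((Sym S ?A (A (b + c)) \<cdot> (Ide S ?A \<boxtimes> t (b, c))) \<cdot> Assoc S ?A ?B ?C)"
  unfolding under_Sym by (simp add: ar_assoc)
 also have "Sym S ?A (A (b + c)) \<cdot> (Ide S ?A \<boxtimes> t (b, c)) = (t (b, c) \<boxtimes> Ide S ?A) \<cdot> Sym S ?A (?B \<boxdot> ?C)"
  using Sym_nat[of "Ide S ?A" "t (b, c)"] by simp
 also have "t (b + c, a) \<cdot> (((t (b, c) \<boxtimes> Ide S ?A) \<cdot> Sym S ?A (?B \<boxdot> ?C)) \<cdot> Assoc S ?A ?B ?C) =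
   (t (b + c, a) \<cdot> (t (b, c) \<boxtimes> Ide S ?A)) \<cdot> (Sym S ?A (?B \<boxdot> ?C) \<cdot> Assoc S ?A ?B ?C)"
  by (simp add: ar_assoc)
 also have "... = t (b, c + a) \<cdot> ((Ide S ?B \<boxtimes> t (c, a)) \<cdot>
   (Assoc S ?B ?C ?A \<cdot> Sym S ?A (?B \<boxdot> ?C) \<cdot> Assoc S ?A ?B ?C))"
  unfolding t_assoc' by (simp add: ar_assoc add_ac)
 also have "Assoc S ?B ?C ?A \<cdot> Sym S ?A (?B \<boxdot> ?C) \<cdot> Assoc S ?A ?B ?C =
   (Ide S ?B \<boxtimes> Sym S ?A ?C) \<cdot> (Assoc S ?B ?A ?C \<cdot> (Sym S ?A ?B \<boxtimes> Ide S ?C))"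
  using hexagon[of ?A ?B ?C] by (simp add: ar_assoc)
 finally have L: "under (Sym P a (b + c)) \<cdot> ?t3 = t (b, c + a) \<cdot> ((Ide S ?B \<boxtimes> t (c, a)) \<cdot>
   ((Ide S ?B \<boxtimes> Sym S ?A ?C) \<cdot> (Assoc S ?B ?A ?C \<cdot> (Sym S ?A ?B \<boxtimes> Ide S ?C))))" .
 define x y where "x = under (Ide P b \<boxtimes>\<^sub>P Sym P a c)" and "y = under (Sym P a b \<boxtimes>\<^sub>P Ide P c)"
 have xy: "x : Arr S" "Dom S x = A (b + (a + c))" "Cod S x = A (b + (c + a))"
  "y : Arr S" "Dom S y = A (a + b + c)" "Cod S y = A (b + a + c)" unfolding x_def y_def by simp_all
 have ex: "x \<cdot> t (b, a + c) = t (b, c + a) \<cdot> (Ide S ?B \<boxtimes> under (Sym P a c))"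
  using under_TArr[of "Ide P b" "Sym P a c"] Sym_Arr[of a c] Ide_Arr[of b] unfolding x_def by simp
 have ey: "y \<cdot> t (a + b, c) = t (b + a, c) \<cdot> (under (Sym P a b) \<boxtimes> Ide S ?C)"
  using under_TArr[of "Sym P a b" "Ide P c"] Sym_Arr[of a b] Ide_Arr[of c] unfolding y_def by simp
 have sy: "(under (Sym P a b) \<boxtimes> Ide S ?C) \<cdot> (t (a, b) \<boxtimes> Ide S ?C) = (t (b, a) \<boxtimes> Ide S ?C) \<cdot> (Sym S ?A ?B \<boxtimes> Ide S ?C)"
  using under_Sym[of a b] Sym_Arr[of a b] by (simp add: ar_tensor_Comp endo_Arr)
 have sx: "(Ide S ?B \<boxtimes> under (Sym P a c)) \<cdot> (Ide S ?B \<boxtimes> t (a, c)) = (Ide S ?B \<boxtimes> t (c, a)) \<cdot> (Ide S ?B \<boxtimes> Sym S ?A ?C)"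
  using under_Sym[of a c] Sym_Arr[of a c] by (simp add: ar_tensor_Comp endo_Arr)
 define sab sac where "sab = under (Sym P a b)" and "sac = under (Sym P a c)"
 have s: "sab : Arr S" "Dom S sab = A (a + b)" "Cod S sab = A (b + a)"
   "sac : Arr S" "Dom S sac = A (a + c)" "Cod S sac = A (c + a)" unfolding sab_def sac_def by simp_all
 note ex = ex[folded sac_def] and ey = ey[folded sab_def] and sx = sx[folded sac_def] and sy = sy[folded sab_def]
 have R: "under ?R = x \<cdot> y" unfolding x_def y_def by (simp only: endo_sel mor.sel)
 have bac: "b + a + c = b + (a + c)" by simp
 have "under ?R \<cdot> ?t3 = x \<cdot> ((y \<cdot> t (a + b, c)) \<cdot> (t (a, b) \<boxtimes> Ide S ?C))"
  unfolding R using xy by (simp add: ar_assoc bac)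
 also have "... = x \<cdot> (t (b + a, c) \<cdot> ((sab \<boxtimes> Ide S ?C) \<cdot> (t (a, b) \<boxtimes> Ide S ?C)))"
  unfolding ey using s xy bac by (simp add: ar_assoc)
 also have "... = x \<cdot> ((t (b + a, c) \<cdot> (t (b, a) \<boxtimes> Ide S ?C)) \<cdot> (Sym S ?A ?B \<boxtimes> Ide S ?C))"
  unfolding sy using xy bac by (simp add: ar_assoc)
 also have "... = (x \<cdot> t (b, a + c)) \<cdot> ((Ide S ?B \<boxtimes> t (a, c)) \<cdot> (Assoc S ?B ?A ?C \<cdot> (Sym S ?A ?B \<boxtimes> Ide S ?C)))"
  unfolding t_assoc' using xy bac by (simp add: ar_assoc)
 also have "... = t (b, c + a) \<cdot> (((Ide S ?B \<boxtimes> sac) \<cdot> (Ide S ?B \<boxtimes> t (a, c))) \<cdot> (Assoc S ?B ?A ?C \<cdot> (Sym S ?A ?B \<boxtimes> Ide S ?C)))"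
  unfolding ex using s by (simp add: ar_assoc)
 also have "... = under (Sym P a (b + c)) \<cdot> ?t3"
  unfolding sx L by (simp add: ar_assoc)
 finally have E: "under ?R \<cdot> ?t3 = under (Sym P a (b + c)) \<cdot> ?t3" .
 have "x \<cdot> y = under (Sym P a (b + c))"
 proof (rule t3_cancel[of _ _ a b c])
  show "x \<cdot> y : Arr S" "Dom S (x \<cdot> y) = A (a + b + c)" using xy bac by simp_all
  show "under (Sym P a (b + c)) : Arr S" by simp
  show "Dom S (under (Sym P a (b + c))) = A (a + b + c)" by (simp add: add.assoc)
  show "x \<cdot> y \<cdot> ?t3 = under (Sym P a (b + c)) \<cdot> ?t3" using E unfolding R .
 qed
 then have "under (Sym P a (b + c)) = under ?R" unfolding R by simp
 moreover have "src (Sym P a (b + c)) = src ?R" "tgt (Sym P a (b + c)) = tgt ?R"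
  by (simp_all only: endo_sel mor.sel add_ac)
 ultimately show ?thesis by (intro mor.expand conjI)
qed

lemma endo_Ide_left:
 assumes f: "f : Arr P"
 shows "Ide P 0 \<boxtimes>\<^sub>P f = f"
proof -
 interpret prop_ops P by (rule endo_ops)
 have a: "under f : Arr S" "Dom S (under f) = A (src f)" "Cod S (under f) = A (tgt f)" using f by (auto simp: endo_Arr)
 have "under (Ide P 0 \<boxtimes>\<^sub>P f) \<cdot> LUnit S (A (src f)) = t (0, tgt f) \<cdot> ((Ide S (A 0) \<boxtimes> under f) \<cdot> (u \<boxtimes> Ide S (A (src f))))"
  unfolding t_lunit[symmetric] using a by (simp add: ar_assoc)
 also have "... = t (0, tgt f) \<cdot> (u \<boxtimes> Ide S (A (tgt f))) \<cdot> (Ide S (TUnit S) \<boxtimes> under f)"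
  using a by (simp add: ar_tensor_Comp ar_assoc)
 also have "... = under f \<cdot> LUnit S (A (src f))"
  unfolding t_lunit using LUnit_nat[of "under f"] a by simp
 finally have "under (Ide P 0 \<boxtimes>\<^sub>P f) = under f"
  by (rule iso_cancel_right[rotated -1]) (use a in simp_all)
 then show ?thesis by (intro mor.expand) simp
qed

lemma endo_Ide_right:
 assumes f: "f : Arr P"
 shows "f \<boxtimes>\<^sub>P Ide P 0 = f"
proof -
 interpret prop_ops P by (rule endo_ops)
 have a: "under f : Arr S" "Dom S (under f) = A (src f)" "Cod S (under f) = A (tgt f)" using f by (auto simp: endo_Arr)
 have "under (f \<boxtimes>\<^sub>P Ide P 0) \<cdot> RUnit S (A (src f)) = t (tgt f, 0) \<cdot> ((under f \<boxtimes> Ide S (A 0)) \<cdot> (Ide S (A (src f)) \<boxtimes> u))"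
  unfolding t_runit[symmetric] using a by (simp add: ar_assoc)
 also have "... = t (tgt f, 0) \<cdot> (Ide S (A (tgt f)) \<boxtimes> u) \<cdot> (under f \<boxtimes> Ide S (TUnit S))"
  using a by (simp add: ar_tensor_Comp ar_assoc)
 also have "... = under f \<cdot> RUnit S (A (src f))"
  unfolding t_runit using RUnit_nat[of "under f"] a by simp
 finally have "under (f \<boxtimes>\<^sub>P Ide P 0) = under f"
  by (rule iso_cancel_right[rotated -1]) (use a in simp_all)
 then show ?thesis by (intro mor.expand) simp
qed

text \<open>Strictness is the content of the coherence laws of a tensor system: conjugation by
  \<open>t\<close> brings the constraints of \<open>S\<close> into the form of
  \<open>t_assoc\<close>, \<open>t_lunit\<close> and \<open>t_runit\<close>, where they
  cancel.\<close>

lemma endo_strict_prop: "strict_prop P"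
proof -
 interpret prop_ops P by (rule endo_ops)
 show ?thesis
 proof
  fix f g assume *: "f : Arr P" "g : Arr P"
  then have a: "under f : Arr S" "Dom S (under f) = A (src f)" "Cod S (under f) = A (tgt f)"
   "under g : Arr S" "Dom S (under g) = A (src g)" "Cod S (under g) = A (tgt g)" by (auto simp: endo_Arr)
  have "Sym S (A (tgt f)) (A (tgt g)) \<cdot> ((under f \<boxtimes> under g) \<cdot> Inv S (t (src f, src g))) =
    (Sym S (A (tgt f)) (A (tgt g)) \<cdot> (under f \<boxtimes> under g)) \<cdot> Inv S (t (src f, src g))"
   using a by (simp add: ar_assoc)
  also have "... = (under g \<boxtimes> under f) \<cdot> (Sym S (A (src f)) (A (src g)) \<cdot> Inv S (t (src f, src g)))"
   using Sym_nat[of "under f" "under g"] a by (simp add: ar_assoc)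
  finally show "Sym P (Cod P f) (Cod P g) \<cdot>\<^sub>P (f \<boxtimes>\<^sub>P g) = g \<boxtimes>\<^sub>P f \<cdot>\<^sub>P Sym P (Dom P f) (Dom P g)"
   using a by (simp add: ar_assoc)
 next
  fix a b
  show "Sym P b a \<cdot>\<^sub>P Sym P a b = Ide P (a + b)"
   by (simp add: ar_assoc ar_pull[OF Sym_Sym])
  show "Ide P a \<boxtimes>\<^sub>P Ide P b = Ide P (a + b)" by (simp add: TArr_Ide)
 next
  fix f assume *: "f : Arr P"
  then show "f \<cdot>\<^sub>P Ide P (Dom P f) = f" "Ide P (Cod P f) \<cdot>\<^sub>P f = f"
   by (auto simp: endo_Arr intro: mor.expand)
  show "Ide P 0 \<boxtimes>\<^sub>P f = f" "f \<boxtimes>\<^sub>P Ide P 0 = f"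
   using endo_Ide_left endo_Ide_right * by blast+
 next
  fix f g h assume "f : Arr P" "g : Arr P" "h : Arr P"
  then show "f \<boxtimes>\<^sub>P g \<boxtimes>\<^sub>P h = f \<boxtimes>\<^sub>P (g \<boxtimes>\<^sub>P h)" by (rule endo_TArr_assoc)
  assume "f : Arr P" "g : Arr P" "h : Arr P" "Dom P g = Cod P f" "Dom P h = Cod P g"
  then show "h \<cdot>\<^sub>P g \<cdot>\<^sub>P f = h \<cdot>\<^sub>P (g \<cdot>\<^sub>P f)" by (simp add: endo_Arr ar_assoc)
 next
  fix f g f' g' assume "f : Arr P" "g : Arr P" "f' : Arr P" "g' : Arr P" "Dom P g = Cod P f" "Dom P g' = Cod P f'"
  then show "(g \<boxtimes>\<^sub>P g') \<cdot>\<^sub>P (f \<boxtimes>\<^sub>P f') = (g \<cdot>\<^sub>P f) \<boxtimes>\<^sub>P (g' \<cdot>\<^sub>P f')"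
   by (simp add: endo_Arr ar_assoc ar_tensor_Comp')
 next
  fix a b c
  show "Sym P a (b + c) = (Ide P b \<boxtimes>\<^sub>P Sym P a c) \<cdot>\<^sub>P (Sym P a b \<boxtimes>\<^sub>P Ide P c)" by (rule endo_hexagon)
 qed
qed

end

text \<open>The first power is \<open>X\<close> and not the product of the unit with
  \<open>X\<close>, so that evaluation at 1 returns the given object exactly.\<close>

fun pw :: "('o, 'a, 'z) smc_scheme => 'o => nat => 'o" where
 "pw S X 0 = TUnit S"
| "pw S X (Suc 0) = X"
| "pw S X (Suc (Suc n)) = pw S X (Suc n) \<boxdot>\<^sub>S X"

text \<open>The canonical arrow \<open>pw n \<otimes> X \<rightarrow> pw (n + 1)\<close>; the case \<open>n = 0\<close> is special because we want
 \<open>pw 1 = X\<close> on the nose.\<close>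

definition pk :: "('o, 'a, 'z) smc_scheme => 'o => nat => 'a" where
 "pk S X n = (if n = 0 then LUnit S X else Ide S (pw S X (Suc n)))"

text \<open>The canonical isomorphism from the product of \<open>pw S X a\<close> and
  \<open>pw S X b\<close> to \<open>pw S X (a + b)\<close>: the last factor \<open>X\<close> is
  split off by the inverse of \<open>pk\<close>, reassociated and put back.\<close>

primrec pt :: "('o, 'a, 'z) smc_scheme => 'o => nat => nat => 'a" where
 "pt S X a 0 = RUnit S (pw S X a)"
| "pt S X a (Suc b) = pk S X (a + b) \<cdot>\<^sub>S ((pt S X a b \<boxtimes>\<^sub>S Ide S X) \<cdot>\<^sub>S
   (Inv S (Assoc S (pw S X a) (pw S X b) X) \<cdot>\<^sub>S (Ide S (pw S X a) \<boxtimes>\<^sub>S Inv S (pk S X b))))"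

context symmetric_monoidal_category
begin

text \<open>The third claim serves evaluation at 1: a multiplication on the product of
  \<open>X\<close> with itself is then literally the value of an algebra on
  \<open>q_m\<close>.\<close>

lemma power_system:
 assumes X [simp]: "X : Obj S"
 shows "tensor_system S (pw S X) (%(a, b). pt S X a b) (Ide S (TUnit S))"
  and "pt S X a b : canonical_arrows S"
  and "pt S X 1 1 = Ide S (X \<boxdot> X)"
proof -
 let ?A = "pw S X" and ?k = "pk S X" and ?t = "pt S X"
 have "?A n : Obj S & ?A (Suc n) : Obj S" for n by (induction n) auto
 then have A [simp]: "?A n : Obj S" for n by blast
 have k [simp]: "?k n : Arr S" "Dom S (?k n) = ?A n \<boxdot> X" "Cod S (?k n) = ?A (Suc n)" "iso_arr S (?k n)"
  and kc: "?k n : canonical_arrows S" for n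
  by (cases n; auto simp: pk_def intro: canonical_arrows.intros)+
 have t [simp]: "?t a b : Arr S" "Dom S (?t a b) = ?A a \<boxdot> ?A b" "Cod S (?t a b) = ?A (a + b)" "iso_arr S (?t a b)" for a b
  by (induction b) (auto intro!: iso_Comp iso_tensor iso_Inv)
 have tc: "?t a b : canonical_arrows S" for a b
  by (induction b) (auto intro!: canonical_arrows.intros kc)
 then show "?t a b : canonical_arrows S" .
 \<comment> \<open>The recursion of \<open>pt\<close> freed of inverses, the form in which the
   successor case is used below.\<close>
 have P1: "?t a (Suc b) \<cdot> ((Ide S (?A a) \<boxtimes> ?k b) \<cdot> Assoc S (?A a) (?A b) X) = ?k (a + b) \<cdot> (?t a b \<boxtimes> Ide S X)" for a b
  by (simp add: ar_assoc ar_tensor_Comp' TArr_Ide)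
 have assoc: "?t (a + b) c \<cdot> (?t a b \<boxtimes> Ide S (?A c)) =
   ?t a (b + c) \<cdot> (Ide S (?A a) \<boxtimes> ?t b c) \<cdot> Assoc S (?A a) (?A b) (?A c)" for a b c
 proof (induction c)
  case 0
  show ?case using RUnit_nat[of "?t a b"] RUnit_tensor[of "?A a" "?A b"] by (simp add: ar_assoc)
 next
  case (Suc c)
  let ?a = "?A a" and ?b = "?A b" and ?c = "?A c"
  \<comment> \<open>Both sides are compared after splitting the power at \<open>Suc c\<close> into
    the power at \<open>c\<close> and one factor \<open>X\<close>; the pentagon then reduces the
    claim to the induction hypothesis tensored with \<open>X\<close>.\<close>
  let ?Y = "((Ide S ?a \<boxtimes> Ide S ?b) \<boxtimes> ?k c) \<cdot> Assoc S (?a \<boxdot> ?b) ?c X"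
  have IH: "?t (a + b) c \<cdot> (?t a b \<boxtimes> Ide S ?c) = ?t a (b + c) \<cdot> ((Ide S ?a \<boxtimes> ?t b c) \<cdot> Assoc S ?a ?b ?c)"
   using Suc by (simp add: ar_assoc)
  have "(?t (a + b) (Suc c) \<cdot> (?t a b \<boxtimes> Ide S (?A (Suc c)))) \<cdot> ?Y =
    ?t (a + b) (Suc c) \<cdot> ((Ide S (?A (a + b)) \<boxtimes> ?k c) \<cdot> ((?t a b \<boxtimes> (Ide S ?c \<boxtimes> Ide S X)) \<cdot> Assoc S (?a \<boxdot> ?b) ?c X))"
   by (simp add: ar_assoc ar_tensor_Comp' TArr_Ide del: pt.simps)
  also have "(?t a b \<boxtimes> (Ide S ?c \<boxtimes> Ide S X)) \<cdot> Assoc S (?a \<boxdot> ?b) ?c X =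
    Assoc S (?A (a + b)) ?c X \<cdot> ((?t a b \<boxtimes> Ide S ?c) \<boxtimes> Ide S X)"
   using Assoc_nat[of "?t a b" "Ide S ?c" "Ide S X"] by simp
  also have "?t (a + b) (Suc c) \<cdot> ((Ide S (?A (a + b)) \<boxtimes> ?k c) \<cdot> (Assoc S (?A (a + b)) ?c X \<cdot> ((?t a b \<boxtimes> Ide S ?c) \<boxtimes> Ide S X)))
    = (?t (a + b) (Suc c) \<cdot> ((Ide S (?A (a + b)) \<boxtimes> ?k c) \<cdot> Assoc S (?A (a + b)) ?c X)) \<cdot> ((?t a b \<boxtimes> Ide S ?c) \<boxtimes> Ide S X)"
   by (simp add: ar_assoc del: pt.simps)
  also have "... = ?k (a + b + c) \<cdot> ((?t (a + b) c \<cdot> (?t a b \<boxtimes> Ide S ?c)) \<boxtimes> Ide S X)"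
   unfolding P1 by (simp add: ar_assoc ar_tensor_Comp)
  finally have L: "(?t (a + b) (Suc c) \<cdot> (?t a b \<boxtimes> Ide S (?A (Suc c)))) \<cdot> ?Y =
    ?k (a + b + c) \<cdot> ((?t (a + b) c \<cdot> (?t a b \<boxtimes> Ide S ?c)) \<boxtimes> Ide S X)" .
  have "(?t a (b + Suc c) \<cdot> ((Ide S ?a \<boxtimes> ?t b (Suc c)) \<cdot> Assoc S ?a ?b (?A (Suc c)))) \<cdot> ?Y =
    ?t a (b + Suc c) \<cdot> ((Ide S ?a \<boxtimes> ?t b (Suc c)) \<cdot> ((Assoc S ?a ?b (?A (Suc c)) \<cdot> ((Ide S ?a \<boxtimes> Ide S ?b) \<boxtimes> ?k c)) \<cdot> Assoc S (?a \<boxdot> ?b) ?c X))"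
   by (simp add: ar_assoc del: pt.simps)
  also have "Assoc S ?a ?b (?A (Suc c)) \<cdot> ((Ide S ?a \<boxtimes> Ide S ?b) \<boxtimes> ?k c) = (Ide S ?a \<boxtimes> (Ide S ?b \<boxtimes> ?k c)) \<cdot> Assoc S ?a ?b (?c \<boxdot> X)"
   using Assoc_nat[of "Ide S ?a" "Ide S ?b" "?k c"] by simp
  also have "((Ide S ?a \<boxtimes> (Ide S ?b \<boxtimes> ?k c)) \<cdot> Assoc S ?a ?b (?c \<boxdot> X)) \<cdot> Assoc S (?a \<boxdot> ?b) ?c X =
    (Ide S ?a \<boxtimes> (Ide S ?b \<boxtimes> ?k c)) \<cdot> ((Ide S ?a \<boxtimes> Assoc S ?b ?c X) \<cdot> (Assoc S ?a (?b \<boxdot> ?c) X \<cdot> (Assoc S ?a ?b ?c \<boxtimes> Ide S X)))"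
   by (simp add: pentagon' ar_assoc)
  also have "(Ide S ?a \<boxtimes> ?t b (Suc c)) \<cdot> ... =
    (Ide S ?a \<boxtimes> (?t b (Suc c) \<cdot> ((Ide S ?b \<boxtimes> ?k c) \<cdot> Assoc S ?b ?c X))) \<cdot> (Assoc S ?a (?b \<boxdot> ?c) X \<cdot> (Assoc S ?a ?b ?c \<boxtimes> Ide S X))"
   by (simp add: ar_assoc ar_tensor_Comp' del: pt.simps)
  also have "... = (Ide S ?a \<boxtimes> ?k (b + c)) \<cdot> (((Ide S ?a \<boxtimes> (?t b c \<boxtimes> Ide S X)) \<cdot> Assoc S ?a (?b \<boxdot> ?c) X) \<cdot> (Assoc S ?a ?b ?c \<boxtimes> Ide S X))"
   unfolding P1 by (simp add: ar_assoc ar_tensor_Comp')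
  also have "(Ide S ?a \<boxtimes> (?t b c \<boxtimes> Ide S X)) \<cdot> Assoc S ?a (?b \<boxdot> ?c) X = Assoc S ?a (?A (b + c)) X \<cdot> ((Ide S ?a \<boxtimes> ?t b c) \<boxtimes> Ide S X)"
   using Assoc_nat[of "Ide S ?a" "?t b c" "Ide S X"] by simp
  also have "?t a (b + Suc c) \<cdot> ((Ide S ?a \<boxtimes> ?k (b + c)) \<cdot> ((Assoc S ?a (?A (b + c)) X \<cdot> ((Ide S ?a \<boxtimes> ?t b c) \<boxtimes> Ide S X)) \<cdot> (Assoc S ?a ?b ?c \<boxtimes> Ide S X)))
    = (?t a (Suc (b + c)) \<cdot> ((Ide S ?a \<boxtimes> ?k (b + c)) \<cdot> Assoc S ?a (?A (b + c)) X)) \<cdot> (((Ide S ?a \<boxtimes> ?t b c) \<cdot> Assoc S ?a ?b ?c) \<boxtimes> Ide S X)"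
   by (simp add: ar_assoc ar_tensor_Comp del: pt.simps)
  also have "... = ?k (a + b + c) \<cdot> ((?t a (b + c) \<cdot> ((Ide S ?a \<boxtimes> ?t b c) \<cdot> Assoc S ?a ?b ?c)) \<boxtimes> Ide S X)"
   unfolding P1 by (simp add: ar_assoc ar_tensor_Comp add.assoc)
  finally have "(?t (a + b) (Suc c) \<cdot> (?t a b \<boxtimes> Ide S (?A (Suc c)))) \<cdot> ?Y =
    (?t a (b + Suc c) \<cdot> ((Ide S ?a \<boxtimes> ?t b (Suc c)) \<cdot> Assoc S ?a ?b (?A (Suc c)))) \<cdot> ?Y"
   unfolding L IH by simp
  then have "?t (a + b) (Suc c) \<cdot> (?t a b \<boxtimes> Ide S (?A (Suc c))) =
    ?t a (b + Suc c) \<cdot> ((Ide S ?a \<boxtimes> ?t b (Suc c)) \<cdot> Assoc S ?a ?b (?A (Suc c)))"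
   by (rule iso_cancel_right[rotated -1]) (simp_all add: iso_Comp add.assoc del: pt.simps)
  then show ?case by (simp add: ar_assoc add.assoc del: pt.simps)
 qed
 have lunit: "?t 0 a = LUnit S (?A a)" for a
 proof (induction a)
  case 0
  show ?case by (simp add: LUnit_RUnit)
 next
  case (Suc a)
  let ?Y = "(Ide S (TUnit S) \<boxtimes> ?k a) \<cdot> Assoc S (TUnit S) (?A a) X"
  have "?t 0 (Suc a) \<cdot> ?Y = ?k a \<cdot> (LUnit S (?A a \<boxdot> X) \<cdot> Assoc S (TUnit S) (?A a) X)"
   using P1[of 0 a] Suc by (simp add: LUnit_tensor)
  also have "... = (?k a \<cdot> LUnit S (?A a \<boxdot> X)) \<cdot> Assoc S (TUnit S) (?A a) X"
   by (simp add: ar_assoc)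
  also have "?k a \<cdot> LUnit S (?A a \<boxdot> X) = LUnit S (?A (Suc a)) \<cdot> (Ide S (TUnit S) \<boxtimes> ?k a)"
   using LUnit_nat[of "?k a"] by simp
  also have "LUnit S (?A (Suc a)) \<cdot> (Ide S (TUnit S) \<boxtimes> ?k a) \<cdot> Assoc S (TUnit S) (?A a) X = LUnit S (?A (Suc a)) \<cdot> ?Y"
   by (simp add: ar_assoc)
  finally show ?case by (rule iso_cancel_right[rotated -1]) (simp_all add: iso_Comp del: pt.simps)
 qed
 show "tensor_system S ?A (%(a, b). ?t a b) (Ide S (TUnit S))"
 proof
  fix a b c
  show "(case (a + b, c) of (a, b) => ?t a b) \<cdot> ((case (a, b) of (a, b) => ?t a b) \<boxtimes> Ide S (?A c)) =
    (case (a, b + c) of (a, b) => ?t a b) \<cdot> (Ide S (?A a) \<boxtimes> (case (b, c) of (a, b) => ?t a b)) \<cdot> Assoc S (?A a) (?A b) (?A c)"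
   using assoc[of a b c] by simp
 qed (auto simp: Hom_iff lunit TArr_Ide)
 \<comment> \<open>Since \<open>pk\<close> at 0 is the left unit constraint, the recursion for this
   comparison is the triangle identity.\<close>
 have "?t (Suc 0) (Suc 0) \<cdot> ((Ide S X \<boxtimes> LUnit S X) \<cdot> Assoc S X (TUnit S) X) =
   Ide S (X \<boxdot> X) \<cdot> ((Ide S X \<boxtimes> LUnit S X) \<cdot> Assoc S X (TUnit S) X)"
  using P1[of "Suc 0" 0] triangle[of X X] by (simp add: pk_def del: pt.simps(2))
 then have "?t (Suc 0) (Suc 0) = Ide S (X \<boxdot> X)"
  by (rule iso_cancel_right[rotated -1]) (simp_all add: iso_Comp del: pt.simps)
 then show "?t 1 1 = Ide S (X \<boxdot> X)" by simp
qed

end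

section \<open>Algebras over a PROP as strict functors\<close>

locale prop_shape = prop_ops T for T :: "(nat, 'p, 'z) smc_scheme" (structure) +
 assumes shape [simp]: "Obj T = UNIV" "TObj T = (+)" "TUnit T = 0" "LUnit T = Ide T" "RUnit T = Ide T"
  and shape_Assoc [simp]: "Assoc T a b c = Ide T (a + b + c)"

definition hat :: "(nat, 'p, 'z) smc_scheme => ('p => 'a) => 'p => (nat, 'a) mor" where
 "hat T F f = Mor (Dom T f) (Cod T f) (F f)"

text \<open>Multiplying by the inverse of \<open>FTens\<close> turns the squares that express
  compatibility with tensor products and symmetries into preservation on the nose in
  \<open>endo\<close>. What remains of an algebra is its tensor system with canonical structure
  maps.\<close>

lemma (in prop_shape) ssmf_iff:
 assumes S: "symmetric_monoidal_category S"
 shows "symmetric_strict_monoidal_functor T S F <->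
  tensor_system S (FObj F) (FTens F) (FUnit F) & FUnit F : canonical_arrows S &
  (\<forall>ab. FTens F ab : canonical_arrows S) &
  prop_map T (endo S (FObj F) (FTens F)) (hat T (FArr F))"
  (is "?L <-> ?R")
proof -
 interpret S: symmetric_monoidal_category S by (rule S)
 let ?A = "FObj F" and ?t = "FTens F" and ?u = "FUnit F" and ?f = "FArr F"
 let ?P = "endo S ?A ?t"
 show ?thesis
 proof
  assume L: ?L
  have fn: "is_functor T S F" using L by (simp add: symmetric_strict_monoidal_functor_def)
  have fI: "?f (Ide T n) = Ide S (?A n)" for n using fn by (simp add: is_functor_def)
  have fC: "?f (g \<cdot> f) = ?f g \<cdot>\<^sub>S ?f f" if "f : Arr T" "g : Arr T" "Dom T g = Cod T f" for f g
   using fn that by (simp add: is_functor_def)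
  have fA [simp]: "?f f : Arr S" "Dom S (?f f) = ?A (Dom T f)" "Cod S (?f f) = ?A (Cod T f)" if "f : Arr T" for f
   using fn that by (auto simp: is_functor_def S.Hom_iff)
  have A [simp]: "?A n : Obj S" for n using fn by (simp add: is_functor_def)
  have t [simp]: "?t (a, b) : Arr S" "Dom S (?t (a, b)) = ?A a \<boxdot>\<^sub>S ?A b" "Cod S (?t (a, b)) = ?A (a + b)"
   and tc: "?t (a, b) : canonical_arrows S" for a b
   using L by (auto simp: symmetric_strict_monoidal_functor_def S.Hom_iff)
  have u [simp]: "?u : Arr S" "Dom S ?u = TUnit S" "Cod S ?u = ?A 0" and uc: "?u : canonical_arrows S"
   using L by (auto simp: symmetric_strict_monoidal_functor_def S.Hom_iff)
  interpret X: tensor_system S ?A ?t ?u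
  proof
   fix a b c
   show "iso_arr S (?t (a, b))" by (rule S.canonical_iso[OF tc])
   show "iso_arr S ?u" by (rule S.canonical_iso[OF uc])
   have "?f (Ide T (a + b + c)) \<cdot>\<^sub>S ?t (a + b, c) \<cdot>\<^sub>S (?t (a, b) \<boxtimes>\<^sub>S Ide S (?A c)) =
    ?t (a, b + c) \<cdot>\<^sub>S (Ide S (?A a) \<boxtimes>\<^sub>S ?t (b, c)) \<cdot>\<^sub>S Assoc S (?A a) (?A b) (?A c)"
    using L by (simp add: symmetric_strict_monoidal_functor_def)
   then show "?t (a + b, c) \<cdot>\<^sub>S (?t (a, b) \<boxtimes>\<^sub>S Ide S (?A c)) =
    ?t (a, b + c) \<cdot>\<^sub>S (Ide S (?A a) \<boxtimes>\<^sub>S ?t (b, c)) \<cdot>\<^sub>S Assoc S (?A a) (?A b) (?A c)"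
    by (simp add: fI)
   have "?f (Ide T a) \<cdot>\<^sub>S ?t (0, a) \<cdot>\<^sub>S (?u \<boxtimes>\<^sub>S Ide S (?A a)) = LUnit S (?A a)"
    "?f (Ide T a) \<cdot>\<^sub>S ?t (a, 0) \<cdot>\<^sub>S (Ide S (?A a) \<boxtimes>\<^sub>S ?u) = RUnit S (?A a)"
    using L by (simp_all add: symmetric_strict_monoidal_functor_def)
   then show "?t (0, a) \<cdot>\<^sub>S (?u \<boxtimes>\<^sub>S Ide S (?A a)) = LUnit S (?A a)"
    "?t (a, 0) \<cdot>\<^sub>S (Ide S (?A a) \<boxtimes>\<^sub>S ?u) = RUnit S (?A a)"
    by (simp_all add: fI)
  qed (auto simp: S.Hom_iff)
  have "prop_map T ?P (hat T ?f)"
   unfolding prop_map_def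
  proof (intro conjI ballI allI impI)
   fix f g assume fg: "f : Arr T" "g : Arr T"
   have "?f (f \<boxtimes> g) \<cdot>\<^sub>S ?t (Dom T f, Dom T g) = ?t (Cod T f, Cod T g) \<cdot>\<^sub>S (?f f \<boxtimes>\<^sub>S ?f g)"
    using L fg by (simp add: symmetric_strict_monoidal_functor_def)
   then have "?f (f \<boxtimes> g) \<cdot>\<^sub>S ?t (Dom T f, Dom T g) \<cdot>\<^sub>S Inv S (?t (Dom T f, Dom T g)) =
     ?t (Cod T f, Cod T g) \<cdot>\<^sub>S (?f f \<boxtimes>\<^sub>S ?f g) \<cdot>\<^sub>S Inv S (?t (Dom T f, Dom T g))" by simp
   then show "hat T ?f (f \<boxtimes> g) = hat T ?f f \<boxtimes>\<^sub>?P hat T ?f g"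
    using fg by (simp add: hat_def S.ar_assoc TArr_Arr)
  next
   fix a b
   have "?f (Sym T a b) \<cdot>\<^sub>S ?t (a, b) = ?t (b, a) \<cdot>\<^sub>S Sym S (?A a) (?A b)"
    using L by (simp add: symmetric_strict_monoidal_functor_def)
   then have "?f (Sym T a b) \<cdot>\<^sub>S ?t (a, b) \<cdot>\<^sub>S Inv S (?t (a, b)) = ?t (b, a) \<cdot>\<^sub>S Sym S (?A a) (?A b) \<cdot>\<^sub>S Inv S (?t (a, b))"
    by simp
   then show "hat T ?f (Sym T a b) = Sym ?P a b"
    by (simp add: hat_def S.ar_assoc)
  qed (auto simp: hat_def X.endo_Arr fI fC)
  then show ?R using X.tensor_system_axioms tc uc by auto
 next
  assume R: ?R
  then interpret X: tensor_system S ?A ?t ?u by blast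
  have pm: "prop_map T ?P (hat T ?f)" using R by blast
  have fA [simp]: "?f f : Arr S" "Dom S (?f f) = ?A (Dom T f)" "Cod S (?f f) = ?A (Cod T f)" if "f : Arr T" for f
   using pm that by (auto simp: prop_map_def hat_def X.endo_Arr)
  have fI [simp]: "?f (Ide T n) = Ide S (?A n)" for n using pm by (simp add: prop_map_def hat_def)
  have fC: "?f (g \<cdot> f) = ?f g \<cdot>\<^sub>S ?f f" if "f : Arr T" "g : Arr T" "Dom T g = Cod T f" for f g
   using pm that by (simp add: prop_map_def hat_def)
  have fT: "?f (f \<boxtimes> g) = ?t (Cod T f, Cod T g) \<cdot>\<^sub>S ((?f f \<boxtimes>\<^sub>S ?f g) \<cdot>\<^sub>S Inv S (?t (Dom T f, Dom T g)))"
   if "f : Arr T" "g : Arr T" for f g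
   using pm that by (simp add: prop_map_def hat_def)
  have fS: "?f (Sym T a b) = ?t (b, a) \<cdot>\<^sub>S (Sym S (?A a) (?A b) \<cdot>\<^sub>S Inv S (?t (a, b)))" for a b
   using pm by (simp add: prop_map_def hat_def)
  have "is_functor T S F" by (simp add: is_functor_def S.Hom_iff fC)
  then show ?L
   unfolding symmetric_strict_monoidal_functor_def
   using R X.t_assoc X.t_lunit X.t_runit by (simp add: S.Hom_iff fT fS S.ar_assoc)
 qed
qed

definition alg_of :: "(nat, 'p, 'y) smc_scheme => (nat => 'o) => (nat \<times> nat => 'a) => 'a => ('p => (nat, 'a) mor) =>
  (nat, 'p, 'o, 'a) monfunctor" where
 "alg_of T A t u H = \<lparr>FObj = A, FArr = (\<lambda>f \<in> Arr T. under (H f)), FTens = t, FUnit = u\<rparr>"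

lemma (in prop_shape) Alg_Obj:
 "F : Obj (Alg T S) <-> symmetric_strict_monoidal_functor T S F & FArr F : extensional (Arr T)"
 by (auto simp: Alg_def Let_def extensional_def)

lemma (in prop_shape) alg_of_Alg:
 assumes S: "symmetric_monoidal_category S" and X: "tensor_system S A t u"
  and c: "u : canonical_arrows S" "!!a b. t (a, b) : canonical_arrows S"
  and H: "prop_map T (endo S A t) H"
 shows "alg_of T A t u H : Obj (Alg T S)"
proof -
 have h: "hat T (\<lambda>f \<in> Arr T. under (H f)) f = H f" if "f : Arr T" for f
  using H that by (intro mor.expand) (simp add: hat_def prop_map_def)
 have "prop_map T (endo S A t) (hat T (\<lambda>f \<in> Arr T. under (H f)))"
  using H unfolding prop_map_def
  by (simp add: h Comp_Arr TArr_Arr del: endo_sel)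
 then show ?thesis
  unfolding Alg_Obj ssmf_iff[OF S] using X c by (auto simp: alg_of_def)
qed

section \<open>Monoidal transformations\<close>

locale system_pair = X: tensor_system S A t u + Y: tensor_system S B s v
 for S :: "('o, 'a, 'z) smc_scheme" (structure) and A t u B s v
begin

definition mono_tr :: "(nat => 'a) => bool" where
 "mono_tr th <-> (\<forall>n. th n : Arr S & Dom S (th n) = A n & Cod S (th n) = B n) &
   (\<forall>a b. th (a + b) \<cdot> t (a, b) = s (a, b) \<cdot> (th a \<boxtimes> th b)) & th 0 \<cdot> u = v"

text \<open>\<open>t (n, 1)\<close> is invertible, so the component at \<open>n + 1\<close> is
  forced by those at \<open>n\<close> and at 1, and the component at 0 is forced by
  \<open>u\<close>.\<close>

lemma mono_tr_unique:
 assumes "mono_tr th" "mono_tr th'" "th 1 = th' 1"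
 shows "th n = th' n"
proof (induction n)
 case 0
 show ?case
  by (rule X.iso_cancel_right[of u]) (use assms in "auto simp: mono_tr_def")
next
 case (Suc n)
 have *: "th (n + 1) \<cdot> t (n, 1) = th' (n + 1) \<cdot> t (n, 1)"
  using assms Suc unfolding mono_tr_def by metis
 have "th (n + 1) = th' (n + 1)"
  by (rule X.iso_cancel_right[OF X.t_iso _ _ _ _ *]) (use assms in "simp_all add: mono_tr_def")
 then show ?case by simp
qed

text \<open>The recursion that the equation of \<open>mono_tr\<close> at \<open>(n, 1)\<close>
  forces on a family with \<open>h\<close> at 1.\<close>

primrec ext :: "'a => nat => 'a" where
 "ext h 0 = v \<cdot> Inv S u"
| "ext h (Suc n) = s (n, 1) \<cdot> ((ext h n \<boxtimes> h) \<cdot> Inv S (t (n, 1)))"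

text \<open>Monoidality at \<open>(n, 1)\<close> holds by construction, and induction on
  \<open>b\<close> with \<open>t_assoc\<close> gives it at \<open>(a, b)\<close>. That
  \<open>ext h 1\<close> is \<open>h\<close> again comes from the left unit law, since the recursion
  starts at 0.\<close>

lemma ext_mono_tr:
 assumes h: "h : Arr S" "Dom S h = A 1" "Cod S h = B 1"
 shows "mono_tr (ext h)" "ext h 1 = h"
proof -
 let ?e = "ext h"
 have h' [simp]: "h : Arr S" "Dom S h = A (Suc 0)" "Cod S h = B (Suc 0)" using h by auto
 have e [simp]: "?e n : Arr S" "Dom S (?e n) = A n" "Cod S (?e n) = B n" for n
  by (induction n) auto
 have eS: "?e (Suc n) \<cdot> t (n, Suc 0) = s (n, Suc 0) \<cdot> (?e n \<boxtimes> h)" for n by (simp add: X.ar_assoc)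
 have e0: "?e 0 \<cdot> u = v" by (simp add: X.ar_assoc)
 have "?e 1 \<cdot> LUnit S (A 1) = s (0, 1) \<cdot> ((?e 0 \<boxtimes> h) \<cdot> (u \<boxtimes> Ide S (A 1)))"
  unfolding X.t_lunit[symmetric] by (simp add: X.ar_assoc)
 also have "... = (s (0, 1) \<cdot> (v \<boxtimes> Ide S (B 1))) \<cdot> (Ide S (TUnit S) \<boxtimes> h)"
  by (simp add: X.ar_assoc X.ar_tensor_Comp)
 also have "... = h \<cdot> LUnit S (A 1)"
  unfolding Y.t_lunit using X.LUnit_nat[of h] by simp
 finally show "?e 1 = h" by (rule X.iso_cancel_right[rotated -1]) (simp_all del: ext.simps)
 have "?e (a + b) \<cdot> t (a, b) = s (a, b) \<cdot> (?e a \<boxtimes> ?e b)" for a b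
 proof (induction b)
  case 0
  have "?e a \<cdot> t (a, 0) \<cdot> (Ide S (A a) \<boxtimes> u) = ?e a \<cdot> (t (a, 0) \<cdot> (Ide S (A a) \<boxtimes> u))"
   by (rule X.ar_assoc) simp_all
  also have "... = ?e a \<cdot> RUnit S (A a)" unfolding X.t_runit ..
  also have "... = (s (a, 0) \<cdot> (Ide S (B a) \<boxtimes> v)) \<cdot> (?e a \<boxtimes> Ide S (TUnit S))"
   unfolding Y.t_runit using X.RUnit_nat[of "?e a"] by simp
  also have "... = s (a, 0) \<cdot> (?e a \<boxtimes> ?e 0) \<cdot> (Ide S (A a) \<boxtimes> u)"
   using e0 by (simp add: X.ar_assoc X.ar_tensor_Comp del: ext.simps)
  finally have "?e a \<cdot> t (a, 0) = s (a, 0) \<cdot> (?e a \<boxtimes> ?e 0)"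
   by (rule X.iso_cancel_right[rotated -1]) (simp_all del: ext.simps)
  then show ?case by simp
 next
  case (Suc b)
  let ?C = "Assoc S (A a) (A b) (A (Suc 0))" and ?D = "Assoc S (B a) (B b) (B (Suc 0))"
  let ?Y = "(Ide S (A a) \<boxtimes> t (b, Suc 0)) \<cdot> ?C"
  have "?e (a + Suc b) \<cdot> t (a, Suc b) \<cdot> ?Y = ?e (Suc (a + b)) \<cdot> (t (a, b + Suc 0) \<cdot> ?Y)"
   by (simp add: X.ar_assoc del: ext.simps)
  also have "... = (?e (Suc (a + b)) \<cdot> t (a + b, Suc 0)) \<cdot> (t (a, b) \<boxtimes> Ide S (A (Suc 0)))"
   unfolding X.t_assoc'[symmetric] by (simp add: X.ar_assoc del: ext.simps)
  also have "... = s (a + b, Suc 0) \<cdot> ((?e (a + b) \<cdot> t (a, b)) \<boxtimes> h)"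
   unfolding eS by (simp add: X.ar_assoc X.ar_tensor_Comp)
  also have "... = (s (a + b, Suc 0) \<cdot> (s (a, b) \<boxtimes> Ide S (B (Suc 0)))) \<cdot> ((?e a \<boxtimes> ?e b) \<boxtimes> h)"
   unfolding Suc by (simp add: X.ar_assoc X.ar_tensor_Comp)
  also have "... = s (a, b + Suc 0) \<cdot> ((Ide S (B a) \<boxtimes> s (b, Suc 0)) \<cdot> (?D \<cdot> ((?e a \<boxtimes> ?e b) \<boxtimes> h)))"
   unfolding Y.t_assoc' by (simp add: X.ar_assoc)
  also have "?D \<cdot> ((?e a \<boxtimes> ?e b) \<boxtimes> h) = (?e a \<boxtimes> (?e b \<boxtimes> h)) \<cdot> ?C"
   using X.Assoc_nat[of "?e a" "?e b" h] by simp
  also have "s (a, b + Suc 0) \<cdot> ((Ide S (B a) \<boxtimes> s (b, Suc 0)) \<cdot> ((?e a \<boxtimes> (?e b \<boxtimes> h)) \<cdot> ?C)) =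
    s (a, b + Suc 0) \<cdot> ((?e a \<boxtimes> (s (b, Suc 0) \<cdot> (?e b \<boxtimes> h))) \<cdot> ?C)"
   by (simp add: X.ar_tensor_Comp')
  also have "(?e a \<boxtimes> (s (b, Suc 0) \<cdot> (?e b \<boxtimes> h))) \<cdot> ?C = (?e a \<boxtimes> ?e (Suc b)) \<cdot> ?Y"
   by (subst X.ar_tensor_Comp') (simp_all add: eS del: ext.simps)
  also have "s (a, b + Suc 0) \<cdot> ((?e a \<boxtimes> ?e (Suc b)) \<cdot> ?Y) = s (a, b + Suc 0) \<cdot> (?e a \<boxtimes> ?e (Suc b)) \<cdot> ?Y"
   by (rule X.ar_assoc[symmetric]) (simp_all del: ext.simps)
  finally have "?e (a + Suc b) \<cdot> t (a, Suc b) = s (a, Suc b) \<cdot> (?e a \<boxtimes> ?e (Suc b))"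
   unfolding add_Suc_right add_0_right
   by (rule X.iso_cancel_right[rotated -1]) (simp_all add: X.iso_Comp del: ext.simps)
  then show ?case .
 qed
 then show "mono_tr ?e" using e e0 by (simp add: mono_tr_def)
qed

text \<open>Naturality at one pair of arrows. By the lemmas that follow, it is stable under the
  operations of a PROP, so that naturality can be checked on generators.\<close>

definition nat_at :: "(nat => 'a) => (nat, 'a) mor => (nat, 'a) mor => bool" where
 "nat_at th f g <-> under g \<cdot> th (src f) = th (tgt f) \<cdot> under f"

lemma nat_at_Ide: "mono_tr th ==> nat_at th (Ide X.P n) (Ide Y.P n)"
 by (simp add: nat_at_def mono_tr_def)

lemma nat_at_Comp:
 assumes th: "mono_tr th" and f: "f : Arr X.P" "f' : Arr X.P" "src f' = tgt f"
  and g: "g : Arr Y.P" "g' : Arr Y.P" "src g = src f" "tgt g = tgt f" "src g' = src f'" "tgt g' = tgt f'"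
  and n: "nat_at th f g" "nat_at th f' g'"
 shows "nat_at th (f' \<cdot>\<^sub>X.P f) (g' \<cdot>\<^sub>Y.P g)"
proof -
 have a: "th n : Arr S" "Dom S (th n) = A n" "Cod S (th n) = B n" for n using th by (auto simp: mono_tr_def)
 have "under g' \<cdot> under g \<cdot> th (src f) = under g' \<cdot> (under g \<cdot> th (src f))"
  using f g a by (simp add: X.endo_Arr Y.endo_Arr X.ar_assoc)
 also have "... = (under g' \<cdot> th (src f')) \<cdot> under f"
  using f g a n(1) by (simp add: nat_at_def X.endo_Arr Y.endo_Arr X.ar_assoc)
 also have "... = th (tgt f') \<cdot> (under f' \<cdot> under f)"
  using f g a n(2) by (simp add: nat_at_def X.endo_Arr Y.endo_Arr X.ar_assoc)
 finally show ?thesis by (simp add: nat_at_def)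
qed

lemma nat_at_TArr:
 assumes th: "mono_tr th" and f: "f : Arr X.P" "f' : Arr X.P"
  and g: "g : Arr Y.P" "g' : Arr Y.P" "src g = src f" "tgt g = tgt f" "src g' = src f'" "tgt g' = tgt f'"
  and n: "nat_at th f g" "nat_at th f' g'"
 shows "nat_at th (f \<boxtimes>\<^sub>X.P f') (g \<boxtimes>\<^sub>Y.P g')"
proof -
 have a [simp]: "th n : Arr S" "Dom S (th n) = A n" "Cod S (th n) = B n" for n using th by (auto simp: mono_tr_def)
 have m: "th (a + b) \<cdot> t (a, b) = s (a, b) \<cdot> (th a \<boxtimes> th b)" for a b using th by (auto simp: mono_tr_def)
 have u [simp]: "under f : Arr S" "Dom S (under f) = A (src f)" "Cod S (under f) = A (tgt f)"
  "under f' : Arr S" "Dom S (under f') = A (src f')" "Cod S (under f') = A (tgt f')"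
  "under g : Arr S" "Dom S (under g) = B (src f)" "Cod S (under g) = B (tgt f)"
  "under g' : Arr S" "Dom S (under g') = B (src f')" "Cod S (under g') = B (tgt f')"
  using f g by (auto simp: X.endo_Arr Y.endo_Arr)
 let ?F = "under (f \<boxtimes>\<^sub>X.P f')" and ?G = "under (g \<boxtimes>\<^sub>Y.P g')"
 have FG [simp]: "?F : Arr S" "Dom S ?F = A (src f + src f')" "Cod S ?F = A (tgt f + tgt f')"
  "?G : Arr S" "Dom S ?G = B (src f + src f')" "Cod S ?G = B (tgt f + tgt f')" using g by simp_all
 have F: "?F \<cdot> t (src f, src f') = t (tgt f, tgt f') \<cdot> (under f \<boxtimes> under f')" by (rule X.under_TArr[OF f])
 have G: "?G \<cdot> s (src f, src f') = s (tgt f, tgt f') \<cdot> (under g \<boxtimes> under g')"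
  using Y.under_TArr[OF g(1,2)] unfolding g(3-6) .
 have "(?G \<cdot> th (src f + src f')) \<cdot> t (src f, src f') = ?G \<cdot> (s (src f, src f') \<cdot> (th (src f) \<boxtimes> th (src f')))"
  unfolding m[symmetric] by (rule X.ar_assoc) (simp_all only: FG a X.t_simps)
 also have "... = (?G \<cdot> s (src f, src f')) \<cdot> (th (src f) \<boxtimes> th (src f'))"
  by (rule X.ar_assoc[symmetric]) (simp_all only: FG a X.t_simps Y.t_simps X.ar_tensor)
 also have "... = s (tgt f, tgt f') \<cdot> ((under g \<cdot> th (src f)) \<boxtimes> (under g' \<cdot> th (src f')))"
  unfolding G by (simp add: X.ar_assoc X.ar_tensor_Comp)
 also have "... = (s (tgt f, tgt f') \<cdot> (th (tgt f) \<boxtimes> th (tgt f'))) \<cdot> (under f \<boxtimes> under f')"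
  using n unfolding nat_at_def by (simp add: X.ar_assoc X.ar_tensor_Comp)
 also have "... = th (tgt f + tgt f') \<cdot> (t (tgt f, tgt f') \<cdot> (under f \<boxtimes> under f'))"
  unfolding m[symmetric] by (simp add: X.ar_assoc)
 also have "... = (th (tgt f + tgt f') \<cdot> ?F) \<cdot> t (src f, src f')"
  unfolding F[symmetric] by (rule X.ar_assoc[symmetric]) (simp_all only: FG a X.t_simps)
 finally have "?G \<cdot> th (src f + src f') = th (tgt f + tgt f') \<cdot> ?F"
  by (rule X.iso_cancel_right[rotated -1]) (simp_all only: FG a X.t_simps X.t_iso X.ar_Comp)
 then show ?thesis by (simp only: nat_at_def endo_sel mor.sel)
qed

lemma nat_at_Sym:
 assumes th: "mono_tr th"
 shows "nat_at th (Sym X.P a b) (Sym Y.P a b)"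
proof -
 have a [simp]: "th n : Arr S" "Dom S (th n) = A n" "Cod S (th n) = B n" for n using th by (auto simp: mono_tr_def)
 have m: "th (a + b) \<cdot> t (a, b) = s (a, b) \<cdot> (th a \<boxtimes> th b)" for a b using th by (auto simp: mono_tr_def)
 let ?F = "under (Sym X.P a b)" and ?G = "under (Sym Y.P a b)"
 have FG [simp]: "?F : Arr S" "Dom S ?F = A (a + b)" "Cod S ?F = A (b + a)"
  "?G : Arr S" "Dom S ?G = B (a + b)" "Cod S ?G = B (b + a)" by simp_all
 have "(?G \<cdot> th (a + b)) \<cdot> t (a, b) = ?G \<cdot> (s (a, b) \<cdot> (th a \<boxtimes> th b))"
  unfolding m[symmetric] by (rule X.ar_assoc) (simp_all only: FG a X.t_simps)
 also have "... = (?G \<cdot> s (a, b)) \<cdot> (th a \<boxtimes> th b)"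
  by (rule X.ar_assoc[symmetric]) (simp_all only: FG a X.t_simps Y.t_simps X.ar_tensor)
 also have "... = s (b, a) \<cdot> (Sym S (B a) (B b) \<cdot> (th a \<boxtimes> th b))"
  unfolding Y.under_Sym by (simp add: X.ar_assoc)
 also have "Sym S (B a) (B b) \<cdot> (th a \<boxtimes> th b) = (th b \<boxtimes> th a) \<cdot> Sym S (A a) (A b)"
  using X.Sym_nat[of "th a" "th b"] by simp
 also have "s (b, a) \<cdot> ((th b \<boxtimes> th a) \<cdot> Sym S (A a) (A b)) = (s (b, a) \<cdot> (th b \<boxtimes> th a)) \<cdot> Sym S (A a) (A b)"
  by (simp add: X.ar_assoc)
 also have "... = th (b + a) \<cdot> (t (b, a) \<cdot> Sym S (A a) (A b))"
  unfolding m[symmetric] by (simp add: X.ar_assoc)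
 also have "... = (th (b + a) \<cdot> ?F) \<cdot> t (a, b)"
  unfolding X.under_Sym[symmetric] by (rule X.ar_assoc[symmetric]) (simp_all only: FG a X.t_simps)
 finally have "?G \<cdot> th (a + b) = th (b + a) \<cdot> ?F"
  by (rule X.iso_cancel_right[rotated -1]) (simp_all only: FG a X.t_simps X.t_iso X.ar_Comp)
 then show ?thesis by (simp only: nat_at_def endo_sel mor.sel)
qed

end

section \<open>Equivalences of categories\<close>

text \<open>Objects are hit exactly. The inverse functor chooses preimages, the counit is the
  identity, and the unit at \<open>a\<close> is the arrow over the identity of
  \<open>FObj E a\<close>, from \<open>a\<close> to the chosen preimage.\<close>

lemma equivalent_categoriesI:
 fixes E :: "('o, 'a, 'p, 'b) cfunctor"
 assumes C: "category C" and D: "category D" and E: "is_functor C D E"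
  and ff: "!!a b. a : Obj C ==> b : Obj C ==> bij_betw (FArr E) (Hom C a b) (Hom D (FObj E a) (FObj E b))"
  and surj: "!!d. d : Obj D ==> \<exists>c \<in> Obj C. FObj E c = d"
 shows "equivalent_categories C D"
proof -
 interpret C: category C by (rule C)
 interpret D: category D by (rule D)
 obtain g where g: "!!d. d : Obj D ==> g d : Obj C & FObj E (g d) = d"
  using surj by metis
 define l where "l a b f = inv_into (Hom C a b) (FArr E) f" for a b f
 have l: "l a b f : Hom C a b" "FArr E (l a b f) = f"
  if "a : Obj C" "b : Obj C" "f : Hom D (FObj E a) (FObj E b)" for a b f
  using ff[OF that(1,2)] that(3) unfolding l_def bij_betw_def by (metis inv_into_into, metis f_inv_into_f)
 have faithful: "x = y" if "a : Obj C" "b : Obj C" "x : Hom C a b" "y : Hom C a b" "FArr E x = FArr E y" for a b x y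
  using ff[OF that(1,2)] that(3-5) unfolding bij_betw_def inj_on_def by blast
 have EO: "FObj E a : Obj D" if "a : Obj C" for a using E that by (simp add: is_functor_def)
 have EI: "FArr E (Ide C a) = Ide D (FObj E a)" if "a : Obj C" for a using E that by (simp add: is_functor_def)
 have EH: "FArr E f : Hom D (FObj E a) (FObj E b)" if "f : Hom C a b" for a b f
  using E that by (auto simp: is_functor_def Hom_def)
 have EC: "FArr E (f' \<cdot>\<^sub>C f) = FArr E f' \<cdot>\<^sub>D FArr E f" if "f : Hom C a b" "f' : Hom C b c" for a b c f f'
  using E that by (auto simp: is_functor_def Hom_def)
 define Gr where "Gr = \<lparr>FObj = g, FArr = (%f. l (g (Dom D f)) (g (Cod D f)) f)\<rparr>"
 have GH: "FArr Gr f : Hom C (g a) (g b)" "FArr E (FArr Gr f) = f" if "f : Hom D a b" for f a b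
 proof -
  have ab: "Dom D f = a" "Cod D f = b" "a : Obj D" "b : Obj D"
   using that D.Dom_in_Obj D.Cod_in_Obj by (auto simp: Hom_def)
  show "FArr Gr f : Hom C (g a) (g b)" "FArr E (FArr Gr f) = f"
   using l[of "g a" "g b" f] g[OF ab(3)] g[OF ab(4)] that by (simp_all add: Gr_def ab)
 qed
 have functG: "is_functor D C Gr"
  unfolding is_functor_def
 proof (intro conjI ballI impI)
  fix a assume a: "a : Obj D"
  show "FObj Gr a : Obj C" using g[OF a] by (simp add: Gr_def)
  have "FArr Gr (Ide D a) = Ide C (g a)"
   using faithful[OF _ _ GH(1)[OF D.Ide_in_Hom[OF a]] C.Ide_in_Hom] g[OF a] GH(2)[OF D.Ide_in_Hom[OF a]] EI[of "g a"] by simp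
  then show "FArr Gr (Ide D a) = Ide C (FObj Gr a)" by (simp add: Gr_def)
 next
  fix f assume f: "f : Arr D"
  then show "FArr Gr f : Hom C (FObj Gr (Dom D f)) (FObj Gr (Cod D f))"
   using GH(1)[of f "Dom D f" "Cod D f"] by (simp add: Hom_def[of D] Gr_def)
 next
  fix f f' assume f: "f : Arr D" "f' : Arr D" "Dom D f' = Cod D f"
  let ?a = "Dom D f" and ?b = "Cod D f" and ?c = "Cod D f'"
  have h: "f : Hom D ?a ?b" "f' : Hom D ?b ?c" using f by (auto simp: Hom_def)
  have c: "f' \<cdot>\<^sub>D f : Hom D ?a ?c" by (rule D.Comp_in_Hom[OF h])
  show "FArr Gr (f' \<cdot>\<^sub>D f) = FArr Gr f' \<cdot>\<^sub>C FArr Gr f"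
  proof (rule faithful[of "g ?a" "g ?c"])
   show "g ?a : Obj C" "g ?c : Obj C" using f g D.Dom_in_Obj D.Cod_in_Obj by blast+
   show "FArr Gr (f' \<cdot>\<^sub>D f) : Hom C (g ?a) (g ?c)" by (rule GH(1)[OF c])
   show "FArr Gr f' \<cdot>\<^sub>C FArr Gr f : Hom C (g ?a) (g ?c)"
    by (rule C.Comp_in_Hom[OF GH(1)[OF h(1)] GH(1)[OF h(2)]])
   show "FArr E (FArr Gr (f' \<cdot>\<^sub>D f)) = FArr E (FArr Gr f' \<cdot>\<^sub>C FArr Gr f)"
    using GH(2)[OF c] GH(2)[OF h(1)] GH(2)[OF h(2)] EC[OF GH(1)[OF h(1)] GH(1)[OF h(2)]] by simp
  qed
 qed
 define eta where "eta a = l a (g (FObj E a)) (Ide D (FObj E a))" for a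
 have eta: "eta a : Hom C a (g (FObj E a))" "FArr E (eta a) = Ide D (FObj E a)" if "a : Obj C" for a
  using l[of a "g (FObj E a)" "Ide D (FObj E a)"] g[OF EO[OF that]] that D.Ide_in_Hom[OF EO[OF that]]
  by (simp_all add: eta_def)
 have nat1: "natural_transformation C C id_functor (comp_functor Gr E) eta"
  unfolding natural_transformation_def
 proof (intro conjI ballI)
  fix a assume "a : Obj C"
  then show "eta a : Hom C (FObj id_functor a) (FObj (comp_functor Gr E) a)"
   using eta by (simp add: id_functor_def comp_functor_def Gr_def)
 next
  fix f assume f: "f : Arr C"
  let ?a = "Dom C f" and ?b = "Cod C f"
  have ab: "?a : Obj C" "?b : Obj C" using f C.Dom_in_Obj C.Cod_in_Obj by blast+
  have h: "f : Hom C ?a ?b" using f by (simp add: Hom_def)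
  note Eh = EH[OF h]
  have "FArr Gr (FArr E f) \<cdot>\<^sub>C eta ?a = eta ?b \<cdot>\<^sub>C f"
  proof (rule faithful[of ?a "g (FObj E ?b)"])
   show "FArr Gr (FArr E f) \<cdot>\<^sub>C eta ?a : Hom C ?a (g (FObj E ?b))"
    by (rule C.Comp_in_Hom[OF eta(1)[OF ab(1)] GH(1)[OF Eh]])
   show "eta ?b \<cdot>\<^sub>C f : Hom C ?a (g (FObj E ?b))"
    by (rule C.Comp_in_Hom[OF h eta(1)[OF ab(2)]])
   show "FArr E (FArr Gr (FArr E f) \<cdot>\<^sub>C eta ?a) = FArr E (eta ?b \<cdot>\<^sub>C f)"
    unfolding EC[OF eta(1)[OF ab(1)] GH(1)[OF Eh]] EC[OF h eta(1)[OF ab(2)]] GH(2)[OF Eh] eta(2)[OF ab(1)] eta(2)[OF ab(2)]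
    using D.Comp_Ide[OF Eh] D.Ide_Comp[OF Eh] by simp
  qed (use ab g[OF EO] in auto)
  then show "FArr (comp_functor Gr E) f \<cdot>\<^sub>C eta ?a = eta ?b \<cdot>\<^sub>C FArr id_functor f"
   by (simp add: id_functor_def comp_functor_def)
 qed
 have iso1: "iso_arr C (eta a)" if a: "a : Obj C" for a
 proof -
  let ?b = "g (FObj E a)"
  have b: "?b : Obj C" "FObj E ?b = FObj E a" using g[OF EO[OF a]] by auto
  have i: "Ide D (FObj E a) : Hom D (FObj E a) (FObj E a)" by (rule D.Ide_in_Hom[OF EO[OF a]])
  let ?k = "l ?b a (Ide D (FObj E a))"
  have k: "?k : Hom C ?b a" "FArr E ?k = Ide D (FObj E a)" using l[OF b(1) a] i b(2) by auto
  note e = eta[OF a]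
  have "?k \<cdot>\<^sub>C eta a = Ide C a"
   by (rule faithful[OF a a C.Comp_in_Hom[OF e(1) k(1)] C.Ide_in_Hom[OF a]])
    (simp add: EC[OF e(1) k(1)] e(2) k(2) EI[OF a] D.Comp_Ide[OF i])
  moreover have "eta a \<cdot>\<^sub>C ?k = Ide C ?b"
   by (rule faithful[OF b(1) b(1) C.Comp_in_Hom[OF k(1) e(1)] C.Ide_in_Hom[OF b(1)]])
    (simp add: EC[OF k(1) e(1)] e(2) k(2) EI[OF b(1)] b(2) D.Comp_Ide[OF i])
  ultimately have "inverse_arrows C (eta a) ?k"
   using e(1) k(1) by (simp add: inverse_arrows_def Hom_def)
  then show ?thesis by (auto simp: iso_arr_def)
 qed
 have nat2: "natural_transformation D D (comp_functor E Gr) id_functor (Ide D)"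
  unfolding natural_transformation_def
 proof (intro conjI ballI)
  fix a assume "a : Obj D"
  then show "Ide D a : Hom D (FObj (comp_functor E Gr) a) (FObj id_functor a)"
   using g D.Ide_in_Hom by (simp add: id_functor_def comp_functor_def Gr_def)
 next
  fix f assume "f : Arr D"
  then have h: "f : Hom D (Dom D f) (Cod D f)" by (simp add: Hom_def)
  show "FArr id_functor f \<cdot>\<^sub>D Ide D (Dom D f) = Ide D (Cod D f) \<cdot>\<^sub>D FArr (comp_functor E Gr) f"
   using GH(2)[OF h] D.Comp_Ide[OF h] D.Ide_Comp[OF h] by (simp add: id_functor_def comp_functor_def)
 qed
 have iso2: "iso_arr D (Ide D b)" if "b : Obj D" for b
  using that by (rule D.iso_Ide)
 show ?thesis
  unfolding equivalent_categories_def using C D E functG nat1 iso1 nat2 iso2 by blast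
qed

lemma natural_transformation_Comp:
 assumes C: "category C" and D: "category D"
  and F: "is_functor C D F" and K: "is_functor C D K" and H: "is_functor C D H"
  and p: "natural_transformation C D F K p" and q: "natural_transformation C D K H q"
 shows "natural_transformation C D F H (\<lambda>a \<in> Obj C. q a \<cdot>\<^sub>D p a)"
proof -
 interpret C: category C by (rule C)
 interpret D: category D by (rule D)
 show ?thesis
  unfolding natural_transformation_def
 proof (intro conjI ballI)
  fix a assume "a : Obj C"
  then show "(\<lambda>a \<in> Obj C. q a \<cdot>\<^sub>D p a) a : Hom D (FObj F a) (FObj H a)"
   using p q D.Comp_in_Hom by (fastforce simp: natural_transformation_def)
 next
  fix f assume f: "f : Arr C"
  let ?a = "Dom C f" and ?b = "Cod C f"
  have ab: "?a : Obj C" "?b : Obj C" using f by auto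
  have h: "p ?a : Hom D (FObj F ?a) (FObj K ?a)" "p ?b : Hom D (FObj F ?b) (FObj K ?b)"
   "q ?a : Hom D (FObj K ?a) (FObj H ?a)" "q ?b : Hom D (FObj K ?b) (FObj H ?b)"
   "FArr F f : Hom D (FObj F ?a) (FObj F ?b)" "FArr K f : Hom D (FObj K ?a) (FObj K ?b)"
   "FArr H f : Hom D (FObj H ?a) (FObj H ?b)"
   using p q F K H ab f by (auto simp: natural_transformation_def is_functor_def)
  have e: "FArr K f \<cdot>\<^sub>D p ?a = p ?b \<cdot>\<^sub>D FArr F f" "FArr H f \<cdot>\<^sub>D q ?a = q ?b \<cdot>\<^sub>D FArr K f"
   using p q f by (auto simp: natural_transformation_def)
  have "FArr H f \<cdot>\<^sub>D (q ?a \<cdot>\<^sub>D p ?a) = q ?b \<cdot>\<^sub>D p ?b \<cdot>\<^sub>D FArr F f"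
   using D.Comp_assoc[OF h(1) h(3) h(7)] D.Comp_assoc[OF h(1) h(6) h(4)] D.Comp_assoc[OF h(5) h(2) h(4)] e by simp
  then show "FArr H f \<cdot>\<^sub>D (\<lambda>a \<in> Obj C. q a \<cdot>\<^sub>D p a) ?a = (\<lambda>a \<in> Obj C. q a \<cdot>\<^sub>D p a) ?b \<cdot>\<^sub>D FArr F f"
   using ab by simp
 qed
qed

lemma natural_transformation_Ide:
 assumes C: "category C" and D: "category D" and F: "is_functor C D F"
 shows "natural_transformation C D F F (\<lambda>a \<in> Obj C. Ide D (FObj F a))"
proof -
 interpret C: category C by (rule C)
 interpret D: category D by (rule D)
 show ?thesis
  unfolding natural_transformation_def
 proof (intro conjI ballI)
  fix f assume f: "f : Arr C"
  then have "FArr F f : Hom D (FObj F (Dom C f)) (FObj F (Cod C f))" using F by (auto simp: is_functor_def)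
  then show "FArr F f \<cdot>\<^sub>D (\<lambda>a \<in> Obj C. Ide D (FObj F a)) (Dom C f) =
    (\<lambda>a \<in> Obj C. Ide D (FObj F a)) (Cod C f) \<cdot>\<^sub>D FArr F f"
   using f D.Comp_Ide D.Ide_Comp by simp
 qed (use F D.Ide_in_Hom in "auto simp: is_functor_def")
qed

lemma Fun_category:
 assumes C: "category C" and D: "category D"
 shows "category (Fun C D)"
proof -
 interpret C: category C by (rule C)
 interpret D: category D by (rule D)
 note nt = natural_transformation_Comp[OF C D] and ni = natural_transformation_Ide[OF C D]
 have th: "p a : Hom D (FObj F a) (FObj K a)" if "natural_transformation C D F K p" "a : Obj C" for F K p a
  using that by (auto simp: natural_transformation_def)
 have ext: "(\<lambda>a \<in> Obj C. q a) = p" if "p : extensional (Obj C)" "!!a. a : Obj C ==> q a = p a" for p q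
  using that by (auto simp: extensional_def restrict_def)
 have H: "x : Hom (Fun C D) F K <-> (F : Obj (Fun C D) & K : Obj (Fun C D) &
   (\<exists>p. x = Mor F K p & natural_transformation C D F K p & p : extensional (Obj C)))" for x F K
  by (auto simp: Fun_def Let_def Hom_def)
 have O: "F : Obj (Fun C D) <-> is_functor C D F & FObj F : extensional (Obj C) & FArr F : extensional (Arr C)" for F
  by (simp add: Fun_def Let_def)
 have sel: "Ide (Fun C D) F = Mor F F (\<lambda>a \<in> Obj C. Ide D (FObj F a))"
  "y \<cdot>\<^bsub>Fun C D\<^esub> x = Mor (src x) (tgt y) (\<lambda>a \<in> Obj C. under y a \<cdot>\<^sub>D under x a)"
  "Dom (Fun C D) = src" "Cod (Fun C D) = tgt" for F x y
  by (simp_all add: Fun_def Let_def)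
 show ?thesis
 proof
  fix f assume "f : Arr (Fun C D)"
  then show "Dom (Fun C D) f : Obj (Fun C D)" "Cod (Fun C D) f : Obj (Fun C D)"
   by (auto simp: Fun_def Let_def)
 next
  fix F assume "F : Obj (Fun C D)"
  then show "Ide (Fun C D) F : Hom (Fun C D) F F" unfolding H sel using ni O by blast
 next
  fix x y F K L assume "x : Hom (Fun C D) F K" "y : Hom (Fun C D) K L"
  then show "y \<cdot>\<^bsub>Fun C D\<^esub> x : Hom (Fun C D) F L"
   unfolding H sel O using nt[of F K L] by (elim conjE exE) simp
 next
  fix x F K assume "x : Hom (Fun C D) F K"
  then obtain p where x: "x = Mor F K p" "natural_transformation C D F K p" "p : extensional (Obj C)" unfolding H by blast
  show "x \<cdot>\<^bsub>Fun C D\<^esub> Ide (Fun C D) F = x"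
   unfolding sel x(1) mor.sel by (rule arg_cong[of _ _ "Mor F K"], rule ext[OF x(3)]) (simp add: D.Comp_Ide[OF th[OF x(2)]])
  show "Ide (Fun C D) K \<cdot>\<^bsub>Fun C D\<^esub> x = x"
   unfolding sel x(1) mor.sel by (rule arg_cong[of _ _ "Mor F K"], rule ext[OF x(3)]) (simp add: D.Ide_Comp[OF th[OF x(2)]])
 next
  fix x y z F K L M assume "x : Hom (Fun C D) F K" "y : Hom (Fun C D) K L" "z : Hom (Fun C D) L M"
  then obtain p q r where x: "x = Mor F K p" "natural_transformation C D F K p"
   and y: "y = Mor K L q" "natural_transformation C D K L q" and z: "z = Mor L M r" "natural_transformation C D L M r"
   unfolding H by blast
  show "z \<cdot>\<^bsub>Fun C D\<^esub> (y \<cdot>\<^bsub>Fun C D\<^esub> x) = z \<cdot>\<^bsub>Fun C D\<^esub> y \<cdot>\<^bsub>Fun C D\<^esub> x"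
   unfolding sel x(1) y(1) z(1) mor.sel
   by (rule arg_cong[of _ _ "Mor F M"], rule restrict_ext)
    (simp add: D.Comp_assoc[OF th[OF x(2)] th[OF y(2)] th[OF z(2)]])
 qed
qed

lemma structured_category:
 assumes S: "category S" and ob: "!!M. M : X ==> ob M : Obj S"
  and id: "!!M. M : X ==> R M M (Ide S (ob M))"
  and comp: "!!M N K f g. M : X ==> N : X ==> K : X ==> f : Hom S (ob M) (ob N) ==> g : Hom S (ob N) (ob K) ==>
   R M N f ==> R N K g ==> R M K (g \<cdot>\<^sub>S f)"
 shows "category (structured_objects S X ob R)"
proof -
 interpret S: category S by (rule S)
 let ?C = "structured_objects S X ob R"
 have H: "x : Hom ?C M N <-> (\<exists>f. x = Mor M N f & M : X & N : X & f : Hom S (ob M) (ob N) & R M N f)" for x M N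
  by (auto simp: structured_objects_def Hom_def[of "\<lparr>Obj = _, Arr = _, Dom = _, Cod = _, Ide = _, Comp = _\<rparr>"])
 have sel: "Ide ?C M = Mor M M (Ide S (ob M))" "y \<cdot>\<^sub>?C x = Mor (src x) (tgt y) (under y \<cdot>\<^sub>S under x)" "Obj ?C = X" for M x y
  by (simp_all add: structured_objects_def)
 show ?thesis
 proof
  fix f assume "f : Arr ?C"
  then show "Dom ?C f : Obj ?C" "Cod ?C f : Obj ?C" by (auto simp: structured_objects_def)
 next
  fix M assume "M : Obj ?C"
  then show "Ide ?C M : Hom ?C M M" unfolding H sel using id ob S.Ide_in_Hom by blast
 next
  fix x y M N K assume "x : Hom ?C M N" "y : Hom ?C N K"
  then show "y \<cdot>\<^sub>?C x : Hom ?C M K"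
   unfolding H sel by (elim conjE exE) (simp add: S.Comp_in_Hom comp)
 next
  fix x M N assume "x : Hom ?C M N"
  then show "x \<cdot>\<^sub>?C Ide ?C M = x" "Ide ?C N \<cdot>\<^sub>?C x = x"
   unfolding H sel by (auto simp: S.Comp_Ide S.Ide_Comp)
 next
  fix x y z M N K L assume "x : Hom ?C M N" "y : Hom ?C N K" "z : Hom ?C K L"
  then show "z \<cdot>\<^sub>?C (y \<cdot>\<^sub>?C x) = z \<cdot>\<^sub>?C y \<cdot>\<^sub>?C x"
   unfolding H sel by (elim conjE exE) (simp add: S.Comp_assoc)
 qed
qed

lemma one_object_category: "group G ==> category (one_object_category G)"
proof -
 assume "group G"
 then interpret group G .
 show ?thesis by unfold_locales (auto simp: one_object_category_def Hom_def m_assoc)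
qed

section \<open>The category of algebras over a PROP\<close>

context prop_shape
begin

context
 fixes S :: "('o, 'a, 'y) smc_scheme"
 assumes S: "symmetric_monoidal_category S"
begin

interpretation S: symmetric_monoidal_category S by (rule S)

lemma Alg_system:
 assumes "F : Obj (Alg T S)"
 shows "tensor_system S (FObj F) (FTens F) (FUnit F)" "prop_map T (endo S (FObj F) (FTens F)) (hat T (FArr F))"
 using assms unfolding Alg_Obj ssmf_iff[OF S] by auto

lemma Alg_functor: "F : Obj (Alg T S) ==> is_functor T S F"
 unfolding Alg_Obj symmetric_strict_monoidal_functor_def by blast

lemma Alg_FArr:
 assumes "F : Obj (Alg T S)" "f : Arr T"
 shows "FArr F f : Arr S" "Dom S (FArr F f) = FObj F (Dom T f)" "Cod S (FArr F f) = FObj F (Cod T f)"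
 using Alg_functor[OF assms(1)] assms(2) by (auto simp: is_functor_def S.Hom_iff)

lemma Alg_Arr: "Arr (Alg T S) = {Mor F F' th | F F' th. F : Obj (Alg T S) & F' : Obj (Alg T S) & monoidal_transformation T S F F' th}"
 by (auto simp: Alg_def Let_def extensional_def)

lemma Alg_sel [simp]: "Dom (Alg T S) = src" "Cod (Alg T S) = tgt"
 "Ide (Alg T S) F = Mor F F (%a. Ide S (FObj F a))"
 "q \<cdot>\<^bsub>Alg T S\<^esub> p = Mor (src p) (tgt q) (%a. under q a \<cdot>\<^sub>S under p a)"
 by (simp_all add: Alg_def Let_def restrict_def)

lemma monoidal_iff:
 assumes F: "F : Obj (Alg T S)" and K: "K : Obj (Alg T S)"
 shows "monoidal_transformation T S F K th <->
  (\<forall>n. th n : Arr S & Dom S (th n) = FObj F n & Cod S (th n) = FObj K n) &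
  (\<forall>f \<in> Arr T. FArr K f \<cdot>\<^sub>S th (Dom T f) = th (Cod T f) \<cdot>\<^sub>S FArr F f) &
  (\<forall>a b. th (a + b) \<cdot>\<^sub>S FTens F (a, b) = FTens K (a, b) \<cdot>\<^sub>S (th a \<boxtimes>\<^sub>S th b)) & th 0 \<cdot>\<^sub>S FUnit F = FUnit K"
 by (auto simp: monoidal_transformation_def natural_transformation_def S.Hom_iff)

lemma Alg_category: "category (Alg T S)"
proof
 fix F assume F: "F : Obj (Alg T S)"
 interpret X: tensor_system S "FObj F" "FTens F" "FUnit F" by (rule Alg_system[OF F])
 have "monoidal_transformation T S F F (%a. Ide S (FObj F a))"
  using F by (simp add: monoidal_iff Alg_FArr S.TArr_Ide)
 then show "Ide (Alg T S) F : Hom (Alg T S) F F" using F by (auto simp: Hom_def Alg_Arr)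
next
 fix p q F K H assume pq: "p : Hom (Alg T S) F K" "q : Hom (Alg T S) K H"
 then obtain th ph where e: "p = Mor F K th" "q = Mor K H ph" and F: "F : Obj (Alg T S)" "K : Obj (Alg T S)" "H : Obj (Alg T S)"
  and m: "monoidal_transformation T S F K th" "monoidal_transformation T S K H ph"
  by (auto simp: Hom_def Alg_Arr)
 interpret X: tensor_system S "FObj F" "FTens F" "FUnit F" by (rule Alg_system[OF F(1)])
 interpret Y: tensor_system S "FObj K" "FTens K" "FUnit K" by (rule Alg_system[OF F(2)])
 interpret Z: tensor_system S "FObj H" "FTens H" "FUnit H" by (rule Alg_system[OF F(3)])
 have th: "th n : Arr S" "Dom S (th n) = FObj F n" "Cod S (th n) = FObj K n"
  and ph: "ph n : Arr S" "Dom S (ph n) = FObj K n" "Cod S (ph n) = FObj H n" for n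
  using m by (auto simp: monoidal_iff F)
 have "monoidal_transformation T S F H (%a. ph a \<cdot>\<^sub>S th a)"
  unfolding monoidal_iff[OF F(1,3)]
 proof (intro conjI allI ballI)
  fix f assume f: "f : Arr T"
  have 1: "FArr K f \<cdot>\<^sub>S th (Dom T f) = th (Cod T f) \<cdot>\<^sub>S FArr F f" "FArr H f \<cdot>\<^sub>S ph (Dom T f) = ph (Cod T f) \<cdot>\<^sub>S FArr K f"
   using m f by (auto simp: monoidal_iff F)
  note a = th ph Alg_FArr[OF F(1) f] Alg_FArr[OF F(2) f] Alg_FArr[OF F(3) f]
  have "FArr H f \<cdot>\<^sub>S (ph (Dom T f) \<cdot>\<^sub>S th (Dom T f)) = ph (Cod T f) \<cdot>\<^sub>S (FArr K f \<cdot>\<^sub>S th (Dom T f))"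
   using S.ar_pull[OF 1(2)] a by (simp add: S.ar_assoc)
  then show "FArr H f \<cdot>\<^sub>S (ph (Dom T f) \<cdot>\<^sub>S th (Dom T f)) = ph (Cod T f) \<cdot>\<^sub>S th (Cod T f) \<cdot>\<^sub>S FArr F f"
   unfolding 1(1) using a by (simp add: S.ar_assoc)
 next
  fix a b
  have 1: "th (a + b) \<cdot>\<^sub>S FTens F (a, b) = FTens K (a, b) \<cdot>\<^sub>S (th a \<boxtimes>\<^sub>S th b)"
   "ph (a + b) \<cdot>\<^sub>S FTens K (a, b) = FTens H (a, b) \<cdot>\<^sub>S (ph a \<boxtimes>\<^sub>S ph b)"
   using m by (auto simp: monoidal_iff F)
  have "ph (a + b) \<cdot>\<^sub>S th (a + b) \<cdot>\<^sub>S FTens F (a, b) = ph (a + b) \<cdot>\<^sub>S (FTens K (a, b) \<cdot>\<^sub>S (th a \<boxtimes>\<^sub>S th b))"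
   using 1(1) th ph by (simp add: S.ar_assoc)
  also have "... = FTens H (a, b) \<cdot>\<^sub>S ((ph a \<cdot>\<^sub>S th a) \<boxtimes>\<^sub>S (ph b \<cdot>\<^sub>S th b))"
   using S.ar_pull[OF 1(2)] th ph by (simp add: S.ar_assoc S.ar_tensor_Comp)
  finally show "ph (a + b) \<cdot>\<^sub>S th (a + b) \<cdot>\<^sub>S FTens F (a, b) = FTens H (a, b) \<cdot>\<^sub>S ((ph a \<cdot>\<^sub>S th a) \<boxtimes>\<^sub>S (ph b \<cdot>\<^sub>S th b))" .
 next
  have "th 0 \<cdot>\<^sub>S FUnit F = FUnit K" "ph 0 \<cdot>\<^sub>S FUnit K = FUnit H" using m by (auto simp: monoidal_iff F)
  then show "ph 0 \<cdot>\<^sub>S th 0 \<cdot>\<^sub>S FUnit F = FUnit H" using th ph by (simp add: S.ar_assoc)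
 qed (use th ph in auto)
 then show "q \<cdot>\<^bsub>Alg T S\<^esub> p : Hom (Alg T S) F H" using F by (auto simp: Hom_def Alg_Arr e)
next
 fix p q r F K H L assume "p : Hom (Alg T S) F K" "q : Hom (Alg T S) K H" "r : Hom (Alg T S) H L"
 then show "r \<cdot>\<^bsub>Alg T S\<^esub> (q \<cdot>\<^bsub>Alg T S\<^esub> p) = r \<cdot>\<^bsub>Alg T S\<^esub> q \<cdot>\<^bsub>Alg T S\<^esub> p"
  by (auto simp: Hom_def Alg_Arr monoidal_iff S.ar_assoc)
qed (auto simp: Hom_def Alg_Arr monoidal_iff)

text \<open>Every arrow \<open>h\<close> between the values at 1 extends to a monoidal family
  \<open>th\<close>; what may fail is naturality. The set \<open>N\<close> of arrows where it holds
  is closed under the operations of the PROP, so that in applications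
  \<open>Arr T \<subseteq> N\<close> follows by induction over generators.\<close>

lemma Alg_full:
 assumes F: "F : Obj (Alg T S)" and K: "K : Obj (Alg T S)" and h: "h : Hom S (FObj F 1) (FObj K 1)"
 obtains th where "th 1 = h"
  "th (1 + 1) \<cdot>\<^sub>S FTens F (1, 1) = FTens K (1, 1) \<cdot>\<^sub>S (h \<boxtimes>\<^sub>S h)" "th 0 \<cdot>\<^sub>S FUnit F = FUnit K"
  "!!n. th n : Arr S & Dom S (th n) = FObj F n & Cod S (th n) = FObj K n"
  "!!N. N = {f \<in> Arr T. FArr K f \<cdot>\<^sub>S th (Dom T f) = th (Cod T f) \<cdot>\<^sub>S FArr F f} ==>
   (\<forall>n. Ide T n : N) & (\<forall>a b. Sym T a b : N) &
   (\<forall>f \<in> N. \<forall>g \<in> N. Dom T g = Cod T f --> g \<cdot> f : N) & (\<forall>f \<in> N. \<forall>g \<in> N. f \<boxtimes> g : N) &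
   (Arr T \<subseteq> N --> monoidal_transformation T S F K th)"
proof -
 interpret X: tensor_system S "FObj F" "FTens F" "FUnit F" by (rule Alg_system[OF F])
 interpret Y: tensor_system S "FObj K" "FTens K" "FUnit K" by (rule Alg_system[OF K])
 interpret XY: system_pair S "FObj F" "FTens F" "FUnit F" "FObj K" "FTens K" "FUnit K" ..
 note pF = Alg_system(2)[OF F] and pK = Alg_system(2)[OF K]
 have hF: "hat T (FArr F) f : Arr X.P" "src (hat T (FArr F) f) = Dom T f" "tgt (hat T (FArr F) f) = Cod T f"
  "under (hat T (FArr F) f) = FArr F f" if "f : Arr T" for f
  using pF that by (auto simp: prop_map_def hat_def)
 have hK: "hat T (FArr K) f : Arr Y.P" "src (hat T (FArr K) f) = Dom T f" "tgt (hat T (FArr K) f) = Cod T f"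
  "under (hat T (FArr K) f) = FArr K f" if "f : Arr T" for f
  using pK that by (auto simp: prop_map_def hat_def)
 let ?th = "XY.ext h"
 have th: "XY.mono_tr ?th" "?th 1 = h" using XY.ext_mono_tr[of h] h by (auto simp: S.Hom_iff)
 have N_iff: "f : {f \<in> Arr T. FArr K f \<cdot>\<^sub>S ?th (Dom T f) = ?th (Cod T f) \<cdot>\<^sub>S FArr F f} <->
   f : Arr T & XY.nat_at ?th (hat T (FArr F) f) (hat T (FArr K) f)" for f
  using hF hK by (auto simp: XY.nat_at_def)
 show ?thesis
 proof (rule that[of ?th])
  show "?th 1 = h" by (rule th(2))
  show "?th (1 + 1) \<cdot>\<^sub>S FTens F (1, 1) = FTens K (1, 1) \<cdot>\<^sub>S (h \<boxtimes>\<^sub>S h)"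
   using th unfolding XY.mono_tr_def by metis
  show "?th 0 \<cdot>\<^sub>S FUnit F = FUnit K" "?th n : Arr S & Dom S (?th n) = FObj F n & Cod S (?th n) = FObj K n" for n
   using th(1) unfolding XY.mono_tr_def by blast+
  fix N assume N: "N = {f \<in> Arr T. FArr K f \<cdot>\<^sub>S ?th (Dom T f) = ?th (Cod T f) \<cdot>\<^sub>S FArr F f}"
  have N_iff: "f : N <-> f : Arr T & XY.nat_at ?th (hat T (FArr F) f) (hat T (FArr K) f)" for f
   unfolding N by (rule N_iff)
  have 1: "Ide T n : N" for n
   using XY.nat_at_Ide[OF th(1), of n] pF pK by (simp add: N_iff prop_map_def del: endo_sel)
  have 2: "Sym T a b : N" for a b
   using XY.nat_at_Sym[OF th(1), of a b] pF pK by (simp add: N_iff prop_map_def del: endo_sel)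
  have 3: "g \<cdot> f : N" if "f : N" "g : N" "Dom T g = Cod T f" for f g
  proof -
   have fg: "f : Arr T" "g : Arr T" using that by (auto simp: N_iff)
   have "hat T (FArr F) (g \<cdot> f) = hat T (FArr F) g \<cdot>\<^sub>X.P hat T (FArr F) f"
    "hat T (FArr K) (g \<cdot> f) = hat T (FArr K) g \<cdot>\<^sub>Y.P hat T (FArr K) f"
    using pF pK fg that(3) unfolding prop_map_def by blast+
   then show ?thesis
    using XY.nat_at_Comp[OF th(1) hF(1)[OF fg(1)] hF(1)[OF fg(2)] _ hK(1)[OF fg(1)] hK(1)[OF fg(2)]] that fg hF hK
    by (simp add: N_iff Comp_Arr del: endo_sel)
  qed
  have 4: "f \<boxtimes> g : N" if "f : N" "g : N" for f g
  proof -
   have fg: "f : Arr T" "g : Arr T" using that by (auto simp: N_iff)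
   have "hat T (FArr F) (f \<boxtimes> g) = hat T (FArr F) f \<boxtimes>\<^sub>X.P hat T (FArr F) g"
    "hat T (FArr K) (f \<boxtimes> g) = hat T (FArr K) f \<boxtimes>\<^sub>Y.P hat T (FArr K) g"
    using pF pK fg unfolding prop_map_def by blast+
   then show ?thesis
    using XY.nat_at_TArr[OF th(1) hF(1)[OF fg(1)] hF(1)[OF fg(2)] hK(1)[OF fg(1)] hK(1)[OF fg(2)]] that fg hF hK
    by (simp add: N_iff TArr_Arr del: endo_sel)
  qed
  have "monoidal_transformation T S F K ?th" if "Arr T \<subseteq> N"
   using that th(1) unfolding monoidal_iff[OF F K] XY.mono_tr_def N by blast
  then show "(\<forall>n. Ide T n : N) & (\<forall>a b. Sym T a b : N) &
   (\<forall>f \<in> N. \<forall>g \<in> N. Dom T g = Cod T f --> g \<cdot> f : N) & (\<forall>f \<in> N. \<forall>g \<in> N. f \<boxtimes> g : N) &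
   (Arr T \<subseteq> N --> monoidal_transformation T S F K ?th)"
   using 1 2 3 4 by blast
 qed
qed

lemma Alg_faithful:
 assumes F: "F : Obj (Alg T S)" and K: "K : Obj (Alg T S)"
  and "monoidal_transformation T S F K p" "monoidal_transformation T S F K q" "p 1 = q 1"
 shows "p = q"
proof -
 interpret X: tensor_system S "FObj F" "FTens F" "FUnit F" by (rule Alg_system[OF F])
 interpret Y: tensor_system S "FObj K" "FTens K" "FUnit K" by (rule Alg_system[OF K])
 interpret XY: system_pair S "FObj F" "FTens F" "FUnit F" "FObj K" "FTens K" "FUnit K" ..
 have "XY.mono_tr p" "XY.mono_tr q"
  using assms(3,4) unfolding monoidal_iff[OF F K] XY.mono_tr_def by blast+
 then show ?thesis using XY.mono_tr_unique[of p q] assms(5) by blast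
qed

end

end

text \<open>The part common to the three equivalences. An algebra has a structure
  \<open>str F\<close> on its value at 1, with homomorphisms described by \<open>R\<close>, and
  elements of \<open>G\<close> act through the arrows \<open>act g\<close> of the PROP. The
  assumption \<open>surj\<close> asks for equality with the given structure, as
  \<open>equivalent_categoriesI\<close> requires.\<close>

locale alg_equiv = prop_shape T + group G
 for T :: "(nat, 'p, 'z) smc_scheme" (structure) and G :: "('g, 'w) monoid_scheme" (structure) +
 fixes S :: "('o, 'a, 'y) smc_scheme" and X :: "'x set" and ob :: "'x => 'o" and R :: "'x => 'x => 'a => bool"
  and str :: "(nat, 'p, 'o, 'a) monfunctor => 'x" and act :: "'g => 'p"
 assumes S: "symmetric_monoidal_category S"
  and act: "g : carrier G ==> act g : Arr T & Dom T (act g) = 1 & Cod T (act g) = 1"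
  and act_one: "act \<one>\<^bsub>G\<^esub> = Ide T 1"
  and act_mult: "g : carrier G ==> h : carrier G ==> act (g \<otimes>\<^bsub>G\<^esub> h) = act g \<cdot> act h"
  and X_Obj: "M : X ==> ob M : Obj S"
  and R_Ide: "M : X ==> R M M (Ide S (ob M))"
  and R_Comp: "M : X ==> N : X ==> K : X ==> f : Hom S (ob M) (ob N) ==> f' : Hom S (ob N) (ob K) ==>
   R M N f ==> R N K f' ==> R M K (f' \<cdot>\<^sub>S f)"
  and str: "F : Obj (Alg T S) ==> str F : X & ob (str F) = FObj F 1"
  and R_act: "F : Obj (Alg T S) ==> g : carrier G ==> R (str F) (str F) (FArr F (act g))"
  and R_nat: "F : Obj (Alg T S) ==> F' : Obj (Alg T S) ==> monoidal_transformation T S F F' th ==>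
   R (str F) (str F') (th 1)"
  and R_full: "F : Obj (Alg T S) ==> F' : Obj (Alg T S) ==> k : Hom S (FObj F 1) (FObj F' 1) ==>
   R (str F) (str F') k ==> (!!g. g : carrier G ==> FArr F' (act g) \<cdot>\<^sub>S k = k \<cdot>\<^sub>S FArr F (act g)) ==>
   \<exists>th. monoidal_transformation T S F F' th & th 1 = k"
  and surj: "M : X ==> (!!g. g : carrier G ==> a g : Hom S (ob M) (ob M) & R M M (a g)) ==>
   a \<one>\<^bsub>G\<^esub> = Ide S (ob M) ==>
   (!!g h. g : carrier G ==> h : carrier G ==> a (g \<otimes>\<^bsub>G\<^esub> h) = a g \<cdot>\<^sub>S a h) ==>
   \<exists>F \<in> Obj (Alg T S). str F = M & (\<forall>g \<in> carrier G. FArr F (act g) = a g)"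
begin

abbreviation "SO \<equiv> structured_objects S X ob R"
abbreviation "GF \<equiv> Fun (one_object_category G) SO"

definition ev_Obj :: "(nat, 'p, 'o, 'a) monfunctor => (unit, 'g, 'x, ('x, 'a) mor) cfunctor" where
 "ev_Obj F = \<lparr>FObj = (%_. str F), FArr = (\<lambda>g \<in> carrier G. Mor (str F) (str F) (FArr F (act g)))\<rparr>"

definition ev where
 "ev = \<lparr>FObj = ev_Obj, FArr = (%p. Mor (ev_Obj (src p)) (ev_Obj (tgt p))
   (%_::unit. Mor (str (src p)) (str (tgt p)) (under p 1)))\<rparr>"

lemma GF_Obj: "Phi : Obj GF <-> (\<exists>M a. M : X & Phi = \<lparr>FObj = (%_. M), FArr = (\<lambda>g \<in> carrier G. Mor M M (a g))\<rparr> &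
  (\<forall>g \<in> carrier G. a g : Hom S (ob M) (ob M) & R M M (a g)) & a \<one>\<^bsub>G\<^esub> = Ide S (ob M) &
  (\<forall>g \<in> carrier G. \<forall>h \<in> carrier G. a (g \<otimes>\<^bsub>G\<^esub> h) = a g \<cdot>\<^sub>S a h))"
  (is "?L <-> ?R")
proof
 assume ?R
 then show ?L
  by (auto simp: Fun_def Let_def is_functor_def one_object_category_def structured_objects_def
    Hom_def[of "structured_objects S X ob R"] Hom_def[of "\<lparr>Obj = _, Arr = _, Dom = _, Cod = _, Ide = _, Comp = _\<rparr>"] extensional_def)
next
 assume L: ?L
 then have fn: "is_functor (one_object_category G) SO Phi" and ext: "FArr Phi : extensional (carrier G)"
  by (auto simp: Fun_def Let_def one_object_category_def)
 let ?M = "FObj Phi ()" and ?a = "%g. under (FArr Phi g)"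
 have M: "?M : X" using fn by (simp add: is_functor_def one_object_category_def structured_objects_def)
 have a: "FArr Phi g = Mor ?M ?M (?a g) & ?a g : Hom S (ob ?M) (ob ?M) & R ?M ?M (?a g)" if "g : carrier G" for g
 proof -
  have "FArr Phi g : Hom SO ?M ?M" using fn that by (simp add: is_functor_def one_object_category_def)
  then show ?thesis by (auto simp: structured_objects_def Hom_def[of "\<lparr>Obj = _, Arr = _, Dom = _, Cod = _, Ide = _, Comp = _\<rparr>"])
 qed
 have "FArr Phi \<one>\<^bsub>G\<^esub> = Mor ?M ?M (Ide S (ob ?M))" using fn by (simp add: is_functor_def one_object_category_def structured_objects_def)
 then have 1: "?a \<one>\<^bsub>G\<^esub> = Ide S (ob ?M)" by simp
 have "FArr Phi (g \<otimes>\<^bsub>G\<^esub> h) = FArr Phi g \<cdot>\<^sub>SO FArr Phi h" if "g : carrier G" "h : carrier G" for g h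
  using fn that by (simp add: is_functor_def one_object_category_def)
 then have 2: "?a (g \<otimes>\<^bsub>G\<^esub> h) = ?a g \<cdot>\<^sub>S ?a h" if "g : carrier G" "h : carrier G" for g h
  using that by (simp add: structured_objects_def)
 have "FArr Phi = (\<lambda>g \<in> carrier G. Mor ?M ?M (?a g))"
  by (rule extensionalityI[OF ext restrict_extensional]) (use a in simp)
 then have Phi: "Phi = \<lparr>FObj = (%_. ?M), FArr = (\<lambda>g \<in> carrier G. Mor ?M ?M (?a g))\<rparr>"
  by (intro cfunctor.equality) (simp_all add: fun_eq_iff)
 show ?R
 proof (intro exI conjI ballI)
  show "Phi = \<lparr>FObj = (%_. ?M), FArr = (\<lambda>g \<in> carrier G. Mor ?M ?M (?a g))\<rparr>" by (rule Phi)
 qed (use M a 1 2 in "simp_all")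
qed

lemma ev_Obj: "F : Obj (Alg T S) ==> ev_Obj F : Obj GF"
proof -
 assume F: "F : Obj (Alg T S)"
 have fn: "is_functor T S F" by (rule Alg_functor[OF S F])
 have "FArr F (act g) : Hom S (FObj F 1) (FObj F 1)" if "g : carrier G" for g
  using Alg_FArr[OF S F, of "act g"] act[OF that] by (simp add: Hom_def)
 moreover have "FArr F (act (g \<otimes>\<^bsub>G\<^esub> h)) = FArr F (act g) \<cdot>\<^sub>S FArr F (act h)" if "g : carrier G" "h : carrier G" for g h
  using fn act[OF that(1)] act[OF that(2)] by (simp add: act_mult[OF that] is_functor_def)
 moreover have "FArr F (act \<one>\<^bsub>G\<^esub>) = Ide S (FObj F 1)" using fn by (simp add: act_one is_functor_def)
 ultimately show ?thesis
  unfolding GF_Obj ev_Obj_def using str[OF F] R_act[OF F]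
  by (intro exI[of _ "str F"] exI[of _ "%g. FArr F (act g)"]) simp
qed

lemma GF_Hom:
 assumes F: "F : Obj (Alg T S)" and K: "K : Obj (Alg T S)"
 shows "p : Hom GF (ev_Obj F) (ev_Obj K) <->
  (\<exists>h. p = Mor (ev_Obj F) (ev_Obj K) (%_. Mor (str F) (str K) h) & h : Hom S (FObj F 1) (FObj K 1) &
   R (str F) (str K) h & (\<forall>g \<in> carrier G. FArr K (act g) \<cdot>\<^sub>S h = h \<cdot>\<^sub>S FArr F (act g)))"
  (is "_ <-> ?R")
proof -
 have "p : Hom GF (ev_Obj F) (ev_Obj K) <->
   (\<exists>th. p = Mor (ev_Obj F) (ev_Obj K) th & natural_transformation (one_object_category G) SO (ev_Obj F) (ev_Obj K) th)"
  using ev_Obj[OF F] ev_Obj[OF K]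
  by (auto simp: Fun_def Let_def Hom_def[of "\<lparr>Obj = _, Arr = _, Dom = _, Cod = _, Ide = _, Comp = _\<rparr>"] one_object_category_def extensional_def)
 also have "... <-> ?R"
 proof (intro iffI; elim exE conjE)
  fix th assume p: "p = Mor (ev_Obj F) (ev_Obj K) th"
   and n: "natural_transformation (one_object_category G) SO (ev_Obj F) (ev_Obj K) th"
  have "th () : Hom SO (str F) (str K)" using n by (simp add: natural_transformation_def one_object_category_def ev_Obj_def)
  then obtain h where h: "th () = Mor (str F) (str K) h" "h : Hom S (FObj F 1) (FObj K 1)" "R (str F) (str K) h"
   using str[OF F] str[OF K] by (auto simp: structured_objects_def Hom_def[of "\<lparr>Obj = _, Arr = _, Dom = _, Cod = _, Ide = _, Comp = _\<rparr>"])
  have "th = (%_. Mor (str F) (str K) h)" using h(1) by (simp add: fun_eq_iff)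
  moreover have "FArr K (act g) \<cdot>\<^sub>S h = h \<cdot>\<^sub>S FArr F (act g)" if "g : carrier G" for g
   using n that h(1) by (simp add: natural_transformation_def one_object_category_def ev_Obj_def structured_objects_def)
  ultimately show ?R using p h by blast
 next
  fix h assume p: "p = Mor (ev_Obj F) (ev_Obj K) (%_. Mor (str F) (str K) h)" and h: "h : Hom S (FObj F 1) (FObj K 1)"
   "R (str F) (str K) h" "\<forall>g \<in> carrier G. FArr K (act g) \<cdot>\<^sub>S h = h \<cdot>\<^sub>S FArr F (act g)"
  have "natural_transformation (one_object_category G) SO (ev_Obj F) (ev_Obj K) (%_. Mor (str F) (str K) h)"
   using str[OF F] str[OF K] h
   by (auto simp: natural_transformation_def one_object_category_def ev_Obj_def structured_objects_def
     Hom_def[of "\<lparr>Obj = _, Arr = _, Dom = _, Cod = _, Ide = _, Comp = _\<rparr>"])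
  then show "\<exists>th. p = Mor (ev_Obj F) (ev_Obj K) th & natural_transformation (one_object_category G) SO (ev_Obj F) (ev_Obj K) th"
   using p by blast
 qed
 finally show ?thesis .
qed

theorem equivalence: "equivalent_categories (Alg T S) GF"
proof (rule equivalent_categoriesI)
 interpret S: symmetric_monoidal_category S by (rule S)
 show C: "category (Alg T S)" by (rule Alg_category[OF S])
 show D: "category GF"
  by (rule Fun_category[OF one_object_category[OF group_axioms] structured_category[OF S.category_axioms X_Obj R_Ide R_Comp]])
 have AH: "p : Hom (Alg T S) F K <-> F : Obj (Alg T S) & K : Obj (Alg T S) &
   (\<exists>th. p = Mor F K th & monoidal_transformation T S F K th)" for p F K
  by (auto simp: Hom_def Alg_Arr[OF S] Alg_sel[OF S])
 have m1: "th 1 : Hom S (FObj F 1) (FObj K 1)" "g : carrier G ==> FArr K (act g) \<cdot>\<^sub>S th 1 = th 1 \<cdot>\<^sub>S FArr F (act g)"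
  if "F : Obj (Alg T S)" "K : Obj (Alg T S)" "monoidal_transformation T S F K th" for F K th g
  using that(3) act[of g] unfolding monoidal_iff[OF S that(1,2)] by (auto simp: S.Hom_iff)
 have evA: "FArr ev p : Hom GF (ev_Obj F) (ev_Obj K)" if "p : Hom (Alg T S) F K" for p F K
  using that m1[of F K] R_nat[of F K] unfolding AH by (auto simp: GF_Hom ev_def)
 show "is_functor (Alg T S) GF ev"
  unfolding is_functor_def
 proof (intro conjI ballI impI)
  fix F assume F: "F : Obj (Alg T S)"
  show "FObj ev F : Obj GF" using ev_Obj[OF F] by (simp add: ev_def)
  show "FArr ev (Ide (Alg T S) F) = Ide GF (FObj ev F)"
   using str[OF F] by (simp add: ev_def Alg_sel[OF S] Fun_def Let_def structured_objects_def ev_Obj_def one_object_category_def fun_eq_iff)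
 next
  fix p assume "p : Arr (Alg T S)"
  then show "FArr ev p : Hom GF (FObj ev (Dom (Alg T S) p)) (FObj ev (Cod (Alg T S) p))"
   using evA[of p "Dom (Alg T S) p" "Cod (Alg T S) p"] by (simp add: Hom_def[of "Alg T S"] ev_def)
 next
  fix p q assume "p : Arr (Alg T S)" "q : Arr (Alg T S)" "Dom (Alg T S) q = Cod (Alg T S) p"
  then show "FArr ev (q \<cdot>\<^bsub>Alg T S\<^esub> p) = FArr ev q \<cdot>\<^sub>GF FArr ev p"
   by (simp add: ev_def Alg_sel[OF S] Fun_def Let_def structured_objects_def one_object_category_def fun_eq_iff)
 qed
 fix F K assume F: "F : Obj (Alg T S)" and K: "K : Obj (Alg T S)"
 show "bij_betw (FArr ev) (Hom (Alg T S) F K) (Hom GF (FObj ev F) (FObj ev K))"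
  unfolding bij_betw_def
 proof
  show "inj_on (FArr ev) (Hom (Alg T S) F K)"
  proof (rule inj_onI)
   fix p q assume "p : Hom (Alg T S) F K" "q : Hom (Alg T S) F K" and e: "FArr ev p = FArr ev q"
   then obtain th ph where p: "p = Mor F K th" "monoidal_transformation T S F K th"
    and q: "q = Mor F K ph" "monoidal_transformation T S F K ph" unfolding AH by blast
   have "th 1 = ph 1" using fun_cong[OF arg_cong[OF e, of under], of "()"] by (simp add: ev_def p(1) q(1))
   then show "p = q" using Alg_faithful[OF S F K p(2) q(2)] by (simp add: p(1) q(1))
  qed
  show "FArr ev ` Hom (Alg T S) F K = Hom GF (FObj ev F) (FObj ev K)"
  proof
   show "FArr ev ` Hom (Alg T S) F K \<subseteq> Hom GF (FObj ev F) (FObj ev K)" using evA by (auto simp: ev_def)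
   show "Hom GF (FObj ev F) (FObj ev K) \<subseteq> FArr ev ` Hom (Alg T S) F K"
   proof
    fix p assume "p : Hom GF (FObj ev F) (FObj ev K)"
    then have "p : Hom GF (ev_Obj F) (ev_Obj K)" by (simp add: ev_def)
    then obtain h where p: "p = Mor (ev_Obj F) (ev_Obj K) (%_. Mor (str F) (str K) h)" and h: "h : Hom S (FObj F 1) (FObj K 1)"
     "R (str F) (str K) h" "!!g. g : carrier G ==> FArr K (act g) \<cdot>\<^sub>S h = h \<cdot>\<^sub>S FArr F (act g)"
     unfolding GF_Hom[OF F K] by blast
    obtain th where th: "monoidal_transformation T S F K th" "th 1 = h" using R_full[OF F K h] by blast
    have "Mor F K th : Hom (Alg T S) F K" using th F K unfolding AH by blast
    moreover have "FArr ev (Mor F K th) = p" using th(2) by (simp add: ev_def p)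
    ultimately show "p : FArr ev ` Hom (Alg T S) F K" by blast
   qed
  qed
 qed
next
 fix Phi assume "Phi : Obj GF"
 then obtain M a where M: "M : X" "Phi = \<lparr>FObj = (%_. M), FArr = (\<lambda>g \<in> carrier G. Mor M M (a g))\<rparr>"
  and a: "!!g. g : carrier G ==> a g : Hom S (ob M) (ob M) & R M M (a g)" "a \<one>\<^bsub>G\<^esub> = Ide S (ob M)"
   "!!g h. g : carrier G ==> h : carrier G ==> a (g \<otimes>\<^bsub>G\<^esub> h) = a g \<cdot>\<^sub>S a h"
  unfolding GF_Obj by blast
 obtain F where F: "F : Obj (Alg T S)" "str F = M" "!!g. g : carrier G ==> FArr F (act g) = a g"
  using surj[OF M(1) a] by blast
 have "FObj ev F = Phi" using F(2,3) by (simp add: ev_def ev_Obj_def M(2) cong: restrict_cong)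
 then show "\<exists>F \<in> Obj (Alg T S). FObj ev F = Phi" using F(1) by blast
qed

end

section \<open>Structures on an object in terms of its endomorphism PROP\<close>

context category
begin

lemma iso_eq_right: "iso_arr C f ==> x : Arr C ==> y : Arr C ==> Dom C x = Cod C f ==> Dom C y = Cod C f ==>
  x \<cdot> f = x' ==> y \<cdot> f = y' ==> x = y <-> x' = y'"
 using iso_cancel_right by blast

lemma iso_eq_left: "iso_arr C f ==> x : Arr C ==> y : Arr C ==> Cod C x = Dom C f ==> Cod C y = Dom C f ==>
  f \<cdot> x = x' ==> f \<cdot> y = y' ==> x = y <-> x' = y'"
 using iso_cancel_left by blast

end

text \<open>Used with \<open>k = 1\<close>; as a variable, \<open>k\<close> keeps sums such as
  \<open>k + k\<close> in this form under simplification.\<close>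

locale arrows_at = tensor_system S A t u
 for S :: "('o, 'a, 'z) smc_scheme" (structure) and A t u +
 fixes k :: nat and jj kk :: 'a
 assumes jj: "jj : Hom S (A k) (A k)" and kk: "kk : Hom S (A k) (A k)"
begin

abbreviation (input) "X \<equiv> A k"
abbreviation (input) "j \<equiv> Mor k k jj"
abbreviation (input) "j' \<equiv> Mor k k kk"

lemma ars1 [simp]: "jj : Arr S" "Dom S jj = A k" "Cod S jj = A k" "kk : Arr S" "Dom S kk = A k" "Cod S kk = A k"
 using jj kk by (auto simp: Hom_iff)

end

locale monoid_arrows = arrows_at S A t u k jj kk
 for S :: "('o, 'a, 'z) smc_scheme" (structure) and A t u k jj kk +
 fixes mm ee :: 'a
 assumes mm: "mm : Hom S (A (k + k)) (A k)" and ee: "ee : Hom S (A 0) (A k)"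
begin

abbreviation (input) "m \<equiv> Mor (k + k) k mm"
abbreviation (input) "e \<equiv> Mor 0 k ee"
abbreviation (input) "mu \<equiv> mm \<cdot> t (k, k)"
abbreviation (input) "eta \<equiv> ee \<cdot> u"

lemma ars2 [simp]: "mm : Arr S" "Dom S mm = A (k + k)" "Cod S mm = A k" "ee : Arr S" "Dom S ee = A 0" "Cod S ee = A k"
 using mm ee by (auto simp: Hom_iff)

text \<open>The lemmas \<open>conv_...\<close> here and in the next two locales translate equations
  in \<open>endo\<close> into equations in \<open>S\<close>. As a rule both sides are composed with
  an isomorphism built from \<open>t\<close> and \<open>u\<close>, after which the inverses of
  \<open>t\<close> cancel.\<close>

lemma conv_assoc: "m \<cdot>\<^sub>P (m \<boxtimes>\<^sub>P Ide P k) = m \<cdot>\<^sub>P (Ide P k \<boxtimes>\<^sub>P m) <->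
  mu \<cdot> (mu \<boxtimes> Ide S X) = mu \<cdot> (Ide S X \<boxtimes> mu) \<cdot> Assoc S X X X"
proof -
 let ?x = "mm \<cdot> (t (k, k) \<cdot> ((mm \<boxtimes> Ide S X) \<cdot> Inv S (t (k + k, k))))"
 let ?y = "mm \<cdot> (t (k, k) \<cdot> ((Ide S X \<boxtimes> mm) \<cdot> Inv S (t (k, k + k))))"
 have "?x = ?y <-> mu \<cdot> (mu \<boxtimes> Ide S X) = mu \<cdot> (Ide S X \<boxtimes> mu) \<cdot> Assoc S X X X"
 proof (rule iso_eq_right[of "t (k + k, k) \<cdot> (t (k, k) \<boxtimes> Ide S X)"])
  show "?x \<cdot> (t (k + k, k) \<cdot> (t (k, k) \<boxtimes> Ide S X)) = mu \<cdot> (mu \<boxtimes> Ide S X)"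
   by (simp add: ar_assoc ar_tensor_Comp)
  show "?y \<cdot> (t (k + k, k) \<cdot> (t (k, k) \<boxtimes> Ide S X)) = mu \<cdot> (Ide S X \<boxtimes> mu) \<cdot> Assoc S X X X"
   unfolding t_assoc' by (simp add: ar_assoc ar_tensor_Comp' add.assoc)
 qed (simp_all add: iso_Comp add.assoc)
 then show ?thesis by (simp add: add.assoc)
qed

lemma conv_unit_left: "m \<cdot>\<^sub>P (e \<boxtimes>\<^sub>P Ide P k) = Ide P k <-> mu \<cdot> (eta \<boxtimes> Ide S X) = LUnit S X"
proof -
 let ?x = "mm \<cdot> (t (k, k) \<cdot> ((ee \<boxtimes> Ide S X) \<cdot> Inv S (t (0, k))))"
 have "?x = Ide S X <-> mu \<cdot> (eta \<boxtimes> Ide S X) = LUnit S X"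
 proof (rule iso_eq_right[of "t (0, k) \<cdot> (u \<boxtimes> Ide S X)"])
  show "?x \<cdot> (t (0, k) \<cdot> (u \<boxtimes> Ide S X)) = mu \<cdot> (eta \<boxtimes> Ide S X)" by (simp add: ar_assoc ar_tensor_Comp)
  show "Ide S X \<cdot> (t (0, k) \<cdot> (u \<boxtimes> Ide S X)) = LUnit S X" using t_lunit[of k] by simp
 qed (simp_all add: iso_Comp)
 then show ?thesis by simp
qed

lemma conv_unit_right: "m \<cdot>\<^sub>P (Ide P k \<boxtimes>\<^sub>P e) = Ide P k <-> mu \<cdot> (Ide S X \<boxtimes> eta) = RUnit S X"
proof -
 let ?x = "mm \<cdot> (t (k, k) \<cdot> ((Ide S X \<boxtimes> ee) \<cdot> Inv S (t (k, 0))))"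
 have "?x = Ide S X <-> mu \<cdot> (Ide S X \<boxtimes> eta) = RUnit S X"
 proof (rule iso_eq_right[of "t (k, 0) \<cdot> (Ide S X \<boxtimes> u)"])
  show "?x \<cdot> (t (k, 0) \<cdot> (Ide S X \<boxtimes> u)) = mu \<cdot> (Ide S X \<boxtimes> eta)" by (simp add: ar_assoc ar_tensor_Comp)
  show "Ide S X \<cdot> (t (k, 0) \<cdot> (Ide S X \<boxtimes> u)) = RUnit S X" using t_runit[of k] by simp
 qed (simp_all add: iso_Comp)
 then show ?thesis by simp
qed

lemma conv_hom_mult: "j \<cdot>\<^sub>P m = m \<cdot>\<^sub>P (j' \<boxtimes>\<^sub>P j') <-> jj \<cdot> mu = mu \<cdot> (kk \<boxtimes> kk)"
proof -
 let ?y = "mm \<cdot> (t (k, k) \<cdot> ((kk \<boxtimes> kk) \<cdot> Inv S (t (k, k))))"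
 have "jj \<cdot> mm = ?y <-> jj \<cdot> mu = mu \<cdot> (kk \<boxtimes> kk)"
  by (rule iso_eq_right[of "t (k, k)"]) (simp_all add: ar_assoc)
 then show ?thesis by simp
qed

lemma conv_anti_mult: "j \<cdot>\<^sub>P m = m \<cdot>\<^sub>P Sym P k k \<cdot>\<^sub>P (j' \<boxtimes>\<^sub>P j') <-> jj \<cdot> mu = mu \<cdot> Sym S X X \<cdot> (kk \<boxtimes> kk)"
proof -
 let ?y = "mm \<cdot> (t (k, k) \<cdot> (Sym S X X \<cdot> Inv S (t (k, k)))) \<cdot> (t (k, k) \<cdot> ((kk \<boxtimes> kk) \<cdot> Inv S (t (k, k))))"
 have "jj \<cdot> mm = ?y <-> jj \<cdot> mu = mu \<cdot> Sym S X X \<cdot> (kk \<boxtimes> kk)"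
  by (rule iso_eq_right[of "t (k, k)"]) (simp_all add: ar_assoc)
 then show ?thesis by simp
qed

lemma conv_hom_unit: "j \<cdot>\<^sub>P e = e <-> jj \<cdot> eta = eta"
proof -
 have "jj \<cdot> ee = ee <-> jj \<cdot> eta = eta"
  by (rule iso_eq_right[of u]) (simp_all add: ar_assoc)
 then show ?thesis by simp
qed

end

locale comonoid_arrows = arrows_at S A t u k jj kk
 for S :: "('o, 'a, 'z) smc_scheme" (structure) and A t u k jj kk +
 fixes dd cc :: 'a
 assumes dd: "dd : Hom S (A k) (A (k + k))" and cc: "cc : Hom S (A k) (A 0)"
begin

abbreviation (input) "d \<equiv> Mor k (k + k) dd"
abbreviation (input) "c \<equiv> Mor k 0 cc"
abbreviation (input) "Delta \<equiv> Inv S (t (k, k)) \<cdot> dd"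
abbreviation (input) "eps \<equiv> Inv S u \<cdot> cc"

lemma ars3 [simp]: "dd : Arr S" "Dom S dd = A k" "Cod S dd = A (k + k)" "cc : Arr S" "Dom S cc = A k" "Cod S cc = A 0"
 using dd cc by (auto simp: Hom_iff)

lemma conv_coassoc: "(d \<boxtimes>\<^sub>P Ide P k) \<cdot>\<^sub>P d = (Ide P k \<boxtimes>\<^sub>P d) \<cdot>\<^sub>P d <->
  Assoc S X X X \<cdot> (Delta \<boxtimes> Ide S X) \<cdot> Delta = (Ide S X \<boxtimes> Delta) \<cdot> Delta"
proof -
 let ?x = "(t (k + k, k) \<cdot> ((dd \<boxtimes> Ide S X) \<cdot> Inv S (t (k, k)))) \<cdot> dd"
 let ?y = "(t (k, k + k) \<cdot> ((Ide S X \<boxtimes> dd) \<cdot> Inv S (t (k, k)))) \<cdot> dd"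
 let ?f = "t (k, k + k) \<cdot> (Ide S X \<boxtimes> t (k, k))"
 have "Assoc S X X X \<cdot> (Delta \<boxtimes> Ide S X) \<cdot> Delta = (Ide S X \<boxtimes> Delta) \<cdot> Delta <-> ?x = ?y"
 proof (rule iso_eq_left[of ?f])
  have "?f \<cdot> (Assoc S X X X \<cdot> (Delta \<boxtimes> Ide S X) \<cdot> Delta) =
    (t (k, k + k) \<cdot> ((Ide S X \<boxtimes> t (k, k)) \<cdot> Assoc S X X X)) \<cdot> ((Delta \<boxtimes> Ide S X) \<cdot> Delta)"
   by (simp add: ar_assoc)
  also have "... = ?x" unfolding t_assoc'[symmetric] by (simp add: ar_assoc ar_tensor_Comp')
  finally show "?f \<cdot> (Assoc S X X X \<cdot> (Delta \<boxtimes> Ide S X) \<cdot> Delta) = ?x" .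
  show "?f \<cdot> ((Ide S X \<boxtimes> Delta) \<cdot> Delta) = ?y" by (simp add: ar_assoc ar_tensor_Comp')
 qed (simp_all add: iso_Comp)
 then show ?thesis by (simp add: add.assoc)
qed

lemma conv_counit_left: "(c \<boxtimes>\<^sub>P Ide P k) \<cdot>\<^sub>P d = Ide P k <-> LUnit S X \<cdot> (eps \<boxtimes> Ide S X) \<cdot> Delta = Ide S X"
proof -
 have "LUnit S X \<cdot> (eps \<boxtimes> Ide S X) \<cdot> Delta = (t (0, k) \<cdot> ((cc \<boxtimes> Ide S X) \<cdot> Inv S (t (k, k)))) \<cdot> dd"
  unfolding t_lunit[symmetric] by (simp add: ar_assoc ar_tensor_Comp')
 then show ?thesis by simp
qed

lemma conv_counit_right: "(Ide P k \<boxtimes>\<^sub>P c) \<cdot>\<^sub>P d = Ide P k <-> RUnit S X \<cdot> (Ide S X \<boxtimes> eps) \<cdot> Delta = Ide S X"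
proof -
 have "RUnit S X \<cdot> (Ide S X \<boxtimes> eps) \<cdot> Delta = (t (k, 0) \<cdot> ((Ide S X \<boxtimes> cc) \<cdot> Inv S (t (k, k)))) \<cdot> dd"
  unfolding t_runit[symmetric] by (simp add: ar_assoc ar_tensor_Comp')
 then show ?thesis by simp
qed

lemma conv_hom_comult: "d \<cdot>\<^sub>P j = (j' \<boxtimes>\<^sub>P j') \<cdot>\<^sub>P d <-> Delta \<cdot> jj = (kk \<boxtimes> kk) \<cdot> Delta"
proof -
 let ?y = "(t (k, k) \<cdot> ((kk \<boxtimes> kk) \<cdot> Inv S (t (k, k)))) \<cdot> dd"
 have "Delta \<cdot> jj = (kk \<boxtimes> kk) \<cdot> Delta <-> dd \<cdot> jj = ?y"
  by (rule iso_eq_left[of "t (k, k)"]) (simp_all add: ar_assoc)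
 then show ?thesis by simp
qed

lemma conv_anti_comult: "d \<cdot>\<^sub>P j = (j' \<boxtimes>\<^sub>P j') \<cdot>\<^sub>P Sym P k k \<cdot>\<^sub>P d <-> Delta \<cdot> jj = (kk \<boxtimes> kk) \<cdot> Sym S X X \<cdot> Delta"
proof -
 let ?y = "(t (k, k) \<cdot> ((kk \<boxtimes> kk) \<cdot> Inv S (t (k, k)))) \<cdot> (t (k, k) \<cdot> (Sym S X X \<cdot> Inv S (t (k, k)))) \<cdot> dd"
 have "Delta \<cdot> jj = (kk \<boxtimes> kk) \<cdot> Sym S X X \<cdot> Delta <-> dd \<cdot> jj = ?y"
  by (rule iso_eq_left[of "t (k, k)"]) (simp_all add: ar_assoc)
 then show ?thesis by simp
qed

lemma conv_hom_counit: "c \<cdot>\<^sub>P j = c <-> eps \<cdot> jj = eps"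
proof -
 have "eps \<cdot> jj = eps <-> cc \<cdot> jj = cc"
  by (rule iso_eq_left[of u]) (simp_all add: ar_assoc)
 then show ?thesis by simp
qed

end

locale bimonoid_arrows = monoid_arrows S A t u k jj kk mm ee + comonoid_arrows S A t u k jj kk dd cc
 for S :: "('o, 'a, 'z) smc_scheme" (structure) and A t u k jj kk mm ee dd cc
begin

lemma conv_bimult: "d \<cdot>\<^sub>P m = (m \<boxtimes>\<^sub>P m) \<cdot>\<^sub>P (Ide P k \<boxtimes>\<^sub>P (Sym P k k \<boxtimes>\<^sub>P Ide P k)) \<cdot>\<^sub>P (d \<boxtimes>\<^sub>P d) <->
  Delta \<cdot> mu = (mu \<boxtimes> mu) \<cdot> middle_exchange S X X X X \<cdot> (Delta \<boxtimes> Delta)"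
proof -
 let ?a = "Assoc S X X X" and ?b = "Assoc S X X (X \<boxdot> X)" and ?c = "Assoc S X X (A (k + k))"
 define sg where "sg = under (Sym P k k)"
 have sg [simp]: "sg : Arr S" "Dom S sg = A (k + k)" "Cod S sg = A (k + k)" by (simp_all add: sg_def)
 have sgt: "sg \<cdot> t (k, k) = t (k, k) \<cdot> Sym S X X" unfolding sg_def by (rule under_Sym)
 define s3 where "s3 = t (k + k, k) \<cdot> ((sg \<boxtimes> Ide S X) \<cdot> Inv S (t (k + k, k)))"
 have s3 [simp]: "s3 : Arr S" "Dom S s3 = A (k + k + k)" "Cod S s3 = A (k + k + k)" by (simp_all add: s3_def)
 define w where "w = t (k, k + k) \<cdot> (Ide S X \<boxtimes> t (k, k))"
 have w [simp]: "w : Arr S" "Dom S w = X \<boxdot> (X \<boxdot> X)" "Cod S w = A (k + k + k)" "iso_arr S w"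
  by (simp_all add: w_def add.assoc iso_Comp)
 define ex where "ex = ?a \<cdot> ((Sym S X X \<boxtimes> Ide S X) \<cdot> Inv S ?a)"
 have ex [simp]: "ex : Arr S" "Dom S ex = X \<boxdot> (X \<boxdot> X)" "Cod S ex = X \<boxdot> (X \<boxdot> X)" by (simp_all add: ex_def)
 have wa: "w \<cdot> ?a = t (k + k, k) \<cdot> (t (k, k) \<boxtimes> Ide S X)" unfolding t_assoc' w_def by (simp add: ar_assoc)
 have "s3 \<cdot> w \<cdot> ?a = t (k + k, k) \<cdot> ((sg \<cdot> t (k, k)) \<boxtimes> Ide S X)"
  using wa by (simp add: ar_assoc) (simp add: s3_def ar_assoc ar_tensor_Comp)
 also have "... = w \<cdot> ex \<cdot> ?a"
  unfolding sgt ex_def using ar_pull[OF wa] by (simp add: ar_assoc ar_tensor_Comp)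
 finally have sw: "s3 \<cdot> w = w \<cdot> ex" by (rule iso_cancel_right[rotated -1]) simp_all
 \<comment> \<open>The aim is \<open>M \<cdot> tt = tt \<cdot> middle_exchange S X X X X\<close>,
   where \<open>tt\<close> compares the product of two squares of \<open>X\<close> with the fourfold
   object. Here \<open>s3\<close> and \<open>ex\<close> are the same exchange as it acts on the last
   three factors, in \<open>endo\<close> and in \<open>S\<close>.\<close>
 define M where "M = t (k, k + k + k) \<cdot> ((Ide S X \<boxtimes> s3) \<cdot> Inv S (t (k, k + k + k)))"
 have M [simp]: "M : Arr S" "Dom S M = A (k + (k + k + k))" "Cod S M = A (k + (k + k + k))" by (simp_all add: M_def)
 define tt where "tt = t (k + k, k + k) \<cdot> (t (k, k) \<boxtimes> t (k, k))"
 have tt [simp]: "tt : Arr S" "Dom S tt = X \<boxdot> X \<boxdot> (X \<boxdot> X)" "Cod S tt = A (k + (k + k + k))" "iso_arr S tt"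
  by (simp_all add: tt_def add.assoc iso_Comp)
 have "tt = (t (k + k, k + k) \<cdot> (t (k, k) \<boxtimes> Ide S (A (k + k)))) \<cdot> ((Ide S X \<boxtimes> Ide S X) \<boxtimes> t (k, k))"
  unfolding tt_def by (simp add: ar_assoc ar_tensor_Comp TArr_Ide)
 also have "... = t (k, k + (k + k)) \<cdot> ((Ide S X \<boxtimes> t (k, k + k)) \<cdot> (?c \<cdot> ((Ide S X \<boxtimes> Ide S X) \<boxtimes> t (k, k))))"
  unfolding t_assoc' by (simp add: ar_assoc)
 also have "?c \<cdot> ((Ide S X \<boxtimes> Ide S X) \<boxtimes> t (k, k)) = (Ide S X \<boxtimes> (Ide S X \<boxtimes> t (k, k))) \<cdot> ?b"
  using Assoc_nat[of "Ide S X" "Ide S X" "t (k, k)"] by simp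
 also have "t (k, k + (k + k)) \<cdot> ((Ide S X \<boxtimes> t (k, k + k)) \<cdot> ((Ide S X \<boxtimes> (Ide S X \<boxtimes> t (k, k))) \<cdot> ?b)) =
   t (k, k + k + k) \<cdot> ((Ide S X \<boxtimes> w) \<cdot> ?b)"
  unfolding w_def by (simp add: ar_assoc ar_tensor_Comp' add.assoc)
 finally have tt2: "tt = t (k, k + k + k) \<cdot> ((Ide S X \<boxtimes> w) \<cdot> ?b)" .
 have mx: "middle_exchange S X X X X = Inv S ?b \<cdot> ((Ide S X \<boxtimes> ex) \<cdot> ?b)"
  unfolding middle_exchange_def ex_def by (simp add: ar_assoc)
 have "M \<cdot> tt = t (k, k + k + k) \<cdot> ((Ide S X \<boxtimes> (s3 \<cdot> w)) \<cdot> ?b)"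
  unfolding tt2 M_def by (simp add: ar_assoc ar_tensor_Comp')
 also have "... = tt \<cdot> middle_exchange S X X X X"
  unfolding sw mx tt2 by (simp add: ar_assoc ar_tensor_Comp')
 finally have Mt: "M \<cdot> tt = tt \<cdot> middle_exchange S X X X X" .
 have mxA [simp]: "middle_exchange S X X X X : Arr S" "Dom S (middle_exchange S X X X X) = X \<boxdot> X \<boxdot> (X \<boxdot> X)"
   "Cod S (middle_exchange S X X X X) = X \<boxdot> X \<boxdot> (X \<boxdot> X)" unfolding mx by simp_all
 define q where "q = t (k + k, k + k) \<cdot> ((dd \<boxtimes> dd) \<cdot> Inv S (t (k, k)))"
 define p where "p = t (k, k) \<cdot> ((mm \<boxtimes> mm) \<cdot> Inv S (t (k + k, k + k)))"
 have pq [simp]: "p : Arr S" "Dom S p = A (k + (k + k + k))" "Cod S p = A (k + k)"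
  "q : Arr S" "Dom S q = A (k + k)" "Cod S q = A (k + (k + k + k))"
  unfolding p_def q_def by (simp_all add: add.assoc)
 have qt: "q \<cdot> t (k, k) = tt \<cdot> (Delta \<boxtimes> Delta)" unfolding q_def tt_def by (simp add: ar_assoc ar_tensor_Comp)
 have ptt: "p \<cdot> tt = t (k, k) \<cdot> (mu \<boxtimes> mu)" unfolding p_def tt_def by (simp add: ar_assoc ar_tensor_Comp)
 have "(p \<cdot> M \<cdot> q) \<cdot> t (k, k) = p \<cdot> (M \<cdot> (q \<cdot> t (k, k)))" by (simp add: ar_assoc)
 also have "... = p \<cdot> ((M \<cdot> tt) \<cdot> (Delta \<boxtimes> Delta))" unfolding qt by (simp add: ar_assoc)
 also have "... = (p \<cdot> tt) \<cdot> (middle_exchange S X X X X \<cdot> (Delta \<boxtimes> Delta))" unfolding Mt by (simp add: ar_assoc)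
 also have "... = t (k, k) \<cdot> ((mu \<boxtimes> mu) \<cdot> middle_exchange S X X X X \<cdot> (Delta \<boxtimes> Delta))"
  unfolding ptt by (simp add: ar_assoc)
 finally have R: "(p \<cdot> M \<cdot> q) \<cdot> t (k, k) = t (k, k) \<cdot> ((mu \<boxtimes> mu) \<cdot> middle_exchange S X X X X \<cdot> (Delta \<boxtimes> Delta))" .
 have "dd \<cdot> mm = p \<cdot> M \<cdot> q <-> t (k, k) \<cdot> (Delta \<cdot> mu) = t (k, k) \<cdot> ((mu \<boxtimes> mu) \<cdot> middle_exchange S X X X X \<cdot> (Delta \<boxtimes> Delta))"
  by (rule iso_eq_right[of "t (k, k)"]) (use R in "simp_all add: ar_assoc")
 also have "... <-> Delta \<cdot> mu = (mu \<boxtimes> mu) \<cdot> middle_exchange S X X X X \<cdot> (Delta \<boxtimes> Delta)"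
  by (rule iso_eq_left[of "t (k, k)", symmetric]) simp_all
 finally show ?thesis
  unfolding endo_sel mor.sel p_def q_def M_def s3_def sg_def by (simp add: add.assoc)
qed

lemma unit_square: "t (0, 0) \<cdot> (u \<boxtimes> u) = u \<cdot> LUnit S (TUnit S)"
proof -
 have "t (0, 0) \<cdot> (u \<boxtimes> u) = (t (0, 0) \<cdot> (u \<boxtimes> Ide S (A 0))) \<cdot> (Ide S (TUnit S) \<boxtimes> u)"
  by (simp add: ar_assoc ar_tensor_Comp)
 then show ?thesis unfolding t_lunit using LUnit_nat[of u] by simp
qed

lemma conv_bi_unit: "d \<cdot>\<^sub>P e = e \<boxtimes>\<^sub>P e <-> Delta \<cdot> eta = (eta \<boxtimes> eta) \<cdot> Inv S (LUnit S (TUnit S))"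
proof -
 let ?L = "LUnit S (TUnit S)"
 define y where "y = t (k, k) \<cdot> ((ee \<boxtimes> ee) \<cdot> Inv S (t (0, 0)))"
 have y [simp]: "y : Arr S" "Dom S y = A 0" "Cod S y = A (k + k)"
  unfolding y_def using t_simps(3)[of 0 0] by simp_all
 have yt: "y \<cdot> (t (0, 0) \<cdot> (u \<boxtimes> u)) = t (k, k) \<cdot> (eta \<boxtimes> eta)"
  unfolding y_def using t_simps(3)[of 0 0] by (simp add: ar_assoc ar_tensor_Comp)
 have "y \<cdot> u = (y \<cdot> (u \<cdot> ?L)) \<cdot> Inv S ?L" by (simp add: ar_assoc)
 also have "... = (t (k, k) \<cdot> (eta \<boxtimes> eta)) \<cdot> Inv S ?L" unfolding unit_square[symmetric] yt ..
 also have "... = t (k, k) \<cdot> ((eta \<boxtimes> eta) \<cdot> Inv S ?L)" by (simp add: ar_assoc)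
 finally have yu: "y \<cdot> u = t (k, k) \<cdot> ((eta \<boxtimes> eta) \<cdot> Inv S ?L)" .
 have "dd \<cdot> ee = y <-> t (k, k) \<cdot> (Delta \<cdot> eta) = t (k, k) \<cdot> ((eta \<boxtimes> eta) \<cdot> Inv S ?L)"
  by (rule iso_eq_right[OF _ _ _ _ _ _ yu]) (simp_all add: ar_assoc)
 also have "... <-> Delta \<cdot> eta = (eta \<boxtimes> eta) \<cdot> Inv S ?L"
  by (rule iso_eq_left[of "t (k, k)", symmetric]) simp_all
 finally show ?thesis unfolding y_def by simp
qed

lemma conv_bi_counit: "c \<cdot>\<^sub>P m = c \<boxtimes>\<^sub>P c <-> eps \<cdot> mu = LUnit S (TUnit S) \<cdot> (eps \<boxtimes> eps)"
proof -
 let ?L = "LUnit S (TUnit S)"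
 define y where "y = t (0, 0) \<cdot> ((cc \<boxtimes> cc) \<cdot> Inv S (t (k, k)))"
 have y [simp]: "y : Arr S" "Dom S y = A (k + k)" "Cod S y = A 0"
  unfolding y_def using t_simps(3)[of 0 0] by simp_all
 have "u \<cdot> (?L \<cdot> (eps \<boxtimes> eps)) = (u \<cdot> ?L) \<cdot> (eps \<boxtimes> eps)" by (simp add: ar_assoc)
 also have "... = (t (0, 0) \<cdot> (u \<boxtimes> u)) \<cdot> (eps \<boxtimes> eps)" unfolding unit_square ..
 also have "... = y \<cdot> t (k, k)" unfolding y_def using t_simps(3)[of 0 0] by (simp add: ar_assoc ar_tensor_Comp)
 finally have yu: "y \<cdot> t (k, k) = u \<cdot> (?L \<cdot> (eps \<boxtimes> eps))" ..
 have "cc \<cdot> mm = y <-> u \<cdot> (eps \<cdot> mu) = u \<cdot> (?L \<cdot> (eps \<boxtimes> eps))"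
  by (rule iso_eq_right[OF _ _ _ _ _ _ yu]) (simp_all add: ar_assoc)
 also have "... <-> eps \<cdot> mu = ?L \<cdot> (eps \<boxtimes> eps)"
  by (rule iso_eq_left[of u, symmetric]) simp_all
 finally show ?thesis unfolding y_def by simp
qed

lemma conv_bi_unit_counit: "c \<cdot>\<^sub>P e = Ide P 0 <-> eps \<cdot> eta = Ide S (TUnit S)"
proof -
 have "cc \<cdot> ee = Ide S (A 0) <-> u \<cdot> (eps \<cdot> eta) = u"
  by (rule iso_eq_right[of u]) (simp_all add: ar_assoc)
 also have "... <-> eps \<cdot> eta = Ide S (TUnit S)"
  by (rule iso_eq_left[of u, symmetric]) simp_all
 finally show ?thesis by simp
qed

end

section \<open>Pullback squares in \<open>Q\<close>\<close>

context group
begin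

lemma lp_inv_lperms [simp]:
 assumes g: "g : lperms G n"
 shows "lp_inv G n g : lperms G n"
  and "qcomp G (qiso n g) (qiso n (lp_inv G n g)) = qide G n"
  and "qcomp G (qiso n (lp_inv G n g)) (qiso n g) = qide G n"
proof -
 let ?s = "perm g"
 have s: "?s permutes {1..n}" and x: "glabel g : {1..n} \<rightarrow>\<^sub>E carrier G" using g by (auto simp: lperms_iff)
 have inv: "inv_into UNIV ?s permutes {1..n}" by (rule permutes_inv[OF s])
 have gc: "glabel g k : carrier G" if "k : {1..n}" for k using x that by (rule PiE_mem)
 have ic: "glabel g (inv_into UNIV ?s k) : carrier G" if "k : {1..n}" for k
  using that permutes_in_image[OF inv, of k] gc by blast
 show i: "lp_inv G n g : lperms G n"
  unfolding lperms_iff lp_inv_def using inv ic by simp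
 have "lp_mult G n g (lp_inv G n g) = lp_one G n"
  unfolding lp_mult_def lp_one_def lp_inv_def
  using permutes_inv_o(1)[OF s] ic by (auto intro!: restrict_ext)
 then show "qcomp G (qiso n g) (qiso n (lp_inv G n g)) = qide G n"
  unfolding lp_mult_lperms(2)[OF g i] by (simp add: qide_def)
 have "lp_mult G n (lp_inv G n g) g = lp_one G n"
  unfolding lp_mult_def lp_one_def lp_inv_def
  using permutes_inv_o(2)[OF s] permutes_inverses(2)[OF s] gc permutes_in_image[OF s] by (auto intro!: restrict_ext)
 then show "qcomp G (qiso n (lp_inv G n g)) (qiso n g) = qide G n"
  unfolding lp_mult_lperms(2)[OF i g] by (simp add: qide_def)
qed

lemma QI_E:
 assumes "k : QI G"
 obtains g where "g : lperms G (qdom k)" "k = qiso (qdom k) g"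
 using assms unfolding QI_def by auto

lemma QI_inv:
 assumes "k : QI G"
 obtains k' where "k' : QI G" "qdom k' = qdom k" "qcod k' = qdom k"
  "qcomp G k k' = qide G (qdom k)" "qcomp G k' k = qide G (qdom k)"
proof -
 obtain g where g: "g : lperms G (qdom k)" and k: "k = qiso (qdom k) g" using QI_E[OF assms] .
 show thesis
 proof (rule that[of "qiso (qdom k) (lp_inv G (qdom k) g)"])
  show "qcomp G k (qiso (qdom k) (lp_inv G (qdom k) g)) = qide G (qdom k)"
   by (subst (1) k, rule lp_inv_lperms(2)[OF g])
  show "qcomp G (qiso (qdom k) (lp_inv G (qdom k) g)) k = qide G (qdom k)"
   by (subst (3) k, rule lp_inv_lperms(3)[OF g])
 qed (use g in simp_all)
qed

lemma lp_inv_lp_inv: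
 assumes g: "g : lperms G n"
 shows "lp_inv G n (lp_inv G n g) = g"
proof -
 let ?h = "lp_inv G n g" let ?k = "lp_inv G n ?h"
 have "qiso n ?k = qcomp G (qcomp G (qiso n g) (qiso n ?h)) (qiso n ?k)"
  using g qcomp_qide(2)[of "qiso n ?k"] by (simp add: qiso_QA)
 also have "... = qcomp G (qiso n g) (qcomp G (qiso n ?h) (qiso n ?k))"
  by (rule qcomp_assoc) (use g in "simp_all add: qiso_QA")
 also have "... = qiso n g"
  using g lp_inv_lperms(2)[of ?h n] qcomp_qide(1)[of "qiso n g"] by (simp add: qiso_QA)
 finally show ?thesis by (simp add: qiso_def)
qed

lemma QI_qf_inj:
 assumes "k : QI G" "Suc 0 <= y" "y <= qdom k" "Suc 0 <= z" "z <= qdom k" "qf k y = qf k z"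
 shows "y = z"
proof -
 have "inj_on (qf k) {1..qdom k}" using assms(1) by (simp add: QI_iff)
 from inj_onD[OF this assms(6)] show ?thesis using assms by simp
qed

text \<open>The exchange rule behind \<open>push\<close> and \<open>pull\<close>, checked pointwise;
  on orders it is \<open>pull_less\<close>.\<close>

lemma push_pull_square:
 assumes f: "f : ord_maps n m" and g: "g : lperms G m"
 shows "qcomp G (qiso m g) (qord G n m f) = qcomp G (qord G n m (push n m g f)) (qiso n (pull n m f g))"
proof -
 let ?p = "push n m g f" and ?q = "pull n m f g"
 have q: "?q : lperms G n" by (rule pull_lperms[OF f g])
 have p: "?p : ord_maps n m" by (rule push_ord_maps[OF f g])
 have [simp]: "qiso m g : QA G" "qiso n ?q : QA G" "qord G n m f : QA G" "qord G n m ?p : QA G" "f : ord_maps n m" "?p : ord_maps n m"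
  using f g p q by (simp_all add: qiso_QA)
 have fr: "Suc 0 <= f k & f k <= m" if "Suc 0 <= k" "k <= n" for k using ord_maps_range[OF f, of k] that by simp
 have qr: "Suc 0 <= perm ?q k & perm ?q k <= n" if "Suc 0 <= k" "k <= n" for k
  using permutes_in_image[OF perm_pull[OF f g], of k] that by simp
 have gc: "glabel g k : carrier G" if "Suc 0 <= k" "k <= m" for k
  using gl_carrier[of "qiso m g" G k] that by simp
 show ?thesis
 proof (rule qarr_eqI[of _ G])
  fix k assume k: "1 <= k" "k <= qdom (qcomp G (qiso m g) (qord G n m f))"
  then have k': "Suc 0 <= k" "k <= n" by simp_all
  have "qf (qcomp G (qiso m g) (qord G n m f)) k = perm g (f k)"
   using k' fr[OF k'] by (subst qcomp_qf) (auto simp: qiso_qf[OF g])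
  moreover have "qf (qcomp G (qord G n m ?p) (qiso n ?q)) k = ?p (perm ?q k)"
   using k' by (subst qcomp_qf) (auto simp: qiso_qf[OF q])
  ultimately show "qf (qcomp G (qiso m g) (qord G n m f)) k = qf (qcomp G (qord G n m ?p) (qiso n ?q)) k"
   using k' push_perm[OF f g, of k] by simp
  show "gl (qcomp G (qiso m g) (qord G n m f)) k = gl (qcomp G (qord G n m ?p) (qiso n ?q)) k"
   using k' fr[OF k'] qr[OF k'] gc by (simp add: qcomp_gl qiso_qf[OF q] pull_labels)
  show "cl (qcomp G (qiso m g) (qord G n m f)) k = cl (qcomp G (qord G n m ?p) (qiso n ?q)) k"
   using k' fr[OF k'] qr[OF k'] by (simp add: qcomp_cl qiso_qf[OF q] pull_labels)
  fix j assume j: "Suc 0 <= j" "j <= qdom (qcomp G (qiso m g) (qord G n m f))" "k ~= j"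
  then have j': "Suc 0 <= j" "j <= n" by simp_all
  have "perm g (f k) = perm g (f j) <-> f k = f j"
   using perm_inj[of "qiso m g" G "f k" "f j"] by simp
  moreover have "perm ?q k ~= perm ?q j" using perm_inj[of "qiso n ?q" G k j] j(3) by simp
  ultimately show "qlt (qcomp G (qiso m g) (qord G n m f)) k j = qlt (qcomp G (qord G n m ?p) (qiso n ?q)) k j"
   using k' j' j(3) fr[OF k'] fr[OF j'] qr[OF k'] qr[OF j'] pull_less[OF f g, of k j]
   by (auto simp: qcomp_qlt qiso_qf[OF q] fib_less_def)
 qed simp_all
qed

end

text \<open>
 The span \<open>(l, r)\<close> exhibits its middle object as the set-theoretic pullback of the cospan \<open>(f, h)\<close>;
 the labels of the two composites agree, but their orders only agree along the fibres of \<open>l\<close> and of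
 \<open>r\<close>. This determines \<open>(l, r)\<close> up to an isomorphism of the middle object.
\<close>

locale pullback = group G for G (structure) +
 fixes f h l r :: "'a qarr"
 assumes f: "f : QA G" and h: "h : QA G" and l: "l : QA G" and r: "r : QA G"
  and cod: "qcod h = qcod f" and cod_l: "qcod l = qdom f" and cod_r: "qcod r = qdom h" and dom: "qdom r = qdom l"
  and sq: "!!z. Suc 0 <= z ==> z <= qdom l ==> qf h (qf r z) = qf f (qf l z)"
  and joint: "!!y z. Suc 0 <= y ==> y <= qdom l ==> Suc 0 <= z ==> z <= qdom l ==>
   qf l y = qf l z ==> qf r y = qf r z ==> y = z"
  and fill: "!!a b. Suc 0 <= a ==> a <= qdom f ==> Suc 0 <= b ==> b <= qdom h ==> qf f a = qf h b ==>
   \<exists>z. Suc 0 <= z & z <= qdom l & qf l z = a & qf r z = b"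
  and glab: "!!z. Suc 0 <= z ==> z <= qdom l ==> gl h (qf r z) \<otimes> gl r z = gl f (qf l z) \<otimes> gl l z"
  and clab: "!!z. Suc 0 <= z ==> z <= qdom l ==> (cl h (qf r z) = cl r z) = (cl f (qf l z) = cl l z)"
  and ord_l: "!!y z. Suc 0 <= y ==> y <= qdom l ==> Suc 0 <= z ==> z <= qdom l ==> y ~= z ==>
   qf l y = qf l z ==> qlt h (qf r y) (qf r z) = (qlt l y z ~= cl f (qf l z))"
  and ord_r: "!!y z. Suc 0 <= y ==> y <= qdom l ==> Suc 0 <= z ==> z <= qdom l ==> y ~= z ==>
   qf r y = qf r z ==> qlt f (qf l y) (qf l z) = (qlt r y z ~= cl h (qf r z))"
begin

text \<open>The conditions come in mirrored pairs, so statements about the right leg follow from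
  those about the left leg.\<close>

lemma sym: "pullback G h f r l"
proof (rule pullback.intro[OF is_group], rule pullback_axioms.intro)
 show "\<exists>z. Suc 0 <= z & z <= qdom r & qf r z = a & qf l z = b"
  if "Suc 0 <= a" "a <= qdom h" "Suc 0 <= b" "b <= qdom f" "qf h a = qf f b" for a b
  using fill[of b a] that dom by auto
 show "y = z" if "Suc 0 <= y" "y <= qdom r" "Suc 0 <= z" "z <= qdom r" "qf r y = qf r z" "qf l y = qf l z" for y z
  using joint[of y z] that dom by simp
qed (use dom in "simp_all add: f h l r cod cod_l cod_r dom sq glab clab ord_l ord_r")

lemma rng: "Suc 0 <= z ==> z <= qdom l ==> Suc 0 <= qf l z" "Suc 0 <= z ==> z <= qdom l ==> qf l z <= qdom f"
 "Suc 0 <= z ==> z <= qdom l ==> Suc 0 <= qf r z" "Suc 0 <= z ==> z <= qdom l ==> qf r z <= qdom h"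
 using qf_range[OF l, of z] qf_range[OF r, of z] cod_l cod_r dom by auto

end

context group
begin

text \<open>Points paste as for sets and labels multiply; the work lies in the orders inside the
  fibres of the composite leg.\<close>

lemma pullback_comp_left:
 assumes "pullback G f h l r" and "pullback G f' l l' r'"
 shows "pullback G (qcomp G f f') h l' (qcomp G r r')"
proof -
 interpret A: pullback G f h l r by fact
 interpret B: pullback G f' l l' r' by fact
 let ?F = "qcomp G f f'" and ?R = "qcomp G r r'"
 have F: "?F : QA G" using A.f B.f B.cod A.cod_l by simp
 have R: "?R : QA G" using A.r B.r B.cod_r A.dom by simp
 have df: "qdom f = qcod f'" using B.cod A.cod_l by simp
 have dr: "qdom r = qcod r'" using B.cod_r A.dom by simp
 note Fs = qcomp_qf[OF B.f A.f df] qcomp_gl[OF B.f A.f df] qcomp_cl[OF B.f A.f df]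
 note Rs = qcomp_qf[OF B.r A.r dr] qcomp_gl[OF B.r A.r dr] qcomp_cl[OF B.r A.r dr]
 show ?thesis
 proof (rule pullback.intro[OF is_group], rule pullback_axioms.intro)
  fix z assume z: "Suc 0 <= z" "z <= qdom l'"
  let ?y = "qf r' z"
  have y: "Suc 0 <= ?y" "?y <= qdom l" using B.rng[OF z] by simp_all
  have zr: "z <= qdom r'" using z B.dom by simp
  note r1 = B.rng[OF z] A.rng[OF y]
  have fl: "qf f' (qf l' z) = qf l ?y" using B.sq[OF z] by simp
  show "qf h (qf ?R z) = qf ?F (qf l' z)" using A.sq[OF y] fl z zr r1 by (simp add: Fs Rs)
  have c: "gl f (qf l ?y) : carrier G" "gl h (qf r ?y) : carrier G" "gl l ?y : carrier G" "gl r ?y : carrier G"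
   "gl f' (qf l' z) : carrier G" "gl l' z : carrier G" "gl r' z : carrier G"
   using gl_carrier[OF A.f, of "qf l ?y"] gl_carrier[OF A.h, of "qf r ?y"] gl_carrier[OF A.l y] gl_carrier[OF A.r, of ?y]
    gl_carrier[OF B.f, of "qf l' z"] gl_carrier[OF B.l z] gl_carrier[OF B.r z(1) zr] y r1 A.dom by simp_all
  have "gl h (qf ?R z) \<otimes> gl ?R z = (gl h (qf r ?y) \<otimes> gl r ?y) \<otimes> gl r' z"
   using z zr c by (simp add: Rs m_assoc)
  also have "... = gl f (qf l ?y) \<otimes> (gl l ?y \<otimes> gl r' z)" unfolding A.glab[OF y] using c by (simp add: m_assoc)
  also have "... = gl ?F (qf l' z) \<otimes> gl l' z" unfolding B.glab[OF z] using c r1 fl by (simp add: Fs m_assoc)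
  finally show "gl h (qf ?R z) \<otimes> gl ?R z = gl ?F (qf l' z) \<otimes> gl l' z" .
  show "(cl h (qf ?R z) = cl ?R z) = (cl ?F (qf l' z) = cl l' z)"
   using A.clab[OF y] B.clab[OF z] fl z zr r1 by (auto simp: Fs Rs)
 next
  fix z x assume z: "Suc 0 <= z" "z <= qdom l'" and x: "Suc 0 <= x" "x <= qdom l'"
  have y: "Suc 0 <= qf r' z" "qf r' z <= qdom l" "Suc 0 <= qf r' x" "qf r' x <= qdom l"
   using B.rng[OF z] B.rng[OF x] by simp_all
  have zr: "z <= qdom r'" "x <= qdom r'" using z x B.dom by simp_all
  note r1 = B.rng[OF z] B.rng[OF x] A.rng[OF y(1,2)] A.rng[OF y(3,4)]
  have fl: "qf f' (qf l' z) = qf l (qf r' z)" "qf f' (qf l' x) = qf l (qf r' x)" using B.sq[OF z] B.sq[OF x] by simp_all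
  have Rz: "qf ?R z = qf r (qf r' z)" "qf ?R x = qf r (qf r' x)" using z x zr by (simp_all add: Rs)
  note qR = qcomp_qlt[OF B.r A.r dr z(1) zr(1) x(1) zr(2)]
  note qF = qcomp_qlt[OF B.f A.f df r1(1,2,5,6)]
  note cF = Fs(3)[OF r1(5,6)]
  have ll: "qf l (qf r' z) = qf l (qf r' x)" if "qf l' z = qf l' x"
   by (simp only: fl[symmetric] that)
  show "z = x" if e: "qf l' z = qf l' x" and e': "qf ?R z = qf ?R x"
   by (rule B.joint[OF z x e], rule A.joint[OF y ll[OF e]], rule e'[unfolded Rz])
  show "qlt h (qf ?R z) (qf ?R x) = (qlt l' z x ~= cl ?F (qf l' x))" if ne: "z ~= x" and e: "qf l' z = qf l' x"
  proof -
   have ne': "qf r' z ~= qf r' x" using B.joint[OF z x e] ne by blast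
   show ?thesis unfolding Rz cF fl A.ord_l[OF y ne' ll[OF e]] B.ord_l[OF z x ne e] by blast
  qed
  show "qlt ?F (qf l' z) (qf l' x) = (qlt ?R z x ~= cl h (qf ?R x))" if ne: "z ~= x" and e: "qf ?R z = qf ?R x"
  \<comment> \<open>Strands merged by \<open>?R\<close> are merged either by \<open>r'\<close>
    already, where the order comes from the square \<open>B\<close> up to reversal by labels in the
    square \<open>A\<close>, or only by \<open>r\<close>, where it comes from the square
    \<open>A\<close>.\<close>
  proof (cases "qf r' z = qf r' x")
   case True
   have t: "qlt r' x z <-> ~ qlt r' z x" using qlt_total[OF B.r ne] by blast
   have ne': "qf l' z ~= qf l' x" using B.joint[OF z x _ True] ne by blast
   have t': "qlt f' (qf l' x) (qf l' z) <-> ~ qlt f' (qf l' z) (qf l' x)" using qlt_total[OF B.f ne'] by blast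
   have F: "qlt ?F (qf l' z) (qf l' x) <-> (qlt f' (qf l' z) (qf l' x) ~= cl f (qf l (qf r' x)))"
    unfolding qF fl True t' by simp
   have R: "qlt ?R z x <-> (qlt r' z x ~= cl r (qf r' x))" unfolding qR t using True by simp
   show ?thesis
    unfolding F R Rz B.ord_r[OF z x ne True] using A.clab[OF y(3,4)] by blast
  next
   case False
   have e': "qf r (qf r' z) = qf r (qf r' x)" using e unfolding Rz .
   have ne': "qf l (qf r' z) ~= qf l (qf r' x)" using A.joint[OF y _ e'] False by blast
   have F: "qlt ?F (qf l' z) (qf l' x) <-> qlt f (qf l (qf r' z)) (qf l (qf r' x))"
    unfolding qF fl using ne' by simp
   have R: "qlt ?R z x <-> qlt r (qf r' z) (qf r' x)" unfolding qR using False by simp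
   show ?thesis unfolding F R Rz A.ord_r[OF y False e'] ..
  qed
 next
  fix a b assume a: "Suc 0 <= a" "a <= qdom ?F" and b: "Suc 0 <= b" "b <= qdom h" and e: "qf ?F a = qf h b"
  have a': "Suc 0 <= qf f' a" "qf f' a <= qdom f" using qf_range[OF B.f, of a] a df by simp_all
  obtain y where y: "Suc 0 <= y" "y <= qdom l" "qf l y = qf f' a" "qf r y = b"
   using A.fill[OF a' b] e a by (auto simp: Fs)
  obtain z where z: "Suc 0 <= z" "z <= qdom l'" "qf l' z = a" "qf r' z = y"
   using B.fill[of a y] a y by auto
  then show "\<exists>z. Suc 0 <= z & z <= qdom l' & qf l' z = a & qf ?R z = b"
   using y B.dom by (auto simp: Rs)
 qed (simp_all add: F R A.h B.l A.cod B.cod_l A.cod_r B.dom)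
qed

lemma pullback_comp_right:
 assumes "pullback G f h l r" and "pullback G r h' l' r'"
 shows "pullback G f (qcomp G h h') (qcomp G l l') r'"
 by (rule pullback.sym, rule pullback_comp_left) (rule pullback.sym, fact)+

text \<open>Since \<open>l\<close> is injective, its fibres impose no order condition; the condition
  for the fibres of \<open>r\<close> is read off from the equality of the composites.\<close>

lemma pullback_iso:
 assumes QA: "f : QA G" "h : QI G" "l : QI G" "r : QA G"
  and ty: "qcod h = qcod f" "qcod l = qdom f" "qcod r = qdom h" "qdom r = qdom l"
  and e: "qcomp G f l = qcomp G h r"
 shows "pullback G f h l r"
proof -
 have hQ: "h : QA G" and lQ: "l : QA G" using QA QI_QA by blast+
 note fl = qcomp_qf[OF lQ QA(1) ty(2)[symmetric]] qcomp_gl[OF lQ QA(1) ty(2)[symmetric]]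
  qcomp_cl[OF lQ QA(1) ty(2)[symmetric]] qcomp_qlt[OF lQ QA(1) ty(2)[symmetric]]
 note hr = qcomp_qf[OF QA(4) hQ ty(3)[symmetric]] qcomp_gl[OF QA(4) hQ ty(3)[symmetric]]
  qcomp_cl[OF QA(4) hQ ty(3)[symmetric]] qcomp_qlt[OF QA(4) hQ ty(3)[symmetric]]
 have rr: "Suc 0 <= qf r z & qf r z <= qdom h" if "Suc 0 <= z" "z <= qdom l" for z
  using qf_range[OF QA(4), of z] that ty by simp
 have sq: "qf h (qf r z) = qf f (qf l z)" if "Suc 0 <= z" "z <= qdom l" for z
  using fl(1)[OF that] hr(1)[of z] that ty e by simp
 have dl: "qcod l = qdom l" using QA(3) by (rule QI_qcod)
 have bij: "\<exists>z. Suc 0 <= z & z <= qdom l & qf l z = a" if "Suc 0 <= a" "a <= qdom f" for a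
 proof -
  have "qf l ` {1..qdom l} \<subseteq> {1..qdom l}" using qf_range[OF lQ] dl by auto
  moreover have "inj_on (qf l) {1..qdom l}" using QA(3) by (simp add: QI_iff)
  ultimately have "qf l ` {1..qdom l} = {1..qdom l}" by (intro endo_inj_surj) auto
  moreover have "a : {1..qdom l}" using that dl ty(2) by simp
  ultimately have "a : qf l ` {1..qdom l}" by simp
  then show ?thesis by auto
 qed
 show ?thesis
 proof (rule pullback.intro[OF is_group], rule pullback_axioms.intro)
  fix z assume z: "Suc 0 <= z" "z <= qdom l"
  then have zr: "z <= qdom r" using ty by simp
  show "gl h (qf r z) \<otimes> gl r z = gl f (qf l z) \<otimes> gl l z"
   using fl(2)[OF z] hr(2)[OF z(1) zr] e by simp
  show "(cl h (qf r z) = cl r z) = (cl f (qf l z) = cl l z)"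
   using fl(3)[OF z] hr(3)[OF z(1) zr] e by auto
 next
  fix y z assume y: "Suc 0 <= y" "y <= qdom l" and z: "Suc 0 <= z" "z <= qdom l"
  have inj: "qf l y = qf l z ==> y = z" by (rule QI_qf_inj[OF QA(3) y z])
  then show "qf l y = qf l z ==> qf r y = qf r z ==> y = z" by simp
  show "qlt h (qf r y) (qf r z) = (qlt l y z ~= cl f (qf l z))" if "y ~= z" "qf l y = qf l z" using inj that by simp
  show "qlt f (qf l y) (qf l z) = (qlt r y z ~= cl h (qf r z))" if ne: "y ~= z" and rz: "qf r y = qf r z"
  proof -
   have yr: "y <= qdom r" "z <= qdom r" using y z ty by simp_all
   have "qlt r y z <-> ~ qlt r z y" by (rule qlt_total[OF QA(4) ne])
   then have "qlt (qcomp G h r) y z <-> (qlt r y z ~= cl h (qf r z))"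
    using hr(4)[OF y(1) yr(1) z(1) yr(2)] rz by auto
   moreover have "qlt (qcomp G f l) y z = qlt f (qf l y) (qf l z)"
    using fl(4)[OF y z] inj ne by auto
   ultimately show ?thesis using e by simp
  qed
 next
  fix a b assume a: "Suc 0 <= a" "a <= qdom f" and b: "Suc 0 <= b" "b <= qdom h" and ab: "qf f a = qf h b"
  obtain z where z: "Suc 0 <= z" "z <= qdom l" "qf l z = a" using bij[OF a] by blast
  have "qf h (qf r z) = qf h b" using sq[OF z(1,2)] z(3) ab by simp
  then have "qf r z = b" using QI_qf_inj[OF QA(2), of "qf r z" b] rr[OF z(1,2)] b by simp
  then show "\<exists>z. Suc 0 <= z & z <= qdom l & qf l z = a & qf r z = b" using z by blast
 qed (simp_all add: QA hQ lQ ty sq)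
qed

lemma pullback_tensor:
 assumes "pullback G f h l r" and "pullback G f' h' l' r'"
 shows "pullback G (qtensor f f') (qtensor h h') (qtensor l l') (qtensor r r')"
proof -
 interpret A: pullback G f h l r by fact
 interpret B: pullback G f' h' l' r' by fact
 note Q = A.f A.h A.l A.r B.f B.h B.l B.r
 have dd: "qdom r = qdom l" "qdom r' = qdom l'" "qcod l = qdom f" "qcod r = qdom h" "qcod l' = qdom f'" "qcod r' = qdom h'"
   "qcod h = qcod f" "qcod h' = qcod f'"
  by (rule A.dom B.dom A.cod_l A.cod_r B.cod_l B.cod_r A.cod B.cod)+
 note T = qtensor_left[OF A.f B.f] qtensor_left[OF A.h B.h] qtensor_left[OF A.l B.l] qtensor_left[OF A.r B.r, unfolded dd]
  qtensor_right[OF A.f B.f] qtensor_right[OF A.h B.h] qtensor_right[OF A.l B.l] qtensor_right[OF A.r B.r, unfolded dd]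
 have nz: "0 < qf l' z" "0 < qf r' z" if "0 < z" "z <= qdom l'" for z
  using B.rng[of z] that by auto
 have sep: "qf l y ~= qf l' z + qdom f" "qf r y ~= qf r' z + qdom h" "qf l' z + qdom f ~= qf l y" "qf r' z + qdom h ~= qf r y"
  if "Suc 0 <= y" "y <= qdom l" "0 < z" "z <= qdom l'" for y z
  using A.rng[of y] nz[of z] that by auto
 show ?thesis
 proof (rule pullback.intro[OF is_group], rule pullback_axioms.intro)
  fix z assume "Suc 0 <= z" "z <= qdom (qtensor l l')"
  then have z: "Suc 0 <= z" "z <= qdom l + qdom l'" by simp_all
  show "qf (qtensor h h') (qf (qtensor r r') z) = qf (qtensor f f') (qf (qtensor l l') z)"
   using z by (rule split_cases) (use z in "simp_all add: T dd A.sq B.sq A.rng B.rng nz")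
  show "gl (qtensor h h') (qf (qtensor r r') z) \<otimes> gl (qtensor r r') z = gl (qtensor f f') (qf (qtensor l l') z) \<otimes> gl (qtensor l l') z"
   using z by (rule split_cases) (use z in "simp_all add: T dd A.glab B.glab A.rng B.rng nz del: qtensor_labels")
  show "(cl (qtensor h h') (qf (qtensor r r') z) = cl (qtensor r r') z) = (cl (qtensor f f') (qf (qtensor l l') z) = cl (qtensor l l') z)"
   using z by (rule split_cases) (use z in "simp_all add: T dd A.clab B.clab A.rng B.rng nz del: qtensor_labels")
 next
  fix y z assume "Suc 0 <= y" "y <= qdom (qtensor l l')" and "Suc 0 <= z" "z <= qdom (qtensor l l')"
  then have y: "Suc 0 <= y" "y <= qdom l + qdom l'" and z: "Suc 0 <= z" "z <= qdom l + qdom l'" by simp_all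
  show "y = z" if "qf (qtensor l l') y = qf (qtensor l l') z" "qf (qtensor r r') y = qf (qtensor r r') z"
   using y by (rule split_cases; use z in "rule split_cases")
    (use y z that A.joint[of y z] in "auto simp: T dd sep intro: B.joint")
  show "qlt (qtensor h h') (qf (qtensor r r') y) (qf (qtensor r r') z) = (qlt (qtensor l l') y z ~= cl (qtensor f f') (qf (qtensor l l') z))"
   if "y ~= z" "qf (qtensor l l') y = qf (qtensor l l') z"
   using y by (rule split_cases; use z in "rule split_cases")
    (use y z that in "simp_all add: T dd sep A.ord_l B.ord_l A.rng B.rng nz del: qtensor_labels")
  show "qlt (qtensor f f') (qf (qtensor l l') y) (qf (qtensor l l') z) = (qlt (qtensor r r') y z ~= cl (qtensor h h') (qf (qtensor r r') z))"
   if "y ~= z" "qf (qtensor r r') y = qf (qtensor r r') z"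
   using y by (rule split_cases; use z in "rule split_cases")
    (use y z that in "simp_all add: T dd sep A.ord_r B.ord_r A.rng B.rng nz del: qtensor_labels")
 next
  fix a b assume "Suc 0 <= a" "a <= qdom (qtensor f f')" "Suc 0 <= b" "b <= qdom (qtensor h h')"
   and e: "qf (qtensor f f') a = qf (qtensor h h') b"
  then have a: "Suc 0 <= a" "a <= qdom f + qdom f'" and b: "Suc 0 <= b" "b <= qdom h + qdom h'" by simp_all
  note F = T(1) qtensor_left(1)[OF A.h B.h] qtensor_right(1)[OF A.f B.f] qtensor_right(1)[OF A.h B.h]
  show "\<exists>z. Suc 0 <= z & z <= qdom (qtensor l l') & qf (qtensor l l') z = a & qf (qtensor r r') z = b"
   using a
  proof (rule split_cases)
   assume a': "a <= qdom f"
   show ?thesis using b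
   proof (rule split_cases)
    assume b': "b <= qdom h"
    obtain z where z: "Suc 0 <= z" "z <= qdom l" "qf l z = a" "qf r z = b"
     using A.fill[OF a(1) a' b(1) b'] e a b a' b' by (auto simp: F)
    then show ?thesis by (intro exI[of _ z]) (simp add: T dd)
   next
    fix j assume j: "b = j + qdom h" "0 < j" "j <= qdom h'"
    have "qf f a <= qcod f" using qf_range[OF A.f a(1) a'] by simp
    moreover have "0 < qf h' j" using qf_nz[OF B.h, of j] j by simp
    ultimately show ?thesis using e a a' j dd by (simp add: F)
   qed
  next
   fix i assume i: "a = i + qdom f" "0 < i" "i <= qdom f'"
   show ?thesis using b
   proof (rule split_cases)
    assume b': "b <= qdom h"
    have "qf h b <= qcod f" using qf_range[OF A.h b(1) b'] dd by simp
    moreover have "0 < qf f' i" using qf_nz[OF B.f, of i] i by simp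
    ultimately show ?thesis using e b b' i dd by (simp add: F)
   next
    fix j assume j: "b = j + qdom h" "0 < j" "j <= qdom h'"
    obtain z where z: "Suc 0 <= z" "z <= qdom l'" "qf l' z = i" "qf r' z = j"
     using B.fill[of i j] e i j dd by (auto simp: F)
    then show ?thesis using i j by (intro exI[of _ "z + qdom l"]) (simp add: T dd)
   qed
  qed
 qed (simp_all add: Q dd)
qed

end

section \<open>Uniqueness of pullbacks, and the distributive law as a source of pullbacks\<close>

context group
begin

lemma pullback_qide_right: "f : QA G ==> pullback G f (qide G (qcod f)) (qide G (qdom f)) f"
 by (rule pullback_iso) (simp_all add: qcomp_qide)

lemma pullback_qide_left: "f : QA G ==> pullback G (qide G (qcod f)) f f (qide G (qdom f))"
 by (rule pullback.sym[OF pullback_qide_right])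

text \<open>The pullback of an isomorphism along itself is trivial; pasting it in adds
  \<open>k\<close> to each leg of the cospan.\<close>

lemma pullback_cospan_iso:
 assumes "pullback G f h l r" and k: "k : QI G" "qdom k = qcod f"
 shows "pullback G (qcomp G k f) (qcomp G k h) l r"
proof -
 interpret A: pullback G f h l r by fact
 have kQ: "k : QA G" using k(1) by (rule QI_QA)
 have "pullback G k k (qide G (qdom k)) (qide G (qdom k))"
  by (rule pullback_iso) (use k kQ in simp_all)
 from pullback_comp_left[OF this, of f "qide G (qdom f)" f]
 have "pullback G (qcomp G k f) k (qide G (qdom f)) f"
  using pullback_qide_right[OF A.f] k(2) qcomp_qide(2)[OF A.f] by simp
 from pullback_comp_right[OF this assms(1)] show ?thesis
  using qcomp_qide(2)[OF A.l] A.cod_l by simp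
qed

lemma pullback_span_iso:
 assumes "pullback G f h l r" and k: "k : QI G" "qcod k = qdom l"
 shows "pullback G f h (qcomp G l k) (qcomp G r k)"
proof -
 interpret A: pullback G f h l r by fact
 have kQ: "k : QA G" using k(1) by (rule QI_QA)
 have dk: "qdom k = qdom l" using k QI_qcod by simp
 have dr: "qdom r = qcod k" and dl: "qdom l = qcod k" using k A.dom by simp_all
 note Ls = qcomp_qf[OF kQ A.l dl] qcomp_gl[OF kQ A.l dl] qcomp_cl[OF kQ A.l dl] qcomp_qlt[OF kQ A.l dl]
 note Rs = qcomp_qf[OF kQ A.r dr] qcomp_gl[OF kQ A.r dr] qcomp_cl[OF kQ A.r dr] qcomp_qlt[OF kQ A.r dr]
 have rk: "Suc 0 <= qf k z" "qf k z <= qdom l" if "Suc 0 <= z" "z <= qdom k" for z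
  using qf_range[OF kQ that] k by simp_all
 show ?thesis
 proof (rule pullback.intro[OF is_group], rule pullback_axioms.intro, unfold qdc)
  fix z assume z: "Suc 0 <= z" "z <= qdom k"
  note y = rk[OF z]
  show "qf h (qf (qcomp G r k) z) = qf f (qf (qcomp G l k) z)"
   unfolding Ls(1)[OF z] Rs(1)[OF z] by (rule A.sq[OF y])
  have c: "gl k z : carrier G" "gl l (qf k z) : carrier G" "gl r (qf k z) : carrier G"
   "gl f (qf l (qf k z)) : carrier G" "gl h (qf r (qf k z)) : carrier G"
   using gl_carrier[OF kQ z] gl_carrier[OF A.l y] gl_carrier[OF A.r, of "qf k z"] gl_carrier[OF A.f, of "qf l (qf k z)"]
    gl_carrier[OF A.h, of "qf r (qf k z)"] A.rng[OF y] y A.dom by simp_all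
  show "gl h (qf (qcomp G r k) z) \<otimes> gl (qcomp G r k) z = gl f (qf (qcomp G l k) z) \<otimes> gl (qcomp G l k) z"
   unfolding Ls(1,2)[OF z] Rs(1,2)[OF z] using A.glab[OF y] c by (simp add: m_assoc[symmetric])
  show "(cl h (qf (qcomp G r k) z) = cl (qcomp G r k) z) = (cl f (qf (qcomp G l k) z) = cl (qcomp G l k) z)"
   unfolding Ls(1,3)[OF z] Rs(1,3)[OF z] using A.clab[OF y] by blast
 next
  fix y z assume y: "Suc 0 <= y" "y <= qdom k" and z: "Suc 0 <= z" "z <= qdom k"
  note yk = rk[OF y] and zk = rk[OF z]
  have inj: "qf k y = qf k z ==> y = z" by (rule QI_qf_inj[OF k(1) y z])
  show "y = z" if "qf (qcomp G l k) y = qf (qcomp G l k) z" "qf (qcomp G r k) y = qf (qcomp G r k) z"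
   by (rule inj, rule A.joint[OF yk zk]) (use that Ls(1)[OF y] Ls(1)[OF z] Rs(1) y z dr in simp_all)
  show "qlt h (qf (qcomp G r k) y) (qf (qcomp G r k) z) = (qlt (qcomp G l k) y z ~= cl f (qf (qcomp G l k) z))"
   if ne: "y ~= z" and e: "qf (qcomp G l k) y = qf (qcomp G l k) z"
  proof -
   have nk: "qf k y ~= qf k z" using inj ne by blast
   have "qlt (qcomp G l k) y z = qlt l (qf k y) (qf k z)" unfolding Ls(4)[OF y z] using nk by simp
   then show ?thesis using A.ord_l[OF yk zk nk] e unfolding Ls(1)[OF y] Ls(1)[OF z] Rs(1)[OF y] Rs(1)[OF z] by simp
  qed
  show "qlt f (qf (qcomp G l k) y) (qf (qcomp G l k) z) = (qlt (qcomp G r k) y z ~= cl h (qf (qcomp G r k) z))"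
   if ne: "y ~= z" and e: "qf (qcomp G r k) y = qf (qcomp G r k) z"
  proof -
   have nk: "qf k y ~= qf k z" using inj ne by blast
   have "qlt (qcomp G r k) y z = qlt r (qf k y) (qf k z)" unfolding Rs(4)[OF y z] using nk by simp
   then show ?thesis using A.ord_r[OF yk zk nk] e unfolding Ls(1)[OF y] Ls(1)[OF z] Rs(1)[OF y] Rs(1)[OF z] by simp
  qed
 next
  fix a b assume "Suc 0 <= a" "a <= qdom f" "Suc 0 <= b" "b <= qdom h" "qf f a = qf h b"
  then obtain y where y: "Suc 0 <= y" "y <= qdom l" "qf l y = a" "qf r y = b" using A.fill by blast
  have "qf k ` {1..qdom k} = {1..qdom k}"
   by (rule endo_inj_surj) (use rk dk k(1) in "auto simp: QI_iff")
  moreover have "y : {1..qdom k}" using y dk by simp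
  ultimately obtain z where "z : {1..qdom k}" "qf k z = y" by (metis imageE)
  then have z: "Suc 0 <= z" "z <= qdom k" "qf k z = y" by simp_all
  show "\<exists>z. Suc 0 <= z & z <= qdom k & qf (qcomp G l k) z = a & qf (qcomp G r k) z = b"
   using Ls(1)[OF z(1,2)] Rs(1)[OF z(1,2)] z y by (intro exI[of _ z]) simp
 qed (use A.l A.r kQ dl dr in "simp_all add: A.f A.h A.cod A.cod_l A.cod_r")
qed

text \<open>Points correspond as in pullbacks of sets. The labels and the permutation of
  \<open>k\<close> are forced by \<open>l' = qcomp G l k\<close>. Orders on the two middle objects
  agree between fibres because of the underlying maps, and inside fibres by \<open>ord_l\<close> and
  \<open>ord_r\<close>.\<close>

lemma pullback_unique:
 assumes "pullback G f h l r" and "pullback G f h l' r'"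
 obtains k where "k : QI G" "qdom k = qdom l" "qcod k = qdom l" "l' = qcomp G l k" "r' = qcomp G r k"
proof -
 interpret A: pullback G f h l r by fact
 interpret B: pullback G f h l' r' by fact
 let ?q = "qdom l'"
 have "\<exists>y. Suc 0 <= y & y <= qdom l & qf l y = qf l' z & qf r y = qf r' z" if z: "Suc 0 <= z" "z <= ?q" for z
  by (rule A.fill[OF B.rng[OF z]]) (use B.sq[OF z] in simp)
 then have "\<forall>z. \<exists>y. Suc 0 <= z & z <= ?q --> Suc 0 <= y & y <= qdom l & qf l y = qf l' z & qf r y = qf r' z" by blast
 from choice[OF this] obtain p where p': "!!z. Suc 0 <= z ==> z <= ?q ==>
   Suc 0 <= p z & p z <= qdom l & qf l (p z) = qf l' z & qf r (p z) = qf r' z" by blast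
 have p: "Suc 0 <= p z" "p z <= qdom l" "qf l (p z) = qf l' z" "qf r (p z) = qf r' z" if "Suc 0 <= z" "z <= ?q" for z
  using p'[OF that] by blast+
 have inj: "inj_on p {1..?q}"
 proof (rule inj_onI)
  fix y z assume "y : {1..?q}" "z : {1..?q}" and e: "p y = p z"
  then have y: "Suc 0 <= y" "y <= ?q" and z: "Suc 0 <= z" "z <= ?q" by auto
  show "y = z"
   by (rule B.joint[OF y z]) (simp_all only: p(3,4)[OF y, symmetric] p(3,4)[OF z, symmetric] e)
 qed
 have surj: "p ` {1..?q} = {1..qdom l}"
 proof (intro equalityI subsetI)
  fix y assume "y : {1..qdom l}"
  then have y: "Suc 0 <= y" "y <= qdom l" by auto
  obtain z where z: "Suc 0 <= z" "z <= ?q" "qf l' z = qf l y" "qf r' z = qf r y"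
   using B.fill[OF A.rng[OF y]] A.sq[OF y] by metis
  have "p z = y" by (rule A.joint) (use y z p in simp_all)
  then show "y : p ` {1..?q}" using z by force
 qed (use p in auto)
 have bij: "bij_betw p {1..?q} {1..qdom l}" using inj surj by (simp add: bij_betw_def)
 have q: "?q = qdom l" using bij_betw_same_card[OF bij] by simp
 define s where "s = (%z. if z : {1..?q} then p z else z)"
 have "bij_betw s {1..?q} {1..?q}"
  using bij unfolding q by (rule bij_betw_cong[THEN iffD2, rotated]) (simp add: s_def q)
 then have s: "s permutes {1..?q}" by (rule bij_imp_permutes) (unfold s_def, rule if_not_P)
 have sp: "s z = p z" if "Suc 0 <= z" "z <= ?q" for z using that by (simp add: s_def)
 \<comment> \<open>The label \<open>x\<close> at \<open>z\<close> solves
   \<open>gl l' z = gl l (p z) \<otimes> x\<close>; in the group of order two the solution is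
   \<open>~=\<close>.\<close>
 define g where "g = LPerm (\<lambda>z \<in> {1..?q}. inv (gl l (p z)) \<otimes> gl l' z) (\<lambda>z \<in> {1..?q}. cl l (p z) ~= cl l' z) s"
 have cl: "gl l (p z) : carrier G" "gl l' z : carrier G" "gl r (p z) : carrier G" "gl r' z : carrier G"
  "gl f (qf l' z) : carrier G" "gl h (qf r' z) : carrier G" if z: "Suc 0 <= z" "z <= ?q" for z
  using gl_carrier[OF A.l p(1,2)[OF z]] gl_carrier[OF B.l z] gl_carrier[OF A.r p(1)[OF z]] gl_carrier[OF B.r z(1)]
   gl_carrier[OF A.f, of "qf l' z"] gl_carrier[OF A.h, of "qf r' z"] p(1,2)[OF z] z A.dom B.dom B.rng[OF z] by simp_all
 have g: "g : lperms G ?q"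
  unfolding lperms_iff g_def using s cl by auto
 define k where "k = qiso ?q g"
 have k: "k : QI G" "k : QA G" "qdom k = ?q" "qcod k = ?q" using g by (simp_all add: k_def qiso_QA)
 have kf: "qf k z = p z" "gl k z = inv (gl l (p z)) \<otimes> gl l' z" "cl k z = (cl l (p z) ~= cl l' z)"
  if z: "Suc 0 <= z" "z <= ?q" for z
  using z sp[OF z] unfolding k_def qiso_qf[OF g z] by (simp_all add: g_def)
 have pne: "p y ~= p z" if "Suc 0 <= y" "y <= ?q" "Suc 0 <= z" "z <= ?q" "y ~= z" for y z
  using inj_onD[OF inj, of y z] that by auto
 have dl: "qdom l = qcod k" and dr: "qdom r = qcod k" using q k A.dom by simp_all
 have "l' = qcomp G l k"
 proof (rule qarr_eqI[of _ G])
  fix z assume "1 <= z" "z <= ?q"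
  then have z: "Suc 0 <= z" "z <= ?q" by simp_all
  have zk: "z <= qdom k" using z k by simp
  show "qf l' z = qf (qcomp G l k) z"
   unfolding qcomp_qf[OF k(2) A.l dl z(1) zk] kf[OF z] p(3)[OF z] ..
  show "gl l' z = gl (qcomp G l k) z"
   unfolding qcomp_gl[OF k(2) A.l dl z(1) zk] kf[OF z] using cl[OF z] by (simp add: m_assoc[symmetric])
  show "cl l' z = cl (qcomp G l k) z"
   unfolding qcomp_cl[OF k(2) A.l dl z(1) zk] kf[OF z] by blast
  fix y assume y: "Suc 0 <= y" "y <= ?q" and ne: "z ~= y"
  have yk: "y <= qdom k" using y k by simp
  have pn: "p z ~= p y" by (rule pne[OF z y ne])
  have "qlt l' z y = qlt l (p z) (p y)"
  proof (cases "qf l' z = qf l' y")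
   case True
   then have "qf l (p z) = qf l (p y)" using p(3)[OF z] p(3)[OF y] by simp
   from A.ord_l[OF p(1,2)[OF z] p(1,2)[OF y] pn this] B.ord_l[OF z y ne True]
   show ?thesis unfolding p(3,4)[OF z] p(3,4)[OF y] by blast
  next
   case False
   then have "qf l (p z) ~= qf l (p y)" using p(3)[OF z] p(3)[OF y] by simp
   from qf_less_iff[OF A.l p(1,2)[OF z] p(1,2)[OF y] this] qf_less_iff[OF B.l z y False]
   show ?thesis unfolding p(3)[OF z] p(3)[OF y] by blast
  qed
  then show "qlt l' z y = qlt (qcomp G l k) z y"
   unfolding qcomp_qlt[OF k(2) A.l dl z(1) zk y(1) yk] kf(1)[OF z] kf(1)[OF y] using pn by simp
 qed (use B.l A.l k dl A.cod_l B.cod_l in simp_all)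
 moreover have "r' = qcomp G r k"
 proof (rule qarr_eqI[of _ G])
  fix z assume "1 <= z" "z <= qdom r'"
  then have z: "Suc 0 <= z" "z <= ?q" using B.dom by simp_all
  have zk: "z <= qdom k" using z k by simp
  show "qf r' z = qf (qcomp G r k) z"
   unfolding qcomp_qf[OF k(2) A.r dr z(1) zk] kf[OF z] p(4)[OF z] ..
  \<comment> \<open>The label of \<open>k\<close> was chosen for the left leg. It fits the right leg
    because both squares express the labels over \<open>h\<close> through those over
    \<open>f\<close>.\<close>
  have "gl h (qf r' z) \<otimes> gl r (p z) = gl f (qf l' z) \<otimes> gl l (p z)"
   using A.glab[OF p(1,2)[OF z]] unfolding p(3,4)[OF z] .
  then have "gl h (qf r' z) \<otimes> (gl r (p z) \<otimes> (inv (gl l (p z)) \<otimes> gl l' z)) = gl f (qf l' z) \<otimes> gl l' z"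
   using cl[OF z] by (simp add: m_assoc[symmetric]) (simp add: m_assoc)
  also have "... = gl h (qf r' z) \<otimes> gl r' z" using B.glab[OF z] ..
  finally show "gl r' z = gl (qcomp G r k) z"
   unfolding qcomp_gl[OF k(2) A.r dr z(1) zk] kf[OF z] using cl[OF z] by simp
  show "cl r' z = cl (qcomp G r k) z"
   unfolding qcomp_cl[OF k(2) A.r dr z(1) zk] kf[OF z]
   using A.clab[OF p(1,2)[OF z]] B.clab[OF z] unfolding p(3,4)[OF z] by blast
  fix y assume "Suc 0 <= y" "y <= qdom r'" and ne: "z ~= y"
  then have y: "Suc 0 <= y" "y <= ?q" using B.dom by simp_all
  have yk: "y <= qdom k" using y k by simp
  have pn: "p z ~= p y" by (rule pne[OF z y ne])
  have zr: "p z <= qdom r" "p y <= qdom r" "z <= qdom r'" "y <= qdom r'" using p z y A.dom B.dom by simp_all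
  have "qlt r' z y = qlt r (p z) (p y)"
  proof (cases "qf r' z = qf r' y")
   case True
   then have "qf r (p z) = qf r (p y)" using p(4)[OF z] p(4)[OF y] by simp
   from A.ord_r[OF p(1,2)[OF z] p(1,2)[OF y] pn this] B.ord_r[OF z y ne True]
   show ?thesis unfolding p(3,4)[OF z] p(3,4)[OF y] by blast
  next
   case False
   then have "qf r (p z) ~= qf r (p y)" using p(4)[OF z] p(4)[OF y] by simp
   from qf_less_iff[OF A.r p(1)[OF z] zr(1) p(1)[OF y] zr(2) this] qf_less_iff[OF B.r z(1) zr(3) y(1) zr(4) False]
   show ?thesis unfolding p(4)[OF z] p(4)[OF y] by blast
  qed
  then show "qlt r' z y = qlt (qcomp G r k) z y"
   unfolding qcomp_qlt[OF k(2) A.r dr z(1) zk y(1) yk] kf(1)[OF z] kf(1)[OF y] using pn by simp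
 qed (use B.r A.r k dr A.cod_r B.cod_r B.dom in simp_all)
 ultimately show thesis using that k q by simp
qed

lemma q_m_q_u [simp]: "q_m G : QA G" "qdom (q_m G) = 2" "qcod (q_m G) = 1"
 "q_u G : QA G" "qdom (q_u G) = 0" "qcod (q_u G) = 1"
 unfolding q_m_qmn q_u_qmn by simp_all

lemma q_sigma23 [simp]: "q_sigma23 G : QI G" "q_sigma23 G : QA G" "qdom (q_sigma23 G) = 4" "qcod (q_sigma23 G) = 4"
 unfolding q_sigma23_def by (simp_all add: qtensor_QI)

lemma le_4: "Suc 0 <= z ==> z <= 4 <-> z = 1 \<or> z = 2 \<or> z = 3 \<or> z = (4 :: nat)"
 by auto

lemma pullback_m_m: "pullback G (q_m G) (q_m G) (qcomp G (qtensor (q_m G) (q_m G)) (q_sigma23 G)) (qtensor (q_m G) (q_m G))"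
proof -
 let ?r = "qtensor (q_m G) (q_m G)"
 let ?l = "qcomp G ?r (q_sigma23 G)"
 let ?s = "%z. if z = 2 then 3 else if z = 3 then 2 else z :: nat"
 have r: "?r : QA G" "qdom ?r = 4" "qdom ?r = qcod (q_sigma23 G)" by simp_all
 have m: "qf (q_m G) z = 1" "gl (q_m G) z = \<one>" "~ cl (q_m G) z" if "Suc 0 <= z" "z <= 2" for z
  using that unfolding q_m_qmn by simp_all
 have m': "qlt (q_m G) y z <-> y < z" for y z unfolding q_m_qmn by simp
 have R: "qf ?r z = (if z <= 2 then 1 else 2)" "gl ?r z = \<one>" "~ cl ?r z" if "Suc 0 <= z" "z <= 4" for z
  using that m[of z] m[of "z - 2"] by (simp_all add: qtensor_qf[of _ G])
 have R': "qlt ?r y z <-> y < z" if "Suc 0 <= y" "y <= 4" "Suc 0 <= z" "z <= 4" for y z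
  using that by (auto simp add: qtensor_qlt[of _ G] m')
 have S: "qf (q_sigma23 G) z = ?s z" "gl (q_sigma23 G) z = \<one>" "~ cl (q_sigma23 G) z" if z: "Suc 0 <= z" "z <= 4" for z
  using z unfolding q_sigma23_def by (auto simp: qtensor_qf[of _ G] le_4[OF z(1)])
 have sr: "Suc 0 <= ?s z" "?s z <= 4" if "Suc 0 <= z" "z <= 4" for z using that by auto
 have L: "qf ?l z = (if ?s z <= 2 then 1 else 2)" "gl ?l z = \<one>" "~ cl ?l z" if z: "Suc 0 <= z" "z <= 4" for z
  using z sr[OF z] by (simp_all add: qcomp_qf qcomp_gl qcomp_cl S R del: if_split qtensor_labels)
 have L': "qlt ?l y z <-> ?s y < ?s z" if y: "Suc 0 <= y" "y <= 4" and z: "Suc 0 <= z" "z <= 4" and ne: "y ~= z" for y z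
 proof -
  have "?s y ~= ?s z" using ne by auto
  moreover have d: "y <= qdom (q_sigma23 G)" "z <= qdom (q_sigma23 G)" using y z by simp_all
  ultimately show ?thesis
   unfolding qcomp_qlt[OF q_sigma23(2) r(1) r(3) y(1) d(1) z(1) d(2)] S(1)[OF y] S(1)[OF z]
   using R'[OF sr[OF y] sr[OF z]] by presburger
 qed
 have rg: "Suc 0 <= qf ?r z" "qf ?r z <= 2" "Suc 0 <= qf ?l z" "qf ?l z <= 2" if z: "Suc 0 <= z" "z <= 4" for z
  unfolding L[OF z] R[OF z] by simp_all
 have dl: "qdom ?l = 4" by simp
 show ?thesis
 proof (rule pullback.intro[OF is_group], rule pullback_axioms.intro, unfold dl)
  fix z :: nat assume z: "Suc 0 <= z" "z <= 4"
  show "qf (q_m G) (qf ?r z) = qf (q_m G) (qf ?l z)" using m rg[OF z] by simp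
  show "gl (q_m G) (qf ?r z) \<otimes> gl ?r z = gl (q_m G) (qf ?l z) \<otimes> gl ?l z"
   using m rg[OF z] L(2)[OF z] R(2)[OF z] by simp
  show "(cl (q_m G) (qf ?r z) = cl ?r z) = (cl (q_m G) (qf ?l z) = cl ?l z)"
   using m rg[OF z] L(3)[OF z] R(3)[OF z] by simp
 next
  fix y z :: nat assume y: "Suc 0 <= y" "y <= 4" and z: "Suc 0 <= z" "z <= 4"
  have yz: "y = 1 \<or> y = 2 \<or> y = 3 \<or> y = 4" "z = 1 \<or> z = 2 \<or> z = 3 \<or> z = 4" using y z by auto
  show "y = z" if "qf ?l y = qf ?l z" "qf ?r y = qf ?r z"
   using that unfolding L(1)[OF y] L(1)[OF z] R(1)[OF y] R(1)[OF z] using yz by (elim disjE) simp_all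
  show "qlt (q_m G) (qf ?r y) (qf ?r z) = (qlt ?l y z ~= cl (q_m G) (qf ?l z))" if ne: "y ~= z" and e: "qf ?l y = qf ?l z"
   using e m(3)[OF rg(3,4)[OF z]] ne unfolding L'[OF y z ne] L(1)[OF y] L(1)[OF z] R(1)[OF y] R(1)[OF z] m'
   using yz by (elim disjE) simp_all
  show "qlt (q_m G) (qf ?l y) (qf ?l z) = (qlt ?r y z ~= cl (q_m G) (qf ?r z))" if ne: "y ~= z" and e: "qf ?r y = qf ?r z"
   using e m(3)[OF rg(1,2)[OF z]] ne unfolding R'[OF y z] L(1)[OF y] L(1)[OF z] R(1)[OF y] R(1)[OF z] m'
   using yz by (elim disjE) simp_all
 next
  fix a b assume "Suc 0 <= a" "a <= qdom (q_m G)" "Suc 0 <= b" "b <= qdom (q_m G)"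
  then have ab: "a = 1 \<or> a = 2" "b = 1 \<or> b = 2" by auto
  \<comment> \<open>Position in the list (1,1), (2,1), (1,2), (2,2) of pairs \<open>(a, b)\<close>:
    \<open>?r\<close> reads off the block and, because of \<open>q_sigma23\<close>,
    \<open>?l\<close> the place inside the block.\<close>
  define z :: nat where "z = (if a = 1 then if b = 1 then 1 else 3 else if b = 1 then 2 else 4)"
  have z: "Suc 0 <= z" "z <= 4" by (simp_all add: z_def)
  have "qf ?l z = a & qf ?r z = b" unfolding L(1)[OF z] R(1)[OF z] using ab by (auto simp: z_def)
  then show "\<exists>z. Suc 0 <= z & z <= 4 & qf ?l z = a & qf ?r z = b" using z by blast
 qed simp_all
qed

lemma pullback_u_u: "pullback G (q_u G) (q_u G) (qide G 0) (qide G 0)"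
 by (rule pullback.intro[OF is_group], rule pullback_axioms.intro) simp_all

lemma pullback_m_u: "pullback G (q_m G) (q_u G) (qtensor (q_u G) (q_u G)) (qide G 0)"
 by (rule pullback.intro[OF is_group], rule pullback_axioms.intro) simp_all

text \<open>Inverts two parallel sides of a commutative square. It turns
  \<open>push_pull_square\<close> into the form with inverses in which the distributive law is
  stated.\<close>

lemma QI_conj:
 assumes a: "a : QA G" and b: "b : QA G" and k: "k : QA G" "k' : QA G" "qdom k = qcod a" "qdom k' = qcod k" "qcod b = qcod k"
  "qcomp G k' k = qide G (qdom k)" and j: "j : QA G" "j' : QA G" "qdom j = qdom a" "qcod j' = qdom j" "qcod j = qdom b" "qdom j' = qcod j"
  "qcomp G j j' = qide G (qcod j)" and e: "qcomp G k a = qcomp G b j"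
 shows "qcomp G a j' = qcomp G k' b"
proof -
 have kc: "qcod k' = qdom k" using arg_cong[OF k(6), of qcod] by simp
 have "qcomp G k' b = qcomp G (qcomp G k' b) (qcomp G j j')"
  using qcomp_qide(1)[of "qcomp G k' b"] b k j by simp
 also have "... = qcomp G (qcomp G k' (qcomp G b j)) j'" using b k j by (simp add: qcomp_assoc)
 also have "qcomp G k' (qcomp G b j) = qcomp G (qcomp G k' k) a"
  unfolding e[symmetric] by (rule qcomp_assoc[symmetric]) (use a k kc in simp_all)
 also have "... = a" using k qcomp_qide(2)[OF a] by simp
 finally show ?thesis ..
qed

lemma pullback_ord_iso:
 assumes f: "f : ord_maps n m" and g: "g : lperms G m"
 shows "pullback G (qord G n m f) (qiso m (lp_inv G m g))
   (qiso n (lp_inv G n (pull n m f g))) (qord G n m (push n m g f))"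
proof -
 have q: "pull n m f g : lperms G n" by (rule pull_lperms[OF f g])
 have p: "push n m g f : ord_maps n m" by (rule push_ord_maps[OF f g])
 show ?thesis
  by (rule pullback_iso, use f g p q in simp_all,
    rule QI_conj[OF _ _ _ _ _ _ _ _ _ _ _ _ _ _ _ push_pull_square[OF f g]])
   (use f g p q lp_inv_lperms(2)[OF q] lp_inv_lperms(3)[OF g] in "simp_all add: qiso_QA")
qed

lemma pullback_iso_iso:
 assumes g: "g : lperms G n" and h: "h : lperms G n"
 shows "pullback G (qiso n g) (qiso n h) (qiso n (lp_inv G n g)) (qiso n (lp_inv G n h))"
 by (rule pullback_iso) (use lp_inv_lperms(1-2)[OF g] lp_inv_lperms(1-2)[OF h] g h in "simp_all add: qiso_QA")

text \<open>Each rule of the law produces pullbacks from pullbacks. Together with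
  \<open>pullback_unique\<close> this makes the law single-valued up to isomorphisms of the middle
  object.\<close>

lemma dist_law_pullback: "dist_law G c s ==> pullback G (fst c) (snd c) (fst s) (snd s)"
proof (induction rule: dist_law.induct)
 case (iso_iso g n h) then show ?case by (simp add: pullback_iso_iso)
next
 case (ord_iso f n m g) then show ?case by (simp add: pullback_ord_iso)
next
 case (iso_ord f n m g) then show ?case by (simp add: pullback.sym[OF pullback_ord_iso])
next
 case m_m show ?case by (simp add: pullback_m_m)
next
 case u_u show ?case by (simp add: pullback_u_u)
next
 case m_u show ?case by (simp add: pullback_m_u)
next
 case u_m show ?case by (simp add: pullback.sym[OF pullback_m_u])
next
 case (cospan_iso f h s k) then show ?case by (simp add: pullback_cospan_iso)
next
 case (span_iso c l r k) then show ?case by (simp add: pullback_span_iso)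
next
 case (comp_left f h l r f' l' r') then show ?case by (simp add: pullback_comp_left)
next
 case (comp_right f h l r h' l' r') then show ?case by (simp add: pullback_comp_right)
next
 case (tensor f h l r f' h' l' r') then show ?case by (simp add: pullback_tensor)
qed

end

section \<open>Totality of the distributive law\<close>

context group
begin

lemma dist_lawD: "dist_law G (f, h) (l, r) ==> pullback G f h l r"
 using dist_law_pullback[of "(f, h)" "(l, r)"] by simp

lemma dist_law_iso_iso:
 assumes "k : QI G" "j : QI G" "qcod k = qcod j"
 obtains l r where "l : QI G" "r : QI G" "dist_law G (k, j) (l, r)"
proof -
 obtain g where g: "g : lperms G (qdom k)" "k = qiso (qdom k) g" using QI_E[OF assms(1)] .
 obtain h where h: "h : lperms G (qdom j)" "j = qiso (qdom j) h" using QI_E[OF assms(2)] .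
 have d: "qdom j = qdom k" using assms QI_qcod by metis
 have "dist_law G (qiso (qdom k) g, qiso (qdom k) h) (qiso (qdom k) (lp_inv G (qdom k) g), qiso (qdom k) (lp_inv G (qdom k) h))"
  by (rule dist_law.iso_iso) (use g(1) h(1) d in simp_all)
 then have "dist_law G (k, j) (qiso (qdom k) (lp_inv G (qdom k) g), qiso (qdom k) (lp_inv G (qdom k) h))"
  unfolding g(2)[symmetric] h(2)[unfolded d, symmetric] .
 then show thesis by (rule that[rotated 2]) (use g(1) h(1) d in simp_all)
qed

lemma dist_law_ord_iso:
 assumes f: "f : ord_maps n m" and j: "j : QI G" "qcod j = m"
 obtains l r where "l : QI G" "dist_law G (qord G n m f, j) (l, r)" "dist_law G (j, qord G n m f) (r, l)"
proof -
 obtain h where h: "h : lperms G (qdom j)" "j = qiso (qdom j) h" using QI_E[OF j(1)] .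
 have d: "qdom j = m" using j QI_qcod by metis
 \<comment> \<open>The rules of the law mention the inverse of \<open>g\<close>, so \<open>g\<close>
   is taken to be the inverse of the given group element.\<close>
 let ?g = "lp_inv G m h"
 have hm: "h : lperms G m" using h d by simp
 have g: "?g : lperms G m" and hj: "qiso m (lp_inv G m ?g) = j" using hm h(2) d lp_inv_lp_inv[OF hm] by simp_all
 have "lp_inv G n (pull n m f ?g) : lperms G n" by (rule lp_inv_lperms(1)[OF pull_lperms[OF f g]])
 then have "qiso n (lp_inv G n (pull n m f ?g)) : QI G" by simp
 then show thesis
  by (rule that) (rule dist_law.ord_iso[OF f g, unfolded hj], rule dist_law.iso_ord[OF f g, unfolded hj])
qed

lemma dist_law_QA_iso:
 assumes f: "f : QA G" and j: "j : QI G" "qcod j = qcod f"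
 shows "\<exists>l r. dist_law G (f, j) (l, r)" and "\<exists>l r. dist_law G (j, f) (l, r)"
proof -
 let ?f = "qord G (qdom f) (qcod f) (qmap f)" and ?s = "qiso (qdom f) (qgrp f)"
 have fm: "qmap f : ord_maps (qdom f) (qcod f)" and fg: "qgrp f : lperms G (qdom f)" using f by (simp_all add: QA_iff)
 have e: "qcomp G ?f ?s = f" by (rule q_decomp[OF f, symmetric])
 obtain l r where lr: "l : QI G" "dist_law G (?f, j) (l, r)" "dist_law G (j, ?f) (r, l)"
  using dist_law_ord_iso[OF fm j] .
 have "qcod l = qdom f" using pullback.cod_l[OF dist_lawD[OF lr(2)]] by simp
 then have sl: "qcod ?s = qcod l" by simp
 have s: "?s : QI G" using fg by simp
 obtain a b where ab: "dist_law G (?s, l) (a, b)" using dist_law_iso_iso[OF s lr(1) sl] by blast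
 obtain c d where cd: "dist_law G (l, ?s) (c, d)" using dist_law_iso_iso[OF lr(1) s sl[symmetric]] by blast
 show "\<exists>l r. dist_law G (f, j) (l, r)" using dist_law.comp_left[OF lr(2) ab] unfolding e by blast
 show "\<exists>l r. dist_law G (j, f) (l, r)" using dist_law.comp_right[OF lr(3) cd] unfolding e by blast
qed

lemma dist_law_comp_right:
 assumes hQ: "h : QA G" and ex: "\<exists>l r. dist_law G (f, qord G (qdom h) (qcod h) (qmap h)) (l, r)"
 shows "\<exists>l r. dist_law G (f, h) (l, r)"
proof -
 have hg: "qgrp h : lperms G (qdom h)" using hQ by (simp add: QA_iff)
 obtain l r where lr: "dist_law G (f, qord G (qdom h) (qcod h) (qmap h)) (l, r)" using ex by blast
 interpret pullback G f "qord G (qdom h) (qcod h) (qmap h)" l r by (rule dist_lawD[OF lr])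
 obtain a b where ab: "dist_law G (r, qiso (qdom h) (qgrp h)) (a, b)"
  using dist_law_QA_iso(1)[OF r, of "qiso (qdom h) (qgrp h)"] hg cod_r by auto
 have e: "qcomp G (qord G (qdom h) (qcod h) (qmap h)) (qiso (qdom h) (qgrp h)) = h" by (rule q_decomp[OF hQ, symmetric])
 show ?thesis using dist_law.comp_right[OF lr ab] unfolding e by blast
qed

text \<open>The right leg is a tensor product of two copies of \<open>f\<close>, so the law can be
  applied in each factor and continued with \<open>comp_right\<close>. For \<open>q_m\<close> and
  \<open>q_u\<close> the required value is given by the rules \<open>m_m\<close> and
  \<open>u_m\<close>.\<close>

lemma dist_law_qmn_step:
 assumes "dist_law G (f, q_m G) (l, qtensor f f)" and f: "f : QA G" "qcod f = 1"
  and ex: "\<exists>l r. dist_law G (f, qmn G n) (l, r)"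
 shows "\<exists>l r. dist_law G (f, qmn G (Suc n)) (l, r)"
proof -
 obtain a b where ab: "dist_law G (f, qmn G n) (a, b)" using ex by blast
 obtain c d where cd: "dist_law G (f, qide G 1) (c, d)" using dist_law_QA_iso(1)[OF f(1), of "qide G 1"] f(2) by auto
 show ?thesis using dist_law.comp_right[OF assms(1) dist_law.tensor[OF ab cd]] unfolding qmn_Suc[symmetric] by blast
qed

text \<open>Induction over the generators of \<open>f\<close>, with \<open>h\<close> arbitrary
  because the rule for composites feeds the left leg of one square into the next. For
  \<open>q_m\<close>, \<open>q_u\<close> and tensor products \<open>h\<close> is reduced to its
  order-preserving part, which for \<open>q_m\<close> and \<open>q_u\<close> is some
  \<open>qmn G n\<close>.\<close>

theorem dist_law_total:
 assumes "f : QA G" and "h : QA G" "qcod h = qcod f"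
 shows "\<exists>l r. dist_law G (f, h) (l, r)"
 using assms
proof (induction f arbitrary: h rule: QA_induct)
 case (qide n) then show ?case using dist_law_QA_iso(2)[of h "qide G n"] by simp
next
 case qsym then show ?case using dist_law_QA_iso(2)[of h "qsym G 1 1"] by simp
next
 case (qlab x e) then show ?case using dist_law_QA_iso(2)[of h "qlab x e"] by simp
next
 case q_m
 have "\<exists>l r. dist_law G (q_m G, qmn G n) (l, r)" for n
 proof (induction n)
  case 0 show ?case using dist_law.m_u[of G] unfolding q_u_qmn by blast
 next
  case (Suc n) show ?case by (rule dist_law_qmn_step[OF dist_law.m_m _ _ Suc]) simp_all
 qed
 moreover have "qmap h : ord_maps (qdom h) 1" using q_m by (simp add: QA_iff)
 then have "qord G (qdom h) (qcod h) (qmap h) = qmn G (qdom h)" using ord_maps_one[of "qmap h" "qdom h"] q_m by simp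
 ultimately show ?case using dist_law_comp_right[OF q_m(1)] by simp
next
 case q_u
 have "\<exists>l r. dist_law G (q_u G, qmn G n) (l, r)" for n
 proof (induction n)
  case 0 show ?case using dist_law.u_u[of G] unfolding q_u_qmn by blast
 next
  case (Suc n) show ?case by (rule dist_law_qmn_step[OF dist_law.u_m _ _ Suc]) simp_all
 qed
 moreover have "qmap h : ord_maps (qdom h) 1" using q_u by (simp add: QA_iff)
 then have "qord G (qdom h) (qcod h) (qmap h) = qmn G (qdom h)" using ord_maps_one[of "qmap h" "qdom h"] q_u by simp
 ultimately show ?case using dist_law_comp_right[OF q_u(1)] by simp
next
 case (qcomp a b)
 obtain l r where lr: "dist_law G (b, h) (l, r)" using qcomp.IH(2)[of h] qcomp.prems by auto
 interpret pullback G b h l r by (rule dist_lawD[OF lr])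
 obtain l' r' where lr': "dist_law G (a, l) (l', r')" using qcomp.IH(1)[OF l] cod_l qcomp.hyps by auto
 show ?case using dist_law.comp_left[OF lr lr'] by blast
next
 case (qtensor a b)
 \<comment> \<open>The order-preserving part of \<open>h\<close> splits along the targets of
   \<open>a\<close> and \<open>b\<close>, so the two induction hypotheses combine by the rule for
   tensor products.\<close>
 have hm: "qmap h : ord_maps (qdom h) (qcod a + qcod b)" using qtensor.prems by (simp add: QA_iff)
 obtain n1 n2 f1 f2 where n: "f1 : ord_maps n1 (qcod a)" "f2 : ord_maps n2 (qcod b)"
  "qord G (qdom h) (qcod a + qcod b) (qmap h) = qtensor (qord G n1 (qcod a) f1) (qord G n2 (qcod b) f2)"
  using qord_split[OF hm] by metis
 obtain l r where lr: "dist_law G (a, qord G n1 (qcod a) f1) (l, r)" using qtensor.IH(1)[of "qord G n1 (qcod a) f1"] n by auto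
 obtain l' r' where lr': "dist_law G (b, qord G n2 (qcod b) f2) (l', r')" using qtensor.IH(2)[of "qord G n2 (qcod b) f2"] n by auto
 have "\<exists>l r. dist_law G (qtensor a b, qord G (qdom h) (qcod h) (qmap h)) (l, r)"
  using dist_law.tensor[OF lr lr'] n(3) qtensor.prems by auto
 then show ?case by (rule dist_law_comp_right[OF qtensor.prems(1)])
qed

end

section \<open>The PROP of spans\<close>

definition span :: "('g, 'z) monoid_scheme => 'g qarr => 'g qarr => 'g sarr" where
 "span G l r = SArr (qcod l) (qcod r) (span_class G l r)"

context group
begin

lemma span_class_QI: "span_class G l r = {(qcomp G l k, qcomp G r k) | k. k : QI G & qcod k = qdom l}"
proof (intro equalityI subsetI)
 fix s assume "s : span_class G l r"
 then obtain g where g: "g : lperms G (qdom l)" "s = (qcomp G l (qiso (qdom l) g), qcomp G r (qiso (qdom l) g))"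
  unfolding span_class_def by blast
 show "s : {(qcomp G l k, qcomp G r k) | k. k : QI G & qcod k = qdom l}"
  unfolding mem_Collect_eq by (rule exI[of _ "qiso (qdom l) g"]) (use g in simp)
next
 fix s assume "s : {(qcomp G l k, qcomp G r k) | k. k : QI G & qcod k = qdom l}"
 then obtain k where k: "k : QI G" "qcod k = qdom l" "s = (qcomp G l k, qcomp G r k)" by blast
 obtain g where g: "g : lperms G (qdom k)" "k = qiso (qdom k) g" using QI_E[OF k(1)] .
 have "qdom k = qdom l" using k QI_qcod by simp
 then show "s : span_class G l r" using g k(3) unfolding span_class_def by auto
qed

lemma span_class_iso:
 assumes l: "l : QA G" and r: "r : QA G" and d: "qdom r = qdom l" and k: "k : QI G" "qcod k = qdom l"
 shows "span_class G (qcomp G l k) (qcomp G r k) = span_class G l r"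
proof -
 have sub: "span_class G (qcomp G l k) (qcomp G r k) \<subseteq> span_class G l r"
  if l: "l : QA G" and r: "r : QA G" and d: "qdom r = qdom l" and k: "k : QI G" "qcod k = qdom l" for l r k
 proof
  fix s assume "s : span_class G (qcomp G l k) (qcomp G r k)"
  then obtain j where j: "j : QI G" "qcod j = qdom k" "s = (qcomp G (qcomp G l k) j, qcomp G (qcomp G r k) j)"
   unfolding span_class_QI by auto
  have kQ: "k : QA G" and jQ: "j : QA G" using k j QI_QA by simp_all
  have "s = (qcomp G l (qcomp G k j), qcomp G r (qcomp G k j))"
   unfolding j(3) using l r d k j kQ jQ by (simp add: qcomp_assoc)
  moreover have "qcomp G k j : QI G" using k j by (simp add: qcomp_QI)
  ultimately show "s : span_class G l r" unfolding span_class_QI using k(2) by auto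
 qed
 obtain k' where k': "k' : QI G" "qdom k' = qdom k" "qcod k' = qdom k" "qcomp G k k' = qide G (qdom k)"
  using QI_inv[OF k(1)] by metis
 have kQ: "k : QA G" and kQ': "k' : QA G" using k k' QI_QA by simp_all
 have dk: "qdom k = qdom l" using k QI_qcod by simp
 have "qcomp G (qcomp G l k) k' = l" "qcomp G (qcomp G r k) k' = r"
  using l r d k k' kQ kQ' dk qcomp_qide(1)[OF l] qcomp_qide(1)[OF r] by (simp_all add: qcomp_assoc)
 then have "span_class G l r \<subseteq> span_class G (qcomp G l k) (qcomp G r k)"
  using sub[of "qcomp G l k" "qcomp G r k" k'] l r d k k' kQ by simp
 then show ?thesis using sub[OF assms] by blast
qed

lemma span_iso_eq:
 assumes "l : QA G" "r : QA G" "qdom r = qdom l" "k : QI G" "qcod k = qdom l"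
 shows "span G (qcomp G l k) (qcomp G r k) = span G l r"
 unfolding span_def span_class_iso[OF assms] by simp

lemma span_class_self: "l : QA G ==> r : QA G ==> qdom r = qdom l ==> (l, r) : span_class G l r"
 unfolding span_class_QI mem_Collect_eq
 by (rule exI[of _ "qide G (qdom l)"]) (use qcomp_qide(1)[of l] qcomp_qide(1)[of r] in simp)

lemma span_sel [simp]: "sdom (span G l r) = qcod l" "scod (span G l r) = qcod r"
 by (simp_all add: span_def)

lemma Union_const: "A ~= {} ==> (!!x. x : A ==> x = C) ==> \<Union>A = C"
 by blast

text \<open>The union in \<open>scomp\<close> ranges over representatives and over values of the
  law. All its members are one class, because pullbacks are unique up to an isomorphism, and there
  is at least one, because the law is total. Hence any pullback computes the composite.\<close>

lemma scomp_span:
 assumes QA: "l1 : QA G" "r1 : QA G" "l2 : QA G" "r2 : QA G"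
  and d: "qdom r1 = qdom l1" "qdom r2 = qdom l2" and pb: "pullback G r1 l2 l r"
 shows "scomp G (span G l2 r2) (span G l1 r1) = span G (qcomp G l1 l) (qcomp G r2 r)"
proof -
 interpret pullback G r1 l2 l r by fact
 let ?A = "{span_class G (qcomp G x1 x) (qcomp G y2 y) | x1 y1 x2 y2 x y.
   (x1, y1) : span_class G l1 r1 & (x2, y2) : span_class G l2 r2 & dist_law G (y1, x2) (x, y)}"
 let ?C = "span_class G (qcomp G l1 l) (qcomp G r2 r)"
 have eqC: "X = ?C" if X: "X : ?A" for X
 proof -
  obtain x1 y1 x2 y2 x y where *: "(x1, y1) : span_class G l1 r1" "(x2, y2) : span_class G l2 r2"
   "dist_law G (y1, x2) (x, y)" "X = span_class G (qcomp G x1 x) (qcomp G y2 y)" using X by blast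
  obtain k where k: "k : QI G" "qcod k = qdom l1" "x1 = qcomp G l1 k" "y1 = qcomp G r1 k"
   using *(1) unfolding span_class_QI by blast
  obtain j where j: "j : QI G" "qcod j = qdom l2" "x2 = qcomp G l2 j" "y2 = qcomp G r2 j"
   using *(2) unfolding span_class_QI by blast
  obtain k' where k': "k' : QI G" "qdom k' = qdom k" "qcod k' = qdom k" "qcomp G k k' = qide G (qdom k)"
   using QI_inv[OF k(1)] by metis
  obtain j' where j': "j' : QI G" "qdom j' = qdom j" "qcod j' = qdom j" "qcomp G j j' = qide G (qdom j)"
   using QI_inv[OF j(1)] by metis
  have Q [simp]: "k : QA G" "k' : QA G" "j : QA G" "j' : QA G" using k k' j j' QI_QA by simp_all
  have dk [simp]: "qdom k = qdom l1" "qdom j = qdom l2" "qdom k' = qdom l1" "qcod k' = qdom l1"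
   "qdom j' = qdom l2" "qcod j' = qdom l2" "qcod k = qdom l1" "qcod j = qdom l2"
   using k j k' j' QI_qcod by simp_all
  have cl [simp]: "qcod l = qdom l1" "qcod r = qdom l2" "qdom r = qdom l" using cod_l cod_r dom d by simp_all
  have kk: "qcomp G k (qcomp G k' z) = z" if "z : QA G" "qcod z = qdom l1" for z
   using that k'(4) qcomp_qide(2)[of z] by (simp add: qcomp_assoc[symmetric])
  have jj: "qcomp G j (qcomp G j' z) = z" if "z : QA G" "qcod z = qdom l2" for z
   using that j'(4) qcomp_qide(2)[of z] by (simp add: qcomp_assoc[symmetric])
  \<comment> \<open>A change of representatives by \<open>k\<close> and \<open>j\<close> is absorbed
    into the legs of the pullback through the inverses \<open>k'\<close> and
    \<open>j'\<close>.\<close>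
  have "pullback G l k (qide G (qdom l)) (qcomp G k' l)"
   by (rule pullback_iso) (use k(1) l kk[OF l] qcomp_qide(1)[OF l] in simp_all)
  from pullback_comp_left[OF pb pullback.sym[OF this]]
  have 1: "pullback G (qcomp G r1 k) l2 (qcomp G k' l) r" using qcomp_qide(1)[OF r] by simp
  have "pullback G r j (qide G (qdom l)) (qcomp G j' r)"
   by (rule pullback_iso) (use j(1) r jj[OF r] qcomp_qide(1)[OF r] in simp_all)
  from pullback_comp_right[OF 1 this]
  have "pullback G (qcomp G r1 k) (qcomp G l2 j) (qcomp G k' l) (qcomp G j' r)"
   using qcomp_qide(1)[of "qcomp G k' l"] l by simp
  from pullback_unique[OF this dist_lawD[OF *(3)[unfolded k(4) j(3)]]]
  obtain i where i: "i : QI G" "qcod i = qdom l" "x = qcomp G (qcomp G k' l) i" "y = qcomp G (qcomp G j' r) i"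
   unfolding qdc by blast
  have iQ [simp]: "i : QA G" using i(1) by (rule QI_QA)
  have "qcomp G x1 x = qcomp G (qcomp G l1 l) i" unfolding k(3) i(3)
   using QA l i(2) kk[of "qcomp G l i"] by (simp add: qcomp_assoc)
  moreover have "qcomp G y2 y = qcomp G (qcomp G r2 r) i" unfolding j(4) i(4)
   using QA r i(2) d jj[of "qcomp G r i"] by (simp add: qcomp_assoc)
  ultimately show "X = ?C" unfolding *(4)
   using span_class_iso[of "qcomp G l1 l" "qcomp G r2 r" i] QA l r d i by simp
 qed
 obtain x y where "dist_law G (r1, l2) (x, y)" using dist_law_total[OF QA(2,3) cod] by blast
 then have "span_class G (qcomp G l1 x) (qcomp G r2 y) : ?A"
  using span_class_self[OF QA(1,2) d(1)] span_class_self[OF QA(3,4) d(2)] by blast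
 then have "\<Union>?A = ?C" by (intro Union_const eqC) blast+
 then show ?thesis unfolding scomp_def by (simp add: span_def)
qed

lemma stensor_span:
 assumes QA [simp]: "l1 : QA G" "r1 : QA G" "l2 : QA G" "r2 : QA G"
  and d [simp]: "qdom r1 = qdom l1" "qdom r2 = qdom l2"
 shows "stensor G (span G l1 r1) (span G l2 r2) = span G (qtensor l1 l2) (qtensor r1 r2)"
proof -
 let ?A = "{span_class G (qtensor x1 x2) (qtensor y1 y2) | x1 y1 x2 y2.
   (x1, y1) : span_class G l1 r1 & (x2, y2) : span_class G l2 r2}"
 let ?C = "span_class G (qtensor l1 l2) (qtensor r1 r2)"
 have eqC: "X = ?C" if X: "X : ?A" for X
 proof -
  obtain x1 y1 x2 y2 where *: "(x1, y1) : span_class G l1 r1" "(x2, y2) : span_class G l2 r2"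
   "X = span_class G (qtensor x1 x2) (qtensor y1 y2)" using X by blast
  obtain k where k: "k : QI G" "qcod k = qdom l1" "x1 = qcomp G l1 k" "y1 = qcomp G r1 k"
   using *(1) unfolding span_class_QI by blast
  obtain j where j: "j : QI G" "qcod j = qdom l2" "x2 = qcomp G l2 j" "y2 = qcomp G r2 j"
   using *(2) unfolding span_class_QI by blast
  have "k : QA G" "j : QA G" using k j QI_QA by simp_all
  then have "qtensor x1 x2 = qcomp G (qtensor l1 l2) (qtensor k j)" "qtensor y1 y2 = qcomp G (qtensor r1 r2) (qtensor k j)"
   unfolding k(3,4) j(3,4) using k(2) j(2) by (simp_all add: qcomp_qtensor)
  then show ?thesis unfolding *(3)
   using span_class_iso[of "qtensor l1 l2" "qtensor r1 r2" "qtensor k j"] k j by (simp add: qtensor_QI)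
 qed
 have "?C : ?A" using span_class_self[OF QA(1,2) d(1)] span_class_self[OF QA(3,4) d(2)] by blast
 then have "\<Union>?A = ?C" by (intro Union_const eqC) blast+
 then show ?thesis unfolding stensor_def by (simp add: span_def)
qed

lemma DHGD_sel [simp]: "Obj (DHGD G) = UNIV" "Dom (DHGD G) = sdom" "Cod (DHGD G) = scod" "Ide (DHGD G) n = span G (qide G n) (qide G n)"
 "Comp (DHGD G) = scomp G" "TObj (DHGD G) = (+)" "TArr (DHGD G) = stensor G" "TUnit (DHGD G) = 0"
 "LUnit (DHGD G) = side G" "RUnit (DHGD G) = side G" "Assoc (DHGD G) a b c = side G (a + b + c)"
 "Sym (DHGD G) a b = span G (qide G (a + b)) (qsym G a b)"
 by (simp_all add: DHGD_def side_def ssym_def span_def)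

lemma DHGD_Arr: "s : Arr (DHGD G) <-> (\<exists>l r. l : QA G & r : QA G & qdom r = qdom l & s = span G l r)"
 unfolding DHGD_def span_def by (auto simp: Hom_def)

lemma span_Arr [simp]: "l : QA G ==> r : QA G ==> qdom r = qdom l ==> span G l r : Arr (DHGD G)"
 unfolding DHGD_Arr by blast

lemma DHGD_shape: "prop_shape (DHGD G)"
proof
 show "Ide (DHGD G) n : Arr (DHGD G)" "Sym (DHGD G) a b : Arr (DHGD G)" for n a b by simp_all
next
 fix f g assume f: "f : Arr (DHGD G)" and g: "g : Arr (DHGD G)"
 obtain l1 r1 where 1: "l1 : QA G" "r1 : QA G" "qdom r1 = qdom l1" "f = span G l1 r1" using f DHGD_Arr by blast
 obtain l2 r2 where 2: "l2 : QA G" "r2 : QA G" "qdom r2 = qdom l2" "g = span G l2 r2" using g DHGD_Arr by blast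
 show "g \<cdot>\<^bsub>DHGD G\<^esub> f : Arr (DHGD G)" if "Dom (DHGD G) g = Cod (DHGD G) f"
 proof -
  have c: "qcod l2 = qcod r1" using that 1(4) 2(4) by simp
  obtain l r where "dist_law G (r1, l2) (l, r)" using dist_law_total[OF 1(2) 2(1) c] by blast
  then have pb: "pullback G r1 l2 l r" by (rule dist_lawD)
  interpret pullback G r1 l2 l r by (rule pb)
  show ?thesis unfolding 1(4) 2(4) DHGD_sel
   unfolding scomp_span[OF 1(1,2) 2(1,2) 1(3) 2(3) pb]
   using 1 2 l r cod_l cod_r dom by simp
 qed
 show "f \<boxtimes>\<^bsub>DHGD G\<^esub> g : Arr (DHGD G)"
  unfolding 1(4) 2(4) DHGD_sel unfolding stensor_span[OF 1(1,2) 2(1,2) 1(3) 2(3)] using 1 2 by simp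
qed (auto simp: scomp_def stensor_def side_def span_def fun_eq_iff )

end

section \<open>Opposite PROPs and maps out of the PROP of spans\<close>

lemma opposite_sel [simp]: "Obj (opposite C) = Obj C" "Arr (opposite C) = Arr C" "Dom (opposite C) = Cod C"
 "Cod (opposite C) = Dom C" "Ide (opposite C) = Ide C" "g \<cdot>\<^bsub>opposite C\<^esub> f = f \<cdot>\<^sub>C g"
 "TObj (opposite C) = TObj C" "TArr (opposite C) = TArr C" "TUnit (opposite C) = TUnit C"
 "Assoc (opposite C) a b c = Inv C (Assoc C a b c)" "LUnit (opposite C) a = Inv C (LUnit C a)"
 "RUnit (opposite C) a = Inv C (RUnit C a)" "Sym (opposite C) a b = Sym C b a"
 by (simp_all add: opposite_def)

lemma strict_prop_opposite:
 fixes P :: "(nat, 'p) smc"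
 assumes "strict_prop P"
 shows "strict_prop (opposite P)"
proof -
 interpret strict_prop P by fact
 show ?thesis
  by unfold_locales
   (simp_all add: Comp_assoc TArr_Comp TArr_assoc Sym_natural hexagon' add.commute)
qed

lemma (in strict_prop) Inv_Ide: "Inv P (Ide P n) = Ide P n"
 unfolding Inv_def
proof (rule the_equality)
 show "inverse_arrows P (Ide P n) (Ide P n)" by (simp add: inverse_arrows_def Hom_def)
 show "g = Ide P n" if "inverse_arrows P (Ide P n) g" for g
  using that by (auto simp: inverse_arrows_def Hom_def)
qed

lemma prop_shape_opposite:
 fixes T :: "(nat, 'p) smc"
 assumes "strict_prop T" "prop_shape T"
 shows "prop_shape (opposite T)"
proof -
 interpret T: strict_prop T by fact
 interpret prop_shape T by fact
 interpret O: strict_prop "opposite T" by (rule strict_prop_opposite) fact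
 show ?thesis by unfold_locales (simp_all add: fun_eq_iff T.Inv_Ide)
qed

lemma prop_mapD:
 assumes "prop_map T P F"
 shows "f : Arr T ==> F f : Arr P" "f : Arr T ==> Dom P (F f) = Dom T f" "f : Arr T ==> Cod P (F f) = Cod T f"
  "F (Ide T n) = Ide P n" "f : Arr T ==> g : Arr T ==> Dom T g = Cod T f ==> F (g \<cdot>\<^sub>T f) = F g \<cdot>\<^sub>P F f"
  "f : Arr T ==> g : Arr T ==> F (f \<boxtimes>\<^sub>T g) = F f \<boxtimes>\<^sub>P F g" "F (Sym T a b) = Sym P a b"
 using assms unfolding prop_map_def by blast+

lemma prop_mapI:
 assumes "!!f. f : Arr T ==> F f : Arr P & Dom P (F f) = Dom T f & Cod P (F f) = Cod T f"
  "!!n. F (Ide T n) = Ide P n" "!!f g. f : Arr T ==> g : Arr T ==> Dom T g = Cod T f ==> F (g \<cdot>\<^sub>T f) = F g \<cdot>\<^sub>P F f"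
  "!!f g. f : Arr T ==> g : Arr T ==> F (f \<boxtimes>\<^sub>T g) = F f \<boxtimes>\<^sub>P F g" "!!a b. F (Sym T a b) = Sym P a b"
 shows "prop_map T P F"
 using assms unfolding prop_map_def by blast

lemma prop_map_opposite: "prop_map (opposite T) P H <-> prop_map T (opposite P) H"
proof
 show "prop_map T (opposite P) H" if "prop_map (opposite T) P H"
  by (rule prop_mapI) (use that in "auto simp: prop_map_def")
 show "prop_map (opposite T) P H" if "prop_map T (opposite P) H"
  by (rule prop_mapI) (use that in "auto simp: prop_map_def")
qed

lemma prop_map_o: "prop_map T P F ==> prop_map P R K ==> prop_map T R (K \<circ> F)"
 unfolding prop_map_def by auto

lemma prop_map_opp_opp: "prop_map T P F ==> prop_map (opposite T) (opposite P) F"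
 unfolding prop_map_def opposite_sel by auto

text \<open>\<open>emb1\<close> includes \<open>Q\<close> covariantly and \<open>emb2\<close> below
  includes it contravariantly; by \<open>span_emb\<close> the two copies of \<open>Q\<close>
  generate all spans.\<close>

definition emb1 :: "('g, 'z) monoid_scheme => 'g qarr => 'g sarr" where
 "emb1 G q = span G (qide G (qdom q)) q"

definition emb2 :: "('g, 'z) monoid_scheme => 'g qarr => 'g sarr" where
 "emb2 G q = span G q (qide G (qdom q))"

context group
begin

lemma DHG_shape: "prop_shape (DHG G)"
 by unfold_locales simp_all

lemma emb1_prop_map: "prop_map (DHG G) (DHGD G) (emb1 G)"
proof (rule prop_mapI)
 fix f assume f: "f : QA G"
 show "emb1 G f : Arr (DHGD G) & Dom (DHGD G) (emb1 G f) = Dom (DHG G) f & Cod (DHGD G) (emb1 G f) = Cod (DHG G) f"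
  using f by (simp add: emb1_def)
 fix g assume g: "g : QA G"
 show "emb1 G (g \<cdot>\<^bsub>DHG G\<^esub> f) = emb1 G g \<cdot>\<^bsub>DHGD G\<^esub> emb1 G f" if "Dom (DHG G) g = Cod (DHG G) f"
 proof -
  have d: "qdom g = qcod f" using that by simp
  have "pullback G f (qide G (qdom g)) (qide G (qdom f)) f" unfolding d by (rule pullback_qide_right[OF f])
  from scomp_span[OF _ f _ g _ _ this] show ?thesis
   using qcomp_qide(1)[of "qide G (qdom f)"] unfolding emb1_def by simp
 qed
 show "emb1 G (f \<boxtimes>\<^bsub>DHG G\<^esub> g) = emb1 G f \<boxtimes>\<^bsub>DHGD G\<^esub> emb1 G g"
  using stensor_span[OF _ f _ g] by (simp add: emb1_def qide_qide)
qed (simp_all add: emb1_def)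

lemma emb2_prop_map: "prop_map (DHG G) (opposite (DHGD G)) (emb2 G)"
proof (rule prop_mapI)
 fix f assume f: "f : QA G"
 show "emb2 G f : Arr (opposite (DHGD G)) & Dom (opposite (DHGD G)) (emb2 G f) = Dom (DHG G) f &
   Cod (opposite (DHGD G)) (emb2 G f) = Cod (DHG G) f"
  using f by (simp add: emb2_def)
 fix g assume g: "g : QA G"
 show "emb2 G (g \<cdot>\<^bsub>DHG G\<^esub> f) = emb2 G g \<cdot>\<^bsub>opposite (DHGD G)\<^esub> emb2 G f" if "Dom (DHG G) g = Cod (DHG G) f"
 proof -
  have d: "qdom g = qcod f" using that by simp
  have "pullback G (qide G (qdom g)) f f (qide G (qdom f))" unfolding d by (rule pullback_qide_left[OF f])
  from scomp_span[OF g _ f _ _ _ this] show ?thesis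
   using qcomp_qide(1)[of "qide G (qdom f)"] unfolding emb2_def by simp
 qed
 show "emb2 G (f \<boxtimes>\<^bsub>DHG G\<^esub> g) = emb2 G f \<boxtimes>\<^bsub>opposite (DHGD G)\<^esub> emb2 G g"
  using stensor_span[OF f _ g] by (simp add: emb2_def qide_qide)
next
 fix a b
 have "span G (qcomp G (qsym G a b) (qsym G b a)) (qcomp G (qide G (a + b)) (qsym G b a)) = span G (qsym G a b) (qide G (a + b))"
  by (rule span_iso_eq) simp_all
 then show "emb2 G (Sym (DHG G) a b) = Sym (opposite (DHGD G)) a b"
  using qcomp_qide(2)[of "qsym G b a"] by (simp add: emb2_def qsym_qsym)
qed (simp_all add: emb2_def)

text \<open>A pullback turns a cospan of arrows of \<open>Q\<close> into a span; this is how
  relations in the PROP of spans are obtained.\<close>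

lemma scomp_emb:
 assumes "pullback G f h l r"
 shows "scomp G (emb2 G h) (emb1 G f) = span G l r"
proof -
 interpret A: pullback G f h l r by fact
 show ?thesis unfolding emb1_def emb2_def
  using scomp_span[OF _ A.f A.h _ _ _ assms, of "qide G (qdom f)" "qide G (qdom h)"]
   qcomp_qide(2)[OF A.l] qcomp_qide(2)[OF A.r] A.cod_l A.cod_r by simp
qed

lemma span_emb:
 assumes l: "l : QA G" and r: "r : QA G" and d: "qdom r = qdom l"
 shows "span G l r = scomp G (emb1 G r) (emb2 G l)"
proof -
 have "pullback G (qide G (qdom l)) (qide G (qdom r)) (qide G (qdom l)) (qide G (qdom l))"
  using pullback_qide_right[of "qide G (qdom l)"] d by simp
 from scomp_span[OF l _ _ r _ _ this] show ?thesis
  unfolding emb1_def emb2_def using qcomp_qide(1)[OF l] qcomp_qide(1)[OF r] d by simp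
qed

text \<open>Reparametrising the middle object by \<open>k'\<close> moves an isomorphism from the
  left leg to the right one, as its inverse.\<close>

lemma emb2_iso:
 assumes k: "k : QI G" and k': "k' : QI G" "qdom k' = qdom k" "qcomp G k k' = qide G (qdom k)"
 shows "emb2 G k = emb1 G k'"
proof -
 have Q: "k : QA G" "k' : QA G" and c: "qcod k' = qdom k" using k k' QI_QA QI_qcod by simp_all
 have "span G (qcomp G k k') (qcomp G (qide G (qdom k)) k') = span G k (qide G (qdom k))"
  by (rule span_iso_eq) (use Q k'(1) c in simp_all)
 then show ?thesis using k'(2,3) Q qcomp_qide(2)[OF Q(2)] c by (simp add: emb1_def emb2_def)
qed

end

text \<open>Data for a map out of the PROP of spans. Agreement on isomorphisms is asked for labels
  on one strand; \<open>F_iso\<close> extends it to all isomorphisms, whose other generators are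
  identities and symmetries.\<close>

locale span_map = strict_prop P + group G
 for P :: "(nat, 'p) smc" (structure) and G :: "('g, 'w) monoid_scheme" (structure) +
 fixes F1 F2 :: "'g qarr => 'p"
 assumes F1: "prop_map (DHG G) P F1" and F2: "prop_map (DHG G) (opposite P) F2"
  and F_lab: "x : carrier G ==> F1 (qlab x e) \<cdot> F2 (qlab x e) = Ide P 1 & F2 (qlab x e) \<cdot> F1 (qlab x e) = Ide P 1"
  and F_m_m: "F2 (q_m G) \<cdot> F1 (q_m G) = (F1 (q_m G) \<boxtimes> F1 (q_m G)) \<cdot> (F2 (q_sigma23 G) \<cdot> (F2 (q_m G) \<boxtimes> F2 (q_m G)))"
  and F_u_u: "F2 (q_u G) \<cdot> F1 (q_u G) = Ide P 0"
  and F_m_u: "F2 (q_u G) \<cdot> F1 (q_m G) = F2 (q_u G) \<boxtimes> F2 (q_u G)"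
  and F_u_m: "F2 (q_m G) \<cdot> F1 (q_u G) = F1 (q_u G) \<boxtimes> F1 (q_u G)"
begin

lemma F1s [simp]: "f : QA G ==> F1 f : Arr P" "f : QA G ==> Dom P (F1 f) = qdom f" "f : QA G ==> Cod P (F1 f) = qcod f"
 "F1 (qide G n) = Ide P n" "F1 (qsym G a b) = Sym P a b"
 using prop_mapD[OF F1] by simp_all

lemma F2s [simp]: "f : QA G ==> F2 f : Arr P" "f : QA G ==> Dom P (F2 f) = qcod f" "f : QA G ==> Cod P (F2 f) = qdom f"
 "F2 (qide G n) = Ide P n" "F2 (qsym G a b) = Sym P b a"
 using prop_mapD[OF F2] by simp_all

lemma F_comp: "f : QA G ==> g : QA G ==> qdom g = qcod f ==> F1 (qcomp G g f) = F1 g \<cdot> F1 f"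
 "f : QA G ==> g : QA G ==> qdom g = qcod f ==> F2 (qcomp G g f) = F2 f \<cdot> F2 g"
 using prop_mapD(5)[OF F1] prop_mapD(5)[OF F2] by simp_all

lemma F_tensor: "f : QA G ==> g : QA G ==> F1 (qtensor f g) = F1 f \<boxtimes> F1 g"
 "f : QA G ==> g : QA G ==> F2 (qtensor f g) = F2 f \<boxtimes> F2 g"
 using prop_mapD(6)[OF F1] prop_mapD(6)[OF F2] by simp_all

lemma F_iso: "k : QI G ==> F1 k \<cdot> F2 k = Ide P (qcod k) & F2 k \<cdot> F1 k = Ide P (qdom k)"
proof (induction k rule: QI_induct)
 case (qlab x e) then show ?case using F_lab by simp
next
 case (qcomp a b)
 have Q [simp]: "a : QA G" "b : QA G" using qcomp.hyps QI_QA by simp_all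
 have "F1 b \<cdot> (F1 a \<cdot> (F2 a \<cdot> F2 b)) = F1 b \<cdot> ((F1 a \<cdot> F2 a) \<cdot> F2 b)"
  using qcomp.hyps by (simp add: Comp_assoc)
 moreover have "F2 a \<cdot> (F2 b \<cdot> (F1 b \<cdot> F1 a)) = F2 a \<cdot> ((F2 b \<cdot> F1 b) \<cdot> F1 a)"
  using qcomp.hyps by (simp add: Comp_assoc)
 ultimately show ?case using qcomp.hyps qcomp.IH by (simp add: F_comp Comp_assoc)
next
 case (qtensor a b)
 have Q [simp]: "a : QA G" "b : QA G" using qtensor.hyps QI_QA by simp_all
 show ?case using qtensor.IH by (simp add: F_tensor TArr_Comp)
qed simp_all

lemma F_iso_cancel:
 assumes "k : QI G" and [simp]: "x : Arr P"
 shows "Cod P x = qcod k ==> F1 k \<cdot> (F2 k \<cdot> x) = x" "Cod P x = qdom k ==> F2 k \<cdot> (F1 k \<cdot> x) = x"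
proof -
 have [simp]: "k : QA G" using assms QI_QA by simp
 show "Cod P x = qcod k ==> F1 k \<cdot> (F2 k \<cdot> x) = x" "Cod P x = qdom k ==> F2 k \<cdot> (F1 k \<cdot> x) = x"
  using F_iso[OF assms(1)] Comp_assoc[of x "F2 k" "F1 k"] Comp_assoc[of x "F1 k" "F2 k"] by simp_all
qed

text \<open>With \<open>h\<close> and \<open>l\<close> invertible, an equation of composites becomes
  an exchange relation by carrying the inverses across.\<close>

lemma F_square:
 assumes [simp]: "f : QA G" "r : QA G" and h: "h : QI G" and l: "l : QI G"
  and d: "qdom f = qcod l" "qdom h = qcod r" "qcod h = qcod f" and e: "qcomp G f l = qcomp G h r"
 shows "F2 h \<cdot> F1 f = F1 r \<cdot> F2 l" "F2 f \<cdot> F1 h = F1 l \<cdot> F2 r"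
proof -
 have [simp]: "h : QA G" "l : QA G" using h l QI_QA by simp_all
 have d': "qdom r = qdom l" using arg_cong[OF e, of qdom] by simp
 have 1: "F1 f \<cdot> F1 l = F1 h \<cdot> F1 r" using arg_cong[OF e, of F1] d by (simp add: F_comp)
 have 2: "F2 l \<cdot> F2 f = F2 r \<cdot> F2 h" using arg_cong[OF e, of F2] d by (simp add: F_comp)
 have "F2 h \<cdot> F1 f = F2 h \<cdot> (F1 f \<cdot> (F1 l \<cdot> F2 l))" using F_iso[OF l] d by simp
 also have "... = F2 h \<cdot> ((F1 f \<cdot> F1 l) \<cdot> F2 l)" using d d' by (simp add: Comp_assoc)
 also have "... = F1 r \<cdot> F2 l" unfolding 1 using F_iso_cancel(2)[OF h, of "F1 r \<cdot> F2 l"] d d' by (simp add: Comp_assoc)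
 finally show "F2 h \<cdot> F1 f = F1 r \<cdot> F2 l" .
 have "F2 f \<cdot> F1 h = F1 l \<cdot> (F2 l \<cdot> (F2 f \<cdot> F1 h))" using F_iso_cancel(1)[OF l, of "F2 f \<cdot> F1 h"] d d' by simp
 also have "... = F1 l \<cdot> ((F2 l \<cdot> F2 f) \<cdot> F1 h)" using d d' by (simp add: Comp_assoc)
 also have "... = F1 l \<cdot> (F2 r \<cdot> (F2 h \<cdot> F1 h))" unfolding 2 using d d' by (simp add: Comp_assoc)
 also have "... = F1 l \<cdot> F2 r" using F_iso[OF h] d d' by simp
 finally show "F2 f \<cdot> F1 h = F1 l \<cdot> F2 r" .
qed

text \<open>The exchange relation is stable under every closure rule of the law, so it spreads from
  the generating cospans to all others.\<close>

lemma F_dist_law: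
 assumes "dist_law G c s"
 shows "F2 (snd c) \<cdot> F1 (fst c) = F1 (snd s) \<cdot> F2 (fst s)"
 using assms
proof (induction rule: dist_law.induct)
 case (iso_iso g n h)
 then show ?case using lp_inv_lperms[OF iso_iso(1)] lp_inv_lperms[OF iso_iso(2)]
  by (simp, intro F_square(1)) (simp_all add: qiso_QA)
next
 case (ord_iso f n m g)
 have q: "pull n m f g : lperms G n" by (rule pull_lperms[OF ord_iso])
 have p: "push n m g f : ord_maps n m" by (rule push_ord_maps[OF ord_iso])
 have "qcomp G (qord G n m f) (qiso n (lp_inv G n (pull n m f g))) = qcomp G (qiso m (lp_inv G m g)) (qord G n m (push n m g f))"
  by (rule QI_conj[OF _ _ _ _ _ _ _ _ _ _ _ _ _ _ _ push_pull_square[OF ord_iso]])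
   (use ord_iso p q lp_inv_lperms(2)[OF q] lp_inv_lperms(3)[OF ord_iso(2)] in "simp_all add: qiso_QA")
 then show ?case using ord_iso p q by (simp, intro F_square(1)) (simp_all add: qiso_QA)
next
 case (iso_ord f n m g)
 have q: "pull n m f g : lperms G n" by (rule pull_lperms[OF iso_ord])
 have p: "push n m g f : ord_maps n m" by (rule push_ord_maps[OF iso_ord])
 have "qcomp G (qord G n m f) (qiso n (lp_inv G n (pull n m f g))) = qcomp G (qiso m (lp_inv G m g)) (qord G n m (push n m g f))"
  by (rule QI_conj[OF _ _ _ _ _ _ _ _ _ _ _ _ _ _ _ push_pull_square[OF iso_ord]])
   (use iso_ord p q lp_inv_lperms(2)[OF q] lp_inv_lperms(3)[OF iso_ord(2)] in "simp_all add: qiso_QA")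
 then show ?case using iso_ord p q by (simp, intro F_square(2)) (simp_all add: qiso_QA)
next
 case m_m show ?case by (simp add: F_m_m F_comp F_tensor)
next
 case u_u show ?case by (simp add: F_u_u)
next
 case m_u show ?case by (simp add: F_m_u F_tensor)
next
 case u_m show ?case by (simp add: F_u_m F_tensor)
next
 case (cospan_iso f h s k)
 interpret A: pullback G f h "fst s" "snd s" using dist_law_pullback[OF cospan_iso(1)] by simp
 have k: "qiso (qcod f) k : QI G" "qiso (qcod f) k : QA G" using cospan_iso(2) by (simp_all add: qiso_QA)
 show ?case using cospan_iso.IH k A.f A.h A.cod F_iso_cancel(2)[OF k(1), of "F1 f"]
  by (simp add: F_comp Comp_assoc)
next
 case (span_iso c l r k)
 interpret A: pullback G "fst c" "snd c" l r using dist_law_pullback[OF span_iso(1)] by simp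
 have k: "qiso (qdom l) k : QI G" "qiso (qdom l) k : QA G" using span_iso(2) by (simp_all add: qiso_QA)
 show ?case using span_iso.IH k A.l A.r A.dom F_iso_cancel(1)[OF k(1), of "F2 l"]
  by (simp add: F_comp Comp_assoc)
next
 case (comp_left f h l r f' l' r')
 interpret A: pullback G f h l r by (rule dist_lawD[OF comp_left(1)])
 interpret B: pullback G f' l l' r' by (rule dist_lawD[OF comp_left(2)])
 have d: "qdom f = qcod f'" "qcod l = qdom f" "qcod r = qdom h" "qdom r = qdom l" "qcod h = qcod f"
  "qcod l' = qdom f'" "qcod r' = qdom l" "qdom r' = qdom l'"
  using A.cod_l B.cod A.cod_r A.dom A.cod B.cod_l B.cod_r B.dom by simp_all
 note Q = A.f A.h A.l A.r B.f B.l B.r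
 have "F2 h \<cdot> (F1 f \<cdot> F1 f') = (F2 h \<cdot> F1 f) \<cdot> F1 f'" using Q d by (simp add: Comp_assoc)
 also have "... = F1 r \<cdot> (F2 l \<cdot> F1 f')" using comp_left.IH(1) Q d by (simp add: Comp_assoc)
 also have "... = F1 r \<cdot> (F1 r' \<cdot> F2 l')" using comp_left.IH(2) by simp
 also have "... = (F1 r \<cdot> F1 r') \<cdot> F2 l'" using Q d by (simp add: Comp_assoc)
 finally show ?case using Q d by (simp add: F_comp)
next
 case (comp_right f h l r h' l' r')
 interpret A: pullback G f h l r by (rule dist_lawD[OF comp_right(1)])
 interpret B: pullback G r h' l' r' by (rule dist_lawD[OF comp_right(2)])
 have d: "qcod l = qdom f" "qcod r = qdom h" "qdom r = qdom l" "qcod h = qcod f"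
  "qcod l' = qdom l" "qcod r' = qdom h'" "qdom r' = qdom l'" "qcod h' = qdom h"
  using A.cod_l B.cod A.cod_r A.dom A.cod B.cod_l B.cod_r B.dom by simp_all
 note Q = A.f A.h A.l A.r B.h B.l B.r
 have "(F2 h' \<cdot> F2 h) \<cdot> F1 f = F2 h' \<cdot> (F1 r \<cdot> F2 l)" using comp_right.IH(1) Q d by (simp add: Comp_assoc)
 also have "... = (F2 h' \<cdot> F1 r) \<cdot> F2 l" using Q d by (simp add: Comp_assoc)
 also have "... = F1 r' \<cdot> (F2 l' \<cdot> F2 l)" using comp_right.IH(2) Q d by (simp add: Comp_assoc)
 finally show ?case using Q d by (simp add: F_comp)
next
 case (tensor f h l r f' h' l' r')
 interpret A: pullback G f h l r by (rule dist_lawD[OF tensor(1)])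
 interpret B: pullback G f' h' l' r' by (rule dist_lawD[OF tensor(2)])
 show ?case using tensor.IH A.f A.h A.l A.r B.f B.h B.l B.r A.cod B.cod A.dom B.dom by (simp add: F_tensor TArr_Comp)
qed

text \<open>Evaluates a chosen representative of the class; \<open>Fs_span\<close> shows that the
  choice does not matter, because \<open>F1\<close> and \<open>F2\<close> are inverse to each other
  on isomorphisms.\<close>

definition Fs :: "'g sarr => 'p" where
 "Fs s = (case SOME lr. lr : spans s of (l, r) => F1 r \<cdot> F2 l)"

lemma Fs_span:
 assumes Q [simp]: "l : QA G" "r : QA G" and d: "qdom r = qdom l"
 shows "Fs (span G l r) = F1 r \<cdot> F2 l"
proof -
 obtain l' r' where lr: "(SOME lr. lr : spans (span G l r)) = (l', r')" by (metis surj_pair)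
 have "(l, r) : spans (span G l r)" using span_class_self[OF Q d] by (simp add: span_def)
 then have "(SOME lr. lr : spans (span G l r)) : spans (span G l r)" by (rule someI)
 then have "(l', r') : span_class G l r" unfolding lr by (simp add: span_def)
 then obtain k where k: "k : QI G" "qcod k = qdom l" "l' = qcomp G l k" "r' = qcomp G r k"
  unfolding span_class_QI by blast
 have [simp]: "k : QA G" using k QI_QA by simp
 show ?thesis unfolding Fs_def lr using k d F_iso_cancel(1)[OF k(1), of "F2 l"] by (simp add: F_comp Comp_assoc)
qed

lemma Fs_prop_map: "prop_map (DHGD G) P Fs"
proof (rule prop_mapI)
 fix f assume "f : Arr (DHGD G)"
 then obtain l1 r1 where 1: "l1 : QA G" "r1 : QA G" "qdom r1 = qdom l1" "f = span G l1 r1" using DHGD_Arr by blast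
 show "Fs f : Arr P & Dom P (Fs f) = Dom (DHGD G) f & Cod P (Fs f) = Cod (DHGD G) f"
  using 1 by (simp add: Fs_span)
 fix g assume "g : Arr (DHGD G)"
 then obtain l2 r2 where 2: "l2 : QA G" "r2 : QA G" "qdom r2 = qdom l2" "g = span G l2 r2" using DHGD_Arr by blast
 show "Fs (f \<boxtimes>\<^bsub>DHGD G\<^esub> g) = Fs f \<boxtimes> Fs g"
  using 1 2 by (simp add: stensor_span Fs_span F_tensor TArr_Comp)
 show "Fs (g \<cdot>\<^bsub>DHGD G\<^esub> f) = Fs g \<cdot> Fs f" if "Dom (DHGD G) g = Cod (DHGD G) f"
 proof -
  have c: "qcod l2 = qcod r1" using that 1(4) 2(4) by simp
  obtain l r where lr: "dist_law G (r1, l2) (l, r)" using dist_law_total[OF 1(2) 2(1) c] by blast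
  have pb: "pullback G r1 l2 l r" by (rule dist_lawD[OF lr])
  interpret A: pullback G r1 l2 l r by (rule pb)
  note d = A.cod_l A.cod_r A.dom 1(3) 2(3) c
  have "Fs (scomp G g f) = (F1 r2 \<cdot> F1 r) \<cdot> (F2 l \<cdot> F2 l1)"
   unfolding 1(4) 2(4) scomp_span[OF 1(1,2) 2(1,2) 1(3) 2(3) pb]
   using 1 2 A.l A.r d by (simp add: Fs_span F_comp)
  also have "... = F1 r2 \<cdot> ((F1 r \<cdot> F2 l) \<cdot> F2 l1)" using 1 2 A.l A.r d by (simp add: Comp_assoc)
  also have "... = F1 r2 \<cdot> ((F2 l2 \<cdot> F1 r1) \<cdot> F2 l1)" using F_dist_law[OF lr] by simp
  also have "... = Fs g \<cdot> Fs f" using 1 2 d by (simp add: Fs_span Comp_assoc)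
  finally show ?thesis by simp
 qed
qed (simp_all add: Fs_span)

lemma Fs_emb: "f : QA G ==> Fs (emb1 G f) = F1 f" "f : QA G ==> Fs (emb2 G f) = F2 f"
 unfolding emb1_def emb2_def by (simp_all add: Fs_span)

end

section \<open>Involutive monoids and comonoids carried by an object\<close>

lemma (in group) prop_map_labelled_monoid:
 assumes P: "strict_prop P" and K: "prop_map (DHG G) P K"
 shows "labelled_monoid P G (K (q_m G)) (K (q_u G)) (%x e. K (qlab x e))"
proof -
 note D = prop_mapD[OF K, unfolded DHG_sel]
 \<comment> \<open>The rules are reversed so that both sides of each equation collapse to a single
   application of \<open>K\<close>, where the relations of \<open>Q\<close> can be used.\<close>
 note CT = D(4)[symmetric] D(7)[symmetric] D(5)[symmetric] D(6)[symmetric] qdc q_m_q_u qlab_simps one_add_one add_0_left add_0_right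
  qide_QA qsym_QA qtensor_QA qcomp_QA qlab_QA
 show ?thesis
 proof (rule labelled_monoid.intro[OF P is_group], rule labelled_monoid_axioms.intro)
  show "K (qlab \<one> False) = Ide P 1" unfolding qlab_one by (rule D(4))
  show "K (q_m G) \<cdot>\<^sub>P (K (q_m G) \<boxtimes>\<^sub>P Ide P 1) = K (q_m G) \<cdot>\<^sub>P (Ide P 1 \<boxtimes>\<^sub>P K (q_m G))"
   by (simp only: CT q_m_assoc)
  show "K (q_m G) \<cdot>\<^sub>P (K (q_u G) \<boxtimes>\<^sub>P Ide P 1) = Ide P 1" "K (q_m G) \<cdot>\<^sub>P (Ide P 1 \<boxtimes>\<^sub>P K (q_u G)) = Ide P 1"
   by (simp_all only: CT q_m_unit)
  fix x assume x: "x : carrier G"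
  show "K (qlab x e) : Arr P & Dom P (K (qlab x e)) = 1 & Cod P (K (qlab x e)) = 1" for e
   using D(1-3)[of "qlab x e"] x by simp
  show "K (qlab x e) \<cdot>\<^sub>P K (q_u G) = K (q_u G)" for e by (simp only: CT x qlab_q_u)
  show "K (qlab x False) \<cdot>\<^sub>P K (q_m G) = K (q_m G) \<cdot>\<^sub>P (K (qlab x False) \<boxtimes>\<^sub>P K (qlab x False))"
   by (simp only: CT x qlab_q_m)
  show "K (qlab x True) \<cdot>\<^sub>P K (q_m G) = K (q_m G) \<cdot>\<^sub>P Sym P 1 1 \<cdot>\<^sub>P (K (qlab x True) \<boxtimes>\<^sub>P K (qlab x True))"
   by (simp only: CT x qlab_q_m')
  show "K (qlab y d) \<cdot>\<^sub>P K (qlab x e) = K (qlab (y \<otimes> x) (d ~= e))" if "y : carrier G" for y d e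
   by (simp only: CT x that qlab_qlab)
 qed (use D(1-3)[of "q_m G"] D(1-3)[of "q_u G"] in simp_all)
qed

context tensor_system
begin

lemma monoid_arrows_at: "mm : Hom S (A (1 + 1)) (A 1) ==> ee : Hom S (A 0) (A 1) ==> jj : Hom S (A 1) (A 1) ==>
  monoid_arrows S A t u 1 jj jj mm ee"
 by (intro monoid_arrows.intro arrows_at.intro tensor_system_axioms arrows_at_axioms.intro monoid_arrows_axioms.intro)

lemma comonoid_arrows_at: "dd : Hom S (A 1) (A (1 + 1)) ==> cc : Hom S (A 1) (A 0) ==> jj : Hom S (A 1) (A 1) ==>
  comonoid_arrows S A t u 1 jj jj dd cc"
 by (intro comonoid_arrows.intro arrows_at.intro tensor_system_axioms arrows_at_axioms.intro comonoid_arrows_axioms.intro)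

text \<open>The label \<open>True\<close> at the neutral element is the involution, and the labels
  with \<open>False\<close> give the action; they commute because the two components of a label
  do.\<close>

lemma labelled_monoidD:
 assumes L: "labelled_monoid P G (Mor (1 + 1) 1 mm) (Mor 0 1 ee) (%x e. Mor 1 1 (ll x e))"
  and M: "MObj M = A 1" "MMult M = mm \<cdot> t (1, 1)" "MUnit M = ee \<cdot> u" "MInv M = ll \<one>\<^bsub>G\<^esub> True"
 shows "is_involutive_monoid S M"
  and "x : carrier G ==> is_monoid_mor S M M (ll x False) & ll x False \<cdot> MInv M = MInv M \<cdot> ll x False"
proof -
 interpret L: labelled_monoid P G "Mor (1 + 1) 1 mm" "Mor 0 1 ee" "%x e. Mor 1 1 (ll x e)" by (rule L)
 have mm: "mm : Hom S (A (1 + 1)) (A 1)" and ee: "ee : Hom S (A 0) (A 1)"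
  using L.mu_Arr L.eta_Arr by (simp_all add: endo_Arr Hom_iff)
 have ll: "ll x e : Hom S (A 1) (A 1)" if "x : carrier G" for x e
  using L.lab_Arr[OF that, of e] by (simp add: endo_Arr Hom_iff)
 note MA = monoid_arrows_at[OF mm ee ll]
 have one: "\<one>\<^bsub>G\<^esub> : carrier G" by simp
 have lab: "ll y d \<cdot> ll x e = ll (y \<otimes>\<^bsub>G\<^esub> x) (d ~= e)" if "x : carrier G" "y : carrier G" for x y d e
  using arg_cong[OF L.lab_lab[OF that, of d e], of under] by simp
 have id: "ll \<one>\<^bsub>G\<^esub> False = Ide S (A 1)" using L.lab_one by simp
 have i: "ll \<one>\<^bsub>G\<^esub> True \<cdot> ll \<one>\<^bsub>G\<^esub> True = Ide S (A 1)" using lab[OF one one, of True True] id by simp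
 note F = monoid_arrows.conv_assoc[OF MA[OF one], THEN iffD1, OF L.mu_assoc]
  monoid_arrows.conv_unit_left[OF MA[OF one], THEN iffD1, OF L.mu_eta_left]
  monoid_arrows.conv_unit_right[OF MA[OF one], THEN iffD1, OF L.mu_eta_right]
 note F' = monoid_arrows.conv_hom_unit[OF MA, THEN iffD1, OF _ L.lab_eta]
  monoid_arrows.conv_hom_mult[OF MA, THEN iffD1, OF _ L.lab_mu]
  monoid_arrows.conv_anti_mult[OF MA, THEN iffD1, OF _ L.lab_mu']
 have h: "mm \<cdot> t (1, 1) : Hom S (A 1 \<boxdot> A 1) (A 1)" "ee \<cdot> u : Hom S (TUnit S) (A 1)"
  using mm ee by (auto simp: Hom_iff)
 show "is_involutive_monoid S M"
  unfolding is_involutive_monoid_def is_monoid_def Let_def M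
  by (intro conjI A_Obj h F F'(1)[OF one one] F'(3)[OF one one] i ll one)
 show "is_monoid_mor S M M (ll x False) & ll x False \<cdot> MInv M = MInv M \<cdot> ll x False" if x: "x : carrier G"
  unfolding is_monoid_mor_def M lab[OF one x] lab[OF x one]
  using F'(1)[OF x x] F'(2)[OF x x] x by simp
qed

lemma labelled_comonoidD:
 assumes L: "labelled_monoid (opposite P) G (Mor 1 (1 + 1) dd) (Mor 1 0 cc) (%x e. Mor 1 1 (ll x e))"
  and M: "CObj M = A 1" "CComult M = Inv S (t (1, 1)) \<cdot> dd" "CCounit M = Inv S u \<cdot> cc" "CInv M = ll \<one>\<^bsub>G\<^esub> True"
 shows "is_involutive_comonoid S M"
  and "x : carrier G ==> is_comonoid_mor S M M (ll x False) & ll x False \<cdot> CInv M = CInv M \<cdot> ll x False"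
proof -
 interpret L: labelled_monoid "opposite P" G "Mor 1 (1 + 1) dd" "Mor 1 0 cc" "%x e. Mor 1 1 (ll x e)" by (rule L)
 interpret P: strict_prop P by (rule endo_strict_prop)
 have dd: "dd : Hom S (A 1) (A (1 + 1))" and cc: "cc : Hom S (A 1) (A 0)"
  using L.mu_Arr L.eta_Arr by (simp_all add: endo_Arr Hom_iff)
 have ll: "ll x e : Hom S (A 1) (A 1)" if "x : carrier G" for x e
  using L.lab_Arr[OF that, of e] by (simp add: endo_Arr Hom_iff)
 note MA = comonoid_arrows_at[OF dd cc ll]
 have one: "\<one>\<^bsub>G\<^esub> : carrier G" by simp
 have lab: "ll x e \<cdot> ll y d = ll (y \<otimes>\<^bsub>G\<^esub> x) (d ~= e)" if "x : carrier G" "y : carrier G" for x y d e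
  using arg_cong[OF L.lab_lab[OF that, of d e], of under] by simp
 have id: "ll \<one>\<^bsub>G\<^esub> False = Ide S (A 1)" using L.lab_one by simp
 have i: "ll \<one>\<^bsub>G\<^esub> True \<cdot> ll \<one>\<^bsub>G\<^esub> True = Ide S (A 1)" using lab[OF one one, of True True] id by simp
 have anti: "Mor 1 (1 + 1) dd \<cdot>\<^sub>P Mor 1 1 (ll x True) =
   (Mor 1 1 (ll x True) \<boxtimes>\<^sub>P Mor 1 1 (ll x True)) \<cdot>\<^sub>P Sym P 1 1 \<cdot>\<^sub>P Mor 1 (1 + 1) dd" if x: "x : carrier G" for x
 proof -
  have lP: "Mor 1 1 (ll x True) : Arr P" and dP: "Mor 1 (1 + 1) dd : Arr P"
   using dd ll[OF x, of True] by (simp_all add: endo_Arr Hom_iff)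
  have "(Mor 1 1 (ll x True) \<boxtimes>\<^sub>P Mor 1 1 (ll x True)) \<cdot>\<^sub>P Sym P 1 1 \<cdot>\<^sub>P Mor 1 (1 + 1) dd =
    (Mor 1 1 (ll x True) \<boxtimes>\<^sub>P Mor 1 1 (ll x True)) \<cdot>\<^sub>P (Sym P 1 1 \<cdot>\<^sub>P Mor 1 (1 + 1) dd)"
   by (rule P.Comp_assoc[OF dP P.Sym_Arr P.TArr_Arr[OF lP lP]]) simp_all
  then show ?thesis using L.lab_mu'[OF x] unfolding opposite_sel by (rule trans[OF _ sym, rotated])
 qed
 note F = comonoid_arrows.conv_coassoc[OF MA[OF one], THEN iffD1, OF L.mu_assoc[unfolded opposite_sel]]
  comonoid_arrows.conv_counit_left[OF MA[OF one], THEN iffD1, OF L.mu_eta_left[unfolded opposite_sel]]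
  comonoid_arrows.conv_counit_right[OF MA[OF one], THEN iffD1, OF L.mu_eta_right[unfolded opposite_sel]]
 note F' = comonoid_arrows.conv_hom_counit[OF MA, THEN iffD1, OF _ L.lab_eta[unfolded opposite_sel]]
  comonoid_arrows.conv_hom_comult[OF MA, THEN iffD1, OF _ L.lab_mu[unfolded opposite_sel]]
  comonoid_arrows.conv_anti_comult[OF MA, THEN iffD1, OF _ anti]
 have h: "Inv S (t (1, 1)) \<cdot> dd : Hom S (A 1) (A 1 \<boxdot> A 1)" "Inv S u \<cdot> cc : Hom S (A 1) (TUnit S)"
  using dd cc by (auto simp: Hom_iff)
 show "is_involutive_comonoid S M"
  unfolding is_involutive_comonoid_def is_comonoid_def Let_def M
  by (intro conjI A_Obj h F F'(1)[OF one one] F'(3)[OF one one] i ll one)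
 show "is_comonoid_mor S M M (ll x False) & ll x False \<cdot> CInv M = CInv M \<cdot> ll x False" if x: "x : carrier G"
  unfolding is_comonoid_mor_def M lab[OF one x] lab[OF x one]
  using F'(1)[OF x x] F'(2)[OF x x] x by simp
qed

text \<open>A label acts by \<open>a x\<close> after the involution or the identity. This is an
  action of the product group because each \<open>a x\<close> commutes with the involution.\<close>

lemma labelled_monoidI:
 assumes G: "group G" and IM: "is_involutive_monoid S M"
  and M: "MObj M = A 1" "MMult M = mm \<cdot> t (1, 1)" "MUnit M = ee \<cdot> u"
  and mm: "mm : Hom S (A (1 + 1)) (A 1)" and ee: "ee : Hom S (A 0) (A 1)"
  and a: "!!g. g : carrier G ==> a g : Hom S (A 1) (A 1) & is_monoid_mor S M M (a g) & a g \<cdot> MInv M = MInv M \<cdot> a g"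
  and a1: "a \<one>\<^bsub>G\<^esub> = Ide S (A 1)" and am: "!!g h. g : carrier G ==> h : carrier G ==> a (g \<otimes>\<^bsub>G\<^esub> h) = a g \<cdot> a h"
 shows "labelled_monoid P G (Mor (1 + 1) 1 mm) (Mor 0 1 ee) (%x e. Mor 1 1 (a x \<cdot> (if e then MInv M else Ide S (A 1))))"
proof -
 interpret G: group G by fact
 define i where "i = MInv M"
 define l where "l x e = a x \<cdot> (if e then i else Ide S (A 1))" for x e
 let ?mu = "mm \<cdot> t (1, 1)" and ?eta = "ee \<cdot> u"
 have mu [simp]: "mm : Arr S" "Dom S mm = A (1 + 1)" "Cod S mm = A 1" "ee : Arr S" "Dom S ee = A 0" "Cod S ee = A 1"
  using mm ee by (auto simp: Hom_iff)
 have mn: "?mu : Arr S" "Dom S ?mu = A 1 \<boxdot> A 1" "Cod S ?mu = A 1" "?eta : Arr S" "Dom S ?eta = TUnit S" "Cod S ?eta = A 1" by simp_all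
 have IM': "?mu \<cdot> (?mu \<boxtimes> Ide S (A 1)) = ?mu \<cdot> (Ide S (A 1) \<boxtimes> ?mu) \<cdot> Assoc S (A 1) (A 1) (A 1)"
  "?mu \<cdot> (?eta \<boxtimes> Ide S (A 1)) = LUnit S (A 1)" "?mu \<cdot> (Ide S (A 1) \<boxtimes> ?eta) = RUnit S (A 1)"
  "i \<cdot> i = Ide S (A 1)" "i \<cdot> ?eta = ?eta" "i \<cdot> ?mu = ?mu \<cdot> Sym S (A 1) (A 1) \<cdot> (i \<boxtimes> i)"
  and ih: "i : Hom S (A 1) (A 1)"
  using IM unfolding is_involutive_monoid_def is_monoid_def Let_def M i_def by blast+
 have i [simp]: "i : Arr S" "Dom S i = A 1" "Cod S i = A 1" using ih by (auto simp: Hom_iff)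
 have aA: "a x : Arr S" "Dom S (a x) = A 1" "Cod S (a x) = A 1" if "x : carrier G" for x
  using a[OF that] by (auto simp: Hom_iff)
 have amu: "a x \<cdot> ?mu = ?mu \<cdot> (a x \<boxtimes> a x)" and aeta: "a x \<cdot> ?eta = ?eta" and ai: "a x \<cdot> i = i \<cdot> a x" if "x : carrier G" for x
  using a[OF that] unfolding is_monoid_mor_def M i_def by auto
 have lT: "l x True = a x \<cdot> i" and lF: "x : carrier G ==> l x False = a x" for x using aA by (simp_all add: l_def)
 have lh: "l x e : Hom S (A 1) (A 1)" if "x : carrier G" for x e using aA[OF that] by (auto simp: l_def Hom_iff)
 note MA = monoid_arrows_at[OF mm ee lh]
 have one: "\<one>\<^bsub>G\<^esub> : carrier G" by simp
 have ll: "l y d \<cdot> l x e = l (y \<otimes>\<^bsub>G\<^esub> x) (d ~= e)" if x: "x : carrier G" and y: "y : carrier G" for x y d e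
 proof -
  note q = aA[OF x] aA[OF y]
  have ii: "i \<cdot> (a x \<cdot> i) = a x" unfolding ai[OF x] using q IM'(4) ar_pull[OF IM'(4), of "a x"] by simp
  show ?thesis using q by (cases d; cases e) (simp_all add: l_def am[OF y x] ar_assoc ii ai[OF x, symmetric])
 qed
 have leta: "l x e \<cdot> ?eta = ?eta" if x: "x : carrier G" for x e
  using aA[OF x] aeta[OF x] IM'(5) mn(4-6) ar_assoc[of ?eta i "a x"] by (cases e) (simp_all add: lT lF[OF x])
 have lmu: "l x False \<cdot> ?mu = ?mu \<cdot> (l x False \<boxtimes> l x False)" if x: "x : carrier G" for x
  unfolding lF[OF x] by (rule amu[OF x])
 have lmu': "l x True \<cdot> ?mu = ?mu \<cdot> Sym S (A 1) (A 1) \<cdot> (l x True \<boxtimes> l x True)" if x: "x : carrier G" for x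
 proof -
  note q = aA[OF x]
  define nu where "nu = ?mu"
  have n [simp]: "nu : Arr S" "Dom S nu = A 1 \<boxdot> A 1" "Cod S nu = A 1" using mn unfolding nu_def by blast+
  have nu: "a x \<cdot> nu = nu \<cdot> (a x \<boxtimes> a x)" "i \<cdot> nu = nu \<cdot> Sym S (A 1) (A 1) \<cdot> (i \<boxtimes> i)"
   unfolding nu_def by (rule amu[OF x], rule IM'(6))
  have sy: "(a x \<boxtimes> a x) \<cdot> Sym S (A 1) (A 1) = Sym S (A 1) (A 1) \<cdot> (a x \<boxtimes> a x)"
   using Sym_nat[of "a x" "a x"] q by simp
  have "(a x \<cdot> i) \<cdot> nu = a x \<cdot> (i \<cdot> nu)" using q by (simp add: ar_assoc)
  also have "... = (a x \<cdot> nu) \<cdot> (Sym S (A 1) (A 1) \<cdot> (i \<boxtimes> i))" unfolding nu(2) using q by (simp add: ar_assoc)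
  also have "... = nu \<cdot> (((a x \<boxtimes> a x) \<cdot> Sym S (A 1) (A 1)) \<cdot> (i \<boxtimes> i))" unfolding nu(1) using q by (simp add: ar_assoc)
  also have "... = nu \<cdot> Sym S (A 1) (A 1) \<cdot> ((a x \<cdot> i) \<boxtimes> (a x \<cdot> i))" unfolding sy using q by (simp add: ar_assoc ar_tensor_Comp)
  finally show ?thesis unfolding lT nu_def .
 qed
 have "labelled_monoid P G (Mor (1 + 1) 1 mm) (Mor 0 1 ee) (%x e. Mor 1 1 (l x e))"
 proof (rule labelled_monoid.intro[OF endo_strict_prop G], rule labelled_monoid_axioms.intro)
  show "Mor 1 1 (l x e) : Arr P & Dom P (Mor 1 1 (l x e)) = 1 & Cod P (Mor 1 1 (l x e)) = 1" if "x : carrier G" for x e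
   using lh[OF that, of e] by (simp add: endo_Arr Hom_iff)
  show "Mor 1 1 (l \<one>\<^bsub>G\<^esub> False) = Ide P 1" using lF[OF one] a1 by simp
  show "Mor 1 1 (l y d) \<cdot>\<^sub>P Mor 1 1 (l x e) = Mor 1 1 (l (y \<otimes>\<^bsub>G\<^esub> x) (d ~= e))" if "x : carrier G" "y : carrier G" for x y d e
   using ll[OF that] by simp
 qed (rule monoid_arrows.conv_assoc[OF MA[OF one], THEN iffD2, OF IM'(1)]
   monoid_arrows.conv_unit_left[OF MA[OF one], THEN iffD2, OF IM'(2)]
   monoid_arrows.conv_unit_right[OF MA[OF one], THEN iffD2, OF IM'(3)]
   monoid_arrows.conv_hom_unit[OF MA, THEN iffD2, OF _ leta]
   monoid_arrows.conv_hom_mult[OF MA, THEN iffD2, OF _ lmu]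
   monoid_arrows.conv_anti_mult[OF MA, THEN iffD2, OF _ lmu'] | assumption | simp add: endo_Arr)+
 then show ?thesis unfolding l_def i_def .
qed

text \<open>Composition in the opposite PROP is reversed, so \<open>a\<close> is evaluated at
  inverses to obtain a multiplicative labelling there.\<close>

lemma labelled_comonoidI:
 assumes G: "group G" and IM: "is_involutive_comonoid S M"
  and M: "CObj M = A 1" "CComult M = Inv S (t (1, 1)) \<cdot> dd" "CCounit M = Inv S u \<cdot> cc"
  and dd: "dd : Hom S (A 1) (A (1 + 1))" and cc: "cc : Hom S (A 1) (A 0)"
  and a: "!!g. g : carrier G ==> a g : Hom S (A 1) (A 1) & is_comonoid_mor S M M (a g) & a g \<cdot> CInv M = CInv M \<cdot> a g"
  and a1: "a \<one>\<^bsub>G\<^esub> = Ide S (A 1)" and am: "!!g h. g : carrier G ==> h : carrier G ==> a (g \<otimes>\<^bsub>G\<^esub> h) = a g \<cdot> a h"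
 shows "labelled_monoid (opposite P) G (Mor 1 (1 + 1) dd) (Mor 1 0 cc)
  (%x e. Mor 1 1 (a (inv\<^bsub>G\<^esub> x) \<cdot> (if e then CInv M else Ide S (A 1))))"
proof -
 interpret G: group G by fact
 interpret P: strict_prop P by (rule endo_strict_prop)
 define i where "i = CInv M"
 define l where "l x e = a (inv\<^bsub>G\<^esub> x) \<cdot> (if e then i else Ide S (A 1))" for x e
 let ?de = "Inv S (t (1, 1)) \<cdot> dd" and ?ep = "Inv S u \<cdot> cc"
 have mu [simp]: "dd : Arr S" "Dom S dd = A 1" "Cod S dd = A (1 + 1)" "cc : Arr S" "Dom S cc = A 1" "Cod S cc = A 0"
  using dd cc by (auto simp: Hom_iff)
 have mn: "?de : Arr S" "Dom S ?de = A 1" "Cod S ?de = A 1 \<boxdot> A 1" "?ep : Arr S" "Dom S ?ep = A 1" "Cod S ?ep = TUnit S" by simp_all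
 have IM': "Assoc S (A 1) (A 1) (A 1) \<cdot> (?de \<boxtimes> Ide S (A 1)) \<cdot> ?de = (Ide S (A 1) \<boxtimes> ?de) \<cdot> ?de"
  "LUnit S (A 1) \<cdot> (?ep \<boxtimes> Ide S (A 1)) \<cdot> ?de = Ide S (A 1)" "RUnit S (A 1) \<cdot> (Ide S (A 1) \<boxtimes> ?ep) \<cdot> ?de = Ide S (A 1)"
  "i \<cdot> i = Ide S (A 1)" "?ep \<cdot> i = ?ep" "?de \<cdot> i = (i \<boxtimes> i) \<cdot> Sym S (A 1) (A 1) \<cdot> ?de"
  and ih: "i : Hom S (A 1) (A 1)"
  using IM unfolding is_involutive_comonoid_def is_comonoid_def Let_def M i_def by blast+
 have i [simp]: "i : Arr S" "Dom S i = A 1" "Cod S i = A 1" using ih by (auto simp: Hom_iff)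
 have aA: "a x : Arr S" "Dom S (a x) = A 1" "Cod S (a x) = A 1" if "x : carrier G" for x
  using a[OF that] by (auto simp: Hom_iff)
 have amu: "?de \<cdot> a x = (a x \<boxtimes> a x) \<cdot> ?de" and aeta: "?ep \<cdot> a x = ?ep" and ai: "a x \<cdot> i = i \<cdot> a x" if "x : carrier G" for x
  using a[OF that] unfolding is_comonoid_mor_def M i_def by auto
 have lT: "l x True = a (inv\<^bsub>G\<^esub> x) \<cdot> i" and lF: "x : carrier G ==> l x False = a (inv\<^bsub>G\<^esub> x)" for x
  using aA[of "inv\<^bsub>G\<^esub> x"] by (simp_all add: l_def)
 have lh: "l x e : Hom S (A 1) (A 1)" if "x : carrier G" for x e
  using aA[of "inv\<^bsub>G\<^esub> x"] that by (auto simp: l_def Hom_iff)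
 note MA = comonoid_arrows_at[OF dd cc lh]
 have one: "\<one>\<^bsub>G\<^esub> : carrier G" by simp
 have ll: "l x e \<cdot> l y d = l (y \<otimes>\<^bsub>G\<^esub> x) (d ~= e)" if x: "x : carrier G" and y: "y : carrier G" for x y d e
 proof -
  note q = aA[OF G.inv_closed[OF x]] aA[OF G.inv_closed[OF y]]
  have ii: "i \<cdot> (a (inv\<^bsub>G\<^esub> y) \<cdot> i) = a (inv\<^bsub>G\<^esub> y)"
   unfolding ai[OF G.inv_closed[OF y]] using q IM'(4) ar_pull[OF IM'(4), of "a (inv\<^bsub>G\<^esub> y)"] by simp
  have "a (inv\<^bsub>G\<^esub> (y \<otimes>\<^bsub>G\<^esub> x)) = a (inv\<^bsub>G\<^esub> x) \<cdot> a (inv\<^bsub>G\<^esub> y)"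
   using am[of "inv\<^bsub>G\<^esub> x" "inv\<^bsub>G\<^esub> y"] x y by (simp add: G.inv_mult_group)
  then show ?thesis using q by (cases d; cases e) (simp_all add: l_def ar_assoc ii ai[OF G.inv_closed[OF y], symmetric])
 qed
 have leta: "?ep \<cdot> l x e = ?ep" if x: "x : carrier G" for x e
 proof (cases e)
  case True
  define ep where "ep = ?ep"
  have n: "ep : Arr S" "Dom S ep = A 1" using mn unfolding ep_def by blast+
  have "ep \<cdot> (a (inv\<^bsub>G\<^esub> x) \<cdot> i) = (ep \<cdot> a (inv\<^bsub>G\<^esub> x)) \<cdot> i" using n aA[of "inv\<^bsub>G\<^esub> x"] x by (simp add: ar_assoc)
  also have "... = ep" using aeta[of "inv\<^bsub>G\<^esub> x"] IM'(5) x unfolding ep_def by simp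
  finally show ?thesis using True by (simp only: lT ep_def)
 qed (use aeta[of "inv\<^bsub>G\<^esub> x"] x lF[OF x] in simp)
 have lmu: "?de \<cdot> l x False = (l x False \<boxtimes> l x False) \<cdot> ?de" if x: "x : carrier G" for x
  unfolding lF[OF x] by (rule amu[OF G.inv_closed[OF x]])
 have lmu': "?de \<cdot> l x True = (l x True \<boxtimes> l x True) \<cdot> Sym S (A 1) (A 1) \<cdot> ?de" if x: "x : carrier G" for x
 proof -
  let ?a = "a (inv\<^bsub>G\<^esub> x)"
  have x': "inv\<^bsub>G\<^esub> x : carrier G" using x by simp
  note q = aA[OF x']
  define nu where "nu = ?de"
  have n [simp]: "nu : Arr S" "Cod S nu = A 1 \<boxdot> A 1" "Dom S nu = A 1" using mn unfolding nu_def by blast+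
  have nu: "nu \<cdot> ?a = (?a \<boxtimes> ?a) \<cdot> nu" "nu \<cdot> i = (i \<boxtimes> i) \<cdot> Sym S (A 1) (A 1) \<cdot> nu"
   unfolding nu_def by (rule amu[OF x'], rule IM'(6))
  have "nu \<cdot> (?a \<cdot> i) = (nu \<cdot> ?a) \<cdot> i" using q by (simp add: ar_assoc)
  also have "... = (?a \<boxtimes> ?a) \<cdot> (nu \<cdot> i)" unfolding nu(1) using q by (simp add: ar_assoc)
  also have "... = ((?a \<cdot> i) \<boxtimes> (?a \<cdot> i)) \<cdot> Sym S (A 1) (A 1) \<cdot> nu"
   unfolding nu(2) using q by (simp add: ar_assoc ar_tensor_Comp')
  finally show ?thesis unfolding lT nu_def .
 qed
 have anti: "(Mor 1 1 (l x True) \<boxtimes>\<^sub>P Mor 1 1 (l x True)) \<cdot>\<^sub>P Sym P 1 1 \<cdot>\<^sub>P Mor 1 (1 + 1) dd =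
   (Mor 1 1 (l x True) \<boxtimes>\<^sub>P Mor 1 1 (l x True)) \<cdot>\<^sub>P (Sym P 1 1 \<cdot>\<^sub>P Mor 1 (1 + 1) dd)" if "x : carrier G" for x
 proof -
  have lP: "Mor 1 1 (l x True) : Arr P" and dP: "Mor 1 (1 + 1) dd : Arr P"
   using dd lh[OF that, of True] by (simp_all add: endo_Arr Hom_iff)
  show ?thesis by (rule P.Comp_assoc[OF dP P.Sym_Arr P.TArr_Arr[OF lP lP]]) simp_all
 qed
 have "labelled_monoid (opposite P) G (Mor 1 (1 + 1) dd) (Mor 1 0 cc) (%x e. Mor 1 1 (l x e))"
 proof (rule labelled_monoid.intro[OF strict_prop_opposite[OF endo_strict_prop] G], rule labelled_monoid_axioms.intro, unfold opposite_sel)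
  show "Mor 1 1 (l x e) : Arr P & Cod P (Mor 1 1 (l x e)) = 1 & Dom P (Mor 1 1 (l x e)) = 1" if "x : carrier G" for x e
   using lh[OF that, of e] by (simp add: endo_Arr Hom_iff)
  show "Mor 1 1 (l \<one>\<^bsub>G\<^esub> False) = Ide P 1" using lF[OF one] a1 by simp
  show "Mor 1 1 (l x e) \<cdot>\<^sub>P Mor 1 1 (l y d) = Mor 1 1 (l (y \<otimes>\<^bsub>G\<^esub> x) (d ~= e))" if "x : carrier G" "y : carrier G" for x y d e
   using ll[OF that] by simp
  show "Mor 1 (1 + 1) dd \<cdot>\<^sub>P Mor 1 1 (l x True) =
    (Mor 1 1 (l x True) \<boxtimes>\<^sub>P Mor 1 1 (l x True)) \<cdot>\<^sub>P (Sym P 1 1 \<cdot>\<^sub>P Mor 1 (1 + 1) dd)" if x: "x : carrier G" for x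
   by (rule trans[OF comonoid_arrows.conv_anti_comult[OF MA[OF x], THEN iffD2, OF lmu'[OF x]] anti[OF x]])
 qed (rule comonoid_arrows.conv_coassoc[OF MA[OF one], THEN iffD2, OF IM'(1)]
   comonoid_arrows.conv_counit_left[OF MA[OF one], THEN iffD2, OF IM'(2)]
   comonoid_arrows.conv_counit_right[OF MA[OF one], THEN iffD2, OF IM'(3)]
   comonoid_arrows.conv_hom_counit[OF MA, THEN iffD2, OF _ leta]
   comonoid_arrows.conv_hom_comult[OF MA, THEN iffD2, OF _ lmu] | assumption | simp add: endo_Arr)+
 then show ?thesis unfolding l_def i_def .
qed

end

context system_pair
begin

context
 fixes h q2 q0
 assumes h: "h : Arr S" "Dom S h = A 1" "Cod S h = B 1" and q2: "q2 : Arr S" "Dom S q2 = A (1 + 1)" "Cod S q2 = B (1 + 1)"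
  and q0: "q0 : Arr S" "Dom S q0 = A 0" "Cod S q0 = B 0"
  and q2t: "q2 \<cdot> t (1, 1) = s (1, 1) \<cdot> (h \<boxtimes> h)" and q0u: "q0 \<cdot> u = v"
begin

text \<open>Here \<open>q2\<close> and \<open>q0\<close> play the components at 2 and 0 of a
  monoidal family with component \<open>h\<close> at 1. In this lemma and the next three, naturality
  at a structure arrow becomes a homomorphism condition once the comparison isomorphisms are
  cancelled.\<close>

lemma mor_mult_iff:
 assumes "f : Arr S" "Dom S f = A (1 + 1)" "Cod S f = A 1" and "g : Arr S" "Dom S g = B (1 + 1)" "Cod S g = B 1"
 shows "g \<cdot> q2 = h \<cdot> f <-> h \<cdot> (f \<cdot> t (1, 1)) = (g \<cdot> s (1, 1)) \<cdot> (h \<boxtimes> h)"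
proof -
 have "g \<cdot> q2 = h \<cdot> f <-> (g \<cdot> s (1, 1)) \<cdot> (h \<boxtimes> h) = h \<cdot> (f \<cdot> t (1, 1))"
 proof (rule X.iso_eq_right[of "t (1, 1)"])
  have "(g \<cdot> q2) \<cdot> t (1, 1) = g \<cdot> (q2 \<cdot> t (1, 1))" using assms q2 by (simp add: X.ar_assoc)
  then show "(g \<cdot> q2) \<cdot> t (1, 1) = (g \<cdot> s (1, 1)) \<cdot> (h \<boxtimes> h)" unfolding q2t using assms h by (simp add: X.ar_assoc)
 qed (use assms h q2 in "simp_all add: X.ar_assoc")
 then show ?thesis by (simp only: eq_commute)
qed

lemma mor_unit_iff:
 assumes "f : Arr S" "Dom S f = A 0" "Cod S f = A 1" and "g : Arr S" "Dom S g = B 0" "Cod S g = B 1"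
 shows "g \<cdot> q0 = h \<cdot> f <-> h \<cdot> (f \<cdot> u) = g \<cdot> v"
proof -
 have "g \<cdot> q0 = h \<cdot> f <-> g \<cdot> v = h \<cdot> (f \<cdot> u)"
  by (rule X.iso_eq_right[of u]) (use assms h q0 q0u in "simp_all add: X.ar_assoc")
 then show ?thesis by (simp only: eq_commute)
qed

lemma mor_comult_iff:
 assumes "f : Arr S" "Dom S f = A 1" "Cod S f = A (1 + 1)" and "g : Arr S" "Dom S g = B 1" "Cod S g = B (1 + 1)"
 shows "g \<cdot> h = q2 \<cdot> f <-> (Inv S (s (1, 1)) \<cdot> g) \<cdot> h = (h \<boxtimes> h) \<cdot> (Inv S (t (1, 1)) \<cdot> f)"
proof -
 have "(Inv S (s (1, 1)) \<cdot> g) \<cdot> h = (h \<boxtimes> h) \<cdot> (Inv S (t (1, 1)) \<cdot> f) <-> g \<cdot> h = q2 \<cdot> f"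
 proof (rule X.iso_eq_left[of "s (1, 1)"])
  have "s (1, 1) \<cdot> ((h \<boxtimes> h) \<cdot> (Inv S (t (1, 1)) \<cdot> f)) = (s (1, 1) \<cdot> (h \<boxtimes> h)) \<cdot> (Inv S (t (1, 1)) \<cdot> f)"
   using assms h by (simp add: X.ar_assoc)
  then show "s (1, 1) \<cdot> ((h \<boxtimes> h) \<cdot> (Inv S (t (1, 1)) \<cdot> f)) = q2 \<cdot> f" unfolding q2t[symmetric] using assms q2 by (simp add: X.ar_assoc)
 qed (use assms h q2 in "simp_all add: X.ar_assoc")
 then show ?thesis ..
qed

lemma mor_counit_iff:
 assumes "f : Arr S" "Dom S f = A 1" "Cod S f = A 0" and "g : Arr S" "Dom S g = B 1" "Cod S g = B 0"
 shows "g \<cdot> h = q0 \<cdot> f <-> (Inv S v \<cdot> g) \<cdot> h = Inv S u \<cdot> f"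
proof -
 have "(Inv S v \<cdot> g) \<cdot> h = Inv S u \<cdot> f <-> g \<cdot> h = q0 \<cdot> f"
 proof (rule X.iso_eq_left[of v])
  have "v \<cdot> (Inv S u \<cdot> f) = q0 \<cdot> (u \<cdot> (Inv S u \<cdot> f))" unfolding q0u[symmetric] using assms q0 by (simp add: X.ar_assoc)
  then show "v \<cdot> (Inv S u \<cdot> f) = q0 \<cdot> f" using assms by simp
 qed (use assms h q0 in "simp_all add: X.ar_assoc")
 then show ?thesis ..
qed

end

end

lemma (in group) QA_closure:
 assumes e: "prop_map (DHG G) T e"
  and N: "\<forall>n. Ide T n : N" "\<forall>a b. Sym T a b : N" "\<forall>f \<in> N. \<forall>g \<in> N. Dom T g = Cod T f --> g \<cdot>\<^sub>T f : N"
   "\<forall>f \<in> N. \<forall>g \<in> N. f \<boxtimes>\<^sub>T g : N"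
  and g: "e (q_m G) : N" "e (q_u G) : N" "e (qlab \<one> True) : N" "!!x. x : carrier G ==> e (qlab x False) : N"
  and f: "f : QA G"
 shows "e f : N"
 using f
proof (induction f rule: QA_induct)
 note D = prop_mapD[OF e, unfolded DHG_sel]
 { case (qide n) then show ?case using N(1) D(4) by simp }
 { case qsym then show ?case using N(2) D(7) by simp }
 { case (qlab x b)
  \<comment> \<open>A label is the product of its component in \<open>G\<close> and the label
    \<open>True\<close> at the neutral element, so these suffice as generators.\<close>
  have "e (qlab x True) = e (qlab x False) \<cdot>\<^sub>T e (qlab \<one> True)"
   using D(5)[of "qlab \<one> True" "qlab x False"] qlab_qlab[of \<one> x False True] qlab by simp
  then have "e (qlab x True) : N" using N(3) g(3) g(4)[OF qlab] D(2,3) qlab by simp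
  then show ?case using g(4)[OF qlab] by (cases b) simp_all }
 { case q_m then show ?case by (rule g) }
 { case q_u then show ?case by (rule g) }
 { case (qcomp a b) then show ?case using D(5)[of a b] D(2,3) N(3) by simp }
 { case (qtensor a b) then show ?case using D(6)[of a b] N(4) by simp }
qed

section \<open>Algebras and involutive structures\<close>

context group
begin

text \<open>The map \<open>e\<close> is the identity for \<open>Q\<close> itself and
  \<open>emb1\<close> for the PROP of spans, so that one argument serves both kinds of
  algebras.\<close>

lemma alg_labelled_monoid:
 assumes S: "symmetric_monoidal_category S" and T: "prop_shape T" and e: "prop_map (DHG G) T e" and F: "F : Obj (Alg T S)"
 shows "labelled_monoid (endo S (FObj F) (FTens F)) G (Mor (1 + 1) 1 (FArr F (e (q_m G)))) (Mor 0 1 (FArr F (e (q_u G))))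
  (%x b. Mor 1 1 (FArr F (e (qlab x b))))"
proof -
 note ts = prop_shape.Alg_system[OF T S F]
 note D = prop_mapD[OF e, unfolded DHG_sel]
 have L: "labelled_monoid (endo S (FObj F) (FTens F)) G (hat T (FArr F) (e (q_m G))) (hat T (FArr F) (e (q_u G)))
   (%x b. hat T (FArr F) (e (qlab x b)))"
  using prop_map_labelled_monoid[OF tensor_system.endo_strict_prop[OF ts(1)] prop_map_o[OF e ts(2)]] by simp
 have q: "hat T (FArr F) (e (q_m G)) = Mor (1 + 1) 1 (FArr F (e (q_m G)))" "hat T (FArr F) (e (q_u G)) = Mor 0 1 (FArr F (e (q_u G)))"
  using D(2,3)[of "q_m G"] D(2,3)[of "q_u G"] by (simp_all add: hat_def)
 interpret L: labelled_monoid "endo S (FObj F) (FTens F)" G "hat T (FArr F) (e (q_m G))" "hat T (FArr F) (e (q_u G))"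
   "%x b. hat T (FArr F) (e (qlab x b))" by (rule L)
 have l: "hat T (FArr F) (e (qlab x b)) = Mor 1 1 (FArr F (e (qlab x b)))" if "x : carrier G" for x b
  using D(2,3)[of "qlab x b"] that by (simp add: hat_def)
 have l1: "hat T (FArr F) (e (qlab \<one> False)) = Mor 1 1 (FArr F (e (qlab \<one> False)))" by (rule l) simp
 show ?thesis
  by (rule labelled_monoid.intro[OF L.strict_prop_axioms is_group], rule labelled_monoid_axioms.intro,
    unfold q[symmetric] l1[symmetric])
   (simp_all only: l[symmetric] m_closed L.lab_Arr L.mu_Arr L.eta_Arr L.lab_one L.lab_lab L.mu_assoc L.mu_eta_left L.mu_eta_right
    L.lab_eta L.lab_mu L.lab_mu' simp_thms)
qed

lemma alg_labelled_comonoid: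
 assumes S: "symmetric_monoidal_category S" and T: "prop_shape T" and e: "prop_map (DHG G) (opposite T) e" and F: "F : Obj (Alg T S)"
 shows "labelled_monoid (opposite (endo S (FObj F) (FTens F))) G (Mor 1 (1 + 1) (FArr F (e (q_m G)))) (Mor 1 0 (FArr F (e (q_u G))))
  (%x b. Mor 1 1 (FArr F (e (qlab x b))))"
proof -
 note ts = prop_shape.Alg_system[OF T S F]
 note D = prop_mapD[OF e, unfolded DHG_sel opposite_sel]
 let ?P = "opposite (endo S (FObj F) (FTens F))"
 have L: "labelled_monoid ?P G (hat T (FArr F) (e (q_m G))) (hat T (FArr F) (e (q_u G))) (%x b. hat T (FArr F) (e (qlab x b)))"
  using prop_map_labelled_monoid[OF strict_prop_opposite[OF tensor_system.endo_strict_prop[OF ts(1)]]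
   prop_map_o[OF e prop_map_opp_opp[OF ts(2)]]] by simp
 have q: "hat T (FArr F) (e (q_m G)) = Mor 1 (1 + 1) (FArr F (e (q_m G)))" "hat T (FArr F) (e (q_u G)) = Mor 1 0 (FArr F (e (q_u G)))"
  using D(2,3)[of "q_m G"] D(2,3)[of "q_u G"] by (simp_all add: hat_def)
 interpret L: labelled_monoid ?P G "hat T (FArr F) (e (q_m G))" "hat T (FArr F) (e (q_u G))"
   "%x b. hat T (FArr F) (e (qlab x b))" by (rule L)
 have l: "hat T (FArr F) (e (qlab x b)) = Mor 1 1 (FArr F (e (qlab x b)))" if "x : carrier G" for x b
  using D(2,3)[of "qlab x b"] that by (simp add: hat_def)
 have l1: "hat T (FArr F) (e (qlab \<one> False)) = Mor 1 1 (FArr F (e (qlab \<one> False)))" by (rule l) simp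
 show ?thesis
  by (rule labelled_monoid.intro[OF L.strict_prop_axioms is_group], rule labelled_monoid_axioms.intro,
    unfold q[symmetric] l1[symmetric])
   (simp_all only: l[symmetric] m_closed L.lab_Arr L.mu_Arr L.eta_Arr L.lab_one L.lab_lab L.mu_assoc L.mu_eta_left L.mu_eta_right
    L.lab_eta L.lab_mu L.lab_mu' simp_thms)
qed

lemma alg_monoid:
 assumes "symmetric_monoidal_category S" "prop_shape T" "prop_map (DHG G) T e" "F : Obj (Alg T S)"
  and M: "MObj M = FObj F 1" "MMult M = FArr F (e (q_m G)) \<cdot>\<^sub>S FTens F (1, 1)" "MUnit M = FArr F (e (q_u G)) \<cdot>\<^sub>S FUnit F"
   "MInv M = FArr F (e (qlab \<one> True))"
 shows "is_involutive_monoid S M"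
  and "x : carrier G ==> is_monoid_mor S M M (FArr F (e (qlab x False))) &
   FArr F (e (qlab x False)) \<cdot>\<^sub>S MInv M = MInv M \<cdot>\<^sub>S FArr F (e (qlab x False))"
 using tensor_system.labelled_monoidD[OF prop_shape.Alg_system(1)[OF assms(2,1,4)] alg_labelled_monoid[OF assms(1-4)] M] by blast+

lemma alg_comonoid:
 assumes "symmetric_monoidal_category S" "prop_shape T" "prop_map (DHG G) (opposite T) e" "F : Obj (Alg T S)"
  and M: "CObj M = FObj F 1" "CComult M = Inv S (FTens F (1, 1)) \<cdot>\<^sub>S FArr F (e (q_m G))"
   "CCounit M = Inv S (FUnit F) \<cdot>\<^sub>S FArr F (e (q_u G))" "CInv M = FArr F (e (qlab \<one> True))"
 shows "is_involutive_comonoid S M"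
  and "x : carrier G ==> is_comonoid_mor S M M (FArr F (e (qlab x False))) &
   FArr F (e (qlab x False)) \<cdot>\<^sub>S CInv M = CInv M \<cdot>\<^sub>S FArr F (e (qlab x False))"
 using tensor_system.labelled_comonoidD[OF prop_shape.Alg_system(1)[OF assms(2,1,4)] alg_labelled_comonoid[OF assms(1-4)] M] by blast+

lemma alg_monoid_mor_iff:
 assumes S: "symmetric_monoidal_category S" and T: "prop_shape T" and e: "prop_map (DHG G) T e"
  and F: "F : Obj (Alg T S)" and K: "K : Obj (Alg T S)"
  and M: "MMult M = FArr F (e (q_m G)) \<cdot>\<^sub>S FTens F (1, 1)" "MUnit M = FArr F (e (q_u G)) \<cdot>\<^sub>S FUnit F"
  and N: "MMult N = FArr K (e (q_m G)) \<cdot>\<^sub>S FTens K (1, 1)" "MUnit N = FArr K (e (q_u G)) \<cdot>\<^sub>S FUnit K"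
  and th: "!!n. th n : Arr S & Dom S (th n) = FObj F n & Cod S (th n) = FObj K n"
  and c: "th (1 + 1) \<cdot>\<^sub>S FTens F (1, 1) = FTens K (1, 1) \<cdot>\<^sub>S (th 1 \<boxtimes>\<^sub>S th 1)" "th 0 \<cdot>\<^sub>S FUnit F = FUnit K"
 shows "is_monoid_mor S M N (th 1) <->
  FArr K (e (q_m G)) \<cdot>\<^sub>S th (Dom T (e (q_m G))) = th (Cod T (e (q_m G))) \<cdot>\<^sub>S FArr F (e (q_m G)) &
  FArr K (e (q_u G)) \<cdot>\<^sub>S th (Dom T (e (q_u G))) = th (Cod T (e (q_u G))) \<cdot>\<^sub>S FArr F (e (q_u G))"
proof -
 note D = prop_mapD[OF e, unfolded DHG_sel]
 have d: "Dom T (e (q_m G)) = 1 + 1" "Cod T (e (q_m G)) = 1" "Dom T (e (q_u G)) = 0" "Cod T (e (q_u G)) = 1"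
  using D(2,3)[of "q_m G"] D(2,3)[of "q_u G"] by simp_all
 have a: "e (q_m G) : Arr T" "e (q_u G) : Arr T" using D(1) by simp_all
 note FA = prop_shape.Alg_FArr[OF T S F a(1), unfolded d] prop_shape.Alg_FArr[OF T S F a(2), unfolded d]
 note KA = prop_shape.Alg_FArr[OF T S K a(1), unfolded d] prop_shape.Alg_FArr[OF T S K a(2), unfolded d]
 interpret system_pair S "FObj F" "FTens F" "FUnit F" "FObj K" "FTens K" "FUnit K"
  by (intro system_pair.intro prop_shape.Alg_system(1)[OF T S F] prop_shape.Alg_system(1)[OF T S K])
 have q: "th n : Arr S" "Dom S (th n) = FObj F n" "Cod S (th n) = FObj K n" for n using th by blast+
 show ?thesis
  unfolding is_monoid_mor_def M N d
  using mor_mult_iff[OF q q q c FA(1-3) KA(1-3)] mor_unit_iff[OF q q q c FA(4-6) KA(4-6)] unfolding c by blast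
qed

lemma alg_comonoid_mor_iff:
 assumes S: "symmetric_monoidal_category S" and T: "prop_shape T" and e: "prop_map (DHG G) (opposite T) e"
  and F: "F : Obj (Alg T S)" and K: "K : Obj (Alg T S)"
  and M: "CComult M = Inv S (FTens F (1, 1)) \<cdot>\<^sub>S FArr F (e (q_m G))" "CCounit M = Inv S (FUnit F) \<cdot>\<^sub>S FArr F (e (q_u G))"
  and N: "CComult N = Inv S (FTens K (1, 1)) \<cdot>\<^sub>S FArr K (e (q_m G))" "CCounit N = Inv S (FUnit K) \<cdot>\<^sub>S FArr K (e (q_u G))"
  and th: "!!n. th n : Arr S & Dom S (th n) = FObj F n & Cod S (th n) = FObj K n"
  and c: "th (1 + 1) \<cdot>\<^sub>S FTens F (1, 1) = FTens K (1, 1) \<cdot>\<^sub>S (th 1 \<boxtimes>\<^sub>S th 1)" "th 0 \<cdot>\<^sub>S FUnit F = FUnit K"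
 shows "is_comonoid_mor S M N (th 1) <->
  FArr K (e (q_m G)) \<cdot>\<^sub>S th (Dom T (e (q_m G))) = th (Cod T (e (q_m G))) \<cdot>\<^sub>S FArr F (e (q_m G)) &
  FArr K (e (q_u G)) \<cdot>\<^sub>S th (Dom T (e (q_u G))) = th (Cod T (e (q_u G))) \<cdot>\<^sub>S FArr F (e (q_u G))"
proof -
 note D = prop_mapD[OF e, unfolded DHG_sel opposite_sel]
 have d: "Dom T (e (q_m G)) = 1" "Cod T (e (q_m G)) = 1 + 1" "Dom T (e (q_u G)) = 1" "Cod T (e (q_u G)) = 0"
  using D(2,3)[of "q_m G"] D(2,3)[of "q_u G"] by simp_all
 have a: "e (q_m G) : Arr T" "e (q_u G) : Arr T" using D(1) by simp_all
 note FA = prop_shape.Alg_FArr[OF T S F a(1), unfolded d] prop_shape.Alg_FArr[OF T S F a(2), unfolded d]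
 note KA = prop_shape.Alg_FArr[OF T S K a(1), unfolded d] prop_shape.Alg_FArr[OF T S K a(2), unfolded d]
 interpret system_pair S "FObj F" "FTens F" "FUnit F" "FObj K" "FTens K" "FUnit K"
  by (intro system_pair.intro prop_shape.Alg_system(1)[OF T S F] prop_shape.Alg_system(1)[OF T S K])
 have q: "th n : Arr S" "Dom S (th n) = FObj F n" "Cod S (th n) = FObj K n" for n using th by blast+
 show ?thesis
  unfolding is_comonoid_mor_def M N d
  using mor_comult_iff[OF q q q c FA(1-3) KA(1-3)] mor_counit_iff[OF q q q c FA(4-6) KA(4-6)] by blast
qed

lemma DHG_id: "prop_map (DHG G) (DHG G) (%q. q)"
 by (rule prop_mapI) simp_all

lemma DHG_op_id: "prop_map (DHG G) (opposite (opposite (DHG G))) (%q. q)"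
 by (rule prop_mapI) simp_all

lemma DHG_op_shape: "prop_shape (opposite (DHG G))"
 by (rule prop_shape_opposite[OF Q.strict_prop_axioms DHG_shape])

lemma monoid_mor_Ide:
 assumes S: "symmetric_monoidal_category S" and M: "is_monoid S M"
 shows "is_monoid_mor S M M (Ide S (MObj M))"
proof -
 interpret symmetric_monoidal_category S by fact
 show ?thesis using M by (auto simp: is_monoid_mor_def is_monoid_def Let_def Hom_iff TArr_Ide)
qed

lemma monoid_mor_Comp:
 assumes S: "symmetric_monoidal_category S" and M: "is_monoid S M" "is_monoid S N" "is_monoid S K"
  and f: "f : Hom S (MObj M) (MObj N)" "g : Hom S (MObj N) (MObj K)"
  and m: "is_monoid_mor S M N f" "is_monoid_mor S N K g"
 shows "is_monoid_mor S M K (g \<cdot>\<^sub>S f)"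
proof -
 interpret symmetric_monoidal_category S by fact
 have q: "MMult M : Hom S (MObj M \<boxdot>\<^sub>S MObj M) (MObj M)" "MUnit M : Hom S (TUnit S) (MObj M)"
  "MMult N : Hom S (MObj N \<boxdot>\<^sub>S MObj N) (MObj N)" "MMult K : Hom S (MObj K \<boxdot>\<^sub>S MObj K) (MObj K)"
  using M by (simp_all add: is_monoid_def Let_def)
 have "(g \<cdot>\<^sub>S f) \<cdot>\<^sub>S MMult M = g \<cdot>\<^sub>S (f \<cdot>\<^sub>S MMult M)" using q f by (simp add: Hom_iff ar_assoc)
 also have "f \<cdot>\<^sub>S MMult M = MMult N \<cdot>\<^sub>S (f \<boxtimes>\<^sub>S f)" using m(1) by (simp add: is_monoid_mor_def)
 also have "g \<cdot>\<^sub>S (MMult N \<cdot>\<^sub>S (f \<boxtimes>\<^sub>S f)) = (g \<cdot>\<^sub>S MMult N) \<cdot>\<^sub>S (f \<boxtimes>\<^sub>S f)"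
  using q f by (simp add: Hom_iff ar_assoc)
 also have "g \<cdot>\<^sub>S MMult N = MMult K \<cdot>\<^sub>S (g \<boxtimes>\<^sub>S g)" using m(2) by (simp add: is_monoid_mor_def)
 also have "MMult K \<cdot>\<^sub>S (g \<boxtimes>\<^sub>S g) \<cdot>\<^sub>S (f \<boxtimes>\<^sub>S f) = MMult K \<cdot>\<^sub>S ((g \<cdot>\<^sub>S f) \<boxtimes>\<^sub>S (g \<cdot>\<^sub>S f))"
  using q f by (simp add: Hom_iff ar_assoc ar_tensor_Comp)
 finally show ?thesis using q f m by (simp add: is_monoid_mor_def Hom_iff ar_assoc)
qed

lemma comonoid_mor_Ide:
 assumes S: "symmetric_monoidal_category S" and M: "is_comonoid S M"
 shows "is_comonoid_mor S M M (Ide S (CObj M))"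
proof -
 interpret symmetric_monoidal_category S by fact
 show ?thesis using M by (auto simp: is_comonoid_mor_def is_comonoid_def Let_def Hom_iff TArr_Ide)
qed

lemma comonoid_mor_Comp:
 assumes S: "symmetric_monoidal_category S" and M: "is_comonoid S M" "is_comonoid S N" "is_comonoid S K"
  and f: "f : Hom S (CObj M) (CObj N)" "g : Hom S (CObj N) (CObj K)"
  and m: "is_comonoid_mor S M N f" "is_comonoid_mor S N K g"
 shows "is_comonoid_mor S M K (g \<cdot>\<^sub>S f)"
proof -
 interpret symmetric_monoidal_category S by fact
 have q: "CComult M : Hom S (CObj M) (CObj M \<boxdot>\<^sub>S CObj M)" "CComult N : Hom S (CObj N) (CObj N \<boxdot>\<^sub>S CObj N)"
  "CComult K : Hom S (CObj K) (CObj K \<boxdot>\<^sub>S CObj K)" "CCounit K : Hom S (CObj K) (TUnit S)"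
  using M by (simp_all add: is_comonoid_def Let_def)
 have "CComult K \<cdot>\<^sub>S (g \<cdot>\<^sub>S f) = (CComult K \<cdot>\<^sub>S g) \<cdot>\<^sub>S f"
  using q f by (simp add: Hom_iff ar_assoc)
 also have "... = (g \<boxtimes>\<^sub>S g) \<cdot>\<^sub>S (CComult N \<cdot>\<^sub>S f)"
  using q f m(2) by (simp add: is_comonoid_mor_def Hom_iff ar_assoc)
 also have "... = ((g \<cdot>\<^sub>S f) \<boxtimes>\<^sub>S (g \<cdot>\<^sub>S f)) \<cdot>\<^sub>S CComult M"
  using q f m(1) by (simp add: is_comonoid_mor_def Hom_iff ar_tensor_Comp')
 finally have 1: "CComult K \<cdot>\<^sub>S (g \<cdot>\<^sub>S f) = ((g \<cdot>\<^sub>S f) \<boxtimes>\<^sub>S (g \<cdot>\<^sub>S f)) \<cdot>\<^sub>S CComult M" .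
 have "CCounit K \<cdot>\<^sub>S (g \<cdot>\<^sub>S f) = (CCounit K \<cdot>\<^sub>S g) \<cdot>\<^sub>S f"
  using q f by (simp add: Hom_iff ar_assoc)
 then show ?thesis using 1 m by (simp add: is_comonoid_mor_def)
qed

lemma commute_Comp:
 assumes S: "category S" and f: "f : Hom S x y" "g : Hom S y z" and i: "i : Hom S x x" "j : Hom S y y" "k : Hom S z z"
  and c: "f \<cdot>\<^sub>S i = j \<cdot>\<^sub>S f" "g \<cdot>\<^sub>S j = k \<cdot>\<^sub>S g"
 shows "(g \<cdot>\<^sub>S f) \<cdot>\<^sub>S i = k \<cdot>\<^sub>S (g \<cdot>\<^sub>S f)"
proof -
 interpret category S by fact
 have "(g \<cdot>\<^sub>S f) \<cdot>\<^sub>S i = (g \<cdot>\<^sub>S j) \<cdot>\<^sub>S f" using f i c(1) by (simp add: Hom_iff ar_assoc)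
 then show ?thesis unfolding c(2) using f i by (simp add: Hom_iff ar_assoc)
qed

end

section \<open>The three equivalences\<close>

context group
begin

lemma IMon_equivalence:
 fixes S :: "('o, 's, 'z) smc_scheme"
 assumes S: "symmetric_monoidal_category S"
 shows "equivalent_categories (Alg (DHG G) S) (Fun (one_object_category G) (IMon S))"
proof -
 interpret S: symmetric_monoidal_category S by fact
 let ?T = "DHG G"
 let ?R = "%(M :: ('o, 's) imon) N f. is_monoid_mor S M N f & f \<cdot>\<^sub>S MInv M = MInv N \<cdot>\<^sub>S f"
 define str :: "(nat, 'a qarr, 'o, 's) monfunctor => ('o, 's) imon" where
  "str F = \<lparr>MObj = FObj F 1, MMult = FArr F (q_m G) \<cdot>\<^sub>S FTens F (1, 1), MUnit = FArr F (q_u G) \<cdot>\<^sub>S FUnit F,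
   MInv = FArr F (qlab \<one> True)\<rparr>" for F
 have st: "MObj (str F) = FObj F 1" "MMult (str F) = FArr F (q_m G) \<cdot>\<^sub>S FTens F (1, 1)"
  "MUnit (str F) = FArr F (q_u G) \<cdot>\<^sub>S FUnit F" "MInv (str F) = FArr F (qlab \<one> True)" for F
  by (simp_all add: str_def)
 have mon: "is_monoid S M" "MInv M : Hom S (MObj M) (MObj M)" if "is_involutive_monoid S M" for M :: "('o, 's) imon"
  using that unfolding is_involutive_monoid_def Let_def by blast+
 have "alg_equiv ?T G S {M. is_involutive_monoid S M} MObj ?R str (%g. qlab g False)"
 proof (rule alg_equiv.intro[OF DHG_shape is_group], rule alg_equiv_axioms.intro[OF S])
  show "qlab g False : Arr ?T & Dom ?T (qlab g False) = 1 & Cod ?T (qlab g False) = 1" if "g : carrier G" for g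
   using that by simp
  show "qlab \<one> False = Ide ?T 1" by (simp only: qlab_one DHG_sel)
  show "qlab (g \<otimes> h) False = qlab g False \<cdot>\<^sub>?T qlab h False" if "g : carrier G" "h : carrier G" for g h
   using qlab_qlab[OF that(2,1), of False False] by simp
  show "MObj M : Obj S" if "M : {M. is_involutive_monoid S M}" for M :: "('o, 's) imon"
   using mon(1)[of M] that by (simp add: is_monoid_def Let_def)
  show "?R M M (Ide S (MObj M))" if "M : {M. is_involutive_monoid S M}" for M
   using monoid_mor_Ide[OF S, of M] mon[of M] that by (auto simp: S.Hom_iff)
  show "?R M K (f' \<cdot>\<^sub>S f)" if "M : {M. is_involutive_monoid S M}" "N : {M. is_involutive_monoid S M}"
   "K : {M. is_involutive_monoid S M}" "f : Hom S (MObj M) (MObj N)" "f' : Hom S (MObj N) (MObj K)" "?R M N f" "?R N K f'" for M N K f f'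
  proof -
   have m: "is_involutive_monoid S M" "is_involutive_monoid S N" "is_involutive_monoid S K" using that by simp_all
   show ?thesis
    using monoid_mor_Comp[OF S mon(1)[OF m(1)] mon(1)[OF m(2)] mon(1)[OF m(3)] that(4,5)] that(6,7)
     commute_Comp[OF S.category_axioms that(4,5) mon(2)[OF m(1)] mon(2)[OF m(2)] mon(2)[OF m(3)]] by blast
  qed
  fix F assume F: "F : Obj (Alg ?T S)"
  note am = alg_monoid[OF S DHG_shape DHG_id F st]
  show "str F : {M. is_involutive_monoid S M} & MObj (str F) = FObj F 1" using am(1) st(1) by simp
  show "?R (str F) (str F) (FArr F (qlab g False))" if "g : carrier G" for g by (rule am(2)[OF that])
  fix K assume K: "K : Obj (Alg ?T S)"
  note iff = alg_monoid_mor_iff[OF S DHG_shape DHG_id F K st(2,3) st(2,3)]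
  note mi = prop_shape.monoidal_iff[OF DHG_shape S F K]
  have oq: "qlab \<one> True : QA G" by simp
  show "?R (str F) (str K) (th 1)" if th: "monoidal_transformation ?T S F K th" for th
  proof
   have nat: "FArr K f \<cdot>\<^sub>S th (Dom ?T f) = th (Cod ?T f) \<cdot>\<^sub>S FArr F f" if "f : Arr ?T" for f
    using th that unfolding mi by blast
   show "is_monoid_mor S (str F) (str K) (th 1)"
   proof (rule iff[THEN iffD2])
    show "th n : Arr S & Dom S (th n) = FObj F n & Cod S (th n) = FObj K n" for n using th unfolding mi by blast
    show "th (1 + 1) \<cdot>\<^sub>S FTens F (1, 1) = FTens K (1, 1) \<cdot>\<^sub>S (th 1 \<boxtimes>\<^sub>S th 1)" "th 0 \<cdot>\<^sub>S FUnit F = FUnit K"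
     using th unfolding mi by blast+
   qed (intro conjI nat q_m_q_u)
   show "th 1 \<cdot>\<^sub>S MInv (str F) = MInv (str K) \<cdot>\<^sub>S th 1" using nat[OF oq] unfolding st by simp
  qed
  show "\<exists>th. monoidal_transformation ?T S F K th & th 1 = k"
   if k: "k : Hom S (FObj F 1) (FObj K 1)" and R: "?R (str F) (str K) k"
    and ac: "!!g. g : carrier G ==> FArr K (qlab g False) \<cdot>\<^sub>S k = k \<cdot>\<^sub>S FArr F (qlab g False)" for k
  proof -
   obtain th where th: "th 1 = k" "th (1 + 1) \<cdot>\<^sub>S FTens F (1, 1) = FTens K (1, 1) \<cdot>\<^sub>S (k \<boxtimes>\<^sub>S k)" "th 0 \<cdot>\<^sub>S FUnit F = FUnit K"
    "!!n. th n : Arr S & Dom S (th n) = FObj F n & Cod S (th n) = FObj K n"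
    and cl: "!!N. N = {f \<in> Arr ?T. FArr K f \<cdot>\<^sub>S th (Dom ?T f) = th (Cod ?T f) \<cdot>\<^sub>S FArr F f} ==>
     (\<forall>n. Ide ?T n : N) & (\<forall>a b. Sym ?T a b : N) &
     (\<forall>f \<in> N. \<forall>g \<in> N. Dom ?T g = Cod ?T f --> g \<cdot>\<^sub>?T f : N) & (\<forall>f \<in> N. \<forall>g \<in> N. f \<boxtimes>\<^sub>?T g : N) &
     (Arr ?T \<subseteq> N --> monoidal_transformation ?T S F K th)"
    using prop_shape.Alg_full[OF DHG_shape S F K k] by blast
   define N where "N = {f \<in> Arr ?T. FArr K f \<cdot>\<^sub>S th (Dom ?T f) = th (Cod ?T f) \<cdot>\<^sub>S FArr F f}"
   note cl = cl[OF N_def]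
   \<comment> \<open>A homomorphism of the structures is natural at \<open>q_m\<close>,
     \<open>q_u\<close> and the involution, and equivariance adds the labels in \<open>G\<close>;
     these generate \<open>Q\<close>.\<close>
   have mu: "q_m G : N" "q_u G : N"
    using iff[OF th(4) th(2,3)[folded th(1)], THEN iffD1] R unfolding th(1) N_def mem_Collect_eq by (blast intro: q_m_q_u)+
   have lab: "qlab \<one> True : N" "x : carrier G ==> qlab x False : N" for x
    using R ac[of x] th(1) unfolding N_def st by simp_all
   have "f : N" if "f : QA G" for f
    using QA_closure[OF DHG_id, of N f] cl mu lab that by blast
   then show ?thesis using cl th(1) by blast
  qed
 next
  fix M :: "('o, 's) imon" and a
  assume "M : {M. is_involutive_monoid S M}" and a: "!!g. g : carrier G ==> a g : Hom S (MObj M) (MObj M) & ?R M M (a g)"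
   and a1: "a \<one> = Ide S (MObj M)" and am: "!!g h. g : carrier G ==> h : carrier G ==> a (g \<otimes> h) = a g \<cdot>\<^sub>S a h"
  then have M: "is_involutive_monoid S M" by simp
  define X where "X = MObj M"
  have Mf: "X : Obj S" "MMult M : Hom S (X \<boxdot>\<^sub>S X) X" "MUnit M : Hom S (TUnit S) X"
   using mon(1)[OF M] by (simp_all add: is_monoid_def Let_def X_def)
  let ?A = "pw S X" and ?t = "%(a, b). pt S X a b" and ?u = "Ide S (TUnit S)"
  note ps = S.power_system[OF Mf(1)]
  have A: "?A 1 = X" "?A (1 + 1) = X \<boxdot>\<^sub>S X" "?A 0 = TUnit S" by simp_all
  have t: "MMult M \<cdot>\<^sub>S ?t (1, 1) = MMult M" "MUnit M \<cdot>\<^sub>S ?u = MUnit M"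
   using Mf ps(3) by (simp_all add: S.Hom_iff)
  have L: "labelled_monoid (endo S ?A ?t) G (Mor (1 + 1) 1 (MMult M)) (Mor 0 1 (MUnit M))
    (%x e. Mor 1 1 (a x \<cdot>\<^sub>S (if e then MInv M else Ide S (?A 1))))"
   by (rule tensor_system.labelled_monoidI[OF ps(1) is_group M _ t(1)[symmetric] t(2)[symmetric]])
    (use a a1 am Mf in "simp_all only: A X_def[symmetric]")
  interpret L: labelled_monoid "endo S ?A ?t" G "Mor (1 + 1) 1 (MMult M)" "Mor 0 1 (MUnit M)"
    "%x e. Mor 1 1 (a x \<cdot>\<^sub>S (if e then MInv M else Ide S (?A 1)))" by (rule L)
  define F where "F = alg_of ?T ?A ?t ?u L.NF"
  have F: "F : Obj (Alg ?T S)" unfolding F_def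
   by (rule prop_shape.alg_of_Alg[OF DHG_shape S ps(1) _ _ L.NF_prop_map])
    (use ps(2) in "auto intro: canonical_arrows.intros S.TUnit_in_Obj")
  have Ff: "FObj F = ?A" "FTens F = ?t" "FUnit F = ?u" "!!f. f : QA G ==> FArr F f = under (L.NF f)"
   by (simp_all add: F_def alg_of_def)
  have FA: "FArr F (q_m G) = MMult M" "FArr F (q_u G) = MUnit M" "FArr F (qlab \<one> True) = MInv M"
   "x : carrier G ==> FArr F (qlab x False) = a x" for x
   using L.NF_q_m L.NF_q_u L.NF_qlab[of \<one> True] L.NF_qlab[of x False] a[of x] a1 mon(2)[OF M]
   by (simp_all add: Ff S.Hom_iff A[unfolded One_nat_def] X_def)
  have "str F = M" unfolding str_def FA Ff A t unfolding X_def by simp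
  then show "\<exists>F \<in> Obj (Alg ?T S). str F = M & (\<forall>g \<in> carrier G. FArr F (qlab g False) = a g)"
   using F FA(4) by blast
 qed
 from alg_equiv.equivalence[OF this] show ?thesis unfolding IMon_def .
qed

lemma IComon_equivalence:
 fixes S :: "('o, 's, 'z) smc_scheme"
 assumes S: "symmetric_monoidal_category S"
 shows "equivalent_categories (Alg (opposite (DHG G)) S) (Fun (one_object_category G) (IComon S))"
proof -
 interpret S: symmetric_monoidal_category S by fact
 let ?T = "opposite (DHG G)"
 let ?R = "%(M :: ('o, 's) icomon) N f. is_comonoid_mor S M N f & f \<cdot>\<^sub>S CInv M = CInv N \<cdot>\<^sub>S f"
 define str :: "(nat, 'a qarr, 'o, 's) monfunctor => ('o, 's) icomon" where
  "str F = \<lparr>CObj = FObj F 1, CComult = Inv S (FTens F (1, 1)) \<cdot>\<^sub>S FArr F (q_m G),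
   CCounit = Inv S (FUnit F) \<cdot>\<^sub>S FArr F (q_u G), CInv = FArr F (qlab \<one> True)\<rparr>" for F
 have st: "CObj (str F) = FObj F 1" "CComult (str F) = Inv S (FTens F (1, 1)) \<cdot>\<^sub>S FArr F (q_m G)"
  "CCounit (str F) = Inv S (FUnit F) \<cdot>\<^sub>S FArr F (q_u G)" "CInv (str F) = FArr F (qlab \<one> True)" for F
  by (simp_all add: str_def)
 have mon: "is_comonoid S M" "CInv M : Hom S (CObj M) (CObj M)" if "is_involutive_comonoid S M" for M
  using that unfolding is_involutive_comonoid_def Let_def by blast+
 \<comment> \<open>The inverse makes up for the reversal of composition in \<open>opposite\<close>,
   so that the action arrows multiply as \<open>G\<close> does.\<close>
 have "alg_equiv ?T G S {M. is_involutive_comonoid S M} CObj ?R str (%g. qlab (inv g) False)"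
 proof (rule alg_equiv.intro[OF DHG_op_shape is_group], rule alg_equiv_axioms.intro[OF S])
  show "qlab (inv g) False : Arr ?T & Dom ?T (qlab (inv g) False) = 1 & Cod ?T (qlab (inv g) False) = 1" if "g : carrier G" for g
   using that by simp
  show "qlab (inv \<one>) False = Ide ?T 1" by (simp only: inv_one qlab_one DHG_sel opposite_sel)
  show "qlab (inv (g \<otimes> h)) False = qlab (inv g) False \<cdot>\<^sub>?T qlab (inv h) False" if "g : carrier G" "h : carrier G" for g h
   using qlab_qlab[OF inv_closed[OF that(1)] inv_closed[OF that(2)], of False False] that by (simp add: inv_mult_group)
  show "CObj M : Obj S" if "M : {M. is_involutive_comonoid S M}" for M
   using mon(1)[of M] that by (simp add: is_comonoid_def Let_def)
  show "?R M M (Ide S (CObj M))" if "M : {M. is_involutive_comonoid S M}" for M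
   using comonoid_mor_Ide[OF S, of M] mon[of M] that by (auto simp: S.Hom_iff)
  show "?R M K (f' \<cdot>\<^sub>S f)" if "M : {M. is_involutive_comonoid S M}" "N : {M. is_involutive_comonoid S M}"
   "K : {M. is_involutive_comonoid S M}" "f : Hom S (CObj M) (CObj N)" "f' : Hom S (CObj N) (CObj K)" "?R M N f" "?R N K f'" for M N K f f'
  proof -
   have m: "is_involutive_comonoid S M" "is_involutive_comonoid S N" "is_involutive_comonoid S K" using that by simp_all
   show ?thesis
    using comonoid_mor_Comp[OF S mon(1)[OF m(1)] mon(1)[OF m(2)] mon(1)[OF m(3)] that(4,5)] that(6,7)
     commute_Comp[OF S.category_axioms that(4,5) mon(2)[OF m(1)] mon(2)[OF m(2)] mon(2)[OF m(3)]] by blast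
  qed
  fix F assume F: "F : Obj (Alg ?T S)"
  note am = alg_comonoid[OF S DHG_op_shape DHG_op_id F st]
  show "str F : {M. is_involutive_comonoid S M} & CObj (str F) = FObj F 1" using am(1) st(1) by simp
  show "?R (str F) (str F) (FArr F (qlab (inv g) False))" if "g : carrier G" for g by (rule am(2)[OF inv_closed[OF that]])
  fix K assume K: "K : Obj (Alg ?T S)"
  note iff = alg_comonoid_mor_iff[OF S DHG_op_shape DHG_op_id F K st(2,3) st(2,3)]
  note mi = prop_shape.monoidal_iff[OF DHG_op_shape S F K]
  have oq: "q_m G : Arr ?T" "q_u G : Arr ?T" "qlab \<one> True : Arr ?T" by simp_all
  show "?R (str F) (str K) (th 1)" if th: "monoidal_transformation ?T S F K th" for th
  proof
   have nat: "FArr K f \<cdot>\<^sub>S th (Dom ?T f) = th (Cod ?T f) \<cdot>\<^sub>S FArr F f" if "f : Arr ?T" for f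
    using th that unfolding mi by blast
   show "is_comonoid_mor S (str F) (str K) (th 1)"
   proof (rule iff[THEN iffD2])
    show "th n : Arr S & Dom S (th n) = FObj F n & Cod S (th n) = FObj K n" for n using th unfolding mi by blast
    show "th (1 + 1) \<cdot>\<^sub>S FTens F (1, 1) = FTens K (1, 1) \<cdot>\<^sub>S (th 1 \<boxtimes>\<^sub>S th 1)" "th 0 \<cdot>\<^sub>S FUnit F = FUnit K"
     using th unfolding mi by blast+
   qed (intro conjI nat oq)
   show "th 1 \<cdot>\<^sub>S CInv (str F) = CInv (str K) \<cdot>\<^sub>S th 1" using nat[OF oq(3)] unfolding st by simp
  qed
  show "\<exists>th. monoidal_transformation ?T S F K th & th 1 = k"
   if k: "k : Hom S (FObj F 1) (FObj K 1)" and R: "?R (str F) (str K) k"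
    and ac: "!!g. g : carrier G ==> FArr K (qlab (inv g) False) \<cdot>\<^sub>S k = k \<cdot>\<^sub>S FArr F (qlab (inv g) False)" for k
  proof -
   obtain th where th: "th 1 = k" "th (1 + 1) \<cdot>\<^sub>S FTens F (1, 1) = FTens K (1, 1) \<cdot>\<^sub>S (k \<boxtimes>\<^sub>S k)" "th 0 \<cdot>\<^sub>S FUnit F = FUnit K"
    "!!n. th n : Arr S & Dom S (th n) = FObj F n & Cod S (th n) = FObj K n"
    and cl: "!!N. N = {f \<in> Arr ?T. FArr K f \<cdot>\<^sub>S th (Dom ?T f) = th (Cod ?T f) \<cdot>\<^sub>S FArr F f} ==>
     (\<forall>n. Ide ?T n : N) & (\<forall>a b. Sym ?T a b : N) &
     (\<forall>f \<in> N. \<forall>g \<in> N. Dom ?T g = Cod ?T f --> g \<cdot>\<^sub>?T f : N) & (\<forall>f \<in> N. \<forall>g \<in> N. f \<boxtimes>\<^sub>?T g : N) &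
     (Arr ?T \<subseteq> N --> monoidal_transformation ?T S F K th)"
    using prop_shape.Alg_full[OF DHG_op_shape S F K k] by blast
   define N where "N = {f \<in> Arr ?T. FArr K f \<cdot>\<^sub>S th (Dom ?T f) = th (Cod ?T f) \<cdot>\<^sub>S FArr F f}"
   note cl = cl[OF N_def]
   have cl': "\<forall>f \<in> N. \<forall>g \<in> N. Dom (opposite ?T) g = Cod (opposite ?T) f --> g \<cdot>\<^bsub>opposite ?T\<^esub> f : N"
     "\<forall>n. Ide (opposite ?T) n : N" "\<forall>a b. Sym (opposite ?T) a b : N" "\<forall>f \<in> N. \<forall>g \<in> N. f \<boxtimes>\<^bsub>opposite ?T\<^esub> g : N"
    using cl unfolding opposite_sel by metis+
   have mu: "q_m G : N" "q_u G : N"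
    using iff[OF th(4) th(2,3)[folded th(1)], THEN iffD1] R unfolding th(1) N_def mem_Collect_eq by (blast intro: oq)+
   have lab: "qlab \<one> True : N" "x : carrier G ==> qlab x False : N" for x
    using R ac[of "inv x"] th(1) unfolding N_def st by simp_all
   have "f : N" if "f : QA G" for f
    using QA_closure[OF DHG_op_id cl'(2,3,1,4) mu lab that] .
   then show ?thesis using cl th(1) unfolding opposite_sel by blast
  qed
 next
  fix M :: "('o, 's) icomon" and a
  assume "M : {M. is_involutive_comonoid S M}" and a: "!!g. g : carrier G ==> a g : Hom S (CObj M) (CObj M) & ?R M M (a g)"
   and a1: "a \<one> = Ide S (CObj M)" and am: "!!g h. g : carrier G ==> h : carrier G ==> a (g \<otimes> h) = a g \<cdot>\<^sub>S a h"
  then have M: "is_involutive_comonoid S M" by simp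
  define X where "X = CObj M"
  have Mf: "X : Obj S" "CComult M : Hom S X (X \<boxdot>\<^sub>S X)" "CCounit M : Hom S X (TUnit S)"
   using mon(1)[OF M] by (simp_all add: is_comonoid_def Let_def X_def)
  let ?A = "pw S X" and ?t = "%(a, b). pt S X a b" and ?u = "Ide S (TUnit S)"
  note ps = S.power_system[OF Mf(1)]
  have A: "?A 1 = X" "?A (1 + 1) = X \<boxdot>\<^sub>S X" "?A 0 = TUnit S" by simp_all
  have t: "Inv S (?t (1, 1)) \<cdot>\<^sub>S CComult M = CComult M" "Inv S ?u \<cdot>\<^sub>S CCounit M = CCounit M"
   using Mf ps(3) by (simp_all add: S.Hom_iff)
  have L: "labelled_monoid (opposite (endo S ?A ?t)) G (Mor 1 (1 + 1) (CComult M)) (Mor 1 0 (CCounit M))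
    (%x e. Mor 1 1 (a (inv x) \<cdot>\<^sub>S (if e then CInv M else Ide S (?A 1))))"
   by (rule tensor_system.labelled_comonoidI[OF ps(1) is_group M _ t(1)[symmetric] t(2)[symmetric]])
    (use a a1 am Mf in "simp_all only: A X_def[symmetric]")
  interpret L: labelled_monoid "opposite (endo S ?A ?t)" G "Mor 1 (1 + 1) (CComult M)" "Mor 1 0 (CCounit M)"
    "%x e. Mor 1 1 (a (inv x) \<cdot>\<^sub>S (if e then CInv M else Ide S (?A 1)))" by (rule L)
  define F where "F = alg_of ?T ?A ?t ?u L.NF"
  have F: "F : Obj (Alg ?T S)" unfolding F_def
   by (rule prop_shape.alg_of_Alg[OF DHG_op_shape S ps(1) _ _ L.NF_prop_map[folded prop_map_opposite]])
    (use ps(2) in "auto intro: canonical_arrows.intros S.TUnit_in_Obj")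
  have Ff: "FObj F = ?A" "FTens F = ?t" "FUnit F = ?u" "!!f. f : QA G ==> FArr F f = under (L.NF f)"
   by (simp_all add: F_def alg_of_def)
  have FA: "FArr F (q_m G) = CComult M" "FArr F (q_u G) = CCounit M" "FArr F (qlab \<one> True) = CInv M"
   "x : carrier G ==> FArr F (qlab (inv x) False) = a x" for x
   using L.NF_q_m L.NF_q_u L.NF_qlab[of \<one> True] L.NF_qlab[of "inv x" False] a[of x] a1 mon(2)[OF M]
   by (simp_all add: Ff S.Hom_iff A[unfolded One_nat_def] X_def)
  have "str F = M" unfolding str_def FA Ff A t unfolding X_def by simp
  then show "\<exists>F \<in> Obj (Alg ?T S). str F = M & (\<forall>g \<in> carrier G. FArr F (qlab (inv g) False) = a g)"
   using F FA(4) by blast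
 qed
 from alg_equiv.equivalence[OF this] show ?thesis unfolding IComon_def .
qed

end

lemma (in tensor_system) bimonoid_conv:
 assumes G: "group G" and H1: "prop_map (DHG G) P H1" and H2: "prop_map (DHG G) (opposite P) H2"
  and e: "H1 (q_m G) = Mor (1 + 1) 1 mm" "H1 (q_u G) = Mor 0 1 ee" "H2 (q_m G) = Mor 1 (1 + 1) dd" "H2 (q_u G) = Mor 1 0 cc"
 shows "H2 (q_m G) \<cdot>\<^sub>P H1 (q_m G) =
   (H1 (q_m G) \<boxtimes>\<^sub>P H1 (q_m G)) \<cdot>\<^sub>P (H2 (q_sigma23 G) \<cdot>\<^sub>P (H2 (q_m G) \<boxtimes>\<^sub>P H2 (q_m G))) <->
   (Inv S (t (1, 1)) \<cdot> dd) \<cdot> (mm \<cdot> t (1, 1)) = ((mm \<cdot> t (1, 1)) \<boxtimes> (mm \<cdot> t (1, 1))) \<cdot>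
    middle_exchange S (A 1) (A 1) (A 1) (A 1) \<cdot> ((Inv S (t (1, 1)) \<cdot> dd) \<boxtimes> (Inv S (t (1, 1)) \<cdot> dd))"
  and "H2 (q_m G) \<cdot>\<^sub>P H1 (q_u G) = H1 (q_u G) \<boxtimes>\<^sub>P H1 (q_u G) <->
   (Inv S (t (1, 1)) \<cdot> dd) \<cdot> (ee \<cdot> u) = ((ee \<cdot> u) \<boxtimes> (ee \<cdot> u)) \<cdot> Inv S (LUnit S (TUnit S))"
  and "H2 (q_u G) \<cdot>\<^sub>P H1 (q_m G) = H2 (q_u G) \<boxtimes>\<^sub>P H2 (q_u G) <->
   (Inv S u \<cdot> cc) \<cdot> (mm \<cdot> t (1, 1)) = LUnit S (TUnit S) \<cdot> ((Inv S u \<cdot> cc) \<boxtimes> (Inv S u \<cdot> cc))"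
  and "H2 (q_u G) \<cdot>\<^sub>P H1 (q_u G) = Ide P 0 <-> (Inv S u \<cdot> cc) \<cdot> (ee \<cdot> u) = Ide S (TUnit S)"
proof -
 interpret G: group G by fact
 interpret P: strict_prop P by (rule endo_strict_prop)
 note D1 = prop_mapD[OF H1, unfolded DHG_sel] and D2 = prop_mapD[OF H2, unfolded DHG_sel opposite_sel]
 have h: "mm : Hom S (A (1 + 1)) (A 1)" "ee : Hom S (A 0) (A 1)" "dd : Hom S (A 1) (A (1 + 1))" "cc : Hom S (A 1) (A 0)"
  using D1(1)[OF G.q_m_q_u(1)] D1(1)[OF G.q_m_q_u(4)] D2(1)[OF G.q_m_q_u(1)] D2(1)[OF G.q_m_q_u(4)]
  unfolding e by (simp_all add: endo_Arr Hom_iff)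
 have B: "bimonoid_arrows S A t u 1 (Ide S (A 1)) (Ide S (A 1)) mm ee dd cc"
  by (intro bimonoid_arrows.intro monoid_arrows_at comonoid_arrows_at h) (simp_all add: Hom_iff)
 have s: "H2 (q_sigma23 G) = Ide P 1 \<boxtimes>\<^sub>P (Sym P 1 1 \<boxtimes>\<^sub>P Ide P 1)"
 proof -
  have "H2 (q_sigma23 G) = Ide P 1 \<boxtimes>\<^sub>P Sym P 1 1 \<boxtimes>\<^sub>P Ide P 1"
   unfolding q_sigma23_def by (simp only: D2(4,6,7) G.qide_QA G.qsym_QA G.qtensor_QA)
  also have "... = Ide P 1 \<boxtimes>\<^sub>P (Sym P 1 1 \<boxtimes>\<^sub>P Ide P 1)"
   by (rule P.TArr_assoc[OF P.Ide_Arr P.Sym_Arr P.Ide_Arr])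
  finally show ?thesis .
 qed
 have mA: "H1 (q_m G) : Arr P" "H2 (q_m G) : Arr P" using D1(1) D2(1) by simp_all
 have as: "(H1 (q_m G) \<boxtimes>\<^sub>P H1 (q_m G)) \<cdot>\<^sub>P (H2 (q_sigma23 G) \<cdot>\<^sub>P (H2 (q_m G) \<boxtimes>\<^sub>P H2 (q_m G))) =
   (H1 (q_m G) \<boxtimes>\<^sub>P H1 (q_m G)) \<cdot>\<^sub>P H2 (q_sigma23 G) \<cdot>\<^sub>P (H2 (q_m G) \<boxtimes>\<^sub>P H2 (q_m G))"
  by (rule P.Comp_assoc[OF P.TArr_Arr[OF mA(2) mA(2)] D2(1)[OF G.q_sigma23(2)] P.TArr_Arr[OF mA(1) mA(1)], symmetric])
   (simp_all only: P.Cod_TArr P.Dom_TArr D1(2) D2(2,3) G.q_m_q_u G.q_sigma23 semiring_norm arith_simps)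
 show "H2 (q_m G) \<cdot>\<^sub>P H1 (q_m G) =
   (H1 (q_m G) \<boxtimes>\<^sub>P H1 (q_m G)) \<cdot>\<^sub>P (H2 (q_sigma23 G) \<cdot>\<^sub>P (H2 (q_m G) \<boxtimes>\<^sub>P H2 (q_m G))) <->
   (Inv S (t (1, 1)) \<cdot> dd) \<cdot> (mm \<cdot> t (1, 1)) = ((mm \<cdot> t (1, 1)) \<boxtimes> (mm \<cdot> t (1, 1))) \<cdot>
    middle_exchange S (A 1) (A 1) (A 1) (A 1) \<cdot> ((Inv S (t (1, 1)) \<cdot> dd) \<boxtimes> (Inv S (t (1, 1)) \<cdot> dd))"
  unfolding as unfolding s e by (rule bimonoid_arrows.conv_bimult[OF B])
 show "H2 (q_m G) \<cdot>\<^sub>P H1 (q_u G) = H1 (q_u G) \<boxtimes>\<^sub>P H1 (q_u G) <->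
   (Inv S (t (1, 1)) \<cdot> dd) \<cdot> (ee \<cdot> u) = ((ee \<cdot> u) \<boxtimes> (ee \<cdot> u)) \<cdot> Inv S (LUnit S (TUnit S))"
  unfolding e by (rule bimonoid_arrows.conv_bi_unit[OF B])
 show "H2 (q_u G) \<cdot>\<^sub>P H1 (q_m G) = H2 (q_u G) \<boxtimes>\<^sub>P H2 (q_u G) <->
   (Inv S u \<cdot> cc) \<cdot> (mm \<cdot> t (1, 1)) = LUnit S (TUnit S) \<cdot> ((Inv S u \<cdot> cc) \<boxtimes> (Inv S u \<cdot> cc))"
  unfolding e by (rule bimonoid_arrows.conv_bi_counit[OF B])
 show "H2 (q_u G) \<cdot>\<^sub>P H1 (q_u G) = Ide P 0 <-> (Inv S u \<cdot> cc) \<cdot> (ee \<cdot> u) = Ide S (TUnit S)"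
  unfolding e by (rule bimonoid_arrows.conv_bi_unit_counit[OF B])
qed

context group
begin

lemma emb2_qlab: "x : carrier G ==> emb2 G (qlab x b) = emb1 G (qlab (inv x) b)"
 by (rule emb2_iso) (simp_all add: qlab_qlab qlab_one[unfolded One_nat_def])

text \<open>Both sides are images of the same span, factored in two ways by \<open>scomp_emb\<close>
  and \<open>span_emb\<close>.\<close>

lemma DHGD_relation:
 assumes K: "prop_map (DHGD G) P K" and pb: "pullback G f h l r"
 shows "K (emb2 G h) \<cdot>\<^sub>P K (emb1 G f) = K (emb1 G r) \<cdot>\<^sub>P K (emb2 G l)"
proof -
 interpret A: pullback G f h l r by (rule pb)
 note D = prop_mapD(5)[OF K, unfolded DHGD_sel, symmetric]
 note E1 = prop_mapD(1-3)[OF emb1_prop_map, unfolded DHG_sel DHGD_sel]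
  and E2 = prop_mapD(1-3)[OF emb2_prop_map, unfolded DHG_sel DHGD_sel opposite_sel]
 have "K (emb2 G h) \<cdot>\<^sub>P K (emb1 G f) = K (scomp G (emb2 G h) (emb1 G f))"
  by (rule D) (simp_all add: E1 E2 A.f A.h A.cod)
 also have "... = K (scomp G (emb1 G r) (emb2 G l))" unfolding scomp_emb[OF pb] span_emb[OF A.l A.r A.dom] ..
 also have "... = K (emb1 G r) \<cdot>\<^sub>P K (emb2 G l)"
  by (rule D[symmetric]) (simp_all add: E1 E2 A.l A.r A.dom)
 finally show ?thesis .
qed

lemma IBimon_equivalence:
 fixes S :: "('o, 's, 'z) smc_scheme"
 assumes S: "symmetric_monoidal_category S"
 shows "equivalent_categories (Alg (DHGD G) S) (Fun (one_object_category G) (IBimon S))"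
proof -
 interpret S: symmetric_monoidal_category S by fact
 let ?T = "DHGD G"
 let ?R = "%(M :: ('o, 's) ibimon) N f. is_monoid_mor S M N f & is_comonoid_mor S (comonoid_part M) (comonoid_part N) f &
   f \<cdot>\<^sub>S MInv M = MInv N \<cdot>\<^sub>S f"
 note E1 = emb1_prop_map and E2 = emb2_prop_map
 note E1D = prop_mapD(1-3)[OF emb1_prop_map, unfolded DHG_sel DHGD_sel]
  and E2D = prop_mapD(1-3)[OF emb2_prop_map, unfolded DHG_sel DHGD_sel opposite_sel]
 define str :: "(nat, 'a sarr, 'o, 's) monfunctor => ('o, 's) ibimon" where
  "str F = \<lparr>MObj = FObj F 1, MMult = FArr F (emb1 G (q_m G)) \<cdot>\<^sub>S FTens F (1, 1),
   MUnit = FArr F (emb1 G (q_u G)) \<cdot>\<^sub>S FUnit F, MInv = FArr F (emb1 G (qlab \<one> True)),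
   BComult = Inv S (FTens F (1, 1)) \<cdot>\<^sub>S FArr F (emb2 G (q_m G)),
   BCounit = Inv S (FUnit F) \<cdot>\<^sub>S FArr F (emb2 G (q_u G))\<rparr>" for F
 have st: "MObj (str F) = FObj F 1" "MMult (str F) = FArr F (emb1 G (q_m G)) \<cdot>\<^sub>S FTens F (1, 1)"
  "MUnit (str F) = FArr F (emb1 G (q_u G)) \<cdot>\<^sub>S FUnit F" "MInv (str F) = FArr F (emb1 G (qlab \<one> True))" for F
  by (simp_all add: str_def)
 \<comment> \<open>\<open>emb2\<close> inverts labels, and the involution is its own inverse, so the
   monoid and the comonoid part share it.\<close>
 have one_inv: "emb2 G (qlab \<one> True) = emb1 G (qlab \<one> True)" using emb2_qlab[of \<one> True] by simp
 have cst: "CObj (comonoid_part (str F)) = FObj F 1"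
  "CComult (comonoid_part (str F)) = Inv S (FTens F (1, 1)) \<cdot>\<^sub>S FArr F (emb2 G (q_m G))"
  "CCounit (comonoid_part (str F)) = Inv S (FUnit F) \<cdot>\<^sub>S FArr F (emb2 G (q_u G))"
  "CInv (comonoid_part (str F)) = FArr F (emb2 G (qlab \<one> True))" for F
  unfolding one_inv by (simp_all add: str_def comonoid_part_def)
 have cp: "CObj (comonoid_part M) = MObj M" "CInv (comonoid_part M) = MInv M" "CComult (comonoid_part M) = BComult M"
  "CCounit (comonoid_part M) = BCounit M" for M :: "('o, 's) ibimon"
  by (simp_all add: comonoid_part_def)
 have mon: "is_monoid S M" "is_comonoid S (comonoid_part M)" "MInv M : Hom S (MObj M) (MObj M)"
  if "is_involutive_bimonoid S M" for M
  using that unfolding is_involutive_bimonoid_def is_bimonoid_def is_involutive_monoid_def Let_def by blast+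
 have "alg_equiv ?T G S {M. is_involutive_bimonoid S M} MObj ?R str (%g. emb1 G (qlab g False))"
 proof (rule alg_equiv.intro[OF DHGD_shape is_group], rule alg_equiv_axioms.intro[OF S])
  show "emb1 G (qlab g False) : Arr ?T & Dom ?T (emb1 G (qlab g False)) = 1 & Cod ?T (emb1 G (qlab g False)) = 1"
   if "g : carrier G" for g
   using that by (simp add: E1D)
  show "emb1 G (qlab \<one> False) = Ide ?T 1" unfolding qlab_one using prop_mapD(4)[OF E1, of 1] by (simp only: DHG_sel)
  show "emb1 G (qlab (g \<otimes> h) False) = emb1 G (qlab g False) \<cdot>\<^sub>?T emb1 G (qlab h False)" if "g : carrier G" "h : carrier G" for g h
   using qlab_qlab[OF that(2,1), of False False] prop_mapD(5)[OF E1, of "qlab h False" "qlab g False"] that by simp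
  show "MObj M : Obj S" if "M : {M. is_involutive_bimonoid S M}" for M :: "('o, 's) ibimon"
   using mon(1)[of M] that by (simp add: is_monoid_def Let_def)
  show "?R M M (Ide S (MObj M))" if "M : {M. is_involutive_bimonoid S M}" for M
  proof -
   have M: "is_involutive_bimonoid S M" using that by simp
   show ?thesis
    using monoid_mor_Ide[OF S mon(1)[OF M]] comonoid_mor_Ide[OF S mon(2)[OF M]] mon(3)[OF M] by (simp add: cp S.Hom_iff)
  qed
  show "?R M K (f' \<cdot>\<^sub>S f)" if "M : {M. is_involutive_bimonoid S M}" "N : {M. is_involutive_bimonoid S M}"
   "K : {M. is_involutive_bimonoid S M}" "f : Hom S (MObj M) (MObj N)" "f' : Hom S (MObj N) (MObj K)" "?R M N f" "?R N K f'" for M N K f f'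
  proof -
   have m: "is_involutive_bimonoid S M" "is_involutive_bimonoid S N" "is_involutive_bimonoid S K" using that by simp_all
   show ?thesis
    using monoid_mor_Comp[OF S mon(1)[OF m(1)] mon(1)[OF m(2)] mon(1)[OF m(3)] that(4,5)]
     comonoid_mor_Comp[OF S mon(2)[OF m(1)] mon(2)[OF m(2)] mon(2)[OF m(3)], unfolded cp, OF that(4,5)] that(6,7)
     commute_Comp[OF S.category_axioms that(4,5) mon(3)[OF m(1)] mon(3)[OF m(2)] mon(3)[OF m(3)]] by blast
  qed
  fix F assume F: "F : Obj (Alg ?T S)"
  note am = alg_monoid[OF S DHGD_shape E1 F st] and ac = alg_comonoid[OF S DHGD_shape E2 F cst]
  show "str F : {M. is_involutive_bimonoid S M} & MObj (str F) = FObj F 1"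
  proof -
   note ts = prop_shape.Alg_system[OF DHGD_shape S F]
   let ?P = "endo S (FObj F) (FTens F)"
   let ?K = "hat ?T (FArr F)"
   interpret tensor_system S "FObj F" "FTens F" "FUnit F" by (rule ts(1))
   interpret P: strict_prop ?P by (rule endo_strict_prop)
   have H1: "prop_map (DHG G) ?P (%q. ?K (emb1 G q))" using prop_map_o[OF E1 ts(2)] by (simp add: comp_def)
   have H2: "prop_map (DHG G) (opposite ?P) (%q. ?K (emb2 G q))"
    using prop_map_o[OF E2 prop_map_opp_opp[OF ts(2)]] by (simp add: comp_def)
   note D1 = prop_mapD[OF H1, unfolded DHG_sel] and D2 = prop_mapD[OF H2, unfolded DHG_sel opposite_sel]
   have e: "?K (emb1 G (q_m G)) = Mor (1 + 1) 1 (FArr F (emb1 G (q_m G)))" "?K (emb1 G (q_u G)) = Mor 0 1 (FArr F (emb1 G (q_u G)))"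
    "?K (emb2 G (q_m G)) = Mor 1 (1 + 1) (FArr F (emb2 G (q_m G)))" "?K (emb2 G (q_u G)) = Mor 1 0 (FArr F (emb2 G (q_u G)))"
    by (simp_all add: hat_def E1D E2D)
   note bc = bimonoid_conv[OF is_group H1 H2 e]
   note rel = DHGD_relation[OF ts(2)]
   have r1: "?K (emb2 G (q_m G)) \<cdot>\<^sub>?P ?K (emb1 G (q_m G)) = (?K (emb1 G (q_m G)) \<boxtimes>\<^sub>?P ?K (emb1 G (q_m G))) \<cdot>\<^sub>?P
     (?K (emb2 G (q_sigma23 G)) \<cdot>\<^sub>?P (?K (emb2 G (q_m G)) \<boxtimes>\<^sub>?P ?K (emb2 G (q_m G))))"
    unfolding rel[OF pullback_m_m] D1(6)[OF q_m_q_u(1) q_m_q_u(1)] D2(6)[OF q_m_q_u(1) q_m_q_u(1), symmetric]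
    by (subst D2(5)) simp_all
   have r2: "?K (emb2 G (q_m G)) \<cdot>\<^sub>?P ?K (emb1 G (q_u G)) = ?K (emb1 G (q_u G)) \<boxtimes>\<^sub>?P ?K (emb1 G (q_u G))"
    unfolding rel[OF pullback.sym[OF pullback_m_u]] D1(6)[OF q_m_q_u(4) q_m_q_u(4)] D2(4)
    by (rule P.Comp_Ide') (use D1(1-3)[OF q_m_q_u(4)] in "simp_all only: P.TArr_Arr P.Dom_TArr q_m_q_u add_0_left")
   have r3: "?K (emb2 G (q_u G)) \<cdot>\<^sub>?P ?K (emb1 G (q_m G)) = ?K (emb2 G (q_u G)) \<boxtimes>\<^sub>?P ?K (emb2 G (q_u G))"
    unfolding rel[OF pullback_m_u] D2(6)[OF q_m_q_u(4) q_m_q_u(4)] D1(4)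
    by (rule P.Ide_Comp') (use D2(1-3)[OF q_m_q_u(4)] in "simp_all only: P.TArr_Arr P.Cod_TArr q_m_q_u add_0_left")
   have r4: "?K (emb2 G (q_u G)) \<cdot>\<^sub>?P ?K (emb1 G (q_u G)) = Ide ?P 0"
    unfolding rel[OF pullback_u_u] D1(4) D2(4) by (rule P.Comp_Ide') (simp_all only: P.Ide_Arr P.Dom_Ide)
   have "is_bimonoid S (str F)"
    unfolding is_bimonoid_def Let_def cp[symmetric]
    unfolding cst st
    using am(1) ac(1) bc(1)[THEN iffD1, OF r1] bc(2)[THEN iffD1, OF r2] bc(3)[THEN iffD1, OF r3] bc(4)[THEN iffD1, OF r4]
    unfolding is_involutive_monoid_def is_involutive_comonoid_def by blast
   then show ?thesis using am(1) ac(1) st(1) by (simp add: is_involutive_bimonoid_def)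
  qed
  \<comment> \<open>On the comonoid part the action of \<open>g\<close> is read off at the inverse
    element, since \<open>emb2\<close> of a label is \<open>emb1\<close> of the inverse
    label.\<close>
  show "?R (str F) (str F) (FArr F (emb1 G (qlab g False)))" if g: "g : carrier G" for g
   using am(2)[OF g] ac(2)[OF inv_closed[OF g]] emb2_qlab[OF inv_closed[OF g], of False] g by simp
  fix K assume K: "K : Obj (Alg ?T S)"
  note iff = alg_monoid_mor_iff[OF S DHGD_shape E1 F K st(2,3) st(2,3)]
  note ciff = alg_comonoid_mor_iff[OF S DHGD_shape E2 F K cst(2,3) cst(2,3)]
  note mi = prop_shape.monoidal_iff[OF DHGD_shape S F K]
  have oq: "emb1 G (q_m G) : Arr ?T" "emb1 G (q_u G) : Arr ?T" "emb2 G (q_m G) : Arr ?T" "emb2 G (q_u G) : Arr ?T"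
   "emb1 G (qlab \<one> True) : Arr ?T" by (simp_all add: E1D E2D)
  show "?R (str F) (str K) (th 1)" if th: "monoidal_transformation ?T S F K th" for th
  proof -
   have nat: "FArr K f \<cdot>\<^sub>S th (Dom ?T f) = th (Cod ?T f) \<cdot>\<^sub>S FArr F f" if "f : Arr ?T" for f
    using th that unfolding mi by blast
   have c: "th n : Arr S & Dom S (th n) = FObj F n & Cod S (th n) = FObj K n"
    "th (1 + 1) \<cdot>\<^sub>S FTens F (1, 1) = FTens K (1, 1) \<cdot>\<^sub>S (th 1 \<boxtimes>\<^sub>S th 1)" "th 0 \<cdot>\<^sub>S FUnit F = FUnit K" for n
    using th unfolding mi by blast+
   have "is_monoid_mor S (str F) (str K) (th 1)" by (rule iff[THEN iffD2, OF c]) (intro conjI nat oq)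
   moreover have "is_comonoid_mor S (comonoid_part (str F)) (comonoid_part (str K)) (th 1)"
    by (rule ciff[THEN iffD2, OF c]) (intro conjI nat oq)
   moreover have "th 1 \<cdot>\<^sub>S MInv (str F) = MInv (str K) \<cdot>\<^sub>S th 1"
    using nat[OF oq(5)] unfolding st by (simp add: E1D)
   ultimately show ?thesis by blast
  qed
  show "\<exists>th. monoidal_transformation ?T S F K th & th 1 = k"
   if k: "k : Hom S (FObj F 1) (FObj K 1)" and R: "?R (str F) (str K) k"
    and ac: "!!g. g : carrier G ==> FArr K (emb1 G (qlab g False)) \<cdot>\<^sub>S k = k \<cdot>\<^sub>S FArr F (emb1 G (qlab g False))" for k
  proof -
   obtain th where th: "th 1 = k" "th (1 + 1) \<cdot>\<^sub>S FTens F (1, 1) = FTens K (1, 1) \<cdot>\<^sub>S (k \<boxtimes>\<^sub>S k)" "th 0 \<cdot>\<^sub>S FUnit F = FUnit K"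
    "!!n. th n : Arr S & Dom S (th n) = FObj F n & Cod S (th n) = FObj K n"
    and cl: "!!N. N = {f \<in> Arr ?T. FArr K f \<cdot>\<^sub>S th (Dom ?T f) = th (Cod ?T f) \<cdot>\<^sub>S FArr F f} ==>
     (\<forall>n. Ide ?T n : N) & (\<forall>a b. Sym ?T a b : N) &
     (\<forall>f \<in> N. \<forall>g \<in> N. Dom ?T g = Cod ?T f --> g \<cdot>\<^sub>?T f : N) & (\<forall>f \<in> N. \<forall>g \<in> N. f \<boxtimes>\<^sub>?T g : N) &
     (Arr ?T \<subseteq> N --> monoidal_transformation ?T S F K th)"
    using prop_shape.Alg_full[OF DHGD_shape S F K k] by blast
   define N where "N = {f \<in> Arr ?T. FArr K f \<cdot>\<^sub>S th (Dom ?T f) = th (Cod ?T f) \<cdot>\<^sub>S FArr F f}"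
   note cl = cl[OF N_def]
   have cl': "\<forall>f \<in> N. \<forall>g \<in> N. Dom (opposite ?T) g = Cod (opposite ?T) f --> g \<cdot>\<^bsub>opposite ?T\<^esub> f : N"
     "\<forall>n. Ide (opposite ?T) n : N" "\<forall>a b. Sym (opposite ?T) a b : N" "\<forall>f \<in> N. \<forall>g \<in> N. f \<boxtimes>\<^bsub>opposite ?T\<^esub> g : N"
    using cl unfolding opposite_sel by metis+
   have mu: "emb1 G (q_m G) : N" "emb1 G (q_u G) : N" "emb2 G (q_m G) : N" "emb2 G (q_u G) : N"
    using iff[OF th(4) th(2,3)[folded th(1)], THEN iffD1] ciff[OF th(4) th(2,3)[folded th(1)], THEN iffD1] R
    unfolding th(1) N_def mem_Collect_eq by (blast intro: oq)+
   have lab: "emb1 G (qlab \<one> True) : N" "x : carrier G ==> emb1 G (qlab x False) : N" for x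
    using R ac[of x] th(1) unfolding N_def st by (simp_all add: E1D)
   have lab': "emb2 G (qlab \<one> True) : N" "x : carrier G ==> emb2 G (qlab x False) : N" for x
    using lab(1) lab(2)[of "inv x"] emb2_qlab[of x False] unfolding one_inv by simp_all
   have N1: "emb1 G f : N" and N2: "emb2 G f : N" if "f : QA G" for f
    using QA_closure[OF E1 _ _ _ _ mu(1,2) lab that] cl QA_closure[OF E2 cl'(2,3,1,4) mu(3,4) lab' that] by blast+
   have "s : N" if s: "s : Arr ?T" for s
   proof -
    obtain l r where lr: "l : QA G" "r : QA G" "qdom r = qdom l" "s = span G l r" using s DHGD_Arr by blast
    \<comment> \<open>Every span factors through the two copies of \<open>Q\<close>, so naturality
      on both copies suffices.\<close>
    have "emb1 G r \<cdot>\<^sub>?T emb2 G l : N"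
     using cl N1[OF lr(2)] N2[OF lr(1)] lr by (simp add: E1D E2D)
    then show ?thesis using span_emb[OF lr(1-3)] lr(4) by simp
   qed
   then show ?thesis using cl th(1) by blast
  qed
 next
  fix M :: "('o, 's) ibimon" and a
  assume "M : {M. is_involutive_bimonoid S M}" and a: "!!g. g : carrier G ==> a g : Hom S (MObj M) (MObj M) & ?R M M (a g)"
   and a1: "a \<one> = Ide S (MObj M)" and am: "!!g h. g : carrier G ==> h : carrier G ==> a (g \<otimes> h) = a g \<cdot>\<^sub>S a h"
  then have M: "is_involutive_bimonoid S M" by simp
  then have MM: "is_involutive_monoid S M" "is_involutive_comonoid S (comonoid_part M)" "is_bimonoid S M"
   unfolding is_involutive_bimonoid_def by blast+
  define X where "X = MObj M"
  have Mf: "X : Obj S" "MMult M : Hom S (X \<boxdot>\<^sub>S X) X" "MUnit M : Hom S (TUnit S) X"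
   "BComult M : Hom S X (X \<boxdot>\<^sub>S X)" "BCounit M : Hom S X (TUnit S)"
   using mon(1,2)[OF M] by (simp_all add: is_monoid_def is_comonoid_def Let_def X_def cp)
  let ?A = "pw S X" and ?t = "%(a, b). pt S X a b" and ?u = "Ide S (TUnit S)"
  let ?P = "endo S ?A ?t"
  note ps = S.power_system[OF Mf(1)]
  interpret TS: tensor_system S ?A ?t ?u by (rule ps(1))
  have A: "?A 1 = X" "?A (1 + 1) = X \<boxdot>\<^sub>S X" "?A 0 = TUnit S" by simp_all
  have t: "MMult M \<cdot>\<^sub>S ?t (1, 1) = MMult M" "MUnit M \<cdot>\<^sub>S ?u = MUnit M"
   "Inv S (?t (1, 1)) \<cdot>\<^sub>S BComult M = BComult M" "Inv S ?u \<cdot>\<^sub>S BCounit M = BCounit M"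
   using Mf ps(3) by (simp_all add: S.Hom_iff)
  let ?l = "%x e. Mor 1 1 (a x \<cdot>\<^sub>S (if e then MInv M else Ide S (?A 1))) :: (nat, 's) mor"
  let ?l' = "%x e. Mor 1 1 (a (inv x) \<cdot>\<^sub>S (if e then CInv (comonoid_part M) else Ide S (?A 1))) :: (nat, 's) mor"
  have L1: "labelled_monoid ?P G (Mor (1 + 1) 1 (MMult M)) (Mor 0 1 (MUnit M)) ?l"
   by (rule TS.labelled_monoidI[OF is_group MM(1) _ t(1)[symmetric] t(2)[symmetric]])
    (use a a1 am Mf in "simp_all only: A X_def[symmetric]")
  have L2: "labelled_monoid (opposite ?P) G (Mor 1 (1 + 1) (BComult M)) (Mor 1 0 (BCounit M)) ?l'"
   by (rule TS.labelled_comonoidI[OF is_group MM(2), unfolded cp, OF _ t(3)[symmetric] t(4)[symmetric], folded cp(2)])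
    (use a a1 am Mf in "simp_all only: A X_def[symmetric] cp")
  interpret L1: labelled_monoid ?P G "Mor (1 + 1) 1 (MMult M)" "Mor 0 1 (MUnit M)" ?l by (rule L1)
  interpret L2: labelled_monoid "opposite ?P" G "Mor 1 (1 + 1) (BComult M)" "Mor 1 0 (BCounit M)" ?l' by (rule L2)
  note bc = TS.bimonoid_conv[OF is_group L1.NF_prop_map L2.NF_prop_map L1.NF_q_m L1.NF_q_u L2.NF_q_m L2.NF_q_u]
  have bi: "BComult M \<cdot>\<^sub>S MMult M = (MMult M \<boxtimes>\<^sub>S MMult M) \<cdot>\<^sub>S
    middle_exchange S X X X X \<cdot>\<^sub>S (BComult M \<boxtimes>\<^sub>S BComult M)"
   "BComult M \<cdot>\<^sub>S MUnit M = (MUnit M \<boxtimes>\<^sub>S MUnit M) \<cdot>\<^sub>S Inv S (LUnit S (TUnit S))"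
   "BCounit M \<cdot>\<^sub>S MMult M = LUnit S (TUnit S) \<cdot>\<^sub>S (BCounit M \<boxtimes>\<^sub>S BCounit M)"
   "BCounit M \<cdot>\<^sub>S MUnit M = Ide S (TUnit S)"
   using MM(3) unfolding is_bimonoid_def Let_def X_def by blast+
  \<comment> \<open>\<open>L1\<close> sends a label to \<open>a x\<close> and \<open>L2\<close> to
    \<open>a (inv x)\<close>, each combined with the same involution, so the two values are inverse
    to each other.\<close>
  have lab: "L1.NF (qlab x e) \<cdot>\<^sub>?P L2.NF (qlab x e) = Ide ?P 1 & L2.NF (qlab x e) \<cdot>\<^sub>?P L1.NF (qlab x e) = Ide ?P 1"
   if x: "x : carrier G" for x e
  proof -
   have ll: "?l' x e = ?l (inv x) e" unfolding cp ..
   have "?l x e \<cdot>\<^sub>?P ?l (inv x) e = ?l (x \<otimes> inv x) (e ~= e)" "?l (inv x) e \<cdot>\<^sub>?P ?l x e = ?l (inv x \<otimes> x) (e ~= e)"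
    by (rule L1.lab_lab; use x in simp)+
   moreover have "?l (x \<otimes> inv x) (e ~= e) = Ide ?P 1" "?l (inv x \<otimes> x) (e ~= e) = Ide ?P 1"
    using L1.lab_one x by (simp_all del: endo_sel)
   ultimately show ?thesis unfolding L1.NF_qlab[OF x] L2.NF_qlab[OF x] ll by (intro conjI) (rule trans, assumption+)+
  qed
  \<comment> \<open>The comparisons at \<open>(1, 1)\<close> and at the unit are identities, so the
    relations translated by \<open>bimonoid_conv\<close> are literally the bimonoid axioms of
    \<open>M\<close>.\<close>
  interpret SM: span_map ?P G L1.NF L2.NF
   by (intro span_map.intro span_map_axioms.intro L1.strict_prop_axioms is_group L1.NF_prop_map L2.NF_prop_map lab
     bc(1)[THEN iffD2] bc(2)[THEN iffD2] bc(3)[THEN iffD2] bc(4)[THEN iffD2]; simp only: t A(1) bi)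
  define F where "F = alg_of ?T ?A ?t ?u SM.Fs"
  have F: "F : Obj (Alg ?T S)" unfolding F_def
   by (rule prop_shape.alg_of_Alg[OF DHGD_shape S ps(1) _ _ SM.Fs_prop_map])
    (use ps(2) in "auto intro: canonical_arrows.intros S.TUnit_in_Obj")
  have Ff: "FObj F = ?A" "FTens F = ?t" "FUnit F = ?u" by (simp_all add: F_def alg_of_def)
  have raw: "FArr F s = under (SM.Fs s)" if "s : Arr ?T" for s using that by (simp add: F_def alg_of_def)
  have Fe: "FArr F (emb1 G q) = under (L1.NF q)" "FArr F (emb2 G q) = under (L2.NF q)" if q: "q : QA G" for q
   unfolding raw[OF E1D(1)[OF q]] raw[OF E2D(1)[OF q]] SM.Fs_emb(1)[OF q] SM.Fs_emb(2)[OF q] by (rule refl)+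
  have FA: "FArr F (emb1 G (q_m G)) = MMult M" "FArr F (emb1 G (q_u G)) = MUnit M" "FArr F (emb1 G (qlab \<one> True)) = MInv M"
   "FArr F (emb2 G (q_m G)) = BComult M" "FArr F (emb2 G (q_u G)) = BCounit M"
   "x : carrier G ==> FArr F (emb1 G (qlab x False)) = a x" for x
   using L1.NF_q_m L1.NF_q_u L2.NF_q_m L2.NF_q_u L1.NF_qlab[of \<one> True] L1.NF_qlab[of x False] a[of x] a1 mon(3)[OF M]
   by (simp_all add: Fe S.Hom_iff A[unfolded One_nat_def] X_def)
  have "str F = M" unfolding str_def FA Ff A t unfolding X_def by simp
  then show "\<exists>F \<in> Obj (Alg ?T S). str F = M & (\<forall>g \<in> carrier G. FArr F (emb1 G (qlab g False)) = a g)"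
   using F FA(6) by blast
 qed
 from alg_equiv.equivalence[OF this] show ?thesis unfolding IBimon_def .
qed

end

theorem theorem7p1:
  fixes S :: "('o, 'a, 'z) smc_scheme" and G :: "('g, 'w) monoid_scheme"
  assumes "symmetric_monoidal_category S" and "group G"
  shows "equivalent_categories (Alg (DHG G) S) (Fun (one_object_category G) (IMon S)) \<and>
    equivalent_categories (Alg (opposite (DHG G)) S) (Fun (one_object_category G) (IComon S)) \<and>
    equivalent_categories (Alg (DHGD G) S) (Fun (one_object_category G) (IBimon S))"
  by (intro conjI group.IMon_equivalence[OF assms(2,1)] group.IComon_equivalence[OF assms(2,1)]
      group.IBimon_equivalence[OF assms(2,1)])

end
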